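(* If the theory ZFC + ``there is a supercompact cardinal'' is consistent, then the theory GB + AC + ``Semi-Weak Vopěnka's Principle'' does not prove the existence of a strongly compact cardinal, and therefore neither does the theory GB + AC + ``Weak Vopěnka's Principle''.
   Context: GB + AC is Gödel–Bernays (second-order) set theory, with sets and classes, together with the Axiom of Choice for sets. A graph is a structure $\langle G,E\rangle$ where $G$ is a set and $E$ is an arbitrary binary relation on $G$. A homomorphism from $\langle G,E\rangle$ to $\langle G',E'\rangle$ is a function $h: G\to G'$ such that $\langle v,w\rangle\in E$ implies $\langle h(v),h(w)\rangle\in E'$. Weak Vopěnka's Principle (WVP): no (class) sequence of graphs $\langle G_\alpha:\alpha\in\mathrm{Ord}\rangle$ has both of the following properties: whenever $\alpha\le\alpha'$ there is a unique homomorphism $G_{\alpha'}\to G_\alpha$, and whenever $\alpha<\alpha'$ there is no homomorphism $G_\alpha\to G_{\alpha'}$. Semi-Weak Vopěnka's Principle (SWVP): no (class) sequence of graphs $\langle G_\alpha:\alpha\in\mathrm{Ord}\rangle$ has both of the following properties: whenever $\alpha\le\alpha'$ there is a homomorphism $G_{\alpha'}\to G_\alpha$ (not necessarily unique), and whenever $\alpha<\alpha'$ there is no homomorphism $G_\alpha\to G_{\alpha'}$. For a cardinal $\kappa$ and a set $X$, $\mathcal{P}_\kappa(X)=\{A\subset X: |A|<\kappa\}$. For an uncountable cardinal $\kappa$ and a set $X$, $\kappa$ is $X$-compact if there is a fine $\kappa$-complete ultrafilter $U$ on $\mathcal{P}_\kappa(X)$, where: fine means that for every $x\in X$ the set $\{A\in\mathcal{P}_\kappa(X):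 x\in A\}$ is in $U$; $\kappa$-complete means that the intersection of fewer than $\kappa$ many sets in $U$ is in $U$. An uncountable cardinal is strongly compact if it is $X$-compact for every set $X$. An uncountable cardinal $\kappa$ is $X$-supercompact if there is a fine $\kappa$-complete ultrafilter $U$ on $\mathcal{P}_\kappa(X)$ that is moreover normal, meaning that every choice function (a function $f$ with $f(A)\in A$ for all $A$ in its domain) defined on a set in $U$ is constant on a set in $U$. An uncountable cardinal is supercompact if it is $X$-supercompact for every set $X$. *)

theory Defs
  imports Main
begin

section \<open>First-order logic over the language of set theory\<close>

text \<open>Variables are de Bruijn indices. The language has no function symbols, so the only terms
  are variables and substitutions are renamings.\<close>

datatype fm =
    Falsum
  | Member nat nat
  | Equal nat nat
  | Implies fm fm
  | Forall fm

fun up :: "(nat \<Rightarrow> nat) \<Rightarrow> nat \<Rightarrow> nat" where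
  "up r 0 = 0"
| "up r (Suc i) = Suc (r i)"

primrec rename :: "(nat \<Rightarrow> nat) \<Rightarrow> fm \<Rightarrow> fm" where
  "rename r Falsum = Falsum"
| "rename r (Member i j) = Member (r i) (r j)"
| "rename r (Equal i j) = Equal (r i) (r j)"
| "rename r (Implies p q) = Implies (rename r p) (rename r q)"
| "rename r (Forall p) = Forall (rename (up r) p)"

definition lift :: "fm \<Rightarrow> fm" where
  "lift p = rename Suc p"

definition inst0 :: "fm \<Rightarrow> nat \<Rightarrow> fm" where
  "inst0 p t = rename (case_nat t (\<lambda>i. i)) p"

primrec free_below :: "nat \<Rightarrow> fm \<Rightarrow> bool" where
  "free_below n Falsum \<longleftrightarrow> True"
| "free_below n (Member i j) \<longleftrightarrow> i < n \<and> j < n"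
| "free_below n (Equal i j) \<longleftrightarrow> i < n \<and> j < n"
| "free_below n (Implies p q) \<longleftrightarrow> free_below n p \<and> free_below n q"
| "free_below n (Forall p) \<longleftrightarrow> free_below (Suc n) p"

text \<open>Classical natural deduction with equality. As usual, models have to be non-empty for
  this calculus to be sound.\<close>

inductive proves :: "fm set \<Rightarrow> fm \<Rightarrow> bool" (infix "\<turnstile>" 50) where
  Assm: "p \<in> T \<Longrightarrow> T \<turnstile> p"
| ImpI: "insert p T \<turnstile> q \<Longrightarrow> T \<turnstile> Implies p q"
| ImpE: "T \<turnstile> Implies p q \<Longrightarrow> T \<turnstile> p \<Longrightarrow> T \<turnstile> q"
| Contr: "insert (Implies p Falsum) T \<turnstile> Falsum \<Longrightarrow> T \<turnstile> p"
| AllI: "lift ` T \<turnstile> p \<Longrightarrow> T \<turnstile> Forall p"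
| AllE: "T \<turnstile> Forall p \<Longrightarrow> T \<turnstile> inst0 p t"
| EqRefl: "T \<turnstile> Equal t t"
| EqSubst: "T \<turnstile> Equal s t \<Longrightarrow> T \<turnstile> inst0 p s \<Longrightarrow> T \<turnstile> inst0 p t"

definition consistent :: "fm set \<Rightarrow> bool" where
  "consistent T \<longleftrightarrow> \<not> T \<turnstile> Falsum"


section \<open>Notation for writing formulas\<close>

text \<open>A formula is written as a function of the number \<open>n\<close> of quantifiers enclosing it, and its
  variables are named by de Bruijn levels, that is, by the number of quantifiers enclosing their
  binder. At depth \<open>n\<close> the variable of level \<open>x\<close> is the index \<open>n - Suc x\<close>. Binders can thus be
  written as binders of the metalogic.\<close>

type_synonym form = "nat \<Rightarrow> fm"

definition f_mem :: "nat \<Rightarrow> nat \<Rightarrow> form" (infix "\<^bold>\<in>" 50) where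
  "(x \<^bold>\<in> y) n = Member (n - Suc x) (n - Suc y)"

definition f_eq :: "nat \<Rightarrow> nat \<Rightarrow> form" (infix "\<^bold>=" 50) where
  "(x \<^bold>= y) n = Equal (n - Suc x) (n - Suc y)"

definition f_imp :: "form \<Rightarrow> form \<Rightarrow> form" (infixr "\<^bold>\<longrightarrow>" 25) where
  "(p \<^bold>\<longrightarrow> q) n = Implies (p n) (q n)"

definition f_not :: "form \<Rightarrow> form" ("\<^bold>\<not> _" [40] 40) where
  "(\<^bold>\<not> p) = (p \<^bold>\<longrightarrow> (\<lambda>n. Falsum))"

definition f_or :: "form \<Rightarrow> form \<Rightarrow> form" (infixr "\<^bold>\<or>" 30) where
  "(p \<^bold>\<or> q) = (\<^bold>\<not> p \<^bold>\<longrightarrow> q)"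

definition f_and :: "form \<Rightarrow> form \<Rightarrow> form" (infixr "\<^bold>\<and>" 35) where
  "(p \<^bold>\<and> q) = (\<^bold>\<not> (p \<^bold>\<longrightarrow> \<^bold>\<not> q))"

definition f_iff :: "form \<Rightarrow> form \<Rightarrow> form" (infixr "\<^bold>\<longleftrightarrow>" 25) where
  "(p \<^bold>\<longleftrightarrow> q) = ((p \<^bold>\<longrightarrow> q) \<^bold>\<and> (q \<^bold>\<longrightarrow> p))"

definition f_all :: "(nat \<Rightarrow> form) \<Rightarrow> form" (binder "\<^bold>\<forall>" 10) where
  "(\<^bold>\<forall>x. F x) n = Forall (F n (Suc n))"

definition f_ex :: "(nat \<Rightarrow> form) \<Rightarrow> form" (binder "\<^bold>\<exists>" 10) where
  "(\<^bold>\<exists>x. F x) = (\<^bold>\<not> (\<^bold>\<forall>x. \<^bold>\<not> F x))"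

definition f_ex1 :: "(nat \<Rightarrow> form) \<Rightarrow> form" (binder "\<^bold>\<exists>\<^bold>!" 10) where
  "(\<^bold>\<exists>\<^bold>!x. F x) = (\<^bold>\<exists>x. F x \<^bold>\<and> (\<^bold>\<forall>y. F y \<^bold>\<longrightarrow> y \<^bold>= x))"

definition sentence :: "form \<Rightarrow> fm" where
  "sentence F = F 0"

text \<open>The instances of an axiom schema: quantify universally over parameters, which are the
  variables of levels \<open>0, \<dots>, k - 1\<close>.\<close>

definition foralls :: "nat \<Rightarrow> form \<Rightarrow> fm" where
  "foralls k F = (Forall ^^ k) (F k)"

text \<open>\<open>schematic p [x, y]\<close> is the formula \<open>p\<close> with its variables \<open>0\<close> and \<open>1\<close> read as \<open>x\<close> and \<open>y\<close>, and
  its variable \<open>2 + j\<close> read as the parameter \<open>j\<close>.\<close>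

definition schematic :: "fm \<Rightarrow> nat list \<Rightarrow> form" where
  "schematic p xs n =
     rename (\<lambda>i. n - Suc (if i < length xs then xs ! i else i - length xs)) p"


section \<open>Set-theoretic notions\<close>

definition subset :: "nat \<Rightarrow> nat \<Rightarrow> form" where
  "subset x y = (\<^bold>\<forall>z. z \<^bold>\<in> x \<^bold>\<longrightarrow> z \<^bold>\<in> y)"

definition nonempty :: "nat \<Rightarrow> form" where
  "nonempty x = (\<^bold>\<exists>z. z \<^bold>\<in> x)"

definition is_upair :: "nat \<Rightarrow> nat \<Rightarrow> nat \<Rightarrow> form" where
  "is_upair p a b = (\<^bold>\<forall>z. z \<^bold>\<in> p \<^bold>\<longleftrightarrow> z \<^bold>= a \<^bold>\<or> z \<^bold>= b)"

definition is_pair :: "nat \<Rightarrow> nat \<Rightarrow> nat \<Rightarrow> form" where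
  "is_pair p a b = (\<^bold>\<exists>s t. is_upair s a a \<^bold>\<and> is_upair t a b \<^bold>\<and> is_upair p s t)"

definition related :: "nat \<Rightarrow> nat \<Rightarrow> nat \<Rightarrow> form" where
  "related r a b = (\<^bold>\<exists>p. is_pair p a b \<^bold>\<and> p \<^bold>\<in> r)"

definition is_succ :: "nat \<Rightarrow> nat \<Rightarrow> form" where
  "is_succ s x = (\<^bold>\<forall>z. z \<^bold>\<in> s \<^bold>\<longleftrightarrow> z \<^bold>\<in> x \<^bold>\<or> z \<^bold>= x)"

definition fun_on :: "nat \<Rightarrow> nat \<Rightarrow> form" where
  "fun_on f a =
     ((\<^bold>\<forall>p. p \<^bold>\<in> f \<^bold>\<longrightarrow> (\<^bold>\<exists>x y. x \<^bold>\<in> a \<^bold>\<and> is_pair p x y))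
      \<^bold>\<and> (\<^bold>\<forall>x. x \<^bold>\<in> a \<^bold>\<longrightarrow> (\<^bold>\<exists>\<^bold>!y. related f x y)))"

definition fun_to :: "nat \<Rightarrow> nat \<Rightarrow> nat \<Rightarrow> form" where
  "fun_to f a b = (fun_on f a \<^bold>\<and> (\<^bold>\<forall>x y. related f x y \<^bold>\<longrightarrow> y \<^bold>\<in> b))"

definition bijection :: "nat \<Rightarrow> nat \<Rightarrow> nat \<Rightarrow> form" where
  "bijection f a b =
     (fun_to f a b \<^bold>\<and> (\<^bold>\<forall>y. y \<^bold>\<in> b \<^bold>\<longrightarrow> (\<^bold>\<exists>\<^bold>!x. related f x y)))"

text \<open>\<open>\<in>\<close> is well-founded by the axiom of foundation, so a transitive set is an ordinal as soon as
  any two of its elements are comparable.\<close>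

definition ordinal :: "nat \<Rightarrow> form" where
  "ordinal a =
     ((\<^bold>\<forall>x. x \<^bold>\<in> a \<^bold>\<longrightarrow> subset x a)
      \<^bold>\<and> (\<^bold>\<forall>x y. x \<^bold>\<in> a \<^bold>\<and> y \<^bold>\<in> a \<^bold>\<longrightarrow> x \<^bold>\<in> y \<^bold>\<or> x \<^bold>= y \<^bold>\<or> y \<^bold>\<in> x))"

definition limit_ordinal :: "nat \<Rightarrow> form" where
  "limit_ordinal a =
     (ordinal a \<^bold>\<and> nonempty a \<^bold>\<and> (\<^bold>\<forall>x. x \<^bold>\<in> a \<^bold>\<longrightarrow> (\<^bold>\<exists>y. y \<^bold>\<in> a \<^bold>\<and> x \<^bold>\<in> y)))"

definition is_omega :: "nat \<Rightarrow> form" where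
  "is_omega w = (limit_ordinal w \<^bold>\<and> (\<^bold>\<forall>x. x \<^bold>\<in> w \<^bold>\<longrightarrow> \<^bold>\<not> limit_ordinal x))"

definition cardinal :: "nat \<Rightarrow> form" where
  "cardinal k =
     (ordinal k \<^bold>\<and> (\<^bold>\<forall>a. a \<^bold>\<in> k \<^bold>\<longrightarrow> \<^bold>\<not> (\<^bold>\<exists>f. bijection f a k)))"

definition uncountable_cardinal :: "nat \<Rightarrow> form" where
  "uncountable_cardinal k = (cardinal k \<^bold>\<and> (\<^bold>\<exists>w. is_omega w \<^bold>\<and> w \<^bold>\<in> k))"


subsection \<open>Strongly compact and supercompact cardinals\<close>

definition card_less :: "nat \<Rightarrow> nat \<Rightarrow> form" where
  "card_less A k = (\<^bold>\<exists>a. a \<^bold>\<in> k \<^bold>\<and> (\<^bold>\<exists>f. bijection f A a))"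

definition is_P :: "nat \<Rightarrow> nat \<Rightarrow> nat \<Rightarrow> form" where
  "is_P P k X = (\<^bold>\<forall>A. A \<^bold>\<in> P \<^bold>\<longleftrightarrow> subset A X \<^bold>\<and> card_less A k)"

definition ultrafilter_on :: "nat \<Rightarrow> nat \<Rightarrow> form" where
  "ultrafilter_on U P =
     ((\<^bold>\<forall>B. B \<^bold>\<in> U \<^bold>\<longrightarrow> subset B P)
      \<^bold>\<and> P \<^bold>\<in> U
      \<^bold>\<and> (\<^bold>\<forall>B. B \<^bold>\<in> U \<^bold>\<longrightarrow> nonempty B)
      \<^bold>\<and> (\<^bold>\<forall>B C. B \<^bold>\<in> U \<^bold>\<and> subset B C \<^bold>\<and> subset C P \<^bold>\<longrightarrow> C \<^bold>\<in> U)
      \<^bold>\<and> (\<^bold>\<forall>B C D. B \<^bold>\<in> U \<^bold>\<and> C \<^bold>\<in> U \<^bold>\<and> (\<^bold>\<forall>z. z \<^bold>\<in> D \<^bold>\<longleftrightarrow> z \<^bold>\<in> B \<^bold>\<and> z \<^bold>\<in> C) \<^bold>\<longrightarrow> D \<^bold>\<in> U)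
      \<^bold>\<and> (\<^bold>\<forall>B C. subset B P \<^bold>\<and> (\<^bold>\<forall>z. z \<^bold>\<in> C \<^bold>\<longleftrightarrow> z \<^bold>\<in> P \<^bold>\<and> \<^bold>\<not> z \<^bold>\<in> B) \<^bold>\<longrightarrow> B \<^bold>\<in> U \<^bold>\<or> C \<^bold>\<in> U))"

text \<open>The empty intersection is taken to be \<open>P\<close>.\<close>

definition complete :: "nat \<Rightarrow> nat \<Rightarrow> nat \<Rightarrow> form" where
  "complete k U P =
     (\<^bold>\<forall>S I. subset S U \<^bold>\<and> card_less S k
        \<^bold>\<and> (\<^bold>\<forall>z. z \<^bold>\<in> I \<^bold>\<longleftrightarrow> z \<^bold>\<in> P \<^bold>\<and> (\<^bold>\<forall>B. B \<^bold>\<in> S \<^bold>\<longrightarrow> z \<^bold>\<in> B))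
        \<^bold>\<longrightarrow> I \<^bold>\<in> U)"

definition fine :: "nat \<Rightarrow> nat \<Rightarrow> nat \<Rightarrow> form" where
  "fine U P X =
     (\<^bold>\<forall>x B. x \<^bold>\<in> X \<^bold>\<and> (\<^bold>\<forall>A. A \<^bold>\<in> B \<^bold>\<longleftrightarrow> A \<^bold>\<in> P \<^bold>\<and> x \<^bold>\<in> A) \<^bold>\<longrightarrow> B \<^bold>\<in> U)"

definition normal :: "nat \<Rightarrow> form" where
  "normal U =
     (\<^bold>\<forall>B f. B \<^bold>\<in> U \<^bold>\<and> fun_on f B \<^bold>\<and> (\<^bold>\<forall>A y. related f A y \<^bold>\<longrightarrow> y \<^bold>\<in> A)
        \<^bold>\<longrightarrow> (\<^bold>\<exists>C c. C \<^bold>\<in> U \<^bold>\<and> (\<^bold>\<forall>A. A \<^bold>\<in> C \<^bold>\<longrightarrow> related f A c)))"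

definition compact_for :: "nat \<Rightarrow> nat \<Rightarrow> form" where
  "compact_for k X =
     (\<^bold>\<exists>P U. is_P P k X \<^bold>\<and> ultrafilter_on U P \<^bold>\<and> fine U P X \<^bold>\<and> complete k U P)"

definition supercompact_for :: "nat \<Rightarrow> nat \<Rightarrow> form" where
  "supercompact_for k X =
     (\<^bold>\<exists>P U. is_P P k X \<^bold>\<and> ultrafilter_on U P \<^bold>\<and> fine U P X \<^bold>\<and> complete k U P \<^bold>\<and> normal U)"

definition strongly_compact :: "nat \<Rightarrow> form" where
  "strongly_compact k = (uncountable_cardinal k \<^bold>\<and> (\<^bold>\<forall>X. compact_for k X))"

definition supercompact :: "nat \<Rightarrow> form" where
  "supercompact k = (uncountable_cardinal k \<^bold>\<and> (\<^bold>\<forall>X. supercompact_for k X))"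


subsection \<open>Sequences of graphs\<close>

definition graph_structure :: "nat \<Rightarrow> nat \<Rightarrow> nat \<Rightarrow> form" where
  "graph_structure g v e =
     (is_pair g v e
      \<^bold>\<and> (\<^bold>\<forall>p. p \<^bold>\<in> e \<^bold>\<longrightarrow> (\<^bold>\<exists>x y. x \<^bold>\<in> v \<^bold>\<and> y \<^bold>\<in> v \<^bold>\<and> is_pair p x y)))"

definition graph :: "nat \<Rightarrow> form" where
  "graph g = (\<^bold>\<exists>v e. graph_structure g v e)"

definition homomorphism :: "nat \<Rightarrow> nat \<Rightarrow> nat \<Rightarrow> form" where
  "homomorphism h g g' =
     (\<^bold>\<exists>v e v' e'. graph_structure g v e \<^bold>\<and> graph_structure g' v' e' \<^bold>\<and> fun_to h v v'
        \<^bold>\<and> (\<^bold>\<forall>x y x' y'. related e x y \<^bold>\<and> related h x x' \<^bold>\<and> related h y y' \<^bold>\<longrightarrow> related e' x' y'))"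

definition graph_sequence :: "nat \<Rightarrow> form" where
  "graph_sequence G =
     ((\<^bold>\<forall>p. p \<^bold>\<in> G \<^bold>\<longrightarrow> (\<^bold>\<exists>a g. ordinal a \<^bold>\<and> graph g \<^bold>\<and> is_pair p a g))
      \<^bold>\<and> (\<^bold>\<forall>a. ordinal a \<^bold>\<longrightarrow> (\<^bold>\<exists>\<^bold>!g. related G a g)))"

definition no_forward_homs :: "nat \<Rightarrow> form" where
  "no_forward_homs G =
     (\<^bold>\<forall>a a' g g'. ordinal a \<^bold>\<and> ordinal a' \<^bold>\<and> a \<^bold>\<in> a' \<^bold>\<and> related G a g \<^bold>\<and> related G a' g'
        \<^bold>\<longrightarrow> \<^bold>\<not> (\<^bold>\<exists>h. homomorphism h g g'))"

definition backward_homs :: "nat \<Rightarrow> form" where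
  "backward_homs G =
     (\<^bold>\<forall>a a' g g'. ordinal a \<^bold>\<and> ordinal a' \<^bold>\<and> (a \<^bold>\<in> a' \<^bold>\<or> a \<^bold>= a')
        \<^bold>\<and> related G a g \<^bold>\<and> related G a' g' \<^bold>\<longrightarrow> (\<^bold>\<exists>h. homomorphism h g' g))"

definition unique_backward_homs :: "nat \<Rightarrow> form" where
  "unique_backward_homs G =
     (\<^bold>\<forall>a a' g g'. ordinal a \<^bold>\<and> ordinal a' \<^bold>\<and> (a \<^bold>\<in> a' \<^bold>\<or> a \<^bold>= a')
        \<^bold>\<and> related G a g \<^bold>\<and> related G a' g' \<^bold>\<longrightarrow> (\<^bold>\<exists>\<^bold>!h. homomorphism h g' g))"


section \<open>The theory ZFC\<close>

definition ax_extensionality :: form where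
  "ax_extensionality = (\<^bold>\<forall>x y. (\<^bold>\<forall>z. z \<^bold>\<in> x \<^bold>\<longleftrightarrow> z \<^bold>\<in> y) \<^bold>\<longrightarrow> x \<^bold>= y)"

definition ax_foundation :: form where
  "ax_foundation = (\<^bold>\<forall>x. nonempty x \<^bold>\<longrightarrow> (\<^bold>\<exists>y. y \<^bold>\<in> x \<^bold>\<and> \<^bold>\<not> (\<^bold>\<exists>z. z \<^bold>\<in> y \<^bold>\<and> z \<^bold>\<in> x)))"

definition ax_pairing :: form where
  "ax_pairing = (\<^bold>\<forall>a b. \<^bold>\<exists>p. is_upair p a b)"

definition ax_union :: form where
  "ax_union = (\<^bold>\<forall>x. \<^bold>\<exists>u. \<^bold>\<forall>z. z \<^bold>\<in> u \<^bold>\<longleftrightarrow> (\<^bold>\<exists>y. y \<^bold>\<in> x \<^bold>\<and> z \<^bold>\<in> y))"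

definition ax_power :: form where
  "ax_power = (\<^bold>\<forall>x. \<^bold>\<exists>u. \<^bold>\<forall>z. z \<^bold>\<in> u \<^bold>\<longleftrightarrow> subset z x)"

definition ax_infinity :: form where
  "ax_infinity =
     (\<^bold>\<exists>x. (\<^bold>\<exists>z. z \<^bold>\<in> x \<^bold>\<and> \<^bold>\<not> nonempty z)
        \<^bold>\<and> (\<^bold>\<forall>y. y \<^bold>\<in> x \<^bold>\<longrightarrow> (\<^bold>\<exists>s. is_succ s y \<^bold>\<and> s \<^bold>\<in> x)))"

definition ax_choice :: form where
  "ax_choice =
     (\<^bold>\<forall>x. (\<^bold>\<forall>y. y \<^bold>\<in> x \<^bold>\<longrightarrow> nonempty y)
        \<^bold>\<longrightarrow> (\<^bold>\<exists>f. fun_on f x \<^bold>\<and> (\<^bold>\<forall>y z. related f y z \<^bold>\<longrightarrow> z \<^bold>\<in> y)))"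

definition separation :: "fm \<Rightarrow> form" where
  "separation p = (\<^bold>\<forall>a. \<^bold>\<exists>b. \<^bold>\<forall>x. x \<^bold>\<in> b \<^bold>\<longleftrightarrow> x \<^bold>\<in> a \<^bold>\<and> schematic p [x])"

definition replacement :: "fm \<Rightarrow> form" where
  "replacement p =
     (\<^bold>\<forall>a. (\<^bold>\<forall>x y z. x \<^bold>\<in> a \<^bold>\<and> schematic p [x, y] \<^bold>\<and> schematic p [x, z] \<^bold>\<longrightarrow> y \<^bold>= z)
        \<^bold>\<longrightarrow> (\<^bold>\<exists>b. \<^bold>\<forall>y. y \<^bold>\<in> b \<^bold>\<longleftrightarrow> (\<^bold>\<exists>x. x \<^bold>\<in> a \<^bold>\<and> schematic p [x, y])))"

definition ZFC :: "fm set" where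
  "ZFC =
     sentence ` {ax_extensionality, ax_foundation, ax_pairing, ax_union, ax_power,
                 ax_infinity, ax_choice}
     \<union> {foralls k (separation p) | k p. free_below (k + 1) p}
     \<union> {foralls k (replacement p) | k p. free_below (k + 2) p}"

definition exists_supercompact :: fm where
  "exists_supercompact = sentence (\<^bold>\<exists>k. supercompact k)"


section \<open>The theory GB + AC\<close>

text \<open>GB is formulated in the same language: the objects are the classes, and the sets are the
  classes that are elements of some class.\<close>

definition is_set :: "nat \<Rightarrow> form" where
  "is_set x = (\<^bold>\<exists>y. x \<^bold>\<in> y)"

text \<open>Relativization of all quantifiers to sets; free variables may still denote proper classes.
  Inside the quantified body, \<open>is_set 0 1\<close> says that the bound variable, that is, index \<open>0\<close>, is a
  set.\<close>

primrec relativize :: "fm \<Rightarrow> fm" where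
  "relativize Falsum = Falsum"
| "relativize (Member i j) = Member i j"
| "relativize (Equal i j) = Equal i j"
| "relativize (Implies p q) = Implies (relativize p) (relativize q)"
| "relativize (Forall p) = Forall (Implies (is_set 0 1) (relativize p))"

definition in_sets :: "form \<Rightarrow> form" where
  "in_sets F n = relativize (F n)"

text \<open>For every formula \<open>p\<close> that quantifies over sets only, \<open>{x. p}\<close> is a class; the parameters may
  be proper classes.\<close>

definition class_comprehension :: "fm \<Rightarrow> form" where
  "class_comprehension p =
     (\<^bold>\<exists>C. \<^bold>\<forall>x. is_set x \<^bold>\<longrightarrow> (x \<^bold>\<in> C \<^bold>\<longleftrightarrow> schematic (relativize p) [x]))"

definition ax_class_replacement :: form where
  "ax_class_replacement =
     (\<^bold>\<forall>F. in_sets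
        ((\<^bold>\<forall>x y z. related F x y \<^bold>\<and> related F x z \<^bold>\<longrightarrow> y \<^bold>= z)
         \<^bold>\<longrightarrow> (\<^bold>\<forall>a. \<^bold>\<exists>b. \<^bold>\<forall>y. y \<^bold>\<in> b \<^bold>\<longleftrightarrow> (\<^bold>\<exists>x. x \<^bold>\<in> a \<^bold>\<and> related F x y))))"

text \<open>Extensionality and foundation are for classes; choice is for sets only.\<close>

definition GB_AC :: "fm set" where
  "GB_AC =
     sentence ` {ax_extensionality, ax_foundation, in_sets ax_pairing, in_sets ax_union,
                 in_sets ax_power, in_sets ax_infinity, ax_class_replacement, in_sets ax_choice}
     \<union> {foralls k (class_comprehension p) | k p. free_below (k + 1) p}"

definition SWVP :: fm where
  "SWVP = sentence
     (\<^bold>\<not> (\<^bold>\<exists>G. in_sets (graph_sequence G \<^bold>\<and> backward_homs G \<^bold>\<and> no_forward_homs G)))"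

definition WVP :: fm where
  "WVP = sentence
     (\<^bold>\<not> (\<^bold>\<exists>G. in_sets (graph_sequence G \<^bold>\<and> unique_backward_homs G \<^bold>\<and> no_forward_homs G)))"

definition exists_strongly_compact :: fm where
  "exists_strongly_compact = sentence (in_sets (\<^bold>\<exists>k. strongly_compact k))"

end

theory Submission
  imports Defs "HOL-Library.Countable" "HOL-Library.Infinite_Set"
begin

text \<open>Start with a countable model of ZFC with a supercompact cardinal \<open>kap\<close>; let \<open>H\<close> be its set of sets of
hereditary size less than \<open>kap\<close>. Normality of the ultrafilters on \<open>P_kap(Pow H)\<close> gives universes \<open>T\<close> in \<open>H\<close> and
maps \<open>ev\<close> from the subsets of \<open>T\<close> to those of \<open>H\<close> that are elementary for given formulas. The model of GB + AC
has as classes the values of subsets of \<open>H\<close>, as names, in an extension of \<open>H\<close> by a generic filter.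

A generic condition adds, with Easton support, ordinals as vertices; a vertex \<open>b\<close> carries triples \<open>(k, (x, n))\<close>
with \<open>x\<close> tending to \<open>b\<close>, and some function \<open>f\<close> into \<open>\<omega>\<close> satisfies \<open>n < f x\<close> whenever \<open>f b <= k\<close>. Above a universe
the forcing is strategically closed, so the extension satisfies replacement, and the restriction of the generic
filter to \<open>T\<close> is again generic. The maps \<open>ev\<close> therefore act on the classes of the extension of \<open>T\<close>; this gives
SWVP, as a sequence of backward homomorphisms is turned into a forward one.

If \<open>a\<close> were strongly compact, choose consecutive universes \<open>T\<close> and \<open>T'\<close> above \<open>a\<close>. A subset of the ordinals between
them that is covered by fewer than \<open>a\<close> elements is bounded, hence lies in the domain of one condition and has a
function \<open>f\<close> as above. Averaging these functions with a fine \<open>a\<close>-complete ultrafilter yields one for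
all vertices of \<open>T'\<close>, which genericity excludes by diagonalization.\<close>

text \<open>The obstacle is to destroy all strongly compact cardinals without losing the reflection
  of classes behind SWVP. Lifting an embedding to a generic extension usually needs a master
  condition. Here \<open>ev\<close> fixes every element of \<open>T\<close> and sends the part of
  the forcing inside \<open>T\<close> to the whole forcing, so a condition in \<open>T\<close> that
  forces a statement over \<open>T\<close> forces the image of that statement over \<open>H\<close>.
  For this the generic filter must restrict well: each condition has to split into an element of
  \<open>T\<close> and a part above \<open>T\<close>, hence the bounded domains in all universes.
  The triples exploit an incompactness of type omega: each bounded set of vertices between two
  universes has a suitable function into omega, all of them together have none. Omega is the right
  target because an uncountable \<open>a\<close> makes \<open>a\<close>-complete ultrafilters decide
  values in omega. The same triples endanger unions of chains, since a relation at a limit might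
  contradict what earlier stages prescribe. That is why a condition carries the existence of its
  function, and why isolated vertices are inserted before every step of a chain.\<close>

abbreviation (input) biimplication (infixr "<->" 25) where "A <-> B == A = (B :: bool)"

section \<open>Soundness and completeness\<close>

primrec sat :: "'a set => ('a => 'a => bool) => fm => (nat => 'a) => bool" where
 "sat C E Falsum e = False"
| "sat C E (Member i j) e = E (e i) (e j)"
| "sat C E (Equal i j) e = (e i = e j)"
| "sat C E (Implies p q) e = (sat C E p e --> sat C E q e)"
| "sat C E (Forall p) e = (ALL x:C. sat C E p (case_nat x e))"

lemma case_nat_comp_up: "case_nat x e o up r = case_nat x (e o r)"
proof
 fix i show "(case_nat x e o up r) i = case_nat x (e o r) i" by (cases i) auto
qed

lemma sat_rename: "sat C E (rename r p) e = sat C E p (e o r)" by (induction p arbitrary: r e) (auto simp: case_nat_comp_up)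

lemma sat_lift: "sat C E (lift p) (case_nat x e) = sat C E p e" by (simp add: lift_def sat_rename comp_def)

lemma sat_inst0: "sat C E (inst0 p t) e = sat C E p (case_nat (e t) e)"
proof -
 have "e o case_nat t (%i. i) = case_nat (e t) e" by (rule ext) (simp split: nat.split)
 thus ?thesis by (simp add: inst0_def sat_rename)
qed

text \<open>The environment has all its values in \<open>C\<close>, so \<open>C\<close> is non-empty
  and \<open>AllE\<close> may instantiate with a variable.\<close>

lemma soundness:
 assumes "T \<turnstile> p" "range e <= C" "ALL q:T. sat C E q e"
 shows "sat C E p e" using assms
proof (induction arbitrary: e rule: proves.induct)
 case (Contr p T)
 thus ?case by fastforce
next
 case (AllI T p)
 have "sat C E p (case_nat x e)" if "x : C" for x
 proof (rule AllI.IH)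
  show "range (case_nat x e) <= C" using that AllI.prems(1) by (fastforce split: nat.splits)
  show "ALL q:lift ` T. sat C E q (case_nat x e)" using AllI.prems(2) by (simp add: sat_lift)
 qed
 thus ?case by simp
next
 case (AllE T p t)
 hence "e t : C" by auto
 thus ?case using AllE by (auto simp: sat_inst0)
next
 case (EqSubst T s t p)
 have "sat C E (Equal s t) e" "sat C E (inst0 p s) e" by (rule EqSubst.IH EqSubst.prems)+
 thus ?case by (simp add: sat_inst0)
next
 case (ImpI p T q)
 thus ?case by simp
next
 case (ImpE T p q)
 have "sat C E (Implies p q) e" "sat C E p e" by (rule ImpE.IH ImpE.prems)+
 thus ?case by simp
qed auto

section \<open>Henkin completeness with variables as witnesses\<close>

abbreviation neg :: "fm => fm" where "neg p \<equiv> Implies p Falsum"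

primrec fv :: "fm => nat set" where
 "fv Falsum = {}"
| "fv (Member i j) = {i, j}"
| "fv (Equal i j) = {i, j}"
| "fv (Implies p q) = fv p Un fv q"
| "fv (Forall p) = {i. Suc i : fv p}"

lemma finite_fv: "finite (fv p)"
proof (induction p)
 case (Forall p)
 have "finite (Suc -` fv p)" using Forall by (simp add: finite_vimageI)
 thus ?case by (simp add: vimage_def)
qed auto

lemma rename_cong: "(!!i. i : fv p ==> r i = s i) ==> rename r p = rename s p"
proof (induction p arbitrary: r s)
 case (Forall p)
 have "rename (up r) p = rename (up s) p"
 proof (rule Forall.IH)
  fix i assume "i : fv p"
  thus "up r i = up s i" using Forall.prems by (cases i) auto
 qed
 thus ?case by simp
next
 case (Implies p q)
 have "rename r p = rename s p" by (rule Implies.IH) (use Implies.prems in simp)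
 moreover have "rename r q = rename s q" by (rule Implies.IH) (use Implies.prems in simp)
 ultimately show ?case by simp
qed auto

lemma up_comp: "up r o up s = up (r o s)"
proof
 fix i show "(up r o up s) i = up (r o s) i" by (cases i) auto
qed

lemma rename_rename: "rename r (rename s p) = rename (r o s) p" by (induction p arbitrary: r s) (auto simp: up_comp)

lemma up_id: "up (%i. i) = (%i. i)"
proof
 fix i show "up (%i. i) i = i" by (cases i) auto
qed

lemma rename_id: "rename (%i. i) p = p" by (induction p) (auto simp: up_id)

lemma sat_cong: "(!!i. i : fv p ==> e i = e' i) ==> sat C E p e = sat C E p e'"
proof (induction p arbitrary: e e')
 case (Forall p)
 have "sat C E p (case_nat x e) = sat C E p (case_nat x e')" for x by (rule Forall.IH) (use Forall.prems in "auto split: nat.splits")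
 thus ?case by simp
next
 case (Implies p q)
 have "sat C E p e = sat C E p e'" by (rule Implies.IH) (use Implies.prems in simp)
 moreover have "sat C E q e = sat C E q e'" by (rule Implies.IH) (use Implies.prems in simp)
 ultimately show ?case by simp
qed auto

text \<open>Holds for non-injective renamings too. It brings proofs back from the doubled variables
  in \<open>completeness\<close>, and turns a fresh variable into the bound variable 0 in
  \<open>consistent_witness\<close>.\<close>

lemma proves_rename: "T \<turnstile> p ==> rename r ` T \<turnstile> rename r p"
proof (induction arbitrary: r rule: proves.induct)
 case (AllI T p)
 have eq: "rename (up r) ` lift ` T = lift ` rename r ` T" by (auto simp: lift_def rename_rename image_image comp_def)
 show ?case using AllI.IH[of "up r"] by (auto simp: eq intro: proves.AllI)
next
 case (AllE T p t)
 have "r o case_nat t (%i. i) = case_nat (r t) (%i. i) o up r" by (rule ext) (case_tac x; simp)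
 hence "rename r (inst0 p t) = inst0 (rename (up r) p) (r t)" by (simp add: inst0_def rename_rename)
 thus ?case using AllE.IH[of r] by (metis proves.AllE rename.simps(5))
next
 case (EqSubst T s t p)
 have "r o case_nat t (%i. i) = case_nat (r t) (%i. i) o up r" for t by (rule ext) (case_tac x; simp)
 hence "rename r (inst0 p t) = inst0 (rename (up r) p) (r t)" for t by (simp add: inst0_def rename_rename)
 thus ?case using EqSubst.IH[of r] by (metis proves.EqSubst rename.simps(3))
next
 case (ImpE T p q)
 thus ?case by (metis proves.ImpE rename.simps(4))
next
 case (Contr p T)
 have "insert (neg (rename r p)) (rename r ` T) \<turnstile> Falsum" using Contr.IH[of r] by simp
 thus ?case by (rule proves.Contr)
next
 case (ImpI p T q)
 have "insert (rename r p) (rename r ` T) \<turnstile> rename r q" using ImpI.IH[of r] by simp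
 hence "rename r ` T \<turnstile> Implies (rename r p) (rename r q)" by (rule proves.ImpI)
 thus ?case by simp
qed (auto intro: proves.Assm proves.EqRefl)

lemma proves_mono: "T \<turnstile> p ==> T <= T' ==> T' \<turnstile> p"
proof (induction arbitrary: T' rule: proves.induct)
 case (ImpI p T q)
 thus ?case by (meson insert_mono proves.ImpI)
next
 case (Contr p T)
 thus ?case by (meson insert_mono proves.Contr)
next
 case (AllI T p)
 thus ?case by (meson image_mono proves.AllI)
next
 case (ImpE T p q)
 thus ?case by (meson proves.ImpE)
next
 case (EqSubst T s t p)
 thus ?case by (meson proves.EqSubst)
next
 case (AllE T p t)
 thus ?case by (meson proves.AllE)
qed (auto intro: proves.Assm proves.EqRefl)

lemma proves_finite: "T \<turnstile> p ==> EX F<=T. finite F & F \<turnstile> p"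
proof (induction rule: proves.induct)
 case (Assm p T)
 thus ?case by (intro exI[of _ "{p}"]) (auto intro: proves.Assm)
next
 case (ImpI p T q)
 then obtain F where F: "F <= insert p T" "finite F" "F \<turnstile> q" by blast
 have "insert p (F - {p}) \<turnstile> q" by (rule proves_mono[OF F(3)]) auto
 hence "F - {p} \<turnstile> Implies p q" by (rule proves.ImpI)
 thus ?case using F by (intro exI[of _ "F - {p}"]) auto
next
 case (ImpE T p q)
 then obtain F F' where F: "F <= T" "finite F" "F \<turnstile> Implies p q"
  and F': "F' <= T" "finite F'" "F' \<turnstile> p" by blast
 have "F Un F' \<turnstile> q" by (rule proves.ImpE[OF proves_mono[OF F(3)] proves_mono[OF F'(3)]]) auto
 thus ?case using F F' by (intro exI[of _ "F Un F'"]) auto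
next
 case (Contr p T)
 then obtain F where F: "F <= insert (neg p) T" "finite F" "F \<turnstile> Falsum" by blast
 have "insert (neg p) (F - {neg p}) \<turnstile> Falsum" by (rule proves_mono[OF F(3)]) auto
 hence "F - {neg p} \<turnstile> p" by (rule proves.Contr)
 thus ?case using F by (intro exI[of _ "F - {neg p}"]) auto
next
 case (AllI T p)
 then obtain F where "F <= lift ` T" "finite F" "F \<turnstile> p" by blast
 thus ?case by (metis finite_subset_image proves.AllI)
next
 case (AllE T p t)
 thus ?case by (meson proves.AllE)
next
 case (EqRefl T t)
 thus ?case by (meson empty_subsetI finite.emptyI proves.EqRefl)
next
 case (EqSubst T s t p)
 then obtain F F' where F: "F <= T" "finite F" "F \<turnstile> Equal s t"
  and F': "F' <= T" "finite F'" "F' \<turnstile> inst0 p s" by blast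
 have "F Un F' \<turnstile> inst0 p t" by (rule proves.EqSubst[OF proves_mono[OF F(3)] proves_mono[OF F'(3)]]) auto
 thus ?case using F F' by (intro exI[of _ "F Un F'"]) auto
qed

lemma consistent_insert_neg:
 assumes "consistent T" "~consistent (insert p T)"
 shows "consistent (insert (neg p) T)" unfolding consistent_def
proof
 assume "insert (neg p) T \<turnstile> Falsum"
 hence "T \<turnstile> p" by (rule proves.Contr)
 moreover have "T \<turnstile> neg p" using assms(2) by (auto simp: consistent_def intro: proves.ImpI)
 ultimately show False using assms(1) by (meson consistent_def proves.ImpE)
qed

text \<open>A variable \<open>y\<close> that occurs nowhere in \<open>T\<close> acts as a Henkin
  constant: renaming \<open>y\<close> to 0 and every other \<open>i\<close> to \<open>Suc i\<close>
  turns \<open>T\<close> into its lift and \<open>inst0 p y\<close> into \<open>p\<close>, which is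
  the premise of \<open>AllI\<close>.\<close>

lemma consistent_witness:
 assumes cons: "consistent T" and all: "neg (Forall p) : T" and y: "ALL q:T. y ~: fv q"
 shows "consistent (insert (neg (inst0 p y)) T)" unfolding consistent_def
proof
 assume "insert (neg (inst0 p y)) T \<turnstile> Falsum"
 hence "T \<turnstile> inst0 p y" by (rule proves.Contr)
 define rho where "rho i = (if i = y then 0 else Suc i)" for i
 have "rename rho q = lift q" if "q : T" for q unfolding lift_def by (rule rename_cong) (use that y in "auto simp: rho_def")
 hence T: "rename rho ` T = lift ` T" by (auto simp: image_iff)
 have yp: "Suc y ~: fv p" using all y by fastforce
 have "rename rho (inst0 p y) = rename (%i. i) p" unfolding inst0_def rename_rename
  by (rule rename_cong) (use yp in "auto simp: rho_def split: nat.splits")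
 hence "lift ` T \<turnstile> p" using proves_rename[OF \<open>T \<turnstile> inst0 p y\<close>, of rho] by (simp add: T rename_id)
 hence "T \<turnstile> Forall p" by (rule proves.AllI)
 moreover have "T \<turnstile> neg (Forall p)" using all by (rule proves.Assm)
 ultimately show False using cons by (meson consistent_def proves.ImpE)
qed

instance fm :: countable by countable_datatype

definition fresh_vars :: "fm set => nat set" where
 "fresh_vars T = {y. ALL q:T. y ~: fv q}"

lemma infinite_fresh_vars_insert:
 "infinite (fresh_vars T) ==> infinite (fresh_vars (insert p T))"
proof -
 assume "infinite (fresh_vars T)"
 moreover have "fresh_vars (insert p T) = fresh_vars T - fv p" by (auto simp: fresh_vars_def)
 ultimately show ?thesis by (simp add: Diff_infinite_finite finite_fv)
qed

text \<open>A refuted universal formula receives its counterexample in the same step, so maximality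
  and witnesses come from a single enumeration. The language has no constants, hence the witnesses
  are variables.\<close>

definition henkin_step :: "fm set => fm => fm set" where
 "henkin_step T q =
   (if consistent (insert q T) then insert q T
   else case q of Forall p =>
       insert (neg (inst0 p (SOME y. y : fresh_vars (insert (neg q) T)))) (insert (neg q) T)
      | _ => insert (neg q) T)"

lemma henkin_step:
 assumes T: "consistent T" "infinite (fresh_vars T)"
 shows "consistent (henkin_step T q) & infinite (fresh_vars (henkin_step T q))"
proof (cases "consistent (insert q T)")
 case True
 thus ?thesis using T by (simp add: henkin_step_def infinite_fresh_vars_insert)
next
 case False
 hence c: "consistent (insert (neg q) T)" using T consistent_insert_neg by blast
 have i: "infinite (fresh_vars (insert (neg q) T))" using T infinite_fresh_vars_insert by blast
 have *: ?thesis if "henkin_step T q = insert (neg q) T" using c i that by simp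
 show ?thesis
 proof (cases q)
  case (Forall p)
  define y where "y = (SOME y. y : fresh_vars (insert (neg q) T))"
  have "y : fresh_vars (insert (neg q) T)" unfolding y_def using i by (metis finite.emptyI some_in_eq)
  hence "consistent (insert (neg (inst0 p y)) (insert (neg q) T))"
   using c Forall by (intro consistent_witness) (auto simp: fresh_vars_def)
  thus ?thesis using False i Forall by (simp add: henkin_step_def y_def infinite_fresh_vars_insert)
 qed (rule *, use False in "simp add: henkin_step_def")+
qed

text \<open>Renaming each variable \<open>i\<close> to \<open>2 * i\<close> frees the odd variables
  for witnesses. The model consists of the variables modulo equality in a maximal consistent
  theory.\<close>

lemma completeness:
 fixes T :: "fm set"
 assumes "consistent T"
 shows "EX (C :: nat set) E e. range e <= C & (ALL p:T. sat C E p e)"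
proof -
 define T0 where "T0 = rename (%i. 2 * i) ` T"
 have "consistent T0" unfolding consistent_def
 proof
  assume "T0 \<turnstile> Falsum"
  hence "rename (%i. i div 2) ` T0 \<turnstile> rename (%i. i div 2) Falsum" by (rule proves_rename)
  thus False using assms by (simp add: T0_def image_image rename_rename comp_def rename_id consistent_def)
 qed
 have fv_even: "even i" if "i : fv (rename (%i. 2 * i) p)" for i p
 proof -
  have *: "fv (rename r p) <= r ` fv p" for r p
  proof (induction p arbitrary: r)
   case (Forall p)
   show ?case
   proof
    fix i assume "i : fv (rename r (Forall p))"
    hence "Suc i : up r ` fv p" using Forall by auto
    then obtain j where "j : fv p" "Suc i = up r j" by auto
    thus "i : r ` fv (Forall p)" by (cases j) auto
   qed
  next
   case (Implies p q)
   thus ?case by (simp add: image_Un) blast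
  qed auto
  from that * [of "%i. 2 * i" p] show ?thesis by auto
 qed
 have "range (%i. Suc (2 * i)) <= fresh_vars T0" using fv_even by (force simp: fresh_vars_def T0_def)
 moreover have "infinite (range (%i::nat. Suc (2 * i)))" by (simp add: finite_image_iff inj_on_def)
 ultimately have "infinite (fresh_vars T0)" using infinite_super by blast
 define D where "D = rec_nat T0 (%n S. henkin_step S (from_nat n))"
 have D0: "D 0 = T0" and DS: "D (Suc n) = henkin_step (D n) (from_nat n)" for n by (simp_all add: D_def)
 have D: "consistent (D n) & infinite (fresh_vars (D n))" for n
 proof (induction n)
  case 0
  thus ?case using D0 \<open>consistent T0\<close> \<open>infinite (fresh_vars T0)\<close> by simp
 next
  case (Suc n)
  thus ?case using DS henkin_step by auto
 qed
 have step: "D n <= D (Suc n)" for n by (auto simp: DS henkin_step_def split: fm.splits)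
 have mono: "n <= m ==> D n <= D m" for n m using step by (rule lift_Suc_mono_le)
 define W where "W = (UN n. D n)"
 have fin: "EX n. F <= D n" if "finite F" "F <= W" for F using that
 proof (induction F)
  case (insert p F)
  then obtain n m where "F <= D n" "p : D m" by (auto simp: W_def)
  hence "insert p F <= D (max n m)" using mono[of n "max n m"] mono[of m "max n m"] by auto
  thus ?case by blast
 qed auto
 have cW: "consistent W" unfolding consistent_def
 proof
  assume "W \<turnstile> Falsum"
  then obtain F where "F <= W" "finite F" "F \<turnstile> Falsum" using proves_finite by blast
  thus False using fin D by (metis consistent_def proves_mono)
 qed
 have dec: "p : W | neg p : W" for p
 proof -
  have "p : D (Suc (to_nat p)) | neg p : D (Suc (to_nat p))" by (auto simp: DS henkin_step_def split: fm.splits)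
  thus ?thesis by (auto simp: W_def)
 qed
 have not_both: "~(p : W & neg p : W)" for p using cW by (meson consistent_def proves.Assm proves.ImpE)
 have cl: "p : W" if "W \<turnstile> p" for p using that dec[of p] cW by (meson consistent_def proves.Assm proves.ImpE)
 have imp: "Implies p q : W <-> (p : W --> q : W)" for p q
 proof
  assume "Implies p q : W"
  thus "p : W --> q : W" by (meson cl proves.Assm proves.ImpE)
 next
  assume *: "p : W --> q : W"
  show "Implies p q : W"
  proof (cases "q : W")
   case True
   thus ?thesis by (intro cl proves.ImpI proves.Assm) auto
  next
   case False
   hence "neg p : W" using * dec by blast
   have "insert p W \<turnstile> Falsum" using \<open>neg p : W\<close> by (meson insertCI proves.Assm proves.ImpE)
   hence "insert p W \<turnstile> q" by (meson proves.Contr proves_mono subset_insertI)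
   thus ?thesis by (intro cl proves.ImpI)
  qed
 qed
 have all: "Forall p : W <-> (ALL y. inst0 p y : W)" for p
 proof
  assume "Forall p : W"
  thus "ALL y. inst0 p y : W" by (meson cl proves.Assm proves.AllE)
 next
  assume *: "ALL y. inst0 p y : W"
  show "Forall p : W"
  proof (rule ccontr)
   assume "Forall p ~: W"
   hence "Forall p ~: D (Suc (to_nat (Forall p)))" by (auto simp: W_def)
   hence "EX y. neg (inst0 p y) : D (Suc (to_nat (Forall p)))" by (auto simp: DS henkin_step_def split: if_splits)
   then obtain y where "neg (inst0 p y) : W" by (auto simp: W_def)
   thus False using * not_both by blast
  qed
 qed
 \<comment> \<open>The least variable of an equality class represents it, so the carrier is a set of
   numbers and no quotient type is needed.\<close>
 define rep where "rep i = (LEAST j. Equal i j : W)" for i :: nat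
 have refl: "Equal i i : W" for i by (intro cl proves.EqRefl)
 have subst: "inst0 p t : W" if "Equal s t : W" "inst0 p s : W" for p s t using that by (meson cl proves.Assm proves.EqSubst)
 have sym: "Equal j i : W" if "Equal i j : W" for i j using subst[OF that, of "Equal 0 (Suc i)"] refl[of i] by (simp add: inst0_def)
 have trans: "Equal i k : W" if "Equal i j : W" "Equal j k : W" for i j k
  using subst[OF that(2), of "Equal (Suc i) 0"] that(1) by (simp add: inst0_def)
 have rep: "Equal i (rep i) : W" for i unfolding rep_def by (rule LeastI) (rule refl)
 have rep_eq: "rep i = rep j <-> Equal i j : W" for i j
 proof
  assume "rep i = rep j"
  thus "Equal i j : W" using rep[of i] rep[of j] sym trans by metis
 next
  assume "Equal i j : W"
  hence "Equal i k : W <-> Equal j k : W" for k using sym trans by blast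
  thus "rep i = rep j" by (simp add: rep_def)
 qed
 have mem: "Member (rep i) (rep j) : W <-> Member i j : W" for i j
 proof -
  have "Member i' j' : W" if "Member i j : W" "Equal i i' : W" "Equal j j' : W" for i j i' j'
   using subst[OF that(2), of "Member 0 (Suc j)"] subst[OF that(3), of "Member (Suc i') 0"] that(1) by (simp add: inst0_def)
  thus ?thesis using rep sym by blast
 qed
 define E where "E i j <-> Member i j : W" for i j
 have truth: "sat (range rep) E p (rep o e) <-> rename e p : W" for p e
 proof (induction p arbitrary: e)
  case Falsum
  thus ?case using cW by (auto simp: consistent_def intro: proves.Assm)
 next
  case (Forall p)
  have "inst0 (rename (up e) p) y = rename (case_nat y e) p" for y
  proof -
   have "case_nat y (%i. i) o up e = case_nat y e" using case_nat_comp_up[of y "%i. i" e] by (simp add: comp_def)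
   thus ?thesis by (simp add: inst0_def rename_rename)
  qed
  moreover have "case_nat (rep y) (rep o e) = rep o case_nat y e" for y by (rule ext) (simp split: nat.split)
  ultimately show ?case by (simp only: sat.simps rename.simps ball_simps all Forall.IH)
 qed (auto simp: E_def mem rep_eq imp)
 have "sat (range rep) E p (rep o (%i. 2 * i))" if "p : T" for p
 proof -
  have "rename (%i. 2 * i) p : D 0" using that by (simp add: D0 T0_def)
  hence "rename (%i. 2 * i) p : W" by (auto simp only: W_def)
  thus ?thesis by (simp only: truth)
 qed
 moreover have "range (rep o (%i. 2 * i)) <= range rep" by auto
 ultimately show ?thesis by blast
qed

section \<open>Evaluating formulas\<close>

text \<open>Written formulas name their variables by level, \<open>sat\<close> reads environments by
  index. With this accessor a written formula is evaluated by simplification, without index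
  arithmetic.\<close>

definition lv :: "(nat => 'a) => nat => nat => 'a" where
 "lv e n x = e (n - Suc x)"

lemma lv_new [simp]: "lv (case_nat a e) (Suc n) n = a" by (simp add: lv_def)

lemma lv_old [simp]: "x < n ==> lv (case_nat a e) (Suc n) x = lv e n x"
 using Suc_diff_Suc[of x n] by (simp add: lv_def del: Suc_diff_Suc) (metis nat.case(2))

lemma sat_form [simp]:
 "sat K E ((x \<^bold>\<in> y) n) e <-> E (lv e n x) (lv e n y)"
 "sat K E ((x \<^bold>= y) n) e <-> lv e n x = lv e n y"
 "sat K E ((F \<^bold>\<longrightarrow> G) n) e <-> (sat K E (F n) e --> sat K E (G n) e)"
 "sat K E ((\<^bold>\<not> F) n) e <-> ~sat K E (F n) e"
 "sat K E ((F \<^bold>\<or> G) n) e <-> sat K E (F n) e | sat K E (G n) e"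
 "sat K E ((F \<^bold>\<and> G) n) e <-> sat K E (F n) e & sat K E (G n) e"
 "sat K E ((F \<^bold>\<longleftrightarrow> G) n) e <-> (sat K E (F n) e <-> sat K E (G n) e)"
 by (auto simp: f_mem_def f_eq_def f_imp_def f_not_def f_or_def f_and_def f_iff_def lv_def)

lemma sat_quantifiers [simp]:
 "sat K E ((\<^bold>\<forall>x. H x) n) e <-> (ALL a:K. sat K E (H n (Suc n)) (case_nat a e))"
 "sat K E ((\<^bold>\<exists>x. H x) n) e <-> (EX a:K. sat K E (H n (Suc n)) (case_nat a e))"
 by (auto simp: f_all_def f_ex_def f_not_def f_imp_def)

lemma sat_ex1 [simp]:
 "sat K E ((\<^bold>\<exists>\<^bold>!x. H x) n) e <->
   (EX a:K. sat K E (H n (Suc n)) (case_nat a e) &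
    (ALL b:K. sat K E (H (Suc n) (Suc (Suc n))) (case_nat b (case_nat a e)) --> b = a))" by (simp add: f_ex1_def)

lemma sat_relativize:
 "sat C E (relativize p) e = sat {x : C. EX y:C. E x y} E p e"
proof (induction p arbitrary: e)
 case (Forall p)
 have "sat C E (is_set 0 1) (case_nat x e) <-> (EX y:C. E x y)" for x by (simp add: is_set_def lv_def)
 thus ?case using Forall by simp blast
qed auto

lemma sat_foralls:
 "sat K E (foralls k F) e <->
   (ALL f. (ALL i<k. f i : K) --> sat K E (F k) (%i. if i < k then f (k - Suc i) else e (i - k)))"
proof -
 have *: "sat K E ((Forall ^^ k) p) e <->
   (ALL f. (ALL i<k. f i : K) --> sat K E p (%i. if i < k then f (k - Suc i) else e (i - k)))" for p
 proof (induction k arbitrary: e)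
  case 0
  thus ?case by simp
 next
  case (Suc k)
  have env: "(%i. if i < k then g (k - Suc i) else case_nat x e (i - k)) =
    (%i. if i < Suc k then (case_nat x g) (Suc k - Suc i) else e (i - Suc k))" for x g
  proof
   fix i
   consider "i < k" | "i = k" | j where "i = Suc (k + j)" by (metis less_imp_Suc_add linorder_neqE_nat)
   thus "(if i < k then g (k - Suc i) else case_nat x e (i - k)) =
     (if i < Suc k then (case_nat x g) (Suc k - Suc i) else e (i - Suc k))"
   proof cases
    case 1
    then obtain j where "k - i = Suc j" by (metis Suc_diff_Suc)
    thus ?thesis using 1 by (simp add: Suc_diff_Suc[symmetric])
   qed simp_all
  qed
  have "sat K E ((Forall ^^ Suc k) p) e <-> (ALL x:K. ALL g. (ALL i<k. g i : K) -->
    sat K E p (%i. if i < Suc k then (case_nat x g) (Suc k - Suc i) else e (i - Suc k)))" by (simp add: Suc env)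
  also have "\<dots> <-> (ALL f. (ALL i<Suc k. f i : K) -->
    sat K E p (%i. if i < Suc k then f (Suc k - Suc i) else e (i - Suc k)))"
  proof (intro iffI allI impI ballI)
   fix f :: "nat => 'a"
   assume *: "ALL x:K. ALL g. (ALL i<k. g i : K) -->
    sat K E p (%i. if i < Suc k then (case_nat x g) (Suc k - Suc i) else e (i - Suc k))"
    and f: "ALL i<Suc k. f i : K"
   have cf: "case_nat (f 0) (%i. f (Suc i)) = f" by (rule ext) (simp split: nat.split)
   thus "sat K E p (%i. if i < Suc k then f (Suc k - Suc i) else e (i - Suc k))"
    using bspec[OF *, of "f 0", THEN spec, of "%i. f (Suc i)"] f by (simp only: cf) simp
  next
   fix x g
   assume *: "ALL f. (ALL i<Suc k. f i : K) -->
    sat K E p (%i. if i < Suc k then f (Suc k - Suc i) else e (i - Suc k))"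
    and "x : K" "ALL i<k. g i : K"
   thus "sat K E p (%i. if i < Suc k then (case_nat x g) (Suc k - Suc i) else e (i - Suc k))"
    by (intro *[rule_format]) (auto split: nat.split)
  qed
  finally show ?case .
 qed
 show ?thesis by (simp add: foralls_def *)
qed

lemma sat_schematic:
 "sat K E (schematic p xs n) e =
   sat K E p (%i. lv e n (if i < length xs then xs ! i else i - length xs))" by (simp add: schematic_def sat_rename comp_def lv_def)

lemma free_below_fv: "free_below n p <-> fv p <= {..<n}"
proof (induction p arbitrary: n)
 case (Forall p)
 show ?case
 proof
  assume "free_below n (Forall p)"
  thus "fv (Forall p) <= {..<n}" using Forall by auto
 next
  assume *: "fv (Forall p) <= {..<n}"
  have "fv p <= {..<Suc n}"
  proof
   fix i assume "i : fv p"
   thus "i : {..<Suc n}" using * by (cases i) auto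
  qed
  thus "free_below n (Forall p)" using Forall by simp
 qed
qed auto

lemma free_below_exists: "EX k. free_below (k + m) p"
proof -
 obtain k where "ALL i:fv p. i < k" using finite_nat_set_iff_bounded[of "fv p"] finite_fv by blast
 hence "free_below (k + m) p" by (auto simp: free_below_fv intro: trans_less_add1)
 thus ?thesis ..
qed

section \<open>Predicates and terms definable with parameters\<close>

named_theorems dps

text \<open>Even indices carry the variables, odd indices the parameters. Both supplies stay
  infinite, so connectives and quantifiers reduce to renamings.\<close>

definition weave :: "(nat => 'a) => (nat => 'a) => nat => 'a" where
 "weave e c i = (if even i then e (i div 2) else c (i div 2))"

lemma weave_simps [simp]: "weave e c (2 * k) = e k" "weave e c (Suc (2 * k)) = c k" by (simp_all add: weave_def)

lemma weave_eqI: "(!!k. f (2 * k) = e k) ==> (!!k. f (Suc (2 * k)) = c k) ==> f = weave e c"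
 by (rule ext) (metis evenE oddE Suc_eq_plus1 weave_simps)

lemma range_weave: "range e <= A ==> range c <= A ==> range (weave e c) <= A" by (auto simp: weave_def)

text \<open>One interface for several structures: the ground model (all objects are sets), the
  subsets of a universe over its elements, and the classes over the sets of a generic
  extension.\<close>

locale base =
 fixes C :: "'a set" and E :: "'a => 'a => bool" (infix "\<E>" 50) and S :: "'a set"
 assumes S_sub: "S <= C"
  and mem_S: "x \<E> y ==> y : C ==> x : S"
  and ext: "x : C ==> y : C ==> (!!z. z : S ==> z \<E> x <-> z \<E> y) ==> x = y"
  and pairing: "a : S ==> b : S ==> EX p:S. ALL z:S. z \<E> p <-> z = a | z = b"
  and nonempty: "S ~= {}"
begin

lemma S_C [intro]: "x : S ==> x : C" using S_sub by blast

definition upair :: "'a => 'a => 'a" where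
 "upair a b = (THE p. p : S & (ALL z:S. z \<E> p <-> z = a | z = b))"

lemma upair:
 assumes "a : S" "b : S"
 shows "upair a b : S" "z \<E> upair a b <-> z = a | z = b"
proof -
 obtain p where p: "p : S & (ALL z:S. z \<E> p <-> z = a | z = b)" using pairing[OF assms] by blast
 moreover have "q = p" if "q : S & (ALL z:S. z \<E> q <-> z = a | z = b)" for q by (rule ext) (use p that in auto)
 ultimately have "upair a b = p" unfolding upair_def by (rule the_equality)
 thus "upair a b : S" "z \<E> upair a b <-> z = a | z = b" using p assms mem_S by auto
qed

lemma upair_eqI:
 assumes "a : S" "b : S" "p : C" "!!z. z : S ==> z \<E> p <-> z = a | z = b"
 shows "p = upair a b" by (rule ext) (use assms upair in auto)

definition opair :: "'a => 'a => 'a" where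
 "opair a b = upair (upair a a) (upair a b)"

lemma opair_S [intro, simp]: "a : S ==> b : S ==> opair a b : S" by (simp add: opair_def upair)

lemma opair_inject:
 assumes "a : S" "b : S" "a' : S" "b' : S"
 shows "opair a b = opair a' b' <-> a = a' & b = b'"
proof
 assume eq: "opair a b = opair a' b'"
 have S1: "upair a a : S" "upair a b : S" "upair a' a' : S" "upair a' b' : S" using assms upair by auto
 have m: "z = upair a a | z = upair a b <-> z = upair a' a' | z = upair a' b'" for z using eq S1 upair(2) unfolding opair_def by metis
 have A: "a = a'" using m[of "upair a a"] m[of "upair a' a'"] upair(2) assms by metis
 have "upair a a = upair a' b' | upair a b = upair a' b'" using m[of "upair a' b'"] by auto
 hence "b' = a | b' = b" using upair(2) assms by metis
 moreover have "upair a b = upair a' a' | upair a b = upair a' b'" using m[of "upair a b"] by auto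
 hence "b = a' | b = b'" using upair(2) assms by metis
 ultimately show "a = a' & b = b'" using A by (metis assms m upair(2))
qed simp

lemma sat_is_upair [simp]:
 assumes "S <= K" "K <= C" "p < n" "a < n" "b < n" "lv e n p : K" "lv e n a : K" "lv e n b : K"
 shows "sat K E (is_upair p a b n) e <->
  lv e n a : S & lv e n b : S & lv e n p = upair (lv e n a) (lv e n b)"
proof -
 have "sat K E (is_upair p a b n) e <->
   (ALL z:K. z \<E> lv e n p <-> z = lv e n a | z = lv e n b)" using assms by (simp add: is_upair_def)
 also have "\<dots> <-> lv e n a : S & lv e n b : S & lv e n p = upair (lv e n a) (lv e n b)"
 proof
  assume *: "ALL z:K. z \<E> lv e n p <-> z = lv e n a | z = lv e n b"
  have p: "lv e n p : C" using assms by blast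
  have ab: "lv e n a : S" "lv e n b : S" using * assms mem_S[OF _ p] by auto
  moreover have "lv e n p = upair (lv e n a) (lv e n b)" by (rule upair_eqI[OF ab p]) (use * assms(1) in blast)
  ultimately show "lv e n a : S & lv e n b : S & lv e n p = upair (lv e n a) (lv e n b)" by blast
 qed (simp add: upair(2))
 finally show ?thesis .
qed

lemma sat_is_pair [simp]:
 assumes "S <= K" "K <= C" "p < n" "a < n" "b < n" "lv e n p : K" "lv e n a : K" "lv e n b : K"
 shows "sat K E (is_pair p a b n) e <->
  lv e n a : S & lv e n b : S & lv e n p = opair (lv e n a) (lv e n b)"
proof -
 have "sat K E (is_pair p a b n) e <->
   (EX s:K. EX t:K. (lv e n a : S & s = upair (lv e n a) (lv e n a)) &
     (lv e n a : S & lv e n b : S & t = upair (lv e n a) (lv e n b)) &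
     s : S & t : S & lv e n p = upair s t)" using assms by (simp add: is_pair_def less_SucI)
 also have "\<dots> <-> lv e n a : S & lv e n b : S & lv e n p = opair (lv e n a) (lv e n b)"
  unfolding opair_def using assms(1) upair(1)[of "lv e n a" "lv e n a"] upair(1)[of "lv e n a" "lv e n b"] by auto
 finally show ?thesis .
qed

lemma sat_related [simp]:
 assumes "S <= K" "K <= C" "r < n" "a < n" "b < n" "lv e n r : C" "lv e n a : K" "lv e n b : K"
 shows "sat K E (related r a b n) e <->
  lv e n a : S & lv e n b : S & opair (lv e n a) (lv e n b) \<E> lv e n r"
proof -
 have "sat K E (related r a b n) e <->
  (EX p:K. lv e n a : S & lv e n b : S & p = opair (lv e n a) (lv e n b) & p \<E> lv e n r)"
  using assms by (simp add: related_def less_SucI)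
 thus ?thesis using assms(1) by auto
qed

text \<open>Definability as a semantic property lets the axiom schemas be applied to HOL predicates.
  That a given predicate is definable is then proved by applying the rules \<open>dps\<close> along
  its syntax. Parameters may be classes.\<close>

definition dp :: "((nat => 'a) => bool) => bool" where
 "dp P <-> (EX p c. range c <= C & (ALL e. range e <= S --> P e = sat S E p (weave e c)))"

definition dt :: "((nat => 'a) => 'a) => bool" where
 "dt f <-> (ALL e. range e <= S --> f e : S) & dp (%e. e 0 = f (%i. e (Suc i)))"

lemma dp_cong: "dp P ==> (!!e. range e <= S ==> Q e = P e) ==> dp Q" unfolding dp_def by metis

lemma dp_base: "dp (%e. e i \<E> e j)" "dp (%e. e i = e j)" "X : C ==> dp (%e. e i \<E> X)"
 "x : S ==> dp (%e. e i = x)" "dp (%e. False)"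
proof -
 obtain s where s: "s : S" using nonempty by blast
 show "dp (%e. e i \<E> e j)"
  unfolding dp_def by (intro exI[of _ "Member (2*i) (2*j)"] exI[of _ "%_. s"]) (use s in "auto simp: weave_def")
 show "dp (%e. e i = e j)" unfolding dp_def by (intro exI[of _ "Equal (2*i) (2*j)"] exI[of _ "%_. s"]) (use s in "auto simp: weave_def")
 show "dp (%e. e i \<E> X)" if "X : C"
  unfolding dp_def by (intro exI[of _ "Member (2*i) 1"] exI[of _ "%_. X"]) (use that in "auto simp: weave_def")
 show "dp (%e. e i = x)" if "x : S"
  unfolding dp_def by (intro exI[of _ "Equal (2*i) 1"] exI[of _ "%_. x"]) (use that in "auto simp: weave_def")
 show "dp (%e. False)" unfolding dp_def by (intro exI[of _ "Falsum"] exI[of _ "%_. s"]) (use s in auto)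
qed

lemma dp_imp:
 assumes "dp P" "dp Q"
 shows "dp (%e. P e --> Q e)"
proof -
 obtain p c where p: "range c <= C" "!!e. range e <= S ==> P e = sat S E p (weave e c)" using assms(1) unfolding dp_def by blast
 obtain q d where q: "range d <= C" "!!e. range e <= S ==> Q e = sat S E q (weave e d)" using assms(2) unfolding dp_def by blast
 define r where "r i = (if even i then i else 2 * i - 1)" for i :: nat
 define s where "s i = (if even i then i else 2 * i + 1)" for i :: nat
 have "weave e (weave c d) o r = weave e c" for e
 proof (rule weave_eqI)
  fix k
  show "(weave e (weave c d) o r) (Suc (2 * k)) = c k" using weave_simps(2)[of e "weave c d" "2 * k"] by (simp add: r_def)
 qed (simp add: r_def)
 moreover have "weave e (weave c d) o s = weave e d" for e
 proof (rule weave_eqI)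
  fix k
  show "(weave e (weave c d) o s) (Suc (2 * k)) = d k" using weave_simps(2)[of e "weave c d" "Suc (2 * k)"] by (simp add: s_def)
 qed (simp add: s_def)
 ultimately have "range e <= S ==>
   (P e --> Q e) = sat S E (Implies (rename r p) (rename s q)) (weave e (weave c d))" for e using p(2) q(2) by (simp add: sat_rename)
 moreover have "range (weave c d) <= C" using p(1) q(1) by (rule range_weave)
 ultimately show ?thesis unfolding dp_def by blast
qed

lemma dp_all:
 assumes "dp (%e. P (%i. e (Suc i)) (e 0))"
 shows "dp (%e. ALL x:S. P e x)"
proof -
 obtain p c where p: "range c <= C"
  "!!e. range e <= S ==> P (%i. e (Suc i)) (e 0) = sat S E p (weave e c)" using assms unfolding dp_def by blast
 define r where "r i = (if i = 0 then 0 else if even i then i - 1 else Suc i)" for i :: nat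
 have "case_nat x (weave e c) o r = weave (case_nat x e) c" for x e
 proof (rule weave_eqI)
  fix k
  show "(case_nat x (weave e c) o r) (2 * k) = case_nat x e k" by (cases k) (simp_all add: r_def)
  show "(case_nat x (weave e c) o r) (Suc (2 * k)) = c k" by (simp add: r_def)
 qed
 moreover have "P e x = sat S E p (weave (case_nat x e) c)" if "range e <= S" "x : S" for e x
 proof -
  have "range (case_nat x e) <= S" using that by (fastforce split: nat.splits)
  from p(2)[OF this] show ?thesis by simp
 qed
 ultimately have "range e <= S ==> (ALL x:S. P e x) = sat S E (Forall (rename r p)) (weave e c)" for e by (simp add: sat_rename)
 thus ?thesis using p(1) unfolding dp_def by blast
qed

lemma dp_reindex:
 assumes "dp P"
 shows "dp (%e. P (%i. e (r i)))"
proof -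
 obtain p c where p: "range c <= C" "!!e. range e <= S ==> P e = sat S E p (weave e c)" using assms unfolding dp_def by blast
 define s where "s i = (if even i then 2 * r (i div 2) else i)" for i :: nat
 have "weave e c o s = weave (%i. e (r i)) c" for e by (rule weave_eqI) (simp_all add: s_def)
 moreover have "range (%i. e (r i)) <= S" if "range e <= S" for e :: "nat => 'a" using that by auto
 ultimately have "range e <= S ==> P (%i. e (r i)) = sat S E (rename s p) (weave e c)" for e using p(2) by (simp add: sat_rename)
 thus ?thesis using p(1) unfolding dp_def by blast
qed

lemma dp_True: "dp (%e. True)" using dp_imp[OF dp_base(5) dp_base(5)] by simp

lemma dp_False: "dp (%e. False)" by (rule dp_base(5))

lemma dp_not: "dp P ==> dp (%e. ~P e)" using dp_imp[OF _ dp_base(5), of P] by simp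

lemma dp_or: "dp P ==> dp Q ==> dp (%e. P e | Q e)" using dp_imp[OF dp_not, of P Q] by (simp add: imp_conv_disj)

lemma dp_and: "dp P ==> dp Q ==> dp (%e. P e & Q e)" using dp_not[OF dp_or[OF dp_not dp_not], of P Q] by simp

lemma dp_iff: "dp P ==> dp Q ==> dp (%e. P e <-> Q e)" using dp_and[OF dp_imp dp_imp, of P Q Q P] by (rule dp_cong) auto

lemma dp_ex:
 assumes "dp (%e. P (%i. e (Suc i)) (e 0))"
 shows "dp (%e. EX x:S. P e x)" using dp_not[OF dp_all[of "%e x. ~P e x"]] dp_not[OF assms] by simp

lemma dp_const: "dp (%e. Q)" using dp_True dp_False by (cases Q) simp_all

lemma dt_var: "dt (%e. e i)" unfolding dt_def using dp_base(2)[of 0 "Suc i"] by auto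

lemma dt_const: "x : S ==> dt (%e. x)" unfolding dt_def using dp_base(4) by auto

lemma dt_S: "dt f ==> range e <= S ==> f e : S" by (simp add: dt_def)

lemma dp_subst:
 assumes "dt f" "dp (%e. P (%i. e (Suc i)) (e 0))"
 shows "dp (%e. P e (f e))"
proof -
 have "dp (%e. EX x:S. x = f e & P e x)" by (rule dp_ex, rule dp_and) (use assms in "auto simp: dt_def")
 thus ?thesis by (rule dp_cong) (use dt_S[OF assms(1)] in auto)
qed

lemma dt_reindex: "dt f ==> dt (%e. f (%i. e (r i)))"
proof -
 assume f: "dt f"
 have "dp (%e. e 0 = f (%i. e (Suc (r i))))" using dp_reindex[of "%e. e 0 = f (%i. e (Suc i))" "case_nat 0 (%i. Suc (r i))"] f
  by (simp add: dt_def)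
 thus ?thesis using f by (auto simp: dt_def image_subset_iff)
qed

lemma dp_rel1:
 assumes "dp (%e. R (e 0))" "dt f"
 shows "dp (%e. R (f e))" by (rule dp_subst[OF assms(2), of "%e. R"]) (rule assms)

lemma dp_rel2:
 assumes R: "dp (%e. R (e 0) (e 1))" and f: "dt f" and g: "dt g"
 shows "dp (%e. R (f e) (g e))"
proof (rule dp_subst[OF f, of "%e x. R x (g e)"], rule dp_subst[OF dt_reindex[OF g]])
 show "dp (%e. R (e (Suc 0)) (e 0))" using dp_reindex[OF R, of "case_nat 1 (%_. 0)"] by simp
qed

lemma dp_rel3:
 assumes R: "dp (%e. R (e 0) (e 1) (e 2))" and f: "dt f" and g: "dt g" and h: "dt h"
 shows "dp (%e. R (f e) (g e) (h e))"
proof (rule dp_subst[OF f, of "%e x. R x (g e) (h e)"],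
  rule dp_subst[OF dt_reindex[OF g], of "%e x. R (e 0) x (h (%i. e (Suc i)))"],
  rule dp_subst[OF dt_reindex[OF h, of "%i. Suc (Suc i)"], of "%e x. R (e (Suc 0)) (e 0) x"])
 show "dp (%e. R (e (Suc (Suc 0))) (e (Suc 0)) (e 0))" using dp_reindex[OF R, of "%i. 2 - i"] by (simp add: numeral_2_eq_2)
qed

lemma dp_mem: "dt f ==> dt g ==> dp (%e. f e \<E> g e)" by (rule dp_rel2[of "%x y. x \<E> y"]) (rule dp_base)

lemma dp_memc: "X : C ==> dt f ==> dp (%e. f e \<E> X)" by (rule dp_rel1[of "%x. x \<E> X"]) (rule dp_base)

lemma dp_eq: "dt f ==> dt g ==> dp (%e. f e = g e)" by (rule dp_rel2[of "%x y. x = y"]) (rule dp_base)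

lemma dtI:
 assumes "!!e. range e <= S ==> f e : S" "dp (%e. P (%i. e (Suc i)) (e 0))"
  "!!e x. range e <= S ==> x : S ==> x = f e <-> P e x"
 shows "dt f" unfolding dt_def
proof (intro conjI allI impI)
 show "dp (%e. e 0 = f (%i. e (Suc i)))" by (rule dp_cong[OF assms(2)], rule assms(3)) auto
qed (use assms(1) in auto)

lemma dt_upair: "dt f ==> dt g ==> dt (%e. upair (f e) (g e))"
proof (rule dtI[where P = "%e x. ALL z:S. z \<E> x <-> z = f e | z = g e"])
 assume fg: "dt f" "dt g"
 show "dp (%e. ALL z:S. z \<E> e 0 <-> z = f (%i. e (Suc i)) | z = g (%i. e (Suc i)))"
  by (intro dp_all dp_iff dp_or dp_eq dp_mem dt_var dt_reindex[OF fg(1)] dt_reindex[OF fg(2)])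
 show "x = upair (f e) (g e) <-> (ALL z:S. z \<E> x <-> z = f e | z = g e)"
  if "range e <= S" "x : S" for e x
 proof
  show "x = upair (f e) (g e)" if "ALL z:S. z \<E> x <-> z = f e | z = g e"
   by (rule upair_eqI) (use that \<open>x : S\<close> dt_S[OF fg(1)] dt_S[OF fg(2)] \<open>range e <= S\<close> in auto)
 qed (use dt_S[OF fg(1)] dt_S[OF fg(2)] that in "simp add: upair")
qed (simp add: dt_S upair)

lemma dt_opair: "dt f ==> dt g ==> dt (%e. opair (f e) (g e))" unfolding opair_def by (intro dt_upair)

lemmas [dps] = dp_all dp_ex dp_imp dp_iff dp_not dp_or dp_and dp_eq dp_mem dp_memc dp_const
 dt_var dt_const dt_opair dt_upair

text \<open>The schemas concern predicates of one or two variables; here the remaining variables of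
  the environment are frozen into parameters.\<close>

lemma dp_fix:
 assumes "dp Q" "range e <= S"
 shows "dp (%e'. Q (%i. if i < n then e' i else e (i - n)))"
proof -
 obtain p c where p: "range c <= C" "!!e. range e <= S ==> Q e = sat S E p (weave e c)" using assms(1) unfolding dp_def by blast
 define r where "r i = (if even i then if i < 2 * n then i else 2 * (i - 2 * n) + 1 else 2 * i + 1)"
  for i :: nat
 have "weave e' (weave e c) o r = weave (%i. if i < n then e' i else e (i - n)) c" for e'
 proof (rule weave_eqI)
  fix k
  show "(weave e' (weave e c) o r) (2 * k) = (if k < n then e' k else e (k - n))"
  proof (cases "k < n")
   case False
   then obtain j where "k = n + j" using le_Suc_ex not_less by blast
   thus ?thesis using weave_simps(2)[of e' "weave e c" "2 * j"] by (simp add: r_def)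
  qed (simp add: r_def)
  show "(weave e' (weave e c) o r) (Suc (2 * k)) = c k" using weave_simps(2)[of e' "weave e c" "Suc (2 * k)"] by (simp add: r_def)
 qed
 moreover have "range (%i. if i < n then e' i else e (i - n)) <= S" if "range e' <= S" for e' using that assms(2) by auto
 ultimately have "range e' <= S ==>
   Q (%i. if i < n then e' i else e (i - n)) = sat S E (rename r p) (weave e' (weave e c))" for e' using p(2) by (simp add: sat_rename)
 moreover have "range (weave e c) <= C"  by (rule range_weave) (use assms(2) S_sub p(1) in auto)
 ultimately show ?thesis unfolding dp_def by blast
qed

lemma dp_fix1:
 assumes "dp (%e. P (%i. e (Suc i)) (e 0))" "range e <= S"
 shows "dp (%e'. P e (e' 0))" using dp_fix[OF assms, of 1] by simp

lemma dp_fix2: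
 assumes "dp (%e. P (%i. e (Suc (Suc i))) (e 0) (e 1))" "range e <= S"
 shows "dp (%e'. P e (e' 0) (e' 1))" using dp_fix[OF assms, of 2] by (simp add: numeral_2_eq_2)

end

section \<open>Set theory inside a model\<close>

context base
begin

lemma dt_fun1:
 assumes "dt (%e. F (e 0))" "dt f"
 shows "dt (%e. F (f e))" unfolding dt_def
proof (intro conjI allI impI)
 have "dp (%e. e 0 = F (e 1))" using assms(1) by (simp add: dt_def)
 from dp_rel2[OF this dt_var[of 0] dt_reindex[OF assms(2)]]
 show "dp (%e. e 0 = F (f (%i. e (Suc i))))" by blast
 fix e :: "nat => 'a" assume e: "range e <= S"
 hence "range (%i. f e) <= S" using dt_S[OF assms(2)] by auto
 from dt_S[OF assms(1) this] show "F (f e) : S" .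
qed

lemma dt_fun2:
 assumes "dt (%e. F (e 0) (e 1))" "dt f" "dt g"
 shows "dt (%e. F (f e) (g e))" unfolding dt_def
proof (intro conjI allI impI)
 have "dp (%e. e 0 = F (e 1) (e 2))" using assms(1) by (simp add: dt_def numeral_2_eq_2)
 from dp_rel3[OF this dt_var[of 0] dt_reindex[OF assms(2)] dt_reindex[OF assms(3)]]
 show "dp (%e. e 0 = F (f (%i. e (Suc i))) (g (%i. e (Suc i))))" by blast
 fix e :: "nat => 'a" assume e: "range e <= S"
 hence "range (case_nat (f e) (%i. g e)) <= S" using dt_S[OF assms(2)] dt_S[OF assms(3)] by (fastforce split: nat.splits)
 from dt_S[OF assms(1) this] show "F (f e) (g e) : S" by simp
qed

end

text \<open>Stating separation and replacement for \<open>dp\<close> predicates hides formulas and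
  parameter lists from all later arguments.\<close>

locale zf = base UNIV E UNIV for E :: "'m => 'm => bool" (infix "\<E>" 50) +
 assumes foundation: "y \<E> x ==> EX y. y \<E> x & (ALL z. z \<E> y --> ~z \<E> x)"
  and union_ax: "EX u. ALL z. z \<E> u <-> (EX y. y \<E> x & z \<E> y)"
  and power_ax: "EX u. ALL z. z \<E> u <-> (ALL w. w \<E> z --> w \<E> x)"
  and choice_ax: "(ALL y. y \<E> x --> (EX z. z \<E> y)) ==>
   EX f. ALL y. y \<E> x --> (EX z. z \<E> y & (ALL z'. opair y z' \<E> f <-> z' = z))"
  and sep_ax: "dp (%e. P (e 0)) ==> EX b. ALL x. x \<E> b <-> x \<E> a & P x"
  and repl_ax: "dp (%e. R (e 0) (e 1)) ==> (!!x y z. x \<E> a ==> R x y ==> R x z ==> y = z)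
   ==> EX b. ALL y. y \<E> b <-> (EX x. x \<E> a & R x y)"
begin

lemma eqI: "(!!z. z \<E> x <-> z \<E> y) ==> x = y" by (rule ext) auto

lemma dp_all' [dps]: "dp (%e. P (%i. e (Suc i)) (e 0)) ==> dp (%e. ALL x. P e x)" using dp_all[of P] by simp

lemma dp_ex' [dps]: "dp (%e. P (%i. e (Suc i)) (e 0)) ==> dp (%e. EX x. P e x)" using dp_ex[of P] by simp

lemma dp_ex1 [dps]: "dp (%e. P (%i. e (Suc i)) (e 0)) ==> dp (%e. EX! x. P e x)"
proof -
 assume P: "dp (%e. P (%i. e (Suc i)) (e 0))"
 have "dp (%e. P (%i. e (Suc (Suc i))) (e 0))" using dp_reindex[OF P, of "case_nat 0 (%i. Suc (Suc i))"] by simp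
 thus ?thesis unfolding Ex1_def by (intro dps P) simp
qed

lemma dt_const' [dps]: "dt (%e. x)" using dt_const by simp

lemma dp_memc' [dps]: "dt f ==> dp (%e. f e \<E> x)" by (intro dps)

lemma upair_iff [simp]: "z \<E> upair a b <-> z = a | z = b" by (simp add: upair)

lemma opair_eq [simp]: "opair a b = opair a' b' <-> a = a' & b = b'" by (simp add: opair_inject)

text \<open>Set-builder terms are total; such a term has the intended members only if the set
  exists, so its uses are paired with an existence argument.\<close>

definition theset where
 "theset Q = (THE b. ALL x. x \<E> b <-> Q x)"

lemma theset_eq: "ALL x. x \<E> b <-> Q x ==> theset Q = b" unfolding theset_def by (rule the_equality) (auto intro: eqI)

lemma mem_theset: "EX b. ALL x. x \<E> b <-> Q x ==> x \<E> theset Q <-> Q x" using theset_eq by blast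

lemma dt_theset:
 assumes "!!e. EX b. ALL x. x \<E> b <-> Q e x" "dp (%e. Q (%i. e (Suc i)) (e 0))"
 shows "dt (%e. theset (Q e))"
proof (rule dtI[where P = "%e b. ALL x. x \<E> b <-> Q e x"])
 have "dp (%e. Q (%i. e (Suc (Suc i))) (e 0))" using dp_reindex[OF assms(2), of "case_nat 0 (%i. Suc (Suc i))"] by simp
 thus "dp (%e. ALL x. x \<E> e 0 <-> Q (%i. e (Suc i)) x)" by (intro dps) simp
next
 show "x = theset (Q e) <-> (ALL z. z \<E> x <-> Q e z)" for e x using mem_theset[OF assms(1)] theset_eq by blast
qed auto

definition Coll where
 "Coll a P = theset (%x. x \<E> a & P x)"

lemma mem_Coll: "dp (%e. P (e 0)) ==> x \<E> Coll a P <-> x \<E> a & P x" unfolding Coll_def by (rule mem_theset) (rule sep_ax)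

lemma dt_Coll [dps]:
 assumes "dt f" "dp (%e. P (%i. e (Suc i)) (e 0))"
 shows "dt (%e. Coll (f e) (P e))" unfolding Coll_def
proof (rule dt_theset)
 show "EX b. ALL x. x \<E> b <-> x \<E> f e & P e x" for e by (rule sep_ax, rule dp_fix1[OF assms(2)]) simp
 show "dp (%e. e 0 \<E> f (%i. e (Suc i)) & P (%i. e (Suc i)) (e 0))" by (intro dps dt_reindex[OF assms(1)] assms(2))
qed

definition Img where
 "Img a F = theset (%y. EX x. x \<E> a & y = F x)"

lemma Img_exists:
 assumes "dp (%e. e 1 = F (e 0))"
 shows "EX b. ALL y. y \<E> b <-> (EX x. x \<E> a & y = F x)" by (rule repl_ax) (use assms in auto)

lemma mem_Img: "dt (%e. F (e 0)) ==> y \<E> Img a F <-> (EX x. x \<E> a & y = F x)"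
proof -
 assume F: "dt (%e. F (e 0))"
 show ?thesis unfolding Img_def by (rule mem_theset, rule Img_exists) (intro dps dt_fun1[OF F])
qed

lemma dt_Img [dps]:
 assumes "dt f" "dt (%e. F (%i. e (Suc i)) (e 0))"
 shows "dt (%e. Img (f e) (F e))" unfolding Img_def
proof (rule dt_theset)
 have *: "dp (%e. e (Suc 0) = F (%i. e (Suc (Suc i))) (e 0))" by (rule dp_eq, rule dt_var)
   (use dt_reindex[OF assms(2), of "case_nat 0 (%i. Suc (Suc i))"] in simp)
 show "EX b. ALL y. y \<E> b <-> (EX x. x \<E> f e & y = F e x)" for e
  by (rule Img_exists) (use dp_fix2[of "%e x y. y = F e x", of e] * in simp)
 show "dp (%e. EX x. x \<E> f (%i. e (Suc i)) & e 0 = F (%i. e (Suc i)) x)" by (intro dps dt_reindex[OF assms(1)])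
   (use dt_reindex[OF assms(2), of "case_nat 0 (%i. Suc (Suc i))"] in simp)
qed

definition emp :: 'm where "emp = theset (%x. False)"

lemma emp_iff [simp]: "~x \<E> emp" using mem_Coll[of "%x. False" x "undefined"] dp_False by (simp add: emp_def Coll_def)

definition union where
 "union x = theset (%z. EX y. y \<E> x & z \<E> y)"

lemma union_iff [simp]: "z \<E> union x <-> (EX y. y \<E> x & z \<E> y)" unfolding union_def by (rule mem_theset) (rule union_ax)

lemma dt_union [dps]:
 assumes "dt f"
 shows "dt (%e. union (f e))" unfolding union_def by (rule dt_theset, rule union_ax) (intro dps dt_reindex[OF assms])

definition Pow where
 "Pow x = theset (%z. ALL w. w \<E> z --> w \<E> x)"

lemma Pow_iff [simp]: "z \<E> Pow x <-> (ALL w. w \<E> z --> w \<E> x)" unfolding Pow_def by (rule mem_theset) (rule power_ax)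

lemma dt_Pow [dps]:
 assumes "dt f"
 shows "dt (%e. Pow (f e))" unfolding Pow_def by (rule dt_theset, rule power_ax) (intro dps dt_reindex[OF assms])

definition cup where "cup a b = union (upair a b)"

lemma cup_iff [simp]: "z \<E> cup a b <-> z \<E> a | z \<E> b" by (auto simp: cup_def)

lemma dt_cup [dps]: "dt f ==> dt g ==> dt (%e. cup (f e) (g e))" unfolding cup_def by (intro dps)

definition sng where "sng a = upair a a"

lemma sng_iff [simp]: "z \<E> sng a <-> z = a" by (simp add: sng_def)

lemma dt_sng [dps]: "dt f ==> dt (%e. sng (f e))" unfolding sng_def by (intro dps)

definition prod where
 "prod a b = union (Img a (%x. Img b (%y. opair x y)))"

lemma dt_prod [dps]:
 assumes "dt f" "dt g"
 shows "dt (%e. prod (f e) (g e))" unfolding prod_def by (intro dps assms dt_reindex[OF assms(2)])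

lemma prod_iff: "z \<E> prod a b <-> (EX x y. x \<E> a & y \<E> b & z = opair x y)"
proof -
 have 1: "dt (%e. Img b (%y. opair (e 0) y))" by (intro dps)
 have 2: "dt (%e. opair x (e 0))" for x by (intro dps)
 show ?thesis unfolding prod_def union_iff mem_Img[OF 1] using mem_Img[OF 2] by auto
qed

lemma opair_prod [simp]: "opair x y \<E> prod a b <-> x \<E> a & y \<E> b" by (auto simp: prod_iff)

lemma opair_union: "opair x y \<E> r ==> x \<E> union (union r) & y \<E> union (union r)" unfolding opair_def union_iff by (meson upair_iff)

definition dom where
 "dom r = Coll (union (union r)) (%x. EX y. opair x y \<E> r)"

lemma dt_dom [dps]: "dt f ==> dt (%e. dom (f e))" by (rule dt_fun1[of dom], unfold dom_def, intro dps)

lemma dom_iff [simp]: "x \<E> dom r <-> (EX y. opair x y \<E> r)"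
proof -
 have "dp (%e. EX y. opair (e 0) y \<E> r)" by (intro dps)
 from mem_Coll[OF this] show ?thesis unfolding dom_def using opair_union by blast
qed

definition ran where
 "ran r = Coll (union (union r)) (%y. EX x. opair x y \<E> r)"

lemma dt_ran [dps]: "dt f ==> dt (%e. ran (f e))" by (rule dt_fun1[of ran], unfold ran_def, intro dps)

lemma ran_iff [simp]: "y \<E> ran r <-> (EX x. opair x y \<E> r)"
proof -
 have "dp (%e. EX x. opair x (e 0) \<E> r)" by (intro dps)
 from mem_Coll[OF this] show ?thesis unfolding ran_def using opair_union by blast
qed

text \<open>The union of the set of values makes application total; for a function that set is a
  singleton. Thus \<open>app f\<close> is a definable operation on all objects.\<close>

definition app where
 "app f x = union (Coll (ran f) (%y. opair x y \<E> f))"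

lemma dt_app [dps]: "dt f ==> dt g ==> dt (%e. app (f e) (g e))" by (rule dt_fun2[of app], unfold app_def, intro dps)

lemma app_eq: "(!!z. opair x z \<E> f <-> z = y) ==> app f x = y"
proof -
 assume *: "!!z. opair x z \<E> f <-> z = y"
 have "dp (%e. opair x (e 0) \<E> f)" by (intro dps)
 from mem_Coll[OF this] show ?thesis unfolding app_def using * by (intro eqI) auto
qed

definition lam where
 "lam a F = Img a (%x. opair x (F x))"

lemma dt_lam [dps]:
 "dt f ==> dt (%e. F (%i. e (Suc i)) (e 0)) ==> dt (%e. lam (f e) (F e))" unfolding lam_def by (intro dps)

lemma lam_iff:
 assumes "dt (%e. F (e 0))"
 shows "p \<E> lam a F <-> (EX x. x \<E> a & p = opair x (F x))" unfolding lam_def by (rule mem_Img) (intro dps assms)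

lemma app_lam [simp]: "dt (%e. F (e 0)) ==> x \<E> a ==> app (lam a F) x = F x" by (rule app_eq) (auto simp: lam_iff)

lemma lam_cong:
 assumes "!!x. x \<E> a ==> F x = G x"
 shows "lam a F = lam a G"
proof -
 have "(%y. EX x. x \<E> a & y = opair x (F x)) = (%y. EX x. x \<E> a & y = opair x (G x))" using assms by metis
 thus ?thesis by (simp add: lam_def Img_def)
qed

lemma dt_app1 [dps]: "dt f ==> dt (%e. app c (f e))" by (intro dps)

lemma app_lam_app [simp]: "x \<E> a ==> app (lam a (app f)) x = app f x" by (rule app_lam) (intro dps)

definition isfn where
 "isfn f a <-> f = lam a (app f)"

lemma dp_isfn [dps]: "dt f ==> dt g ==> dp (%e. isfn (f e) (g e))" by (rule dp_rel2[of isfn], unfold isfn_def, intro dps)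

lemma isfn_lam: "dt (%e. F (e 0)) ==> isfn (lam a F) a" unfolding isfn_def by (rule lam_cong) simp

lemma isfn_opair: "isfn f a ==> opair x y \<E> f <-> x \<E> a & y = app f x"
proof -
 assume f: "isfn f a"
 have "dt (%e. app f (e 0))" by (intro dps)
 from lam_iff[OF this, of "opair x y" a] show ?thesis using f by (auto simp: isfn_def)
qed

lemma isfn_mem: "isfn f a ==> p \<E> f ==> EX x. x \<E> a & p = opair x (app f x)"
proof -
 assume f: "isfn f a" "p \<E> f"
 have "dt (%e. app f (e 0))" by (intro dps)
 from lam_iff[OF this, of p a] show ?thesis using f by (auto simp: isfn_def)
qed

lemma isfnI:
 assumes "!!p. p \<E> f ==> EX x y. x \<E> a & p = opair x y" "!!x. x \<E> a ==> EX! y. opair x y \<E> f"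
 shows "isfn f a"
proof -
 have *: "opair x y \<E> f <-> y = app f x" if h: "x \<E> a" for x y
 proof -
  obtain z where z: "opair x y \<E> f <-> y = z" for y using assms(2)[OF h] by blast
  hence "app f x = z" by (rule app_eq)
  thus ?thesis using z by simp
 qed
 have "dt (%e. app f (e 0))" by (intro dps)
 thus ?thesis unfolding isfn_def
 proof (intro eqI iffI)
  fix p assume "p \<E> f"
  then obtain x y where "x \<E> a" "p = opair x y" "opair x y \<E> f" using assms(1) by blast
  thus "p \<E> lam a (app f)" using * \<open>dt _\<close> by (auto simp: lam_iff)
 qed (use * in "auto simp: lam_iff")
qed

lemma isfn_dom: "isfn f a ==> dom f = a" by (rule eqI) (simp add: isfn_opair)

subsection \<open>Induction and recursion\<close>

definition trans where
 "trans t <-> (ALL x. x \<E> t --> (ALL y. y \<E> x --> y \<E> t))"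

lemma dp_trans [dps]: "dt f ==> dp (%e. trans (f e))" by (rule dp_rel1[of trans], unfold trans_def, intro dps)

lemma transD: "trans t ==> x \<E> t ==> y \<E> x ==> y \<E> t" by (auto simp: trans_def)

lemma min_el:
 assumes "dp (%e. P (e 0))" "x \<E> t" "P x"
 shows "EX y. y \<E> t & P y & (ALL z. z \<E> y --> z \<E> t --> ~P z)"
 using foundation[of x "Coll t P"] assms(2,3) mem_Coll[OF assms(1)] by blast

lemma trans_induct:
 assumes t: "trans t" and P: "dp (%e. P (e 0))" and x: "x \<E> t"
  and step: "!!x. x \<E> t ==> (!!y. y \<E> x ==> P y) ==> P x"
 shows "P x"
proof (rule ccontr)
 assume "~P x"
 with min_el[OF dp_not[OF P] x] obtain y where "y \<E> t" "~P y" "ALL z. z \<E> y --> z \<E> t --> P z" by auto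
 thus False using step[of y] transD[OF t] by blast
qed

lemma rec_unique:
 assumes u: "trans u" and F: "dt (%e. F (e 0))" and F': "dt (%e. F' (e 0))"
  and eq: "!!x. x \<E> u ==> F x = G x (lam x F)" "!!x. x \<E> u ==> F' x = G x (lam x F')"
  and x: "x \<E> u"
 shows "F x = F' x" using u _ x
proof (rule trans_induct)
 show "dp (%e. F (e 0) = F' (e 0))" by (intro dps F F')
 fix x assume "x \<E> u" "!!y. y \<E> x ==> F y = F' y"
 thus "F x = F' x" using eq lam_cong[of x F F'] by metis
qed

text \<open>Attempts on transitive sets agree where they overlap, replacement collects their values
  into \<open>f\<close>, and an element of \<open>t\<close> that is still missing would extend
  \<open>f\<close> to a further attempt.\<close>

lemma rec_exists:
 assumes t: "trans t" and G: "dt (%e. G (e 0) (e 1))"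
 shows "EX f. isfn f t & (ALL x. x \<E> t --> app f x = G x (lam x (app f)))"
proof -
 note G' = dt_fun2[OF G]
 define att where "att u f <-> trans u & (ALL x. x \<E> u --> app f x = G x (lam x (app f)))" for u f
 define V where "V y v <-> (EX u f. att u f & y \<E> u & v = app f y)" for y v
 have dpV: "dp (%e. V (f e) (g e))" if "dt f" "dt g" for f g by (rule dp_rel2[of V, OF _ that], unfold V_def att_def, intro dps G')
 have uniq: "v = v'" if h: "V y v" "V y v'" for y v v'
 proof -
  obtain u f u' f' where *: "att u f" "y \<E> u" "v = app f y" "att u' f'" "y \<E> u'" "v' = app f' y" using h unfolding V_def by blast
  have c: "x \<E> Coll u (%x. x \<E> u') <-> x \<E> u & x \<E> u'" for x by (rule mem_Coll) (intro dps)
  show ?thesis unfolding *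
  proof (rule rec_unique[of "Coll u (%x. x \<E> u')" "app f" "app f'" G])
   show "trans (Coll u (%x. x \<E> u'))" using * unfolding trans_def c att_def by blast
   show "dt (%e. app f (e 0))" "dt (%e. app f' (e 0))" by (intro dps)+
  qed (use * in "auto simp: c att_def")
 qed
 define D where "D = Coll t (%z. EX v. V z v)"
 have D: "z \<E> D <-> z \<E> t & (EX v. V z v)" for z unfolding D_def by (rule mem_Coll) (intro dps dpV)
 have VD: "EX v. V y v" if "V z v" "y \<E> z" for y z v using that unfolding V_def att_def by (meson transD)
 have trD: "trans D" using t VD unfolding trans_def D by blast
 obtain f where f: "!!p. p \<E> f <-> (EX z. z \<E> D & (EX v. V z v & p = opair z v))"
 proof -
  have "EX b. ALL p. p \<E> b <-> (EX z. z \<E> D & (EX v. V z v & p = opair z v))"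
  proof (rule repl_ax)
   show "dp (%e. EX v. V (e 0) v & e 1 = opair (e 0) v)" by (intro dps dpV)
  qed (use uniq in blast)
  thus ?thesis using that by blast
 qed
 have appf: "app f z = v" if "z \<E> D" "V z v" for z v by (rule app_eq) (use f that uniq in auto)
 have isf: "isfn f D" by (rule isfnI) (use f D uniq in auto)
 have attD: "att D f" unfolding att_def
 proof (intro conjI allI impI trD)
  fix z assume z: "z \<E> D"
  then obtain u g where *: "att u g" "z \<E> u" "V z (app g z)" unfolding D V_def by blast
  have "app f y = app g y" if "y \<E> z" for y
  proof (rule appf)
   show "y \<E> D" using transD[OF trD z that] .
   have "y \<E> u" using * that by (auto simp: att_def dest: transD)
   thus "V y (app g y)" unfolding V_def using *(1) by blast
  qed
  hence "lam z (app f) = lam z (app g)" by (rule lam_cong)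
  thus "app f z = G z (lam z (app f))" using appf[OF z *(3)] * by (simp add: att_def)
 qed
 have "x \<E> D" if "x \<E> t" for x using t _ that
 proof (rule trans_induct)
  show "dp (%e. e 0 \<E> D)" by (intro dps)
  fix x assume x: "x \<E> t" and IH: "!!y. y \<E> x ==> y \<E> D"
  show "x \<E> D"
  proof (rule ccontr)
   assume nx: "~x \<E> D"
   define f' where "f' = cup f (sng (opair x (G x (lam x (app f)))))"
   have 1: "app f' z = app f z" if "z \<E> D" for z by (rule app_eq) (use that nx isfn_opair[OF isf] in "auto simp: f'_def")
   have 2: "app f' x = G x (lam x (app f))" by (rule app_eq) (use nx isfn_opair[OF isf] in "auto simp: f'_def")
   have 3: "lam z (app f') = lam z (app f)" if "z \<E> D | z = x" for z by (rule lam_cong, rule 1) (use that IH transD[OF trD] in auto)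
   have "att (cup D (sng x)) f'" unfolding att_def
   proof (intro conjI allI impI)
    show "trans (cup D (sng x))" using trD IH by (auto simp: trans_def)
    fix z assume "z \<E> cup D (sng x)"
    thus "app f' z = G z (lam z (app f'))" using 1 2 3 attD by (auto simp: att_def)
   qed
   hence "V x (app f' x)" unfolding V_def by (metis cup_iff sng_iff)
   thus False using nx x D by blast
  qed
 qed
 hence "D = t" using D by (intro eqI) blast
 thus ?thesis using isf attD by (auto simp: att_def)
qed

subsection \<open>Ordinals\<close>

lemma mem_irrefl [simp]: "~x \<E> x" using foundation[of x "sng x"] by auto

lemma mem_asym: "x \<E> y ==> ~y \<E> x" using foundation[of x "upair x y"] by auto

lemma mem_cycle3: "x \<E> y ==> y \<E> z ==> ~z \<E> x" using foundation[of x "cup (upair x y) (sng z)"] by auto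

definition Ord where
 "Ord a <-> trans a & (ALL x y. x \<E> a & y \<E> a --> x \<E> y | x = y | y \<E> x)"

lemma dp_Ord [dps]: "dt f ==> dp (%e. Ord (f e))" by (rule dp_rel1[of Ord], unfold Ord_def, intro dps)

lemma Ord_transD: "Ord a ==> x \<E> a ==> y \<E> x ==> y \<E> a" by (auto simp: Ord_def dest: transD)

lemma Ord_in: "Ord a ==> x \<E> a ==> Ord x"
proof -
 assume a: "Ord a" "x \<E> a"
 have "z \<E> x" if "y \<E> x" "z \<E> y" for y z
 proof -
  have "z \<E> a" "y \<E> a" using a that by (auto intro: Ord_transD)
  hence "z \<E> x | z = x | x \<E> z" using a unfolding Ord_def by blast
  thus ?thesis using that mem_asym[of y x] mem_cycle3[of x z y] by blast
 qed
 moreover have "y \<E> z | y = z | z \<E> y" if "y \<E> x" "z \<E> x" for y z using a that Ord_transD[OF a] unfolding Ord_def by blast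
 ultimately show "Ord x" unfolding Ord_def trans_def by blast
qed

lemma Ord_initial:
 assumes a: "Ord a" and c: "trans c" "!!x. x \<E> c ==> x \<E> a" "c ~= a"
 shows "c \<E> a"
proof -
 obtain x where "x \<E> a" "~x \<E> c" using c eqI by blast
 moreover have "dp (%e. ~e 0 \<E> c)" by (intro dps)
 ultimately obtain y where y: "y \<E> a" "~y \<E> c" "ALL z. z \<E> y --> z \<E> a --> z \<E> c"
  using min_el[of "%x. ~x \<E> c" x a] by auto
 have "y = c"
 proof (intro eqI iffI)
  fix z assume "z \<E> y" thus "z \<E> c" using y Ord_transD[OF a] by blast
 next
  fix z assume z: "z \<E> c"
  hence "z \<E> y | z = y | y \<E> z" using a c(2) y(1) unfolding Ord_def by blast
  thus "z \<E> y" using z y(2) c(1) transD by blast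
 qed
 thus ?thesis using y by simp
qed

lemma Ord_lin:
 assumes a: "Ord a" and b: "Ord b"
 shows "a \<E> b | a = b | b \<E> a"
proof -
 define c where "c = Coll a (%x. x \<E> b)"
 have c: "x \<E> c <-> x \<E> a & x \<E> b" for x unfolding c_def by (rule mem_Coll) (intro dps)
 have tc: "trans c" using a b unfolding trans_def c Ord_def by blast
 have "c = a | c \<E> a" "c = b | c \<E> b" using Ord_initial[OF a tc] Ord_initial[OF b tc] c by blast+
 thus ?thesis using c mem_irrefl by metis
qed

definition suc where "suc a = cup a (sng a)"

lemma suc_iff [simp]: "x \<E> suc a <-> x \<E> a | x = a" by (simp add: suc_def)

lemma dt_suc [dps]: "dt f ==> dt (%e. suc (f e))" unfolding suc_def by (intro dps)

lemma trans_suc: "trans a ==> trans (suc a)" by (auto simp: trans_def)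

lemma Ord_suc: "Ord a ==> Ord (suc a)" using trans_suc[of a] by (auto simp: Ord_def)

lemma Ord_union: "(!!x. x \<E> A ==> Ord x) ==> Ord (union A)"
proof -
 assume A: "!!x. x \<E> A ==> Ord x"
 have "Ord x" if "x \<E> union A" for x using that A Ord_in by auto
 hence "x \<E> y | x = y | y \<E> x" if "x \<E> union A" "y \<E> union A" for x y using that Ord_lin by blast
 moreover have "trans (union A)" using A Ord_transD unfolding trans_def union_iff by blast
 ultimately show ?thesis unfolding Ord_def by blast
qed

lemma Ord_least:
 assumes "dp (%e. P (e 0))" "Ord a" "P a"
 shows "EX b. Ord b & P b & (ALL c. c \<E> b --> ~P c)"
proof -
 obtain b where b: "b \<E> suc a" "P b" "ALL z. z \<E> b --> z \<E> suc a --> ~P z"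
  using min_el[OF assms(1), of a "suc a"] assms(3) by auto
 thus ?thesis using Ord_suc[OF assms(2)] Ord_in Ord_transD by blast
qed

lemma Ord_induct:
 assumes P: "dp (%e. P (e 0))" and a: "Ord a"
  and step: "!!a. Ord a ==> (!!b. b \<E> a ==> P b) ==> P a"
 shows "P a"
proof (rule ccontr)
 assume "~P a"
 from Ord_least[of "%x. ~P x", OF dp_not[OF P] a this] step show False by blast
qed

text \<open>The result is a definable term and not a set, so that it can be used at all ordinals at
  once. Its value at \<open>a\<close> is read off from an attempt on \<open>suc a\<close>.\<close>

lemma ordrec:
 assumes G: "dt (%e. G (e 0) (e 1))"
 shows "EX val. dt (%e. val (e 0)) & (ALL a. Ord a --> val a = G a (lam a val))"
proof -
 note G' = dt_fun2[OF G]
 define V where "V a f <-> isfn f (suc a) &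
  (ALL x. x \<E> suc a --> app f x = G x (lam x (app f)))" for a f
 have dpV: "dp (%e. V (f e) (g e))" if "dt f" "dt g" for f g by (rule dp_rel2[of V, OF _ that], unfold V_def, intro dps G')
 have Vex: "EX f. V a f" if "trans a" for a using rec_exists[OF trans_suc[OF that] G] unfolding V_def by blast
 have Vun: "app f x = app g x" if "V a f" "V b g" "Ord a" "Ord b" "x \<E> suc a" "x \<E> suc b" for f g a b x
 proof (rule rec_unique[of "suc x" "app f" "app g" G])
  have "Ord x" using that Ord_suc Ord_in by blast
  thus "trans (suc x)" by (simp add: Ord_def trans_suc)
  show "dt (%e. app f (e 0))" "dt (%e. app g (e 0))" by (intro dps)+
  have *: "y \<E> suc x ==> y \<E> suc a & y \<E> suc b" for y
   using that Ord_transD[OF Ord_suc[of a], of x y] Ord_transD[OF Ord_suc[of b], of x y] by auto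
  show "app f y = G y (lam y (app f))" "app g y = G y (lam y (app g))" if "y \<E> suc x" for y
   using *[OF that] \<open>V a f\<close> \<open>V b g\<close> by (auto simp: V_def)
 qed simp
 have same: "app f a = app g a" if "Ord a" "V a f" "V a g" for f g a by (rule Vun[OF that(2,3,1,1)]) simp_all
 define val where "val a = theset (%x. Ord a & (EX f. V a f & x \<E> app f a))" for a
 have val: "val a = app f a" if "Ord a" "V a f" for a f unfolding val_def by (rule theset_eq) (use that same in metis)
 have "dt (%e. val (e 0))" unfolding val_def
 proof (rule dt_theset)
  show "EX b. ALL x. x \<E> b <-> Ord (e 0) & (EX f. V (e 0) f & x \<E> app f (e 0))" for e :: "nat => 'm"
  proof (cases "Ord (e 0)")
   case True
   then obtain f where "V (e 0) f" using Vex Ord_def by blast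
   hence "x \<E> app f (e 0) <-> Ord (e 0) & (EX f. V (e 0) f & x \<E> app f (e 0))" for x using True same by metis
   thus ?thesis by blast
  next
   case False
   thus ?thesis using emp_iff by blast
  qed
 qed (intro dps dpV)
 moreover have "val a = G a (lam a val)" if a: "Ord a" for a
 proof -
  obtain f where f: "V a f" using Vex a Ord_def by blast
  have "val b = app f b" if b: "b \<E> a" for b
  proof -
   have "Ord b" using a b Ord_in by blast
   then obtain g where g: "V b g" using Vex Ord_def by blast
   show ?thesis using val[OF \<open>Ord b\<close> g] Vun[OF g f \<open>Ord b\<close> a] b by simp
  qed
  hence "lam a val = lam a (app f)" by (rule lam_cong)
  thus ?thesis using val[OF a f] f by (simp add: V_def)
 qed
 ultimately show ?thesis by blast
qed

subsection \<open>Choice\<close>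

lemma choice_fun: "EX c. ALL y. y \<E> x --> (EX z. z \<E> y) --> app c y \<E> y"
proof -
 define x' where "x' = Coll x (%y. EX z. z \<E> y)"
 have x': "y \<E> x' <-> y \<E> x & (EX z. z \<E> y)" for y unfolding x'_def by (rule mem_Coll) (intro dps)
 obtain f where "ALL y. y \<E> x' --> (EX z. z \<E> y & (ALL z'. opair y z' \<E> f <-> z' = z))" using choice_ax[of x'] x' by auto
 hence "app f y \<E> y" if "y \<E> x'" for y using app_eq that by metis
 thus ?thesis using x' by blast
qed

lemma AC_fun:
 assumes R: "dp (%e. R (e 0) (e 1))" and ex: "!!x. x \<E> a ==> EX y. y \<E> b & R x y"
 shows "EX f. isfn f a & (ALL x. x \<E> a --> app f x \<E> b & R x (app f x))"
proof -
 note R' = dp_rel2[OF R]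
 obtain c where c: "!!y. y \<E> Pow b ==> (EX z. z \<E> y) ==> app c y \<E> y" using choice_fun by blast
 define F where "F x = app c (Coll b (R x))" for x
 have F: "dt (%e. F (e 0))" unfolding F_def by (intro dps R')
 have C: "y \<E> Coll b (R x) <-> y \<E> b & R x y" for x y by (rule mem_Coll) (intro dps R')
 have "F x \<E> Coll b (R x)" if "x \<E> a" for x unfolding F_def by (rule c) (use ex[OF that] C in auto)
 hence "F x \<E> b & R x (F x)" if "x \<E> a" for x using that C by blast
 thus ?thesis using isfn_lam[OF F] app_lam[OF F] by metis
qed

text \<open>Zermelo's argument: a choice function picks the next element that has not been
  enumerated.\<close>

lemma well_ordering:
 "EX a f. Ord a & isfn f a & (ALL y. y \<E> z <-> (EX x. x \<E> a & y = app f x)) &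
   (ALL x x'. x \<E> a --> x' \<E> a --> app f x = app f x' --> x = x')"
proof -
 obtain c where c: "!!y. y \<E> Pow z ==> (EX w. w \<E> y) ==> app c y \<E> y" using choice_fun by blast
 define rest where "rest f = Coll z (%y. ~y \<E> ran f)" for f
 have rest: "y \<E> rest f <-> y \<E> z & ~y \<E> ran f" for y f unfolding rest_def by (rule mem_Coll) (intro dps)
 \<comment> \<open>The case distinction is coded in the function that is applied: an empty rest is
   sent to \<open>z\<close>, which is not an element of itself and therefore marks the end of the
   enumeration.\<close>
 define G where "G x f = app (cup (lam (Coll (Pow z) (%y. EX w. w \<E> y)) (app c)) (sng (opair emp z))) (rest f)"
  for x f :: 'm
 have nonempty: "y \<E> Coll (Pow z) (%y. EX w. w \<E> y) <-> y \<E> Pow z & (EX w. w \<E> y)" for y by (rule mem_Coll) (intro dps)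
 have dtc: "dt (%e. app c (e 0))" by (intro dps)
 have G1: "G x f = app c (rest f)" if "EX w. w \<E> rest f" for x f
 proof -
  have "rest f ~= emp" using that emp_iff by metis
  moreover have "rest f \<E> Coll (Pow z) (%y. EX w. w \<E> y)" using that rest nonempty by auto
  ultimately show ?thesis unfolding G_def by (intro app_eq) (auto simp: lam_iff[OF dtc])
 qed
 have G2: "G x f = z" if "\<nexists>w. w \<E> rest f" for x f
 proof -
  have e: "rest f = emp" using that by (intro eqI) auto
  show ?thesis unfolding G_def e by (rule app_eq) (auto simp: lam_iff[OF dtc] nonempty)
 qed
 have "dt (%e. G (e 0) (e 1))" unfolding G_def rest_def by (intro dps)
 from ordrec[OF this] obtain val where val: "dt (%e. val (e 0))"
  "!!a. Ord a ==> val a = G a (lam a val)" by blast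
 note val' = dt_fun1[OF val(1)]
 have ranl: "y \<E> ran (lam a val) <-> (EX b. b \<E> a & y = val b)" for a y by (auto simp: lam_iff[OF val(1)])
 have cr: "app c (rest f) \<E> rest f" if "EX w. w \<E> rest f" for f using c[of "rest f"] rest that by simp
 have fresh: "val a \<E> z & (ALL b. b \<E> a --> val b ~= val a)" if "Ord a" "val a ~= z" for a
 proof -
  have "EX w. w \<E> rest (lam a val)" using that G2 val(2) by metis
  hence "val a \<E> rest (lam a val)" using cr G1 val(2)[OF that(1)] by metis
  thus ?thesis using rest ranl by metis
 qed
 have inj: "a = b" if "Ord a" "Ord b" "val a = val b" "val a ~= z" for a b using fresh[of a] fresh[of b] Ord_lin[of a b] that by metis
 \<comment> \<open>The enumeration is injective before the marker, so replacement along its inverse,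
   applied to \<open>z\<close>, makes the stages before the marker a set.\<close>
 define R where "R y a <-> Ord a & val a = y & val a ~= z" for y a
 have "dp (%e. R (e 0) (e 1))" unfolding R_def by (intro dps val')
 then obtain B where B: "!!a. a \<E> B <-> (EX y. y \<E> z & R y a)" using repl_ax[of R z] inj unfolding R_def by metis
 have B': "a \<E> B <-> Ord a & val a ~= z" for a unfolding B R_def using fresh by blast
 have "trans B" unfolding trans_def
 proof (intro allI impI)
  fix a b assume ab: "a \<E> B" "b \<E> a"
  hence a: "Ord a" "val a ~= z" "Ord b" using B' Ord_in by auto
  obtain w where w: "w \<E> rest (lam a val)" using a G2 val(2) by metis
  have "w \<E> rest (lam b val)" using w ab(2) Ord_transD[OF a(1)] unfolding rest ranl by blast
  hence "val b \<E> rest (lam b val)" using cr G1 val(2)[OF a(3)] by metis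
  hence "val b \<E> z" using rest by blast
  thus "b \<E> B" using B' a(3) mem_irrefl by metis
 qed
 moreover have "x \<E> y | x = y | y \<E> x" if "x \<E> B" "y \<E> B" for x y using that B' Ord_lin by blast
 ultimately have OB: "Ord B" unfolding Ord_def by blast
 have "val B = z" using OB B' mem_irrefl by blast
 have "\<nexists>w. w \<E> rest (lam B val)"
 proof
  assume "EX w. w \<E> rest (lam B val)"
  hence "val B \<E> rest (lam B val)" using cr G1 val(2)[OF OB] by metis
  thus False using \<open>val B = z\<close> rest by simp
 qed
 hence onto: "y \<E> z ==> EX b. b \<E> B & y = val b" for y unfolding rest ranl by blast
 show ?thesis
 proof (intro exI conjI)
  show "Ord B" by (rule OB)
  show "isfn (lam B val) B" by (rule isfn_lam[OF val(1)])
  show "ALL y. y \<E> z <-> (EX x. x \<E> B & y = app (lam B val) x)" using onto fresh B' app_lam[OF val(1)] by metis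
  show "ALL x x'. x \<E> B --> x' \<E> B --> app (lam B val) x = app (lam B val) x' --> x = x'" using inj B' app_lam[OF val(1)] by metis
 qed
qed

end

section \<open>Countable models of ZFC\<close>

lemma lv_param [simp]:
 "j < k ==> lv (%i. if i < k then f (k - Suc i) else e (i - k)) k j = f j" by (simp add: lv_def)

lemma sat_transfer:
 assumes "bij_betw h UNIV C"
 shows "sat C E p (h o e) <-> sat UNIV (%x y. E (h x) (h y)) p e"
proof (induction p arbitrary: e)
 case (Equal i j)
 thus ?case using assms by (auto simp: bij_betw_def inj_def)
next
 case (Forall p)
 have "case_nat (h x) (h o e) = h o case_nat x e" for x by (rule ext) (simp split: nat.split)
 moreover have "(ALL x:C. P x) <-> (ALL x. P (h x))" for P using assms by (auto simp: bij_betw_def)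
 ultimately show ?case by (simp only: sat.simps Forall.IH ball_UNIV)
qed auto

text \<open>Adding \<open>x\<close> to itself as an element gives sets with ever more elements. An
  infinite set of numbers can be exchanged for all numbers, and the carrier becomes
  \<open>UNIV\<close>.\<close>

lemma infinite_model:
 assumes zfc: "ALL p:ZFC. sat C E p e" and "C ~= {}"
 shows "infinite C"
proof
 assume fin: "finite C"
 have pairing: "EX p:C. ALL z:C. E z p <-> z = a | z = b" if "a : C" "b : C" for a b
 proof -
  have "sat C E (sentence ax_pairing) e" using zfc by (simp add: ZFC_def)
  thus ?thesis using that by (simp add: sentence_def ax_pairing_def is_upair_def)
 qed
 have union: "EX u:C. ALL z:C. E z u <-> (EX y:C. E y x & E z y)" if "x : C" for x
 proof -
  have "sat C E (sentence ax_union) e" using zfc by (simp add: ZFC_def)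
  thus ?thesis using that by (simp add: sentence_def ax_union_def)
 qed
 have found: "EX y:C. E y x & (ALL z:C. E z y --> ~E z x)" if "x : C" "y : C" "E y x" for x y
 proof -
  have "sat C E (sentence ax_foundation) e" using zfc by (simp add: ZFC_def)
  thus ?thesis using that by (simp add: sentence_def ax_foundation_def Defs.nonempty_def) blast
 qed
 have irrefl: "~E x x" if "x : C" for x
 proof
  assume "E x x"
  obtain s where s: "s : C" "ALL z:C. E z s <-> z = x | z = x" using pairing[OF \<open>x : C\<close> \<open>x : C\<close>] by blast
  thus False using found[of s x] \<open>E x x\<close> \<open>x : C\<close> by auto
 qed
 have "EX x:C. card {z : C. E z x} >= n" for n
 proof (induction n)
  case 0
  thus ?case using \<open>C ~= {}\<close> by auto
 next
  case (Suc n)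
  then obtain x where x: "x : C" "card {z : C. E z x} >= n" by blast
  obtain s where s: "s : C" "ALL z:C. E z s <-> z = x | z = x" using pairing[OF x(1) x(1)] by blast
  obtain t where t: "t : C" "ALL z:C. E z t <-> z = x | z = s" using pairing[OF x(1) s(1)] by blast
  obtain u where u: "u : C" "ALL z:C. E z u <-> (EX y:C. E y t & E z y)" using union[OF t(1)] by blast
  have "{z : C. E z u} = insert x {z : C. E z x}" using u t s x by auto
  moreover have "x ~: {z : C. E z x}" using irrefl x by auto
  ultimately have "card {z : C. E z u} >= Suc n" using fin x by simp
  thus ?case using u by blast
 qed
 then obtain x where "x : C" "card {z : C. E z x} >= Suc (card C)" by blast
 moreover have "card {z : C. E z x} <= card C" by (rule card_mono) (use fin in auto)
 ultimately show False by simp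
qed

lemma countable_model:
 assumes "consistent T" "ZFC <= T"
 shows "EX (E :: nat => nat => bool) e. ALL p:T. sat UNIV E p e"
proof -
 obtain C :: "nat set" and E e where M: "range e <= C" "ALL p:T. sat C E p e" using completeness[OF assms(1)] by blast
 hence "infinite C" using infinite_model[of C E e] assms(2) by blast
 then obtain h :: "nat => nat" where h: "bij_betw h UNIV C" using bij_enumerate by blast
 define e' where "e' i = inv_into UNIV h (e i)" for i
 have "h o e' = e"
 proof
  fix i
  have "e i : range h" using M(1) h by (auto simp: bij_betw_def)
  thus "(h o e') i = e i" by (simp add: e'_def f_inv_into_f)
 qed
 hence "ALL p:T. sat UNIV (%x y. E (h x) (h y)) p e'" using M(2) sat_transfer[OF h, of E _ e'] by simp
 thus ?thesis by blast
qed

lemma zf_of_model: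
 fixes E :: "'m => 'm => bool"
 assumes zfc: "ALL p:ZFC. sat UNIV E p e"
 shows "zf E"
proof -
 have ax: "sat UNIV E (sentence F) e"
  if "F : {ax_extensionality, ax_foundation, ax_pairing, ax_union, ax_power, ax_infinity, ax_choice}" for F
  using zfc that unfolding ZFC_def by blast
 have b: "base UNIV E UNIV"
 proof
  show "x = y" if "!!z. z : UNIV ==> E z x <-> E z y" for x y
   using ax[of ax_extensionality] that by (simp add: sentence_def ax_extensionality_def)
  show "EX p:UNIV. ALL z:UNIV. E z p <-> z = a | z = b" for a b
   using ax[of ax_pairing] by (simp add: sentence_def ax_pairing_def is_upair_def)
 qed auto
 interpret base UNIV E UNIV by (rule b)
 have sep: "EX b. ALL x. E x b <-> E x a & sat UNIV E p (case_nat x f)" for p f a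
 proof -
  obtain k where k: "free_below (k + 1) p" using free_below_exists by blast
  \<comment> \<open>The number \<open>k\<close> of parameters is chosen so large that the formula
    does not see the tail of the environment.\<close>
  define e' where "e' = (%i. if i < k then f (k - Suc i) else e (i - k))"
  have "foralls k (separation p) : ZFC" using k by (auto simp: ZFC_def)
  hence sat: "sat UNIV E (separation p k) e'" using zfc unfolding e'_def by (auto simp: sat_foralls)
  define Q where "Q n d u = sat UNIV E p (%i. lv d n (if i < length [u] then [u] ! i else i - length [u]))"
   for n d and u :: nat
  have Q: "Q n d u = sat UNIV E p (case_nat (lv d n u) f)"
   if "!!i. i < k ==> lv d n i = f i" for n d u unfolding Q_def
  proof (rule sat_cong)
   fix i assume "i : fv p"
   hence "i < k + 1" using k unfolding free_below_fv by auto
   thus "lv d n (if i < length [u] then [u] ! i else i - length [u]) = case_nat (lv d n u) f i"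
    using that by (auto split: nat.split simp: less_Suc_eq)
  qed
  have lve: "lv e' k i = f i" if "i < k" for i using that by (simp add: e'_def)
  have "ALL a. EX b. ALL x. E x b <-> E x a &
     Q (Suc (Suc (Suc k))) (case_nat x (case_nat b (case_nat a e'))) (Suc (Suc k))"
   using sat by (simp add: separation_def sat_schematic Q_def)
  thus ?thesis by (simp add: Q lve)
 qed
 have repl: "EX b. ALL y. E y b <-> (EX x. E x a & sat UNIV E p (case_nat x (case_nat y f)))"
  if fn: "!!x y z. E x a ==> sat UNIV E p (case_nat x (case_nat y f)) ==>
   sat UNIV E p (case_nat x (case_nat z f)) ==> y = z" for p f a
 proof -
  obtain k where k: "free_below (k + 2) p" using free_below_exists by blast
  define e' where "e' = (%i. if i < k then f (k - Suc i) else e (i - k))"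
  define Q where "Q n d u v = sat UNIV E p (%i. lv d n (if i < length [u, v] then [u, v] ! i else i - length [u, v]))"
   for n d and u v :: nat
  have Q: "Q n d u v = sat UNIV E p (case_nat (lv d n u) (case_nat (lv d n v) f))"
   if "!!i. i < k ==> lv d n i = f i" for n d u v unfolding Q_def
  proof (rule sat_cong)
   fix i assume "i : fv p"
   hence "i < k + 2" using k unfolding free_below_fv by auto
   thus "lv d n (if i < length [u, v] then [u, v] ! i else i - length [u, v]) =
     case_nat (lv d n u) (case_nat (lv d n v) f) i" using that by (auto split: nat.split simp: less_Suc_eq)
  qed
  have lve: "lv e' k i = f i" if "i < k" for i using that by (simp add: e'_def)
  have "foralls k (replacement p) : ZFC" using k by (auto simp: ZFC_def)
  hence "sat UNIV E (replacement p k) e'" using zfc unfolding e'_def by (auto simp: sat_foralls)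
  hence "ALL a. (ALL x y z. E x a &
     Q (Suc (Suc (Suc (Suc k)))) (case_nat z (case_nat y (case_nat x (case_nat a e')))) (Suc k) (Suc (Suc k)) &
     Q (Suc (Suc (Suc (Suc k)))) (case_nat z (case_nat y (case_nat x (case_nat a e')))) (Suc k) (Suc (Suc (Suc k)))
     --> y = z) --> (EX b. ALL y. E y b <-> (EX x. E x a &
     Q (Suc (Suc (Suc (Suc k)))) (case_nat x (case_nat y (case_nat b (case_nat a e')))) (Suc (Suc (Suc k))) (Suc (Suc k))))"
   by (simp add: replacement_def sat_schematic Q_def)
  hence "ALL a. (ALL x y z. E x a & sat UNIV E p (case_nat x (case_nat y f)) &
     sat UNIV E p (case_nat x (case_nat z f)) --> y = z) -->
     (EX b. ALL y. E y b <-> (EX x. E x a & sat UNIV E p (case_nat x (case_nat y f))))" by (simp add: Q lve)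
  thus ?thesis using fn by blast
 qed
 show ?thesis
 proof (intro zf.intro b zf_axioms.intro)
  show "EX y. E y x & (ALL z. E z y --> ~E z x)" if "E y x" for x y using ax[of ax_foundation] that
   by (simp add: sentence_def ax_foundation_def Defs.nonempty_def) blast
  show "EX u. ALL z. E z u <-> (EX y. E y x & E z y)" for x using ax[of ax_union] by (simp add: sentence_def ax_union_def)
  show "EX u. ALL z. E z u <-> (ALL w. E w z --> E w x)" for x using ax[of ax_power] by (simp add: sentence_def ax_power_def subset_def)
  show "EX f. ALL y. E y x --> (EX z. E z y & (ALL z'. E (opair y z') f <-> z' = z))"
   if "ALL y. E y x --> (EX z. E z y)" for x
  proof -
   have "EX f. (ALL x'. E x' x --> (EX a. E (opair x' a) f & (ALL b. E (opair x' b) f --> b = a))) &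
     (ALL y z. E (opair y z) f --> E z y)" using ax[of ax_choice] that
    by (simp add: sentence_def ax_choice_def Defs.nonempty_def fun_on_def) blast
   thus ?thesis by blast
  qed
  fix P :: "'m => bool"
  assume "dp (%e. P (e 0))"
  then obtain p c where p: "!!e. P (e 0) = sat UNIV E p (weave e c)" unfolding dp_def by auto
  \<comment> \<open>A predicate of one variable may be evaluated in a constant environment, so all
    even variables are identified.\<close>
  define r where "r i = (if even i then 0 else Suc (i div 2))" for i :: nat
  have "weave (%_. x) c = case_nat x c o r" for x by (rule sym, rule weave_eqI) (auto simp: r_def)
  hence "P x = sat UNIV E (rename r p) (case_nat x c)" for x using p[of "%_. x"] by (simp add: sat_rename)
  thus "EX b. ALL x. E x b <-> E x a & P x" for a using sep[of a "rename r p" c] by simp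
 next
  fix R :: "'m => 'm => bool" and a
  assume "dp (%e. R (e 0) (e 1))" and fn: "!!x y z. E x a ==> R x y ==> R x z ==> y = z"
  then obtain p c where p: "!!e. R (e 0) (e 1) = sat UNIV E p (weave e c)" unfolding dp_def by auto
  define r where "r i = (if i = 0 then 0 else if even i then 1 else i div 2 + 2)" for i :: nat
  have "weave (case_nat x (%_. y)) c = case_nat x (case_nat y c) o r" for x y
   by (rule sym, rule weave_eqI) (auto simp: r_def split: nat.split)
  hence "R x y = sat UNIV E (rename r p) (case_nat x (case_nat y c))" for x y using p[of "case_nat x (%_. y)"] by (simp add: sat_rename)
  thus "EX b. ALL y. E y b <-> (EX x. E x a & R x y)" using repl[of a "rename r p" c] fn by simp
 qed
qed

section \<open>Semantics of the set-theoretic notions\<close>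

context base
begin

lemma S_C' [simp]: "x : S ==> x : C" by (rule S_C)

lemma sat_pair_S [simp]:
 assumes "p < n" "a < n" "b < n" "lv e n p : S" "lv e n a : S" "lv e n b : S"
 shows "sat S E (is_pair p a b n) e <-> lv e n p = opair (lv e n a) (lv e n b)" using sat_is_pair[of S p n a b e] assms S_sub by simp

lemma sat_related_S [simp]:
 assumes "r < n" "a < n" "b < n" "lv e n r : C" "lv e n a : S" "lv e n b : S"
 shows "sat S E (related r a b n) e <-> opair (lv e n a) (lv e n b) \<E> lv e n r" using sat_related[of S r n a b e] assms S_sub by simp

declare sat_is_pair [simp del] sat_related [simp del]

text \<open>This and the following capitalised predicates are the values of the formulas of the
  statement in a structure of sets and classes; a sequence of graphs may be a proper class.\<close>

definition Sub where
 "Sub x y <-> (ALL z:S. z \<E> x --> z \<E> y)"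

definition FunOn where
 "FunOn f a <-> (ALL p:S. p \<E> f --> (EX x:S. EX y:S. x \<E> a & p = opair x y)) &
   (ALL x:S. x \<E> a --> (EX y:S. opair x y \<E> f & (ALL y':S. opair x y' \<E> f --> y' = y)))"

definition FunTo where
 "FunTo f a b <-> FunOn f a & (ALL x:S. ALL y:S. opair x y \<E> f --> y \<E> b)"

definition Bij where
 "Bij f a b <-> FunTo f a b &
   (ALL y:S. y \<E> b --> (EX x:S. opair x y \<E> f & (ALL x':S. opair x' y \<E> f --> x' = x)))"

definition ORD where
 "ORD a <-> (ALL x:S. x \<E> a --> Sub x a) &
   (ALL x:S. ALL y:S. x \<E> a & y \<E> a --> x \<E> y | x = y | y \<E> x)"

definition LORD where
 "LORD a <-> ORD a & (EX z:S. z \<E> a) & (ALL x:S. x \<E> a --> (EX y:S. y \<E> a & x \<E> y))"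

definition OMEGA where
 "OMEGA w <-> LORD w & (ALL x:S. x \<E> w --> ~LORD x)"

definition CARD where
 "CARD k <-> ORD k & (ALL a:S. a \<E> k --> ~(EX f:S. Bij f a k))"

definition UNC where
 "UNC k <-> CARD k & (EX w:S. OMEGA w & w \<E> k)"

definition CardLess where
 "CardLess A k <-> (EX a:S. a \<E> k & (EX f:S. Bij f A a))"

definition IsP where
 "IsP P k X <-> (ALL A:S. A \<E> P <-> Sub A X & CardLess A k)"

definition UF where
 "UF U P <->
   (ALL B:S. B \<E> U --> Sub B P) & P \<E> U &
   (ALL B:S. B \<E> U --> (EX z:S. z \<E> B)) &
   (ALL B:S. ALL D:S. B \<E> U & Sub B D & Sub D P --> D \<E> U) &
   (ALL B:S. ALL D:S. ALL F:S. B \<E> U & D \<E> U & (ALL z:S. z \<E> F <-> z \<E> B & z \<E> D) --> F \<E> U) &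
   (ALL B:S. ALL D:S. Sub B P & (ALL z:S. z \<E> D <-> z \<E> P & ~z \<E> B) --> B \<E> U | D \<E> U)"

definition Complete where
 "Complete k U P <->
   (ALL F:S. ALL I:S. Sub F U & CardLess F k &
    (ALL z:S. z \<E> I <-> z \<E> P & (ALL B:S. B \<E> F --> z \<E> B)) --> I \<E> U)"

definition Fine where
 "Fine U P X <->
   (ALL x:S. ALL B:S. x \<E> X & (ALL A:S. A \<E> B <-> A \<E> P & x \<E> A) --> B \<E> U)"

definition Normal where
 "Normal U <->
   (ALL B:S. ALL f:S. B \<E> U & FunOn f B & (ALL A:S. ALL y:S. opair A y \<E> f --> y \<E> A)
    --> (EX D:S. EX c:S. D \<E> U & (ALL A:S. A \<E> D --> opair A c \<E> f)))"

definition CompactFor where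
 "CompactFor k X <-> (EX P:S. EX U:S. IsP P k X & UF U P & Fine U P X & Complete k U P)"

definition SupercompactFor where
 "SupercompactFor k X <->
  (EX P:S. EX U:S. IsP P k X & UF U P & Fine U P X & Complete k U P & Normal U)"

lemma sat_subset [simp]:
 "x < n ==> y < n ==> sat S E (subset x y n) e <-> Sub (lv e n x) (lv e n y)" by (simp add: subset_def Sub_def)

lemma sat_nonempty [simp]: "x < n ==> sat S E (Defs.nonempty x n) e <-> (EX z:S. z \<E> lv e n x)" by (simp add: Defs.nonempty_def)

lemma sat_fun_on [simp]:
 "f < n ==> a < n ==> lv e n f : C ==>
  sat S E (fun_on f a n) e <-> FunOn (lv e n f) (lv e n a)" by (simp add: fun_on_def FunOn_def)

lemma sat_fun_to [simp]:
 "f < n ==> a < n ==> b < n ==> lv e n f : C ==>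
  sat S E (fun_to f a b n) e <-> FunTo (lv e n f) (lv e n a) (lv e n b)" by (simp add: fun_to_def FunTo_def)

lemma sat_bijection [simp]:
 "f < n ==> a < n ==> b < n ==> lv e n f : C ==>
  sat S E (bijection f a b n) e <-> Bij (lv e n f) (lv e n a) (lv e n b)" by (simp add: bijection_def Bij_def)

lemma sat_ordinal [simp]: "a < n ==> sat S E (ordinal a n) e <-> ORD (lv e n a)" by (simp add: ordinal_def ORD_def)

lemma sat_limit_ordinal [simp]: "a < n ==> sat S E (limit_ordinal a n) e <-> LORD (lv e n a)" by (simp add: limit_ordinal_def LORD_def)

lemma sat_is_omega [simp]: "a < n ==> sat S E (is_omega a n) e <-> OMEGA (lv e n a)" by (simp add: is_omega_def OMEGA_def)

lemma sat_cardinal [simp]: "k < n ==> sat S E (cardinal k n) e <-> CARD (lv e n k)" by (simp add: cardinal_def CARD_def)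

lemma sat_uncountable [simp]:
 "k < n ==> sat S E (uncountable_cardinal k n) e <-> UNC (lv e n k)" by (simp add: uncountable_cardinal_def UNC_def)

lemma sat_card_less [simp]:
 "A < n ==> k < n ==> sat S E (card_less A k n) e <-> CardLess (lv e n A) (lv e n k)" by (simp add: card_less_def CardLess_def)

lemma sat_is_P [simp]:
 "P < n ==> k < n ==> X < n ==>
  sat S E (is_P P k X n) e <-> IsP (lv e n P) (lv e n k) (lv e n X)" by (simp add: is_P_def IsP_def)

lemma sat_ultrafilter_on [simp]:
 "U < n ==> P < n ==> sat S E (ultrafilter_on U P n) e <-> UF (lv e n U) (lv e n P)" by (simp add: ultrafilter_on_def UF_def)

lemma sat_complete [simp]:
 "k < n ==> U < n ==> P < n ==>
  sat S E (complete k U P n) e <-> Complete (lv e n k) (lv e n U) (lv e n P)" by (simp add: complete_def Complete_def)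

lemma sat_fine [simp]:
 "U < n ==> P < n ==> X < n ==>
  sat S E (fine U P X n) e <-> Fine (lv e n U) (lv e n P) (lv e n X)" by (simp add: fine_def Fine_def)

lemma sat_normal [simp]: "U < n ==> sat S E (normal U n) e <-> Normal (lv e n U)" by (simp add: normal_def Normal_def)

lemma sat_strongly_compact [simp]:
 "k < n ==> sat S E (strongly_compact k n) e <->
  UNC (lv e n k) & (ALL X:S. CompactFor (lv e n k) X)" by (simp add: strongly_compact_def compact_for_def CompactFor_def)

lemma sat_supercompact [simp]:
 "k < n ==> sat S E (supercompact k n) e <->
  UNC (lv e n k) & (ALL X:S. SupercompactFor (lv e n k) X)" by (simp add: supercompact_def supercompact_for_def SupercompactFor_def)

definition GStr where
 "GStr g v d <-> g = opair v d &
   (ALL p:S. p \<E> d --> (EX x:S. EX y:S. x \<E> v & y \<E> v & p = opair x y))"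

definition Hom where
 "Hom h g g' <-> (EX v:S. EX d:S. EX v':S. EX d':S. GStr g v d & GStr g' v' d' & FunTo h v v' &
   (ALL x:S. ALL y:S. ALL x':S. ALL y':S. opair x y \<E> d & opair x x' \<E> h & opair y y' \<E> h -->
    opair x' y' \<E> d'))"

definition GSeq where
 "GSeq G <->
   (ALL p:S. p \<E> G --> (EX a:S. EX g:S. ORD a & (EX v:S. EX d:S. GStr g v d) & p = opair a g)) &
   (ALL a:S. ORD a --> (EX g:S. opair a g \<E> G & (ALL g':S. opair a g' \<E> G --> g' = g)))"

definition NoForward where
 "NoForward G <-> (ALL a:S. ALL a':S. ALL g:S. ALL g':S.
   ORD a & ORD a' & a \<E> a' & opair a g \<E> G & opair a' g' \<E> G --> ~(EX h:S. Hom h g g'))"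

definition Backward where
 "Backward G <-> (ALL a:S. ALL a':S. ALL g:S. ALL g':S.
   ORD a & ORD a' & (a \<E> a' | a = a') & opair a g \<E> G & opair a' g' \<E> G --> (EX h:S. Hom h g' g))"

lemma sat_graph_structure [simp]:
 "g < n ==> v < n ==> d < n ==> lv e n g : S ==> lv e n v : S ==> lv e n d : S ==>
  sat S E (graph_structure g v d n) e <-> GStr (lv e n g) (lv e n v) (lv e n d)" by (simp add: graph_structure_def GStr_def)

lemma sat_homomorphism [simp]:
 "h < n ==> g < n ==> g' < n ==> lv e n h : S ==> lv e n g : S ==> lv e n g' : S ==>
  sat S E (homomorphism h g g' n) e <-> Hom (lv e n h) (lv e n g) (lv e n g')" by (simp add: homomorphism_def Hom_def)

lemma sat_graph_sequence [simp]:
 "G < n ==> lv e n G : C ==> sat S E (graph_sequence G n) e <-> GSeq (lv e n G)" by (simp add: graph_sequence_def graph_def GSeq_def)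

lemma sat_no_forward_homs [simp]:
 "G < n ==> lv e n G : C ==> sat S E (no_forward_homs G n) e <-> NoForward (lv e n G)" by (simp add: no_forward_homs_def NoForward_def)

lemma sat_backward_homs [simp]:
 "G < n ==> lv e n G : C ==> sat S E (backward_homs G n) e <-> Backward (lv e n G)" by (simp add: backward_homs_def Backward_def)

lemma sat_unique_backward_homs:
 "G < n ==> lv e n G : C ==> sat S E (unique_backward_homs G n) e ==> Backward (lv e n G)"
 by (simp add: unique_backward_homs_def Backward_def) blast

end

lemma sat_iso:
 assumes h: "bij_betw h C C'" and E: "!!x y. x : C ==> y : C ==> E x y <-> E' (h x) (h y)"
 shows "range e <= C ==> sat C E p e <-> sat C' E' p (h o e)"
proof (induction p arbitrary: e)
 case (Member i j)
 thus ?case using E by (auto simp: image_subset_iff)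
next
 case (Equal i j)
 hence "e i : C" "e j : C" by auto
 thus ?case using h by (auto simp: bij_betw_def inj_on_def)
next
 case (Forall p)
 have cn: "case_nat (h x) (h o e) = h o case_nat x e" for x by (rule ext) (simp split: nat.split)
 have "range (case_nat x e) <= C" if "x : C" for x using that Forall.prems by (fastforce split: nat.splits)
 hence "sat C E p (case_nat x e) = sat C' E' p (case_nat (h x) (h o e))" if "x : C" for x
  unfolding cn using that by (intro Forall.IH) blast
 moreover have "(ALL x:C'. P x) <-> (ALL x:C. P (h x))" for P using h by (auto simp: bij_betw_def)
 ultimately show ?case by (simp only: sat.simps cong: ball_cong)
qed auto

section \<open>Supercompactness\<close>

context zf
begin

lemma ORD_Ord: "ORD a = Ord a" by (auto simp: ORD_def Ord_def Sub_def trans_def)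

lemma Sub_iff: "Sub x y <-> (ALL z. z \<E> x --> z \<E> y)" by (simp add: Sub_def)

lemma FunOn_isfn: "FunOn f a = isfn f a"
proof
 assume "FunOn f a"
 thus "isfn f a" unfolding FunOn_def by (intro isfnI) (simp, metis UNIV_I)
next
 assume "isfn f a"
 thus "FunOn f a" unfolding FunOn_def using isfn_mem isfn_opair by (metis UNIV_I)
qed

lemma Bij_iff:
 "Bij f a b <-> isfn f a & (ALL x. x \<E> a --> app f x \<E> b) &
   (ALL y. y \<E> b --> (EX x. x \<E> a & app f x = y)) &
   (ALL x x'. x \<E> a --> x' \<E> a --> app f x = app f x' --> x = x')"
proof (cases "isfn f a")
 case True
 thus ?thesis unfolding Bij_def FunTo_def FunOn_isfn by (simp add: isfn_opair) (safe; metis)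
qed (simp add: Bij_def FunTo_def FunOn_isfn)

text \<open>For each fixed formula, satisfaction in a set is definable. The formula stays outside
  the model, so no internal syntax is involved.\<close>

lemma dp_sat:
 assumes "dt f" "!!i. dt (g i)"
 shows "dp (%e. sat {x. x \<E> f e} E p (%i. g i e))" using assms
proof (induction p arbitrary: f g)
 case (Forall p)
 have "dp (%e. sat {x. x \<E> f (%i. e (Suc i))} E p (%i. case_nat (e 0) (%i. g i (%i. e (Suc i))) i))"
 proof (rule Forall.IH[OF dt_reindex[OF Forall.prems(1)]])
  show "dt (%e. case_nat (e 0) (%i. g i (%i. e (Suc i))) i)" for i by (cases i) (simp_all add: dt_var dt_reindex[OF Forall.prems(2)])
 qed
 hence "dp (%e. ALL x. x \<E> f e --> sat {x. x \<E> f e} E p (case_nat x (%i. g i e)))" by (intro dps dt_reindex[OF Forall.prems(1)])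
 thus ?case by simp
qed (simp_all add: dps)

definition inj_into where
 "inj_into g z a <-> (ALL x. x \<E> z --> app g x \<E> a) &
   (ALL x y. x \<E> z --> y \<E> z --> app g x = app g y --> x = y)"

lemma dp_inj_into [dps]: "dt f ==> dt g ==> dt h ==> dp (%e. inj_into (f e) (g e) (h e))"
 by (rule dp_rel3[of inj_into], unfold inj_into_def, intro dps)

end

section \<open>Uncountable cardinals and sets of smaller size\<close>

locale unc = zf E for E :: "'m => 'm => bool" (infix "\<E>" 50) +
 fixes kap :: 'm
 assumes unc: "UNC kap"
begin

lemma Ord_kap: "Ord kap" using unc by (simp add: UNC_def CARD_def ORD_Ord)

definition om :: 'm where "om = (SOME w. OMEGA w & w \<E> kap)"

lemma om: "OMEGA om" "om \<E> kap"
proof -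
 have "EX w. OMEGA w & w \<E> kap" using unc by (auto simp: UNC_def)
 from someI_ex[OF this] show "OMEGA om" "om \<E> kap" by (auto simp: om_def)
qed

lemma Ord_om: "Ord om" using om by (simp add: OMEGA_def LORD_def ORD_Ord)

lemma Ord_emp: "Ord emp" by (simp add: Ord_def trans_def)

lemma emp_om: "emp \<E> om"
proof -
 have "EX z. z \<E> om" using om by (simp add: OMEGA_def LORD_def)
 hence "om ~= emp" by auto
 thus ?thesis using Ord_lin[OF Ord_emp Ord_om] by auto
qed

lemma suc_om: "n \<E> om ==> suc n \<E> om"
proof -
 assume n: "n \<E> om"
 then obtain m where m: "m \<E> om" "n \<E> m" using om by (auto simp: OMEGA_def LORD_def)
 have "om ~= suc n" using m mem_asym by auto
 moreover have "~om \<E> suc n" using n mem_asym by auto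
 moreover have "Ord (suc n)" using n Ord_suc Ord_in Ord_om by blast
 ultimately show ?thesis using Ord_lin[OF Ord_om] by blast
qed

lemma om_cases:
 assumes n: "n \<E> om"
 shows "n = emp | (EX m. m \<E> om & n = suc m)"
proof (cases "EX z. z \<E> n")
 case True
 have On: "Ord n" using n Ord_in Ord_om by blast
 have "~LORD n" using om n by (auto simp: OMEGA_def)
 then obtain m where m: "m \<E> n" "!!y. y \<E> n ==> ~m \<E> y" using True On by (auto simp: LORD_def ORD_Ord)
 have "n = suc m"
 proof (intro eqI iffI)
  fix y assume y: "y \<E> n"
  thus "y \<E> suc m" using m Ord_lin[of y m] Ord_in[OF On] by auto
 qed (use m Ord_transD[OF On] in auto)
 thus ?thesis using m n Ord_transD[OF Ord_om] by blast
next
 case False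
 thus ?thesis by (auto intro: eqI)
qed

definition small where "small A <-> CardLess A kap"

lemma small_iff: "small A <-> (EX a. a \<E> kap & (EX f. Bij f A a))" by (simp add: small_def CardLess_def)

text \<open>Smallness by injections is obviously inherited by subsets; \<open>small\<close> is the
  form in which \<open>P\<close> and completeness are given.\<close>

definition ssmall where
 "ssmall z <-> (EX a. a \<E> kap & (EX g. inj_into g z a))"

lemma dp_ssmall [dps]: "dt f ==> dp (%e. ssmall (f e))" by (rule dp_rel1[of ssmall], unfold ssmall_def, intro dps)

lemma small_ssmall: "small A ==> ssmall A" by (auto simp: small_iff ssmall_def Bij_iff inj_into_def)

lemma ssmall_sub: "ssmall z ==> (!!x. x \<E> y ==> x \<E> z) ==> ssmall y" unfolding ssmall_def inj_into_def by meson

lemma lam_id_app: "x \<E> a ==> app (lam a (%x. x)) x = x" by (rule app_lam) (intro dps)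

lemma ssmall_in_kap: "a \<E> kap ==> ssmall a" unfolding ssmall_def inj_into_def using lam_id_app by metis

lemma one_kap: "sng emp \<E> kap"
proof -
 have "suc emp = sng emp" by (rule eqI) auto
 thus ?thesis using suc_om[OF emp_om] Ord_transD[OF Ord_kap om(2)] by simp
qed

lemma small_sng: "small (sng i)"
proof -
 have "dt (%e. emp)" by (intro dps)
 hence "Bij (lam (sng i) (%x. emp)) (sng i) (sng emp)" by (auto simp: Bij_iff isfn_lam)
 thus ?thesis unfolding small_iff using one_kap by blast
qed

lemma small_Img:
 assumes F: "dt (%e. F (e 0))" and inj: "!!x y. x \<E> s ==> y \<E> s ==> F x = F y ==> x = y"
  and s: "s \<E> kap"
 shows "small (Img s F)"
proof -
 define G where "G y = union (Coll s (%x. F x = y))" for y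
 have c: "z \<E> Coll s (%x. F x = y) <-> z \<E> s & F z = y" for z y by (rule mem_Coll) (intro dps dt_fun1[OF F])
 have GF: "G (F x) = x" if "x \<E> s" for x unfolding G_def by (rule eqI) (use that inj c in "auto")
 have dG: "dt (%e. G (e 0))" unfolding G_def by (intro dps dt_fun1[OF F])
 have "Bij (lam (Img s F) G) (Img s F) s" unfolding Bij_iff
 proof (intro conjI allI impI isfn_lam[OF dG])
  show "app (lam (Img s F) G) y \<E> s" if "y \<E> Img s F" for y using that by (auto simp: app_lam[OF dG] mem_Img[OF F] GF)
  show "EX y. y \<E> Img s F & app (lam (Img s F) G) y = x" if "x \<E> s" for x
  proof (intro exI[of _ "F x"] conjI)
   show "F x \<E> Img s F" using that by (auto simp: mem_Img[OF F])
   thus "app (lam (Img s F) G) (F x) = x" using that by (simp add: app_lam[OF dG] GF)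
  qed
  show "y = y'" if "y \<E> Img s F" "y' \<E> Img s F" "app (lam (Img s F) G) y = app (lam (Img s F) G) y'" for y y'
   using that by (auto simp: app_lam[OF dG] mem_Img[OF F] GF)
 qed
 thus ?thesis using s small_iff by blast
qed

end

text \<open>\<open>kap_X\<close> puts the ordinals below \<open>kap\<close> into \<open>X\<close>;
  their singletons are then members of \<open>P\<close> and serve as markers in
  \<open>most_all_below\<close>.\<close>

locale ultra = unc E kap for E :: "'m => 'm => bool" (infix "\<E>" 50) and kap +
 fixes X P U :: 'm
 assumes isP: "IsP P kap X" and uf: "UF U P" and fine: "Fine U P X"
  and complete: "Complete kap U P" and normal: "Normal U"
  and kap_X: "!!x. x \<E> kap ==> x \<E> X"
begin

lemma P_iff: "A \<E> P <-> (ALL x. x \<E> A --> x \<E> X) & small A" using isP by (simp add: IsP_def Sub_iff small_def)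

definition most where
 "most Q <-> Coll P Q \<E> U"

lemma uf_parts:
 "ALL B. B \<E> U --> (ALL z. z \<E> B --> z \<E> P)"
 "P \<E> U"
 "ALL B. B \<E> U --> (EX z. z \<E> B)"
 "ALL B D. B \<E> U & (ALL z. z \<E> B --> z \<E> D) & (ALL z. z \<E> D --> z \<E> P) --> D \<E> U"
 "ALL B D F. B \<E> U & D \<E> U & (ALL z. z \<E> F <-> z \<E> B & z \<E> D) --> F \<E> U"
 "ALL B D. (ALL z. z \<E> B --> z \<E> P) & (ALL z. z \<E> D <-> z \<E> P & ~z \<E> B) --> B \<E> U | D \<E> U"
 using uf unfolding UF_def Sub_iff ball_UNIV bex_UNIV by - (elim conjE, assumption)+

lemma dp_most [dps]: "dp (%e. Q (%i. e (Suc i)) (e 0)) ==> dp (%e. most (Q e))" unfolding most_def by (intro dps)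

lemma mostI:
 assumes Q: "dp (%e. Q (e 0))" and B: "B \<E> U" "!!A. A \<E> B ==> A \<E> P ==> Q A"
 shows "most Q"
proof -
 have "ALL z. z \<E> B --> z \<E> Coll P Q" "ALL z. z \<E> Coll P Q --> z \<E> P" using B uf_parts(1) mem_Coll[OF Q] by auto
 thus ?thesis using uf_parts(4)[rule_format, of B "Coll P Q"] B(1) unfolding most_def by blast
qed

lemma most_mono:
 assumes Q: "most Q" "dp (%e. Q (e 0))" and R: "dp (%e. R (e 0))" "!!A. A \<E> P ==> Q A ==> R A"
 shows "most R"
proof (rule mostI[OF R(1)])
 show "Coll P Q \<E> U" using Q(1) by (simp add: most_def)
 show "R A" if "A \<E> Coll P Q" for A using that R(2) by (simp add: mem_Coll[OF Q(2)])
qed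

lemma most_conj:
 assumes Q: "dp (%e. Q (e 0))" and R: "dp (%e. R (e 0))" and "most Q" "most R"
 shows "most (%A. Q A & R A)"
proof -
 have "z \<E> Coll P (%A. Q A & R A) <-> z \<E> Coll P Q & z \<E> Coll P R" for z
  by (auto simp: mem_Coll[OF dp_and[OF Q R]] mem_Coll[OF Q] mem_Coll[OF R])
 thus ?thesis using uf_parts(5)[rule_format, of "Coll P Q" "Coll P R"] assms(3,4) unfolding most_def by blast
qed

lemma most_not:
 assumes Q: "dp (%e. Q (e 0))" and n: "~most Q"
 shows "most (%A. ~Q A)"
proof -
 have "z \<E> Coll P (%A. ~Q A) <-> z \<E> P & ~z \<E> Coll P Q" for z by (auto simp: mem_Coll[OF dp_not[OF Q]] mem_Coll[OF Q])
 moreover have "z \<E> Coll P Q --> z \<E> P" for z by (simp add: mem_Coll[OF Q])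
 ultimately show ?thesis using uf_parts(6)[rule_format, of "Coll P Q" "Coll P (%A. ~Q A)"] n unfolding most_def by blast
qed

lemma most_ex:
 assumes Q: "dp (%e. Q (e 0))" "most Q"
 shows "EX A. A \<E> P & Q A" using uf_parts(3)[rule_format, of "Coll P Q"] Q(2) by (auto simp: mem_Coll[OF Q(1)] most_def)

lemma most_contra:
 assumes Q: "dp (%e. Q (e 0))" "most Q" "most (%A. ~Q A)"
 shows False using most_ex[OF dp_and[OF Q(1) dp_not[OF Q(1)]] most_conj[OF Q(1) dp_not[OF Q(1)] Q(2,3)]] by blast

lemma most_fine: "x \<E> X ==> most (%A. x \<E> A)"
proof -
 assume x: "x \<E> X"
 have "dp (%e. x \<E> e 0)" by (intro dps)
 hence "ALL A. A \<E> Coll P (%A. x \<E> A) <-> A \<E> P & x \<E> A" using mem_Coll by blast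
 thus ?thesis using fine x unfolding Fine_def most_def ball_UNIV by blast
qed

lemma most_True: "(!!A. A \<E> P ==> Q A) ==> dp (%e. Q (e 0)) ==> most Q" by (rule mostI[of Q P]) (use uf_parts(2) in auto)

text \<open>Completeness is stated for sets of members of \<open>U\<close> that biject with an ordinal below \<open>kap\<close>;
 a family indexed by such an ordinal is made injective by adding the singleton \<open>{i}\<close> to the
 \<open>i\<close>-th set and removing the other singletons.\<close>

lemma most_all_below:
 assumes Q: "dp (%e. Q (e 0) (e 1))" and s: "s \<E> kap" and most: "!!i. i \<E> s ==> most (Q i)"
 shows "most (%A. ALL i. i \<E> s --> Q i A)"
proof -
 note Q' = dp_rel2[OF Q]
 have sX: "i \<E> X" if "i \<E> s" for i using kap_X Ord_transD[OF Ord_kap s that] .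
 \<comment> \<open>Almost every \<open>A\<close> has the two elements 0 and 1 and hence is no
   singleton, so tampering with singletons changes the family only on a negligible set.\<close>
 define sg where "sg A <-> emp \<E> A & sng emp \<E> A" for A
 have sgd: "dp (%e. sg (f e))" if "dt f" for f by (rule dp_rel1[OF _ that, of sg], unfold sg_def, intro dps)
 have sg: "sg A ==> A ~= sng j" for A j unfolding sg_def using emp_iff sng_iff by metis
 have "most (%A. emp \<E> A & sng emp \<E> A)" by (rule most_conj) (intro dps most_fine kap_X one_kap Ord_transD[OF Ord_kap om(2) emp_om])+
 hence msg: "most sg" unfolding sg_def .
 define B where "B i = Coll P (%A. A = sng i | (Q i A & (ALL j. j \<E> s --> A ~= sng j)))" for i
 have B: "A \<E> B i <-> A \<E> P & (A = sng i | (Q i A & (ALL j. j \<E> s --> A ~= sng j)))" for A i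
  unfolding B_def by (rule mem_Coll) (intro dps Q')
 have Bd: "dt (%e. B (e 0))" unfolding B_def by (intro dps Q')
 have BU: "B i \<E> U" if "i \<E> s" for i
 proof -
  have "most (%A. Q i A & sg A)" by (rule most_conj) (intro dps Q' sgd most[OF that] msg)+
  hence "most (%A. A = sng i | (Q i A & (ALL j. j \<E> s --> A ~= sng j)))"
  proof (rule most_mono)
   show "A = sng i | (Q i A & (ALL j. j \<E> s --> A ~= sng j))" if "Q i A & sg A" for A using that sg by blast
  qed (intro dps Q' sgd)+
  thus ?thesis by (simp add: most_def B_def)
 qed
 have "small (Img s B)"
 proof (rule small_Img[OF Bd _ s])
  fix i j assume ij: "i \<E> s" "j \<E> s" "B i = B j"
  have "sng i \<E> P" using P_iff[of "sng i"] sX[OF ij(1)] small_sng[of i] sng_iff by metis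
  hence "sng i \<E> B i" using B[of "sng i" i] by blast
  hence "sng i \<E> B j" unfolding ij(3) .
  hence "sng i = sng j" using B[of "sng i" j] ij(1) by blast
  thus "i = j" using sng_iff by metis
 qed
 moreover have "Sub (Img s B) U" using BU by (auto simp: Sub_iff mem_Img[OF Bd])
 moreover define I where "I = Coll P (%A. ALL b. b \<E> Img s B --> A \<E> b)"
 have I: "A \<E> I <-> A \<E> P & (ALL b. b \<E> Img s B --> A \<E> b)" for A unfolding I_def by (rule mem_Coll) (intro dps)
 ultimately have IU: "I \<E> U" using complete[unfolded Complete_def ball_UNIV, rule_format, of "Img s B" I] by (simp add: small_def)
 have Id: "dp (%e. e 0 \<E> I)" by (intro dps)
 have mI: "most (%A. A \<E> I)" by (rule mostI[OF Id IU])
 have "most (%A. A \<E> I & sg A)" by (rule most_conj[OF Id sgd[OF dt_var] mI msg])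
 thus ?thesis
 proof (rule most_mono)
  fix A assume A: "A \<E> P" "A \<E> I & sg A"
  show "ALL i. i \<E> s --> Q i A"
  proof (intro allI impI)
   fix i assume "i \<E> s"
   hence "B i \<E> Img s B" by (auto simp: mem_Img[OF Bd])
   hence "A \<E> B i" using A(2) I by blast
   thus "Q i A" using B sg A(2) by blast
  qed
 qed (intro dps sgd Q')+
qed

text \<open>An injection of \<open>z\<close> into an ordinal below \<open>kap\<close> reduces this
  to \<open>most_all_below\<close>.\<close>

lemma most_all:
 assumes Q: "dp (%e. Q (e 0) (e 1))" and z: "ssmall z" and most: "!!i. i \<E> z ==> most (Q i)"
 shows "most (%A. ALL i. i \<E> z --> Q i A)"
proof -
 note Q' = dp_rel2[OF Q]
 obtain s g where s: "s \<E> kap" and g: "inj_into g z s" using z by (auto simp: ssmall_def)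
 have "most (%A. ALL j. j \<E> s --> (ALL i. i \<E> z --> app g i = j --> Q i A))"
 proof (rule most_all_below[OF _ s])
  show "dp (%e. ALL i. i \<E> z --> app g i = e 0 --> Q i (e 1))" by (intro dps Q')
  fix j assume "j \<E> s"
  show "most (%A. ALL i. i \<E> z --> app g i = j --> Q i A)"
  proof (cases "EX i. i \<E> z & app g i = j")
   case True
   then obtain i where i: "i \<E> z" "app g i = j" by blast
   show ?thesis
   proof (rule most_mono[OF most[OF i(1)]])
    show "ALL i'. i' \<E> z --> app g i' = j --> Q i' A" if "Q i A" for A using that i g unfolding inj_into_def by metis
   qed (intro dps Q')+
  next
   case False
   show ?thesis
   proof (rule most_True)
    show "ALL i. i \<E> z --> app g i = j --> Q i A" for A using False by blast
   qed (intro dps Q')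
  qed
 qed
 thus ?thesis
 proof (rule most_mono)
  show "ALL i. i \<E> z --> Q i A" if "ALL j. j \<E> s --> (ALL i. i \<E> z --> app g i = j --> Q i A)" for A
   using that g unfolding inj_into_def by blast
 qed (intro dps Q')+
qed

text \<open>Normality concerns choice functions; choosing a witness for each \<open>A\<close> by AC
  turns it into this rule for quantifiers.\<close>

lemma most_normal:
 assumes Q: "dp (%e. Q (e 0) (e 1))" and most: "most (%A. EX x. x \<E> A & Q A x)"
 shows "EX x. x \<E> X & most (%A. Q A x)"
proof -
 note Q' = dp_rel2[OF Q]
 define B where "B = Coll P (%A. EX x. x \<E> A & Q A x)"
 have B: "A \<E> B <-> A \<E> P & (EX x. x \<E> A & Q A x)" for A unfolding B_def by (rule mem_Coll) (intro dps Q')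
 have "EX f. isfn f B & (ALL A. A \<E> B --> app f A \<E> X & (app f A \<E> A & Q A (app f A)))"
 proof (rule AC_fun)
  show "dp (%e. e 1 \<E> e 0 & Q (e 0) (e 1))" by (intro dps Q')
  show "EX x. x \<E> X & (x \<E> A & Q A x)" if "A \<E> B" for A using that B P_iff by blast
 qed
 then obtain f where f: "isfn f B" "!!A. A \<E> B ==> app f A \<E> X & app f A \<E> A & Q A (app f A)" by blast
 have "B \<E> U" using most by (simp add: most_def B_def)
 moreover have "opair A y \<E> f ==> y \<E> A" for A y using f isfn_opair[OF f(1)] by auto
 ultimately obtain D c where D: "D \<E> U" "!!A. A \<E> D ==> opair A c \<E> f" using normal f(1) unfolding Normal_def FunOn_isfn by blast
 have *: "A \<E> B & c = app f A" if "A \<E> D" for A using D(2)[OF that] isfn_opair[OF f(1)] by auto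
 have "most (%A. Q A c)"
 proof (rule mostI[OF _ D(1)])
  show "dp (%e. Q (e 0) c)" by (intro dps Q')
 qed (use * f(2) in blast)
 moreover have "EX A. A \<E> D" using uf_parts(3) D(1) by blast
 ultimately show ?thesis using * f(2) by blast
qed

text \<open>Closure under diagonal intersections: if almost every \<open>A\<close> contained a
  counterexample, normality would give one counterexample for almost all \<open>A\<close>.\<close>

lemma most_diag:
 assumes Q: "dp (%e. Q (e 0) (e 1))" and most: "!!x. x \<E> X ==> most (%A. Q A x)"
 shows "most (%A. ALL x. x \<E> A --> Q A x)"
proof (rule ccontr)
 note Q' = dp_rel2[OF Q]
 assume "~ ?thesis"
 hence "most (%A. ~(ALL x. x \<E> A --> Q A x))" by (rule most_not[rotated]) (intro dps Q')
 hence "most (%A. EX x. x \<E> A & ~Q A x)" by simp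
 moreover have "dp (%e. ~Q (e 0) (e 1))" by (intro dps Q')
 ultimately obtain x where x: "x \<E> X" "most (%A. ~Q A x)" using most_normal[of "%A x. ~Q A x"] by blast
 show False by (rule most_contra[OF _ most[OF x(1)] x(2)]) (intro dps Q')
qed

end

section \<open>The sets of hereditary size less than a supercompact cardinal\<close>

lemma (in zf) eqI2: "(!!z. z \<E> x ==> z \<E> y) ==> (!!z. z \<E> y ==> z \<E> x) ==> x = y" by (rule eqI) blast

locale supercompact = unc E kap for E :: "'m => 'm => bool" (infix "\<E>" 50) and kap +
 assumes sc: "SupercompactFor kap X"
begin

lemma ultra_exists: "EX P U. ultra E kap (cup X kap) P U"
proof -
 obtain P U where "IsP P kap (cup X kap) & UF U P & Fine U P (cup X kap) & Complete kap U P & Normal U"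
  using sc[of "cup X kap"] unfolding SupercompactFor_def by blast
 hence "ultra E kap (cup X kap) P U" by unfold_locales auto
 thus ?thesis by blast
qed

text \<open>Regularity of \<open>kap\<close>. By fineness and completeness almost every
  \<open>A\<close> contains the whole union, and each \<open>A\<close> is small.\<close>

lemma ssmall_union:
 assumes t: "ssmall t" and F: "dt (%e. F (e 0))" and Fs: "!!i. i \<E> t ==> ssmall (F i)"
 shows "ssmall (union (Img t F))"
proof -
 obtain P U where "ultra E kap (cup (union (Img t F)) kap) P U" using ultra_exists by blast
 then interpret u: ultra E kap "cup (union (Img t F)) kap" P U .
 note F' = dt_fun1[OF F]
 have X: "y \<E> cup (union (Img t F)) kap" if "i \<E> t" "y \<E> F i" for i y using that by (auto simp: mem_Img[OF F])
 have "u.most (%A. ALL i. i \<E> t --> (ALL y. y \<E> F i --> y \<E> A))"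
 proof (rule u.most_all[OF _ t])
  show "dp (%e. ALL y. y \<E> F (e 0) --> y \<E> e 1)" by (intro dps F')
  show "u.most (%A. ALL y. y \<E> F i --> y \<E> A)" if "i \<E> t" for i
  proof (rule u.most_all[OF _ Fs[OF that]])
   show "dp (%e. e 0 \<E> e 1)" by (intro dps)
  qed (rule u.most_fine[OF X[OF that]])
 qed
 moreover have "dp (%e. ALL i. i \<E> t --> (ALL y. y \<E> F i --> y \<E> e 0))" by (intro dps F')
 ultimately obtain A where A: "A \<E> P" "ALL i. i \<E> t --> (ALL y. y \<E> F i --> y \<E> A)"
  using u.most_ex[of "%A. ALL i. i \<E> t --> (ALL y. y \<E> F i --> y \<E> A)"] by blast
 have "ssmall A" using A(1) u.P_iff small_ssmall by blast
 thus ?thesis by (rule ssmall_sub) (use A(2) in "auto simp: mem_Img[OF F]")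
qed

text \<open>\<open>kap\<close> is a strong limit. If every \<open>A\<close> missed a subset
  \<open>f A\<close> of \<open>t\<close>, completeness over \<open>t\<close> would make
  \<open>f A\<close> equal to its majority \<open>b\<close> for almost all \<open>A\<close>, while
  fineness puts \<open>b\<close> into almost all \<open>A\<close>.\<close>

lemma ssmall_Pow:
 assumes t: "ssmall t"
 shows "ssmall (Pow t)"
proof -
 obtain P U where "ultra E kap (cup (Pow t) kap) P U" using ultra_exists by blast
 then interpret u: ultra E kap "cup (Pow t) kap" P U .
 have "EX A. A \<E> P & (ALL s. s \<E> Pow t --> s \<E> A)"
 proof (rule ccontr)
  assume no: "~ ?thesis"
  have "EX f. isfn f P & (ALL A. A \<E> P --> app f A \<E> Pow t & ~app f A \<E> A)"
  proof (rule AC_fun)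
   show "dp (%e. ~e 1 \<E> e 0)" by (intro dps)
   show "EX y. y \<E> Pow t & ~y \<E> A" if "A \<E> P" for A using no that by blast
  qed
  then obtain f where f: "!!A. A \<E> P ==> app f A \<E> Pow t" "!!A. A \<E> P ==> ~app f A \<E> A" by blast
  define b where "b = Coll t (%y. u.most (%A. y \<E> app f A))"
  have b: "y \<E> b <-> y \<E> t & u.most (%A. y \<E> app f A)" for y unfolding b_def by (rule mem_Coll) (intro dps u.dp_most)
  have d: "dp (%e. ALL y. y \<E> t --> (y \<E> app f (e 0) <-> y \<E> b))" by (intro dps)
  have 1: "u.most (%A. ALL y. y \<E> t --> (y \<E> app f A <-> y \<E> b))"
  proof (rule u.most_all[OF _ t])
   show "dp (%e. e 0 \<E> app f (e 1) <-> e 0 \<E> b)" by (intro dps)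
   fix y assume y: "y \<E> t"
   have dy: "dp (%e. y \<E> app f (e 0))" by (intro dps)
   show "u.most (%A. y \<E> app f A <-> y \<E> b)"
   proof (cases "y \<E> b")
    case True
    thus ?thesis using b by simp
   next
    case False
    thus ?thesis using u.most_not[OF dy] b y by simp
   qed
  qed
  have 2: "u.most (%A. b \<E> A)" by (rule u.most_fine) (use b in auto)
  have d2: "dp (%e. b \<E> e 0)" by (intro dps)
  obtain A where A: "A \<E> P" "ALL y. y \<E> t --> (y \<E> app f A <-> y \<E> b)" "b \<E> A"
   using u.most_ex[OF dp_and[OF d d2] u.most_conj[OF d d2 1 2]] by blast
  have "app f A = b" by (rule eqI) (use f(1)[OF A(1)] A(2) b in auto)
  thus False using f(2)[OF A(1)] A(3) by simp
 qed
 then obtain A where A: "A \<E> P" "ALL s. s \<E> Pow t --> s \<E> A" by blast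
 have "ssmall A" using A(1) u.P_iff small_ssmall by blast
 thus ?thesis by (rule ssmall_sub) (use A(2) in auto)
qed

definition hsmall where
 "hsmall x <-> (EX t. trans t & x \<E> t & ssmall t)"

lemma dp_hsmall [dps]: "dt f ==> dp (%e. hsmall (f e))" by (rule dp_rel1[of hsmall], unfold hsmall_def, intro dps)

text \<open>A member \<open>x\<close> of a transitive set \<open>t\<close> is determined by the image of \<open>(t, \<E>, x)\<close> under an
 injection of \<open>t\<close> into an ordinal; hence replacement makes the hereditarily small sets a set.\<close>

lemma hsmall_set: "EX h. ALL x. x \<E> h <-> hsmall x"
proof -
 define rel where "rel t g = Coll (prod kap kap)
  (%p. EX u v. u \<E> t & v \<E> t & u \<E> v & p = opair (app g u) (app g v))" for t g
 have rel: "p \<E> rel t g <-> p \<E> prod kap kap &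
   (EX u v. u \<E> t & v \<E> t & u \<E> v & p = opair (app g u) (app g v))" for p t g unfolding rel_def by (rule mem_Coll) (intro dps)
 have drel: "dt (%e. rel (f e) (g e))" if "dt f" "dt g" for f g by (rule dt_fun2[OF _ that, of rel], unfold rel_def, intro dps)
 have dapp: "dt (%e. app g (e 0))" for g by (intro dps)
 define W where "W t g <-> trans t & (EX a. a \<E> kap & inj_into g t a)" for t g
 have dW: "dp (%e. W (f e) (g e))" if "dt f" "dt g" for f g by (rule dp_rel2[OF _ that, of W], unfold W_def, intro dps)
 define R where "R c x <-> (EX t g. W t g & x \<E> t &
  c = opair (Img t (app g)) (opair (rel t g) (app g x)))" for c x
 have gk: "app g u \<E> kap" if "W t g" "u \<E> t" for t g u using that Ord_transD[OF Ord_kap] unfolding W_def inj_into_def by blast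
 have uniq: "x = x'" if h: "R c x" "R c x'" for c x x'
 proof -
  obtain t g t' g' where g: "W t g" "x \<E> t" "W t' g'" "x' \<E> t'"
   and eqs: "Img t (app g) = Img t' (app g')" "rel t g = rel t' g'" "app g x = app g' x'"
   using h unfolding R_def by auto
  have I: "(EX u. u \<E> t & y = app g u) <-> (EX u. u \<E> t' & y = app g' u)" for y
   using mem_Img[OF dapp, of y t] mem_Img[OF dapp, of y t'] eqs(1) by metis
  have inj: "u = v" if "u \<E> t" "v \<E> t" "app g u = app g v" for u v using g(1) that unfolding W_def inj_into_def by blast
  have inj': "u = v" if "u \<E> t'" "v \<E> t'" "app g' u = app g' v" for u v using g(3) that unfolding W_def inj_into_def by blast
  have E: "u \<E> v <-> u' \<E> v'"
   if h: "u \<E> t" "v \<E> t" "u' \<E> t'" "v' \<E> t'" "app g u = app g' u'" "app g v = app g' v'" for u v u' v'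
  proof -
   have "u \<E> v <-> opair (app g u) (app g v) \<E> rel t g" unfolding rel using h(1,2) inj gk[OF g(1)] by (auto, metis)
   moreover have "u' \<E> v' <-> opair (app g' u') (app g' v') \<E> rel t' g'"
    unfolding rel using h(3,4) inj' gk[OF g(3)] by (auto, metis)
   ultimately show ?thesis using h eqs(2) by simp
  qed
  have tr: "trans t" "trans t'" using g by (auto simp: W_def)
  \<comment> \<open>Equal codes induce an isomorphism of the transitive sets \<open>t\<close> and
    \<open>t'\<close>, and such an isomorphism is the identity.\<close>
  have "ALL x'. x' \<E> t' --> app g x = app g' x' --> x = x'" using tr(1) _ g(2)
  proof (rule trans_induct)
   show "dp (%e. ALL x'. x' \<E> t' --> app g (e 0) = app g' x' --> e 0 = x')" by (intro dps)
   fix v assume v: "v \<E> t"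
    and IH: "!!u. u \<E> v ==> ALL x'. x' \<E> t' --> app g u = app g' x' --> u = x'"
   show "ALL x'. x' \<E> t' --> app g v = app g' x' --> v = x'"
   proof (intro allI impI eqI2)
    fix v' u assume v': "v' \<E> t'" "app g v = app g' v'" and u: "u \<E> v"
    have ut: "u \<E> t" using tr(1) v u transD by blast
    then obtain u' where "u' \<E> t'" "app g u = app g' u'" using I by blast
    thus "u \<E> v'" using IH[OF u] E[OF ut v] v' u by blast
   next
    fix v' u' assume v': "v' \<E> t'" "app g v = app g' v'" and u': "u' \<E> v'"
    have ut: "u' \<E> t'" using tr(2) v' u' transD by blast
    then obtain u where u: "u \<E> t" "app g u = app g' u'" using I by metis
    hence "u \<E> v" using E[OF u(1) v ut v'(1) u(2) v'(2)] u' by simp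
    thus "u' \<E> v" using IH ut u by blast
   qed
  qed
  thus "x = x'" using g eqs by blast
 qed
 have "dp (%e. R (e 0) (e 1))" unfolding R_def by (intro dps dW drel)
 hence "EX h. ALL x. x \<E> h <-> (EX c. c \<E> prod (Pow kap) (prod (Pow (prod kap kap)) kap) & R c x)" by (rule repl_ax) (rule uniq)
 then obtain h where
  h0: "ALL x. x \<E> h <-> (EX c. c \<E> prod (Pow kap) (prod (Pow (prod kap kap)) kap) & R c x)" by (rule exE)
 note h = h0[rule_format]
 have "x \<E> h <-> hsmall x" for x
 proof
  assume "x \<E> h"
  thus "hsmall x" unfolding h R_def W_def hsmall_def ssmall_def by blast
 next
  assume "hsmall x"
  then obtain t g where tg: "W t g" "x \<E> t" unfolding W_def hsmall_def ssmall_def by blast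
  have "Img t (app g) \<E> Pow kap" using gk[OF tg(1)] by (auto simp: mem_Img[OF dapp])
  moreover have "rel t g \<E> Pow (prod kap kap)" using rel by simp
  ultimately have "opair (Img t (app g)) (opair (rel t g) (app g x)) \<E>
    prod (Pow kap) (prod (Pow (prod kap kap)) kap)" using gk[OF tg] by (simp only: opair_prod)
  moreover have "R (opair (Img t (app g)) (opair (rel t g) (app g x))) x" unfolding R_def using tg by blast
  ultimately show "x \<E> h" unfolding h by blast
 qed
 thus ?thesis by blast
qed

definition H :: 'm where "H = theset hsmall"

lemma H_iff: "x \<E> H <-> hsmall x" unfolding H_def by (rule mem_theset) (rule hsmall_set)

text \<open>These are Grothendieck universes containing omega: the last clause is replacement for
  arbitrary functions of the model, and pairs come from it (\<open>univ_upair\<close>).\<close>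

definition univ where
 "univ w <-> trans w & om \<E> w & (ALL x. x \<E> w --> Pow x \<E> w) & (ALL x. x \<E> w --> union x \<E> w) &
   (ALL x f. x \<E> w --> (ALL y. y \<E> x --> app f y \<E> w) --> Img x (app f) \<E> w)"

lemma dp_univ [dps]: "dt f ==> dp (%e. univ (f e))" by (rule dp_rel1[of univ], unfold univ_def, intro dps)

lemma trans_H: "trans H"
proof -
 have "y \<E> H" if h: "x \<E> H" "y \<E> x" for x y
 proof -
  obtain t where "trans t" "x \<E> t" "ssmall t" using h by (auto simp: H_iff hsmall_def)
  thus ?thesis using h transD[of t x y] unfolding H_iff hsmall_def by blast
 qed
 thus ?thesis unfolding trans_def by blast
qed

lemma ssmall_H: "x \<E> H ==> ssmall x"
proof -
 assume "x \<E> H"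
 then obtain t where "trans t" "x \<E> t" "ssmall t" by (auto simp: H_iff hsmall_def)
 thus "ssmall x" using ssmall_sub[of t x] transD[of t x] by blast
qed

lemma trans_ssmall_H: "trans t ==> ssmall t ==> t \<E> H"
proof -
 assume t: "trans t" "ssmall t"
 have "trans (Pow t)" unfolding trans_def using t(1) by (auto dest: transD)
 thus ?thesis unfolding H_iff hsmall_def using ssmall_Pow[OF t(2)] by (intro exI[of _ "Pow t"]) auto
qed

lemma univ_H: "univ H" unfolding univ_def
proof (intro conjI allI impI trans_H)
 have "trans om" "ssmall om" using Ord_om ssmall_in_kap[OF om(2)] by (auto simp: Ord_def)
 thus "om \<E> H" by (rule trans_ssmall_H)
next
 fix x assume "x \<E> H"
 then obtain t where t: "trans t" "x \<E> t" "ssmall t" by (auto simp: H_iff hsmall_def)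
 have "trans (Pow t)" unfolding trans_def using t(1) by (auto dest: transD)
 hence "trans (Pow (Pow t))" unfolding trans_def by (auto dest: transD)
 moreover have "Pow x \<E> Pow (Pow t)" using t(2) transD[OF t(1)] by auto
 ultimately show "Pow x \<E> H" unfolding H_iff hsmall_def using ssmall_Pow[OF ssmall_Pow[OF t(3)]] by blast
next
 fix x assume "x \<E> H"
 then obtain t where t: "trans t" "x \<E> t" "ssmall t" by (auto simp: H_iff hsmall_def)
 have "trans (Pow t)" unfolding trans_def using t(1) by (auto dest: transD)
 moreover have "union x \<E> Pow t" using t(2) transD[OF t(1)] by auto
 ultimately show "union x \<E> H" unfolding H_iff hsmall_def using ssmall_Pow[OF t(3)] by blast
next
 fix x f assume x: "x \<E> H" and f: "ALL y. y \<E> x --> app f y \<E> H"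
 have dapp: "dt (%e. app f (e 0))" for f by (intro dps)
 \<comment> \<open>A small transitive set around each value is chosen. Their union \<open>Y\<close>
   is small by regularity, and \<open>Pow Y\<close> shows that the image is hereditarily
   small.\<close>
 have "EX T. isfn T x & (ALL y. y \<E> x --> app T y \<E> Pow H &
   (trans (app T y) & app f y \<E> app T y & ssmall (app T y)))"
 proof (rule AC_fun)
  show "dp (%e. trans (e 1) & app f (e 0) \<E> e 1 & ssmall (e 1))" by (intro dps)
  fix y assume "y \<E> x"
  hence "hsmall (app f y)" using f H_iff by blast
  then obtain t where t: "trans t" "app f y \<E> t" "ssmall t" unfolding hsmall_def by blast
  have "z \<E> H" if "z \<E> t" for z unfolding H_iff hsmall_def using t that by blast
  thus "EX t. t \<E> Pow H & trans t & app f y \<E> t & ssmall t" using t by (intro exI[of _ t]) auto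
 qed
 then obtain T where T: "!!y. y \<E> x ==> trans (app T y) & app f y \<E> app T y & ssmall (app T y)" by blast
 define Y where "Y = union (Img x (app T))"
 have "ssmall Y" unfolding Y_def by (rule ssmall_union[OF ssmall_H[OF x] dapp]) (use T in blast)
 moreover have Y: "z \<E> Y <-> (EX y. y \<E> x & z \<E> app T y)" for z unfolding Y_def by (auto simp: mem_Img[OF dapp])
 hence "trans Y" unfolding trans_def using T by (meson transD)
 ultimately have "trans (Pow Y)" "ssmall (Pow Y)" unfolding trans_def using ssmall_Pow by (auto dest: transD)
 moreover have "Img x (app f) \<E> Pow Y" using Y T by (auto simp: mem_Img[OF dapp])
 ultimately show "Img x (app f) \<E> H" unfolding H_iff hsmall_def by blast
qed

lemma kap_H: "a \<E> kap ==> a \<E> H"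
proof (rule trans_ssmall_H)
 assume "a \<E> kap"
 thus "trans a" "ssmall a" using Ord_in[OF Ord_kap] ssmall_in_kap by (auto simp: Ord_def)
qed

lemma (in zf) opair_trans: "trans w ==> opair x y \<E> w ==> x \<E> w & y \<E> w"
proof -
 assume w: "trans w" "opair x y \<E> w"
 have "upair x y \<E> opair x y" by (simp add: opair_def)
 hence "upair x y \<E> w" using transD[OF w] by blast
 thus ?thesis using transD[OF w(1), of "upair x y"] by simp
qed

context
 fixes w assumes w: "univ w"
begin

lemma univ_trans: "trans w" and univ_om: "om \<E> w" and univ_Pow: "x \<E> w ==> Pow x \<E> w"
 and univ_union: "x \<E> w ==> union x \<E> w"
 and univ_Img: "x \<E> w ==> (!!y. y \<E> x ==> app f y \<E> w) ==> Img x (app f) \<E> w"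
 using w by (auto simp: univ_def)

lemma univ_in: "x \<E> w ==> y \<E> x ==> y \<E> w" using univ_trans transD by blast

lemma univ_sub: "x \<E> w ==> (!!z. z \<E> y ==> z \<E> x) ==> y \<E> w" using univ_in[OF univ_Pow, of x y] by simp

lemma univ_repl:
 assumes F: "dt (%e. F (e 0))" and x: "x \<E> w" "!!y. y \<E> x ==> F y \<E> w"
 shows "Img x F \<E> w"
proof -
 have d: "dt (%e. app (lam x F) (e 0))" by (intro dps)
 have "Img x (app (lam x F)) \<E> w" by (rule univ_Img) (use x app_lam[OF F] in auto)
 moreover have "Img x (app (lam x F)) = Img x F" by (rule eqI) (auto simp: mem_Img[OF d] mem_Img[OF F] app_lam[OF F])
 ultimately show ?thesis by simp
qed

lemma univ_upair: "x \<E> w ==> y \<E> w ==> upair x y \<E> w"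
proof -
 assume xy: "x \<E> w" "y \<E> w"
 \<comment> \<open>Power sets alone provide a set with exactly two elements, \<open>emp\<close> and
   \<open>Pow emp\<close>; replacing them by \<open>x\<close> and \<open>y\<close> gives the
   pair.\<close>
 define F where "F z = union (Coll (upair x y) (%u. (z = emp & u = x) | (z ~= emp & u = y)))" for z
 have F: "dt (%e. F (e 0))" unfolding F_def by (intro dps)
 have c: "u \<E> Coll (upair x y) (%u. (z = emp & u = x) | (z ~= emp & u = y)) <->
   (z = emp & u = x) | (z ~= emp & u = y)" for z u by (subst mem_Coll) (intro dps, auto)
 have F1: "F emp = x" unfolding F_def by (rule eqI) (simp only: union_iff c, blast)
 have F2: "F z = y" if "z ~= emp" for z unfolding F_def by (rule eqI) (simp only: union_iff c, use that in blast)
 have "emp \<E> w" by (rule univ_sub[OF xy(1)]) simp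
 hence 1: "Pow (Pow emp) \<E> w" using univ_Pow by blast
 have "Img (Pow (Pow emp)) F \<E> w" by (rule univ_repl[OF F 1]) (use F1 F2 xy in metis)
 moreover have "upair x y = Img (Pow (Pow emp)) F"
 proof (rule eqI2)
  have "Pow emp ~= emp" using emp_iff Pow_iff by metis
  moreover have "emp \<E> Pow (Pow emp)" "Pow emp \<E> Pow (Pow emp)" by simp_all
  ultimately show "z \<E> Img (Pow (Pow emp)) F" if "z \<E> upair x y" for z using that F1 F2 unfolding mem_Img[OF F] upair_iff by metis
  show "z \<E> upair x y" if "z \<E> Img (Pow (Pow emp)) F" for z using that F1 F2 unfolding mem_Img[OF F] upair_iff by metis
 qed
 ultimately show ?thesis by simp
qed

lemma univ_opair [simp]: "opair x y \<E> w <-> x \<E> w & y \<E> w"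
proof
 show "opair x y \<E> w ==> x \<E> w & y \<E> w" by (rule opair_trans[OF univ_trans])
 show "x \<E> w & y \<E> w ==> opair x y \<E> w" unfolding opair_def by (intro univ_upair) auto
qed

end

subsection \<open>Reflection\<close>

definition subs where
 "subs w = {x. ALL z. z \<E> x --> z \<E> w}"

definition cut where
 "cut w x = Coll x (%z. z \<E> w)"

lemma cut_iff [simp]: "z \<E> cut w x <-> z \<E> x & z \<E> w" unfolding cut_def by (rule mem_Coll) (intro dps)

lemma dt_cut [dps]: "dt f ==> dt g ==> dt (%e. cut (f e) (g e))" by (rule dt_fun2[of cut], unfold cut_def, intro dps)

lemma cut_sub: "(!!z. z \<E> x ==> z \<E> w) ==> cut w x = x" by (rule eqI) auto

lemma subs_Pow: "subs w = {x. x \<E> Pow w}" by (simp add: subs_def)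

text \<open>Three varying slots for a condition and two names, three parameters for the forcing
  notion, a class and a spare.\<close>

definition env6 :: "'m => 'm => 'm => 'm => 'm => 'm => nat => 'm" where
 "env6 x y z a b c =
   case_nat x (case_nat y (case_nat z (case_nat a (case_nat b (case_nat c (%_. emp))))))"

lemma env6_comp: "f o env6 x y z a b c =
  case_nat (f x) (case_nat (f y) (case_nat (f z) (case_nat (f a) (case_nat (f b) (case_nat (f c) (%_. f emp))))))"
proof -
 have *: "f o case_nat x e = case_nat (f x) (f o e)" for f :: "'m => 'c" and x e by (rule HOL.ext) (simp split: nat.split)
 show ?thesis unfolding env6_def * by (simp add: comp_def)
qed

lemma env6_in:
 assumes "x : C" "y : C" "z : C" "a : C" "b : C" "c : C" "emp : C"
 shows "range (env6 x y z a b c) <= C"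
proof -
 have *: "range (case_nat x e) <= C" if "x : C" "range e <= C" for x e using that by (fastforce split: nat.splits)
 show ?thesis unfolding env6_def by (intro * assms) (use assms in simp)
qed

lemma dt_env6:
 assumes "dt x" "dt y" "dt z" "dt a" "dt b" "dt c"
 shows "dt (%e. env6 (x e) (y e) (z e) (a e) (b e) (c e) i)"
proof -
 have *: "dt (%e. case_nat (x e) (g e) i)" if "dt x" "!!i. dt (%e. g e i)" for x g i using that by (cases i) simp_all
 show ?thesis unfolding env6_def by (intro * assms dt_const')
qed

lemma dp_sat_env6:
 assumes "dt f" "dt x" "dt y" "dt z" "dt a" "dt b" "dt c"
 shows "dp (%e. sat {u. u \<E> f e} E p (env6 (x e) (y e) (z e) (a e) (b e) (c e)))"
 using dp_sat[OF assms(1), of "%i e. env6 (x e) (y e) (z e) (a e) (b e) (c e) i" p]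
  dt_env6[OF assms(2-)] by simp

end

context ultra
begin

lemma dp_sat_const: "dt f ==> dp (%e'. sat {x. x \<E> f e'} E p e)" by (rule dp_sat[of f "%i _. e i"]) (simp_all add: dt_const')

text \<open>Almost every \<open>A\<close> is elementary in \<open>X\<close> for the given formula:
  the diagonal intersection handles true universal statements, and fineness puts a counterexample to
  a false one into \<open>A\<close>.\<close>

lemma most_sat:
 assumes "!!i. e i \<E> X"
 shows "most (%A. sat {x. x \<E> A} E p e <-> sat {x. x \<E> X} E p e)" using assms
proof (induction p arbitrary: e)
 case (Implies p q)
 have d: "dp (%e'. sat {x. x \<E> e' 0} E p e <-> sat {x. x \<E> X} E p e)" for p by (rule dp_iff; rule dp_sat_const; intro dps)
 show ?case
 proof (rule most_mono[OF most_conj[OF d d Implies.IH(1)[OF Implies.prems] Implies.IH(2)[OF Implies.prems]] dp_and[OF d d] d])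
  fix A
  assume "(sat {x. x \<E> A} E p e <-> sat {x. x \<E> X} E p e) & (sat {x. x \<E> A} E q e <-> sat {x. x \<E> X} E q e)"
  thus "sat {x. x \<E> A} E (Implies p q) e <-> sat {x. x \<E> X} E (Implies p q) e" by simp
 qed
next
 case (Forall p)
 define Q where "Q A x <-> (sat {x. x \<E> A} E p (case_nat x e) <-> sat {x. x \<E> X} E p (case_nat x e))"
  for A x
 have d: "dp (%e'. sat {x. x \<E> f e'} E p (case_nat (g e') e))" if "dt f" "dt g" for f g
 proof -
  have "dp (%e'. sat {x. x \<E> f e'} E p (%i. case_nat (g e') e i))"
  proof (rule dp_sat[OF that(1)])
   show "dt (%e'. case_nat (g e') e i)" for i by (cases i) (simp_all add: that dt_const')
  qed
  thus ?thesis by simp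
 qed
 have Qd: "dp (%e. Q (f e) (g e))" if "dt f" "dt g" for f g unfolding Q_def by (intro dps d that)
 have 1: "most (%A. ALL x. x \<E> A --> Q A x)"
 proof (rule most_diag)
  show "dp (%e. Q (e 0) (e 1))" by (intro dps Qd)
  show "most (%A. Q A x)" if "x \<E> X" for x unfolding Q_def by (rule Forall.IH) (use that Forall.prems in "auto split: nat.split")
 qed
 have d1: "dp (%e. ALL x. x \<E> e 0 --> Q (e 0) x)" by (intro dps Qd)
 have d3: "dp (%e'. sat {x. x \<E> e' 0} E (Forall p) e <-> sat {x. x \<E> X} E (Forall p) e)"
  by (rule dp_iff; rule dp_sat_const; intro dps)
 show ?case
 proof (cases "sat {x. x \<E> X} E (Forall p) e")
  case True
  show ?thesis
  proof (rule most_mono[OF 1 d1 d3])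
   fix A assume A: "A \<E> P" "ALL x. x \<E> A --> Q A x"
   hence "sat {x. x \<E> A} E (Forall p) e" using True P_iff unfolding Q_def by auto
   thus "sat {x. x \<E> A} E (Forall p) e <-> sat {x. x \<E> X} E (Forall p) e" using True by blast
  qed
 next
  case False
  then obtain x where x: "x \<E> X" "~sat {x. x \<E> X} E p (case_nat x e)" by auto
  have d2: "dp (%e. x \<E> e 0)" by (intro dps)
  show ?thesis
  proof (rule most_mono[OF most_conj[OF d1 d2 1 most_fine[OF x(1)]] dp_and[OF d1 d2] d3])
   fix A assume A: "A \<E> P" "(ALL x. x \<E> A --> Q A x) & x \<E> A"
   hence "~sat {x. x \<E> A} E p (case_nat x e)" using x unfolding Q_def by blast
   hence "~sat {x. x \<E> A} E (Forall p) e" using A by auto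
   thus "sat {x. x \<E> A} E (Forall p) e <-> sat {x. x \<E> X} E (Forall p) e" using False by blast
  qed
 qed
qed (simp_all add: most_True dp_const)

lemma most_finite:
 assumes "finite \<Q>" "!!Q. Q : \<Q> ==> dp (%e. Q (e 0)) & most Q"
 shows "EX A. A \<E> P & (ALL Q:\<Q>. Q A)"
proof -
 have "dp (%e. ALL Q:\<Q>. Q (e 0)) & most (%A. ALL Q:\<Q>. Q A)" using assms
 proof (induction \<Q>)
  case empty
  thus ?case by (simp add: most_True dp_const)
 next
  case (insert Q \<Q>)
  hence "dp (%e. ALL Q:\<Q>. Q (e 0)) & most (%A. ALL Q:\<Q>. Q A)" by blast
  moreover have "dp (%e. Q (e 0)) & most Q" using insert.prems by blast
  ultimately show ?case using most_conj[of Q] dp_and by auto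
 qed
 thus ?thesis using most_ex[of "%A. ALL Q:\<Q>. Q A"] by blast
qed

lemma most_diag2:
 assumes Q: "dp (%e. Q (e 0) (e 1) (e 2))"
  and most: "!!x y. x \<E> X ==> y \<E> X ==> most (%A. Q A x y)"
 shows "most (%A. ALL x. x \<E> A --> (ALL y. y \<E> A --> Q A x y))"
proof (rule most_diag)
 note Q' = dp_rel3[OF Q]
 show "dp (%e. ALL y. y \<E> e 0 --> Q (e 0) (e 1) y)" by (intro dps Q')
 fix x assume x: "x \<E> X"
 show "most (%A. ALL y. y \<E> A --> Q A x y)" by (rule most_diag, intro dps Q') (rule most[OF x])
qed

lemma most_const: "x \<E> X ==> dp (%e. x \<E> e 0) & most (%A. x \<E> A)" by (rule conjI, intro dps) (rule most_fine)

end

context supercompact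
begin

text \<open>For almost every \<open>A\<close> in \<open>P_kap(Pow H)\<close>, the set
  \<open>T\<close> of those elements of \<open>A\<close> that lie in \<open>H\<close> is a universe,
  and restriction to \<open>T\<close> is an isomorphism of \<open>A\<close> onto all subsets of
  \<open>T\<close>; \<open>ev\<close> is its inverse. That every subset of \<open>T\<close> is
  reached, property \<open>m2\<close>, is what elementarity alone would not give.\<close>

theorem reflection:
 assumes \<Phi>: "finite \<Phi>" and c: "c0 : subs H" "c1 : subs H" "c2 : subs H" and x0: "x0 \<E> H"
 shows "EX T ev. T \<E> H & univ T & x0 \<E> T & isfn ev (Pow T) & (ALL b:subs T. app ev b : subs H) &
  (ALL x. x \<E> T --> app ev x = x) &
  app ev (cut T c0) = c0 & app ev (cut T c1) = c1 & app ev (cut T c2) = c2 &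
  (ALL p:\<Phi>. ALL x:subs T. ALL y:subs T. ALL z:subs T.
    sat (subs T) E p (env6 x y z (cut T c0) (cut T c1) (cut T c2)) <->
    sat (subs H) E p (env6 (app ev x) (app ev y) (app ev z) c0 c1 c2))"
proof -
 have "cup (Pow H) kap = Pow H" by (rule eqI) (use kap_H trans_H in "auto dest: transD")
 then obtain P U where "ultra E kap (Pow H) P U" using ultra_exists[of "Pow H"] by auto
 then interpret u: ultra E kap "Pow H" P U .
 have HX: "x \<E> Pow H" if "x \<E> H" for x using that trans_H by (auto dest: transD)
 have cX: "c0 \<E> Pow H" "c1 \<E> Pow H" "c2 \<E> Pow H" using c by (auto simp: subs_def)
 \<comment> \<open>Transitivity of \<open>T\<close>: an element of \<open>H\<close> is small, so
   completeness puts all its members into almost every \<open>A\<close>.\<close>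
 define m1 where "m1 A <-> (ALL x. x \<E> A --> x \<E> H --> (ALL y. y \<E> x --> y \<E> A))" for A
 have m1: "dp (%e. m1 (e 0)) & u.most m1"
 proof
  show "dp (%e. m1 (e 0))" unfolding m1_def by (intro dps)
  have "u.most (%A. ALL x. x \<E> A --> x \<E> H --> (ALL y. y \<E> x --> y \<E> A))"
  proof (rule u.most_diag)
   show "dp (%e. e 1 \<E> H --> (ALL y. y \<E> e 1 --> y \<E> e 0))" by (intro dps)
   fix x
   have d: "dp (%e. x \<E> H --> (ALL y. y \<E> x --> y \<E> e 0))" by (intro dps)
   show "u.most (%A. x \<E> H --> (ALL y. y \<E> x --> y \<E> A))"
   proof (cases "x \<E> H")
    case True
    have "u.most (%A. ALL y. y \<E> x --> y \<E> A)"
    proof (rule u.most_all[OF _ ssmall_H[OF True]])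
     show "dp (%e. e 0 \<E> e 1)" by (intro dps)
     show "u.most (%A. y \<E> A)" if "y \<E> x" for y by (rule u.most_fine, rule HX) (use that True trans_H transD in blast)
    qed
    thus ?thesis using True by simp
   next
    case False
    thus ?thesis by (intro u.most_True d) simp
   qed
  qed
  thus "u.most m1" by (simp add: m1_def[abs_def])
 qed
 \<comment> \<open>If this fails almost always, choose a subset \<open>f A\<close> that no member of
   \<open>A\<close> traces and let \<open>b\<close> be the majority of these sets. Almost every
   \<open>A\<close> contains \<open>b\<close>, so \<open>b\<close> and \<open>f A\<close> differ at
   a point of \<open>A\<close>, and by normality at one fixed point for almost all \<open>A\<close>.
   This contradicts the choice of \<open>b\<close>.\<close>
 define m2 where "m2 A <-> (ALL b. (ALL z. z \<E> b --> z \<E> A & z \<E> H) -->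
  (EX a. a \<E> A & (ALL z. z \<E> A --> z \<E> H --> (z \<E> a <-> z \<E> b))))" for A
 have m2: "dp (%e. m2 (e 0)) & u.most m2"
 proof
  show d: "dp (%e. m2 (e 0))" unfolding m2_def by (intro dps)
  show "u.most m2"
  proof (rule ccontr)
   assume "~u.most m2"
   hence n: "u.most (%A. ~m2 A)" by (rule u.most_not[OF d])
   define D where "D = Coll P (%A. ~m2 A)"
   have D: "A \<E> D <-> A \<E> P & ~m2 A" for A unfolding D_def by (rule mem_Coll[OF dp_not[OF d]])
   define R where "R A b <-> (ALL z. z \<E> b --> z \<E> A & z \<E> H) &
    ~(EX a. a \<E> A & (ALL z. z \<E> A --> z \<E> H --> (z \<E> a <-> z \<E> b)))" for A b
   have "EX f. isfn f D & (ALL A. A \<E> D --> app f A \<E> Pow H & R A (app f A))"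
   proof (rule AC_fun)
    show "dp (%e. R (e 0) (e 1))" unfolding R_def by (intro dps)
    show "EX b. b \<E> Pow H & R A b" if "A \<E> D" for A using that unfolding D m2_def R_def Pow_iff by blast
   qed
   then obtain f where f: "!!A. A \<E> D ==> R A (app f A)" by blast
   define b where "b = Coll H (%x. u.most (%A. x \<E> app f A))"
   have b: "x \<E> b <-> x \<E> H & u.most (%A. x \<E> app f A)" for x unfolding b_def by (rule mem_Coll) (intro dps u.dp_most)
   have bX: "b \<E> Pow H" using b by simp
   define Q where "Q A x <-> x \<E> H & (x \<E> app f A <-> ~x \<E> b)" for A x
   have Qd: "dp (%e. Q (g e) (h e))" if "dt g" "dt h" for g h unfolding Q_def by (intro dps that)
   have d2: "dp (%e. b \<E> e 0)" by (intro dps)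
   have "u.most (%A. EX x. x \<E> A & Q A x)"
   proof (rule u.most_mono[OF u.most_conj[OF dp_not[OF d] d2 n u.most_fine[OF bX]] dp_and[OF dp_not[OF d] d2]])
    fix A assume A: "A \<E> P" "~m2 A & b \<E> A"
    hence "R A (app f A)" using f D by blast
    thus "EX x. x \<E> A & Q A x" using A(2) unfolding R_def Q_def by blast
   qed (intro dps Qd)
   moreover have "dp (%e. Q (e 0) (e 1))" by (intro dps Qd)
   ultimately obtain x where x: "u.most (%A. Q A x)" using u.most_normal[of Q] by blast
   have dx: "dp (%e. x \<E> app f (e 0))" by (intro dps)
   have dQx: "dp (%e. Q (e 0) x)" by (intro dps Qd)
   have xH: "x \<E> H" using u.most_ex[OF dQx x] by (auto simp: Q_def)
   show False
   proof (cases "x \<E> b")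
    case True
    have "u.most (%A. ~x \<E> app f A)" by (rule u.most_mono[OF x dQx dp_not[OF dx]]) (use True in "auto simp: Q_def")
    thus False using u.most_contra[OF dx] True b by blast
   next
    case False
    have "u.most (%A. x \<E> app f A)" by (rule u.most_mono[OF x dQx dx]) (use False in "auto simp: Q_def")
    thus False using False b xH by blast
   qed
  qed
 qed
 \<comment> \<open>Makes restriction to \<open>T\<close> injective on \<open>A\<close>.\<close>
 define m3 where "m3 A <-> (ALL x. x \<E> A --> (ALL y. y \<E> A --> x ~= y -->
  (EX z. z \<E> A & z \<E> H & (z \<E> x <-> ~z \<E> y))))" for A
 have m3: "dp (%e. m3 (e 0)) & u.most m3"
 proof
  show "dp (%e. m3 (e 0))" unfolding m3_def by (intro dps)
  have "u.most (%A. ALL x. x \<E> A --> (ALL y. y \<E> A --> x ~= y -->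
   (EX z. z \<E> A & z \<E> H & (z \<E> x <-> ~z \<E> y))))"
  proof (rule u.most_diag2)
   show "dp (%e. e 1 ~= e 2 --> (EX z. z \<E> e 0 & z \<E> H & (z \<E> e 1 <-> ~z \<E> e 2)))" by (intro dps)
   fix x y assume xy: "x \<E> Pow H" "y \<E> Pow H"
   have d: "dp (%e. x ~= y --> (EX z. z \<E> e 0 & z \<E> H & (z \<E> x <-> ~z \<E> y)))" by (intro dps)
   show "u.most (%A. x ~= y --> (EX z. z \<E> A & z \<E> H & (z \<E> x <-> ~z \<E> y)))"
   proof (cases "x = y")
    case True
    thus ?thesis by (intro u.most_True d) simp
   next
    case False
    then obtain z where z: "z \<E> x <-> ~z \<E> y" using eqI by blast
    hence "z \<E> H" using xy by auto
    thus ?thesis using u.most_mono[OF u.most_fine[OF HX], of z, OF _ _ d] z u.most_const[OF HX] by blast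
   qed
  qed
  thus "u.most m3" by (simp add: m3_def[abs_def])
 qed
 define m4 where "m4 A <-> (ALL x. x \<E> A --> (ALL y. y \<E> A --> x \<E> H --> y \<E> H --> Pow x \<E> A & upair x y \<E> A & union x \<E> A))" for A
 have upH: "upair x y \<E> H" if xy: "x \<E> H" "y \<E> H" for x y by (rule univ_upair[OF univ_H xy])
 have m4: "dp (%e. m4 (e 0)) & u.most m4"
 proof
  show "dp (%e. m4 (e 0))" unfolding m4_def by (intro dps)
  have "u.most (%A. ALL x. x \<E> A --> (ALL y. y \<E> A --> x \<E> H --> y \<E> H --> Pow x \<E> A & upair x y \<E> A & union x \<E> A))"
  proof (rule u.most_diag2)
   show "dp (%e. e 1 \<E> H --> e 2 \<E> H --> Pow (e 1) \<E> e 0 & upair (e 1) (e 2) \<E> e 0 & union (e 1) \<E> e 0)" by (intro dps)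
   fix x y
   have d: "dp (%e. x \<E> H --> y \<E> H --> Pow x \<E> e 0 & upair x y \<E> e 0 & union x \<E> e 0)" by (intro dps)
   have d1: "dp (%e. Pow x \<E> e 0)" and d2: "dp (%e. upair x y \<E> e 0)" and d3: "dp (%e. union x \<E> e 0)" by (intro dps)+
   show "u.most (%A. x \<E> H --> y \<E> H --> Pow x \<E> A & upair x y \<E> A & union x \<E> A)"
   proof (cases "x \<E> H & y \<E> H")
    case True
    hence "Pow x \<E> H" "upair x y \<E> H" "union x \<E> H" using univ_H upH by (auto simp: univ_def)
    hence "u.most (%A. Pow x \<E> A & upair x y \<E> A & union x \<E> A)" by (intro u.most_conj dps u.most_fine[OF HX])
    thus ?thesis using True by simp
   next
    case False
    thus ?thesis by (intro u.most_True d) auto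
   qed
  qed
  thus "u.most m4" by (simp add: m4_def[abs_def])
 qed
 \<comment> \<open>Closure of \<open>T\<close> under replacement. If \<open>a\<close> is no function
   on \<open>x\<close>, the failure is visible inside \<open>A\<close>; when the trace of
   \<open>a\<close> on \<open>T\<close> is a function on \<open>x\<close>, only the first
   alternative remains.\<close>
 define Q5 where "Q5 A a x <-> (x \<E> H -->
   (Img x (app a) \<E> A & (ALL y. y \<E> x --> (EX! z. opair y z \<E> a))) | (EX y. y \<E> x & ~(EX z. opair y z \<E> a)) |
   (EX y z z'. y \<E> x & z \<E> A & z' \<E> A & z \<E> H & z' \<E> H & z ~= z' & opair y z \<E> a & opair y z' \<E> a))"
  for A a x
 have Q5d: "dp (%e. Q5 (f e) (g e) (h e))" if "dt f" "dt g" "dt h" for f g h by (rule dp_rel3[OF _ that, of Q5], unfold Q5_def, intro dps)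
 define m5 where "m5 A <-> (ALL a. a \<E> A --> (ALL x. x \<E> A --> Q5 A a x))" for A
 have m5: "dp (%e. m5 (e 0)) & u.most m5"
 proof
  show "dp (%e. m5 (e 0))" unfolding m5_def by (intro dps Q5d)
  have "u.most (%A. ALL a. a \<E> A --> (ALL x. x \<E> A --> Q5 A a x))"
  proof (rule u.most_diag2)
   show "dp (%e. Q5 (e 0) (e 1) (e 2))" by (intro dps Q5d)
   fix a x assume ax: "a \<E> Pow H" "x \<E> Pow H"
   have d: "dp (%e. Q5 (e 0) a x)" by (intro dps Q5d)
   consider "~x \<E> H | (EX y. y \<E> x & ~(EX z. opair y z \<E> a))"
    | "x \<E> H" "ALL y. y \<E> x --> (EX! z. opair y z \<E> a)"
    | y z z' where "y \<E> x" "z ~= z'" "opair y z \<E> a" "opair y z' \<E> a" by blast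
   thus "u.most (%A. Q5 A a x)"
   proof cases
    case 1
    show ?thesis
    proof (rule u.most_True[OF _ d])
     fix A show "Q5 A a x" unfolding Q5_def using 1 by blast
    qed
   next
    case 2
    have "app f y \<E> H" if "y \<E> x" "f = a" for y f
    proof -
     obtain z where z: "opair y z' \<E> a <-> z' = z" for z' using 2(2) \<open>y \<E> x\<close> by blast
     hence "app a y = z" by (rule app_eq)
     moreover have "opair y z \<E> H" using z ax(1) by simp
     hence "z \<E> H" using opair_trans[OF trans_H] by blast
     ultimately show ?thesis using that by simp
    qed
    hence "Img x (app a) \<E> H" using univ_H 2(1) unfolding univ_def by blast
    from u.most_fine[OF HX[OF this]] show ?thesis
    proof (rule u.most_mono)
     fix A assume "Img x (app a) \<E> A" thus "Q5 A a x" unfolding Q5_def using 2 by blast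
    qed (intro dps d)+
   next
    case 3
    have zH: "z \<E> H" "z' \<E> H" using 3 ax(1) opair_trans[OF trans_H] by (meson Pow_iff)+
    have d1: "dp (%e. z \<E> e 0)" and d2: "dp (%e. z' \<E> e 0)" by (intro dps)+
    from u.most_conj[OF d1 d2 u.most_fine[OF HX[OF zH(1)]] u.most_fine[OF HX[OF zH(2)]]]
    show ?thesis
    proof (rule u.most_mono)
     fix A assume "z \<E> A & z' \<E> A" thus "Q5 A a x" unfolding Q5_def using 3 zH by blast
    qed (intro dps d)+
   qed
  qed
  thus "u.most m5" by (simp add: m5_def[abs_def])
 qed
 define m6 where "m6 p A <-> (ALL x. x \<E> A --> (ALL y. y \<E> A --> (ALL z. z \<E> A -->
  (sat {u. u \<E> A} E p (env6 x y z c0 c1 c2) <-> sat {u. u \<E> Pow H} E p (env6 x y z c0 c1 c2)))))" for p A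
 have m6: "dp (%e. m6 p (e 0)) & u.most (m6 p)" for p
 proof
  show "dp (%e. m6 p (e 0))" unfolding m6_def by (intro dps dp_sat_env6)
  have "u.most (%A. ALL x. x \<E> A --> (ALL y. y \<E> A --> (ALL z. z \<E> A -->
   (sat {u. u \<E> A} E p (env6 x y z c0 c1 c2) <-> sat {u. u \<E> Pow H} E p (env6 x y z c0 c1 c2)))))"
  proof (rule u.most_diag2)
   show "dp (%e. ALL z. z \<E> e 0 --> (sat {u. u \<E> e 0} E p (env6 (e 1) (e 2) z c0 c1 c2) <->
     sat {u. u \<E> Pow H} E p (env6 (e 1) (e 2) z c0 c1 c2)))" by (intro dps dp_sat_env6)
   fix x y assume xy: "x \<E> Pow H" "y \<E> Pow H"
   show "u.most (%A. ALL z. z \<E> A --> (sat {u. u \<E> A} E p (env6 x y z c0 c1 c2) <->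
     sat {u. u \<E> Pow H} E p (env6 x y z c0 c1 c2)))"
   proof (rule u.most_diag)
    show "dp (%e. sat {u. u \<E> e 0} E p (env6 x y (e 1) c0 c1 c2) <->
     sat {u. u \<E> Pow H} E p (env6 x y (e 1) c0 c1 c2))" by (intro dps dp_sat_env6)
    fix z assume z: "z \<E> Pow H"
    have "emp \<E> Pow H" by simp
    hence "range (env6 x y z c0 c1 c2) <= {u. u \<E> Pow H}" using xy z cX by (intro env6_in) auto
    thus "u.most (%A. sat {u. u \<E> A} E p (env6 x y z c0 c1 c2) <->
     sat {u. u \<E> Pow H} E p (env6 x y z c0 c1 c2))" by (intro u.most_sat) blast
   qed
  qed
  thus "u.most (m6 p)" by (simp add: m6_def[abs_def])
 qed
 have omH: "om \<E> H" using univ_H by (simp add: univ_def)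
 define \<Q> where "\<Q> = {m1, m2, m3, m4, m5, %A. x0 \<E> A, %A. om \<E> A, %A. emp \<E> A, %A. c0 \<E> A, %A. c1 \<E> A, %A. c2 \<E> A} Un m6 ` \<Phi>"
 have "EX A. A \<E> P & (ALL Q:\<Q>. Q A)"
 proof (rule u.most_finite)
  show "finite \<Q>" unfolding \<Q>_def using \<Phi> by simp
  have "emp \<E> Pow H" by simp
  thus "dp (%e. Q (e 0)) & u.most Q" if "Q : \<Q>" for Q
   using that m1 m2 m3 m4 m5 m6 u.most_const cX HX[OF x0] HX[OF omH] unfolding \<Q>_def by blast
 qed
 then obtain A where AP: "A \<E> P" and AQ: "m1 A" "m2 A" "m3 A" "m4 A" "m5 A" "!!p. p : \<Phi> ==> m6 p A"
  and Ax: "x0 \<E> A" "om \<E> A" "emp \<E> A" "c0 \<E> A" "c1 \<E> A" "c2 \<E> A"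
  unfolding \<Q>_def by auto
 define T where "T = cut H A"
 have T: "z \<E> T <-> z \<E> A & z \<E> H" for z unfolding T_def by auto
 have trT: "trans T" unfolding trans_def T using AQ(1) trans_H unfolding m1_def by (meson transD)
 have "ssmall T" using AP u.P_iff small_ssmall ssmall_sub[of A T] T by blast
 hence TH: "T \<E> H" using trT trans_ssmall_H by blast
 have AX: "a \<E> Pow H" if "a \<E> A" for a using AP u.P_iff that by blast
 have full: "EX a. a \<E> A & cut T a = b" if b: "b : subs T" for b
 proof -
  obtain a where a: "a \<E> A" "!!z. z \<E> A ==> z \<E> H ==> z \<E> a <-> z \<E> b"
   using AQ(2) b unfolding m2_def subs_def mem_Collect_eq T by meson
  have "cut T a = b" by (rule eqI) (use a b T in "auto simp: subs_def")
  thus ?thesis using a(1) by blast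
 qed
 have inj: "a = a'" if h: "a \<E> A" "a' \<E> A" "cut T a = cut T a'" for a a'
 proof (rule ccontr)
  assume "a ~= a'"
  then obtain z where "z \<E> T" "z \<E> a <-> ~z \<E> a'" using AQ(3) h(1,2) unfolding m3_def T by blast
  thus False using h(3) cut_iff by metis
 qed
 \<comment> \<open>Exactly one member of \<open>A\<close> has the trace \<open>b\<close>, and the
   union extracts it.\<close>
 define ev where "ev = lam (Pow T) (%b. union (Coll A (%a. cut T a = b)))"
 have dev: "dt (%e. union (Coll A (%a. cut T a = e 0)))" by (intro dps)
 have ev: "app ev (cut T a) = a" if "a \<E> A" for a
 proof -
  have c: "x \<E> Coll A (%a'. cut T a' = cut T a) <-> x \<E> A & cut T x = cut T a" for x by (rule mem_Coll) (intro dps)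
  have "union (Coll A (%a'. cut T a' = cut T a)) = a" by (rule eqI) (use c inj that in "auto simp del: cut_iff")
  thus ?thesis unfolding ev_def using app_lam[OF dev, of "cut T a" "Pow T"] by simp
 qed
 have evid: "app ev x = x" if "x \<E> T" for x
 proof -
  have "cut T x = x" by (rule cut_sub) (use that trT transD in blast)
  thus ?thesis using ev[of x] that T by simp
 qed
 have bij: "bij_betw (cut T) {u. u \<E> A} (subs T)" unfolding bij_betw_def
 proof
  show "inj_on (cut T) {u. u \<E> A}" using inj by (auto intro!: inj_onI simp del: cut_iff)
  show "cut T ` {u. u \<E> A} = subs T"
  proof
   show "subs T <= cut T ` {u. u \<E> A}" using full by blast
  qed (auto simp: subs_def)
 qed
 have Eiso: "x \<E> y <-> cut T x \<E> cut T y" if h: "x \<E> A" "y \<E> A" for x y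
 proof
  assume "x \<E> y"
  hence "x \<E> T" using h AX[OF h(2)] T by auto
  moreover have "cut T x = x" by (rule cut_sub) (use \<open>x \<E> T\<close> trT transD in blast)
  ultimately show "cut T x \<E> cut T y" using \<open>x \<E> y\<close> by simp
 next
  assume *: "cut T x \<E> cut T y"
  hence xT: "cut T x \<E> T" "cut T x \<E> y" by simp_all
  have "cut T (cut T x) = cut T x" by (rule cut_sub) simp
  hence "cut T x = x" using inj[of "cut T x" x] xT(1) T h(1) by blast
  thus "x \<E> y" using xT(2) by simp
 qed
 have opT: "opair x y \<E> T" if h: "x \<E> T" "y \<E> T" for x y
 proof -
  have "upair x y \<E> T" if "x \<E> T" "y \<E> T" for x y using that AQ(4) upH unfolding T m4_def by blast
  thus ?thesis using h by (simp add: opair_def)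
 qed
 have univT: "univ T" unfolding univ_def
 proof (intro conjI allI impI trT)
  show "om \<E> T" using Ax omH T by simp
  show "Pow x \<E> T" "union x \<E> T" if "x \<E> T" for x using that AQ(4) univ_H unfolding T m4_def univ_def by blast+
  fix x f assume x: "x \<E> T" and f: "ALL y. y \<E> x --> app f y \<E> T"
  have df: "dt (%e. app f (e 0))" by (intro dps)
  have xT: "y \<E> T" if "y \<E> x" for y using trT x that transD by blast
  have "lam x (app f) : subs T" unfolding subs_def by (auto simp: lam_iff[OF df] f opT xT)
  \<comment> \<open>A function from \<open>x\<close> into \<open>T\<close> is a subset of
    \<open>T\<close>, hence the trace of a member of \<open>A\<close>, to which \<open>Q5\<close>
    applies.\<close>
  then obtain a where a: "a \<E> A" "cut T a = lam x (app f)" using full by blast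
  have op: "opair y z \<E> a <-> z = app f y" if "y \<E> x" "z \<E> T" for y z
  proof -
   have "opair y z \<E> a <-> opair y z \<E> cut T a" using opT xT that by simp
   thus ?thesis unfolding a(2) lam_iff[OF df] using that by auto
  qed
  have "Q5 A a x" using AQ(5) a(1) x T unfolding m5_def by blast
  moreover have "~(EX y. y \<E> x & ~(EX z. opair y z \<E> a))" using op f by blast
  moreover have "~(EX y z z'. y \<E> x & z \<E> A & z' \<E> A & z \<E> H & z' \<E> H & z ~= z' & opair y z \<E> a & opair y z' \<E> a)"
   using op T by blast
  ultimately have *: "Img x (app a) \<E> A" "!!y. y \<E> x ==> EX! z. opair y z \<E> a" using x T unfolding Q5_def by blast+
  have "app a y = app f y" if "y \<E> x" for y
  proof (rule app_eq)
   show "opair y z \<E> a <-> z = app f y" for z using *(2)[OF that] op[OF that] f that by blast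
  qed
  hence "(%z. EX y. y \<E> x & z = app a y) = (%z. EX y. y \<E> x & z = app f y)" by (intro HOL.ext) auto
  hence eq: "Img x (app a) = Img x (app f)" by (simp add: Img_def)
  have "Img x (app f) \<E> H" using univ_H x f T unfolding univ_def by blast
  thus "Img x (app f) \<E> T" using *(1) T eq by simp
 qed
 have subsH: "{u. u \<E> Pow H} = subs H" by (simp add: subs_Pow)
 show ?thesis
 proof (intro exI conjI ballI allI impI)
  show "T \<E> H" "univ T" "x0 \<E> T" using TH univT Ax x0 T by auto
  show "isfn ev (Pow T)" unfolding ev_def by (rule isfn_lam[OF dev])
  show "app ev b : subs H" if "b : subs T" for b using full[OF that] ev AX by (auto simp: subs_def)
  show "app ev (cut T c0) = c0" "app ev (cut T c1) = c1" "app ev (cut T c2) = c2" using ev Ax by auto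
  fix p x y z assume p: "p : \<Phi>" and xyz: "x : subs T" "y : subs T" "z : subs T"
  obtain x' y' z' where x': "x' \<E> A" "cut T x' = x" "y' \<E> A" "cut T y' = y" "z' \<E> A" "cut T z' = z" using full xyz by meson
  have r: "range (env6 x' y' z' c0 c1 c2) <= {u. u \<E> A}" by (rule env6_in) (use x' Ax in auto)
  have iso: "sat {u. u \<E> A} E p (env6 x' y' z' c0 c1 c2) <->
    sat (subs T) E p (cut T o env6 x' y' z' c0 c1 c2)"
  proof (rule sat_iso[OF bij _ r])
   show "a \<E> a' <-> cut T a \<E> cut T a'" if "a : {u. u \<E> A}" "a' : {u. u \<E> A}" for a a' using Eiso that by blast
  qed
  have "cut T emp = emp" by (rule cut_sub) simp
  hence "sat (subs T) E p (env6 x y z (cut T c0) (cut T c1) (cut T c2)) <->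
    sat {u. u \<E> A} E p (env6 x' y' z' c0 c1 c2)" using iso by (simp add: env6_comp x' env6_def[of x])
  also have "\<dots> <-> sat (subs H) E p (env6 x' y' z' c0 c1 c2)" using AQ(6)[OF p] x' unfolding m6_def subsH by blast
  finally have "sat (subs T) E p (env6 x y z (cut T c0) (cut T c1) (cut T c2)) <->
    sat (subs H) E p (env6 x' y' z' c0 c1 c2)" .
  moreover have "x' = app ev x" "y' = app ev y" "z' = app ev z" using ev x' by auto
  ultimately show "sat (subs T) E p (env6 x y z (cut T c0) (cut T c1) (cut T c2)) <->
    sat (subs H) E p (env6 (app ev x) (app ev y) (app ev z) c0 c1 c2)" by simp
 qed (use evid in blast)
qed

end

section \<open>Forcing\<close>

context zf
begin

definition ext' :: "'m => 'm => bool" (infix "<:" 50) where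
 "q <: p <-> (ALL z. z \<E> p --> z \<E> q)"

lemma dp_ext' [dps]: "dt f ==> dt g ==> dp (%e. f e <: g e)" by (rule dp_rel2[of "(<:)"], unfold ext'_def, intro dps)

lemma ext'_refl [simp]: "p <: p" by (simp add: ext'_def)
lemma ext'_trans: "r <: q ==> q <: p ==> r <: p" by (auto simp: ext'_def)

end

text \<open>Names are the subsets of \<open>w\<close>, conditions are ordered by reverse inclusion. A pair \<open>(pi, r)\<close> in a
 name says that \<open>r\<close> forces \<open>pi\<close> to be a member. Equality of names is forced bisimilarity, which
 avoids recursion on names.\<close>

locale fposet = supercompact E kap for E :: "'m => 'm => bool" (infix "\<E>" 50) and kap +
 fixes w Q :: 'm
 assumes univ_w: "univ w" and Q_w: "x \<E> Q ==> x \<E> w" and emp_Q: "emp \<E> Q"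
begin

text \<open>One direction of a bisimulation step. The names \<open>x\<close> and \<open>y\<close>
  may be proper classes of \<open>w\<close>, but \<open>rho\<close> compares only their members,
  which are elements of \<open>w\<close>.\<close>

definition half where
 "half rho p x y <-> (ALL pi. pi \<E> w --> (ALL r. r \<E> w --> opair pi r \<E> x & r \<E> Q -->
   (ALL q. q \<E> w --> q \<E> Q & q <: p & q <: r -->
    (EX q'. q' \<E> w & q' \<E> Q & q' <: q & (EX pi'. pi' \<E> w & (EX r'. r' \<E> w & opair pi' r' \<E> y & r' \<E> Q & q' <: r' &
     rho q' pi pi'))))))"

definition eqP where
 "eqP rho p x y <-> half rho p x y & half (%q a b. rho q b a) p y x"

abbreviation trip :: "'m => 'm => 'm => 'm => bool" where
 "trip R q a b \<equiv> opair q (opair a b) \<E> R"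

definition bis where
 "bis R <-> (ALL q. q \<E> w --> (ALL a. a \<E> w --> (ALL b. b \<E> w --> q \<E> Q & trip R q a b --> eqP (trip R) q a b)))"

text \<open>A bisimulation is coded by a subset \<open>R\<close> of \<open>w\<close>, so forced
  equality of class names costs a single quantifier over subsets of \<open>w\<close>. This is what
  makes it a formula over those subsets (\<open>F_eq\<close>).\<close>

definition eqf where
 "eqf p x y <-> (EX R. R : subs w & bis R & eqP (trip R) p x y)"

definition memP where
 "memP rho p x y <-> (ALL q. q \<E> w --> q \<E> Q & q <: p -->
   (EX q'. q' \<E> w & q' \<E> Q & q' <: q & (EX pi. pi \<E> w & (EX r. r \<E> w & opair pi r \<E> y & r \<E> Q & q' <: r &
    eqP rho q' x pi))))"

definition memf where
 "memf p x y <-> (EX R. R : subs w & bis R & memP (trip R) p x y)"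

lemma halfI:
 assumes "!!pi r q. opair pi r \<E> x ==> r \<E> Q ==> pi \<E> w ==> q \<E> Q ==> q <: p ==> q <: r ==>
  EX q' pi' r'. q' \<E> Q & q' <: q & opair pi' r' \<E> y & pi' \<E> w & r' \<E> Q & q' <: r' & rho q' pi pi'"
 shows "half rho p x y" unfolding half_def
proof (intro allI impI)
 fix pi r q assume h: "pi \<E> w" "r \<E> w" "opair pi r \<E> x & r \<E> Q" "q \<E> w" "q \<E> Q & q <: p & q <: r"
 obtain q' pi' r' where "q' \<E> Q" "q' <: q" "opair pi' r' \<E> y" "pi' \<E> w" "r' \<E> Q" "q' <: r'" "rho q' pi pi'"
  using assms[of pi r q] h by blast
 thus "EX q'. q' \<E> w & q' \<E> Q & q' <: q & (EX pi'. pi' \<E> w & (EX r'. r' \<E> w & opair pi' r' \<E> y & r' \<E> Q & q' <: r' &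
     rho q' pi pi'))" using Q_w[of q'] Q_w[of r'] by (intro exI[of _ q'] exI[of _ pi'] exI[of _ r'] conjI) simp_all
qed

lemma halfD:
 assumes "half rho p x y" "opair pi r \<E> x" "r \<E> Q" "pi \<E> w" "q \<E> Q" "q <: p" "q <: r"
 obtains q' pi' r' where "q' \<E> Q" "q' <: q" "opair pi' r' \<E> y" "pi' \<E> w" "r' \<E> Q" "q' <: r'" "rho q' pi pi'"
proof -
 have "EX q'. q' \<E> w & q' \<E> Q & q' <: q & (EX pi'. pi' \<E> w & (EX r'. r' \<E> w & opair pi' r' \<E> y & r' \<E> Q & q' <: r' &
     rho q' pi pi'))" using assms(1)[unfolded half_def, rule_format, of pi r q] assms(2-7) Q_w by simp
 thus ?thesis using that by blast
qed

lemma half_mono: "half rho p x y ==> q <: p ==> (!!q a b. q \<E> Q ==> a \<E> w ==> b \<E> w ==> rho q a b ==> rho' q a b) ==> half rho' q x y"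
proof (rule halfI)
 assume h: "half rho p x y" and q: "q <: p"
  and rho: "!!q a b. q \<E> Q ==> a \<E> w ==> b \<E> w ==> rho q a b ==> rho' q a b"
 fix pi r q1 assume 0: "opair pi r \<E> x" "r \<E> Q" "pi \<E> w" "q1 \<E> Q" "q1 <: q" "q1 <: r"
 obtain q' pi' r' where "q' \<E> Q" "q' <: q1" "opair pi' r' \<E> y" "pi' \<E> w" "r' \<E> Q" "q' <: r'" "rho q' pi pi'"
  by (rule halfD[OF h 0(1-4) ext'_trans[OF 0(5) q] 0(6)])
 thus "EX q' pi' r'. q' \<E> Q & q' <: q1 & opair pi' r' \<E> y & pi' \<E> w & r' \<E> Q & q' <: r' & rho' q' pi pi'"
  using rho 0(3) by blast
qed

lemma half_dense:
 assumes "!!q. q \<E> Q ==> q <: p ==> EX q'. q' \<E> Q & q' <: q & half rho q' x y"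
 shows "half rho p x y"
proof (rule halfI)
 fix pi r q assume *: "opair pi r \<E> x" "r \<E> Q" "pi \<E> w" "q \<E> Q" "q <: p" "q <: r"
 then obtain q1 where q1: "q1 \<E> Q" "q1 <: q" "half rho q1 x y" using assms by blast
 obtain q' pi' r' where "q' \<E> Q" "q' <: q1" "opair pi' r' \<E> y" "pi' \<E> w" "r' \<E> Q" "q' <: r'" "rho q' pi pi'"
  by (rule halfD[OF q1(3) *(1-3) q1(1) ext'_refl ext'_trans[OF q1(2) *(6)]])
 thus "EX q' pi' r'. q' \<E> Q & q' <: q & opair pi' r' \<E> y & pi' \<E> w & r' \<E> Q & q' <: r' & rho q' pi pi'"
  using ext'_trans[OF _ q1(2)] by blast
qed

lemma eqP_mono: "eqP rho p x y ==> q <: p ==> (!!q a b. q \<E> Q ==> a \<E> w ==> b \<E> w ==> rho q a b ==> rho' q a b) ==> eqP rho' q x y"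
proof -
 assume e: "eqP rho p x y" and q: "q <: p"
  and rho: "!!q a b. q \<E> Q ==> a \<E> w ==> b \<E> w ==> rho q a b ==> rho' q a b"
 have "half rho' q x y" by (rule half_mono[of rho p]) (use e q rho in "auto simp: eqP_def")
 moreover have "half (%q a b. rho' q b a) q y x" by (rule half_mono[of "%q a b. rho q b a" p]) (use e q rho in "auto simp: eqP_def")
 ultimately show "eqP rho' q x y" by (simp add: eqP_def)
qed

lemma dp_half [dps]:
 assumes "dp (%e. rho (%i. e (Suc (Suc (Suc i)))) (e 0) (e 1) (e 2))" "dt p" "dt x" "dt y"
 shows "dp (%e. half (rho e) (p e) (x e) (y e))"
proof -
 have rho: "dp (%e. rho (%i. e (s i)) (e i) (e j) (e k))" for s i j k
  using dp_reindex[OF assms(1), of "case_nat i (case_nat j (case_nat k s))"] by (simp add: numeral_2_eq_2)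
 show ?thesis unfolding half_def by (intro dp_all' dp_ex' dp_imp dp_and dp_mem dt_opair dp_ext' dt_var dt_const' rho
   dt_reindex[OF assms(2)] dt_reindex[OF assms(3)] dt_reindex[OF assms(4)])
qed

lemma dp_eqP [dps]:
 assumes "dp (%e. rho (%i. e (Suc (Suc (Suc i)))) (e 0) (e 1) (e 2))" "dt p" "dt x" "dt y"
 shows "dp (%e. eqP (rho e) (p e) (x e) (y e))"
proof -
 have "dp (%e. rho (%i. e (Suc (Suc (Suc i)))) (e 0) (e 2) (e 1))"
  using dp_reindex[OF assms(1), of "case_nat 0 (case_nat 2 (case_nat 1 (%i. Suc (Suc (Suc i)))))"] by (simp add: numeral_2_eq_2)
 thus ?thesis unfolding eqP_def by (intro dps assms)
qed

lemma dp_subs [dps]: "dt f ==> dt g ==> dp (%e. f e : subs (g e))"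
 by (rule dp_rel2[of "%x y. x : subs y"], unfold subs_def mem_Collect_eq, intro dps)

lemma dp_bis [dps]: "dt f ==> dp (%e. bis (f e))" by (rule dp_rel1[of bis], unfold bis_def, intro dps)

lemma dp_eqf [dps]: "dt f ==> dt g ==> dt h ==> dp (%e. eqf (f e) (g e) (h e))" by (rule dp_rel3[of eqf], unfold eqf_def, intro dps)

text \<open>Any definable bisimulation will do: separation cuts it down to a subset of
  \<open>w\<close>.\<close>

lemma eqf_coinduct:
 assumes d: "dp (%e. rho (e 0) (e 1) (e 2))"
  and step: "!!q a b. q \<E> Q ==> a \<E> w ==> b \<E> w ==> rho q a b ==> eqP rho q a b"
  and xy: "eqP rho p x y"
 shows "eqf p x y"
proof -
 note d' = dp_rel3[OF d]
 define R where "R = Coll w (%t. EX q a b. t = opair q (opair a b) & rho q a b)"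
 have R: "t \<E> R <-> t \<E> w & (EX q a b. t = opair q (opair a b) & rho q a b)" for t unfolding R_def by (rule mem_Coll) (intro dps d')
 have tr: "trip R q a b <-> rho q a b" if "q \<E> Q" "a \<E> w" "b \<E> w" for q a b
  using that Q_w univ_opair[OF univ_w] unfolding R by auto
 have eq: "eqP (trip R) q a b" if "eqP rho q a b" for q a b using that by (rule eqP_mono) (simp_all add: tr)
 have "R : subs w" by (auto simp: subs_def R)
 moreover have "bis R" unfolding bis_def using step eq tr Q_w by blast
 ultimately show ?thesis unfolding eqf_def using eq[OF xy] by blast
qed

lemma eqf_unfold: "eqf p x y ==> eqP eqf p x y"
proof -
 assume "eqf p x y"
 then obtain R where R: "R : subs w" "bis R" "eqP (trip R) p x y" by (auto simp: eqf_def)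
 show ?thesis by (rule eqP_mono[OF R(3)]) (use R in "auto simp: eqf_def bis_def Q_w")
qed

lemma eqfI: "eqP eqf p x y ==> eqf p x y" by (rule eqf_coinduct[of eqf]) (intro dps, auto intro: eqf_unfold)

lemma eqf_iff: "eqf p x y <-> eqP eqf p x y" using eqfI eqf_unfold by blast

lemma eqf_mono: "eqf p x y ==> q <: p ==> eqf q x y" unfolding eqf_iff[of p] eqf_iff[of q] by (rule eqP_mono)

lemma eqf_dense:
 assumes "!!q. q \<E> Q ==> q <: p ==> EX q'. q' \<E> Q & q' <: q & eqf q' x y"
 shows "eqf p x y"
proof (rule eqfI)
 show "eqP eqf p x y" unfolding eqP_def by (intro conjI half_dense) (use assms eqf_unfold in "unfold eqP_def, blast")+
qed

lemma eqf_refl: "eqf p x x"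
proof (rule eqf_coinduct[of "%q a b. a = b"])
 have h: "half (%q a b. a = b) p x x" for p x
 proof (rule halfI)
  fix pi r q assume "opair pi r \<E> x" "r \<E> Q" "pi \<E> w" "q \<E> Q" "q <: p" "q <: r"
  thus "EX q' pi' r'. q' \<E> Q & q' <: q & opair pi' r' \<E> x & pi' \<E> w & r' \<E> Q & q' <: r' & pi = pi'" using ext'_refl by blast
 qed
 have *: "(%(q::'m) a b. b = a) = (%q a b. a = b)" by (intro HOL.ext) auto
 have e: "eqP (%q a b. a = b) p x x" for p x unfolding eqP_def * using h by blast
 show "eqP (%q a b. a = b) p x x" by (rule e)
 show "eqP (%q a b. a = b) q a b" if "a = b" for q a b using e that by simp
qed (intro dps)

lemma eqf_sym: "eqf p x y ==> eqf p y x"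
proof -
 assume "eqf p x y"
 have s: "eqP (%q a b. eqf q b a) q b a" if "eqf q a b" for q a b using eqf_unfold[OF that] by (simp add: eqP_def)
 show ?thesis by (rule eqf_coinduct[of "%q a b. eqf q b a"]) (intro dps, auto intro: s \<open>eqf p x y\<close>)
qed

text \<open>The composition of forced equality with itself, through names in \<open>w\<close>, is a
  bisimulation.\<close>

lemma eqf_trans:
 assumes "eqf p x y" "eqf p y z"
 shows "eqf p x z"
proof -
 define rho where "rho q a c <-> (EX b. b \<E> w & eqf q a b & eqf q b c)" for q a c
 have h: "half rho p x z" if xy: "half eqf p x y" and yz: "half eqf p y z" for p x y z
 proof (rule halfI)
  fix pi r q assume "opair pi r \<E> x" "r \<E> Q" "pi \<E> w" "q \<E> Q" "q <: p" "q <: r"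
  note 0 = this
  obtain q' pi' r' where 1: "q' \<E> Q" "q' <: q" "opair pi' r' \<E> y" "pi' \<E> w" "r' \<E> Q" "q' <: r'" "eqf q' pi pi'"
   by (rule halfD[OF xy 0])
  obtain q'' pi'' r'' where 2: "q'' \<E> Q" "q'' <: q'" "opair pi'' r'' \<E> z" "pi'' \<E> w" "r'' \<E> Q" "q'' <: r''" "eqf q'' pi' pi''"
   by (rule halfD[OF yz 1(3,5,4,1) ext'_trans[OF 1(2) 0(5)] 1(6)])
  have "rho q'' pi pi''" unfolding rho_def using 1(4) 2(7) eqf_mono[OF 1(7) 2(2)] by blast
  thus "EX q' pi' r'. q' \<E> Q & q' <: q & opair pi' r' \<E> z & pi' \<E> w & r' \<E> Q & q' <: r' & rho q' pi pi'"
   using 2 ext'_trans[OF 2(2) 1(2)] by blast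
 qed
 have e: "eqP rho p x z" if "eqf p x y" "eqf p y z" for p x y z
 proof -
  have "half eqf p x y" "half eqf p y z" "half eqf p z y" "half eqf p y x" using eqf_unfold that eqf_sym unfolding eqP_def by blast+
  hence "half rho p x z" "half rho p z x" using h by blast+
  moreover have "rho q b a" if "rho q a b" for q a b using that eqf_sym unfolding rho_def by blast
  ultimately show ?thesis unfolding eqP_def using half_mono[of rho p z x p "%q a b. rho q b a"] by auto
 qed
 show ?thesis
 proof (rule eqf_coinduct[of rho])
  show "dp (%e. rho (e 0) (e 1) (e 2))" unfolding rho_def by (intro dps)
  show "eqP rho p x z" by (rule e[OF assms])
 qed (use e in "unfold rho_def, blast")
qed

lemma memf_iff:
 "memf p x y <-> (ALL q. q \<E> Q --> q <: p -->
   (EX q' pi r. q' \<E> Q & q' <: q & opair pi r \<E> y & pi \<E> w & r \<E> Q & q' <: r & eqf q' x pi))"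
proof
 assume "memf p x y"
 then obtain R where R: "R : subs w" "bis R" "memP (trip R) p x y" by (auto simp: memf_def)
 thus "ALL q. q \<E> Q --> q <: p -->
   (EX q' pi r. q' \<E> Q & q' <: q & opair pi r \<E> y & pi \<E> w & r \<E> Q & q' <: r & eqf q' x pi)"
  unfolding memP_def eqf_def using Q_w by meson
next
 assume *: "ALL q. q \<E> Q --> q <: p -->
   (EX q' pi r. q' \<E> Q & q' <: q & opair pi r \<E> y & pi \<E> w & r \<E> Q & q' <: r & eqf q' x pi)"
 define R where "R = Coll w (%t. EX q a b. t = opair q (opair a b) & eqf q a b)"
 have R: "t \<E> R <-> t \<E> w & (EX q a b. t = opair q (opair a b) & eqf q a b)" for t unfolding R_def by (rule mem_Coll) (intro dps)
 have tr: "trip R q a b <-> eqf q a b" if "q \<E> Q" "a \<E> w" "b \<E> w" for q a b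
  using that Q_w univ_opair[OF univ_w] unfolding R by auto
 have eq: "eqP (trip R) q a b" if "eqf q a b" for q a b using eqf_unfold[OF that] by (rule eqP_mono) (simp_all add: tr)
 have "R : subs w" by (auto simp: subs_def R)
 moreover have "bis R" unfolding bis_def using eq tr by blast
 moreover have "memP (trip R) p x y" unfolding memP_def using * eq Q_w by meson
 ultimately show "memf p x y" unfolding memf_def by blast
qed

lemma memfD:
 assumes "memf p x y" "q \<E> Q" "q <: p"
 obtains q' pi r where "q' \<E> Q" "q' <: q" "opair pi r \<E> y" "pi \<E> w" "r \<E> Q" "q' <: r" "eqf q' x pi"
 using assms unfolding memf_iff by blast

lemma dp_memf [dps]: "dt f ==> dt g ==> dt h ==> dp (%e. memf (f e) (g e) (h e))" by (rule dp_rel3[of memf], unfold memf_iff, intro dps)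

lemma memf_mono: "memf p x y ==> q <: p ==> memf q x y" unfolding memf_iff using ext'_trans by blast

lemma memf_dense:
 assumes "!!q. q \<E> Q ==> q <: p ==> EX q'. q' \<E> Q & q' <: q & memf q' x y"
 shows "memf p x y" unfolding memf_iff
proof (intro allI impI)
 fix q assume "q \<E> Q" "q <: p"
 then obtain q1 where q1: "q1 \<E> Q" "q1 <: q" "memf q1 x y" using assms by blast
 obtain q' pi r where "q' \<E> Q" "q' <: q1" "opair pi r \<E> y" "pi \<E> w" "r \<E> Q" "q' <: r" "eqf q' x pi"
  by (rule memfD[OF q1(3,1) ext'_refl])
 thus "EX q' pi r. q' \<E> Q & q' <: q & opair pi r \<E> y & pi \<E> w & r \<E> Q & q' <: r & eqf q' x pi"
  using ext'_trans[OF _ q1(2)] by blast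
qed

lemma memf_cong1:
 assumes "memf p x y" "eqf p x x'"
 shows "memf p x' y" unfolding memf_iff
proof (intro allI impI)
 fix q assume q: "q \<E> Q" "q <: p"
 obtain q' pi r where 1: "q' \<E> Q" "q' <: q" "opair pi r \<E> y" "pi \<E> w" "r \<E> Q" "q' <: r" "eqf q' x pi"
  by (rule memfD[OF assms(1) q])
 have "eqf q' x' pi" using eqf_trans[OF eqf_sym[OF eqf_mono[OF assms(2) ext'_trans[OF 1(2) q(2)]]] 1(7)] .
 thus "EX q' pi r. q' \<E> Q & q' <: q & opair pi r \<E> y & pi \<E> w & r \<E> Q & q' <: r & eqf q' x' pi" using 1 by blast
qed

lemma memf_cong2:
 assumes "memf p x y" "eqf p y y'"
 shows "memf p x y'" unfolding memf_iff
proof (intro allI impI)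
 fix q assume q: "q \<E> Q" "q <: p"
 obtain q' pi r where 1: "q' \<E> Q" "q' <: q" "opair pi r \<E> y" "pi \<E> w" "r \<E> Q" "q' <: r" "eqf q' x pi"
  by (rule memfD[OF assms(1) q])
 have "half eqf p y y'" using eqf_unfold[OF assms(2)] by (simp add: eqP_def)
 then obtain q'' pi' r' where 2: "q'' \<E> Q" "q'' <: q'" "opair pi' r' \<E> y'" "pi' \<E> w" "r' \<E> Q" "q'' <: r'" "eqf q'' pi pi'"
  by (rule halfD[OF _ 1(3,5,4,1) ext'_trans[OF 1(2) q(2)] 1(6)])
 have "eqf q'' x pi'" using eqf_trans[OF eqf_mono[OF 1(7) 2(2)] 2(7)] .
 thus "EX q' pi r. q' \<E> Q & q' <: q & opair pi r \<E> y' & pi \<E> w & r \<E> Q & q' <: r & eqf q' x pi"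
  using 2 ext'_trans[OF 2(2) 1(2)] by blast
qed

lemma memf_pair:
 assumes "opair pi r \<E> y" "pi \<E> w" "r \<E> Q" "p <: r"
 shows "memf p pi y" unfolding memf_iff using assms eqf_refl ext'_refl ext'_trans by meson

subsection \<open>The forcing relation\<close>

text \<open>With falsity, implication and universal quantification as the only logical symbols, the
  Kripke clauses suffice: density enters in the atomic cases and is inherited
  (\<open>frc_dense\<close>). Quantifiers range over class names.\<close>

primrec frc :: "fm => 'm => (nat => 'm) => bool" where
 "frc Falsum p t = False"
| "frc (Member i j) p t = memf p (t i) (t j)"
| "frc (Equal i j) p t = eqf p (t i) (t j)"
| "frc (Implies a b) p t = (ALL q. q \<E> Q --> q <: p --> frc a q t --> frc b q t)"
| "frc (Forall a) p t = (ALL x. x : subs w --> frc a p (case_nat x t))"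

lemma frc_mono: "frc a p t ==> q <: p ==> frc a q t" by (induction a arbitrary: t) (auto dest: memf_mono eqf_mono intro: ext'_trans)

lemma frc_dense:
 assumes "p \<E> Q" "!!q. q \<E> Q ==> q <: p ==> EX q'. q' \<E> Q & q' <: q & frc a q' t"
 shows "frc a p t" using assms
proof (induction a arbitrary: p t)
 case Falsum
 thus ?case using Falsum.prems(2)[OF Falsum.prems(1) ext'_refl] by simp
next
 case (Member i j)
 thus ?case by (auto intro: memf_dense)
next
 case (Equal i j)
 thus ?case by (auto intro: eqf_dense)
next
 case (Implies a b)
 have "frc b q t" if q: "q \<E> Q" "q <: p" "frc a q t" for q
 proof (rule Implies.IH(2)[OF q(1)])
  fix q1 assume q1: "q1 \<E> Q" "q1 <: q"
  then obtain q' where "q' \<E> Q" "q' <: q1" "frc (Implies a b) q' t" using Implies.prems(2) ext'_trans q(2) by blast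
  thus "EX q'. q' \<E> Q & q' <: q1 & frc b q' t" using frc_mono[OF q(3)] ext'_trans[OF _ q1(2)] ext'_refl by (metis frc.simps(4))
 qed
 thus ?case by simp
next
 case (Forall a)
 have "frc a p (case_nat x t)" if "x : subs w" for x by (rule Forall.IH[OF Forall.prems(1)]) (use Forall.prems(2) that in "simp, blast")
 thus ?case by simp
qed

lemma dp_frc:
 assumes "dt f" "!!i. dt (g i)"
 shows "dp (%e. frc a (f e) (%i. g i e))" using assms
proof (induction a arbitrary: f g)
 case (Implies a b)
 have "dp (%e. ALL q. q \<E> Q --> q <: f e --> frc a q (%i. g i e) --> frc b q (%i. g i e))"
  by (intro dps dt_reindex[OF Implies.prems(1)] Implies.IH dt_reindex[OF Implies.prems(2)])
 thus ?case by simp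
next
 case (Forall a)
 have "dp (%e. frc a (f (%i. e (Suc i))) (%i. case_nat (e 0) (%i. g i (%i. e (Suc i))) i))"
 proof (rule Forall.IH[OF dt_reindex[OF Forall.prems(1)]])
  show "dt (%e. case_nat (e 0) (%i. g i (%i. e (Suc i))) i)" for i by (cases i) (simp_all add: dt_var dt_reindex[OF Forall.prems(2)])
 qed
 hence "dp (%e. ALL x. x : subs w --> frc a (f e) (case_nat x (%i. g i e)))" by (intro dps)
 thus ?case by simp
qed (simp_all add: dps)

end

text \<open>\<open>g\<close> is a set of the metatheory, but \<open>D\<close> ranges only over
  elements of the ground model, which can be enumerated when the model is countable.\<close>

locale generic = fposet E kap w Q for E :: "'m => 'm => bool" (infix "\<E>" 50) and kap w Q +
 fixes g :: "'m set"
 assumes g_Q: "p : g ==> p \<E> Q" and g_nonempty: "g ~= {}"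
  and g_up: "p : g ==> q \<E> Q ==> p <: q ==> q : g"
  and g_dir: "p : g ==> q : g ==> EX r:g. r <: p & r <: q"
  and g_gen: "(!!p. p \<E> Q ==> EX q. q \<E> D & q \<E> Q & q <: p) ==> EX p:g. p \<E> D"
begin

lemma g_dense:
 assumes "dp (%e. D (e 0))" "!!p. p \<E> Q ==> EX q. q \<E> Q & q <: p & D q"
 shows "EX p:g. D p"
proof -
 have "EX p:g. p \<E> Coll Q D" by (rule g_gen) (use assms(2) mem_Coll[OF assms(1)] in blast)
 thus ?thesis using mem_Coll[OF assms(1)] by blast
qed

text \<open>Adding the conditions incompatible with \<open>p0\<close> makes the set dense
  everywhere; directedness of \<open>g\<close> discards them again.\<close>

lemma g_dense_below:
 assumes "dp (%e. D (e 0))" "p0 : g" "!!p. p \<E> Q ==> p <: p0 ==> EX q. q \<E> Q & q <: p & D q"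
 shows "EX p:g. p <: p0 & D p"
proof -
 have "EX p:g. (p <: p0 & D p) | ~(EX q. q \<E> Q & q <: p & q <: p0)"
 proof (rule g_dense)
  show "dp (%e. (e 0 <: p0 & D (e 0)) | ~(EX q. q \<E> Q & q <: e 0 & q <: p0))" by (intro dps assms(1))
  fix p assume p: "p \<E> Q"
  show "EX q. q \<E> Q & q <: p & ((q <: p0 & D q) | ~(EX q'. q' \<E> Q & q' <: q & q' <: p0))"
  proof (cases "EX q. q \<E> Q & q <: p & q <: p0")
   case True
   then obtain q where "q \<E> Q" "q <: p" "q <: p0" by blast
   thus ?thesis using assms(3)[of q] ext'_trans by blast
  next
   case False
   thus ?thesis using p ext'_refl by blast
  qed
 qed
 then obtain p where p: "p : g" "(p <: p0 & D p) | ~(EX q. q \<E> Q & q <: p & q <: p0)" by blast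
 moreover have "EX q. q \<E> Q & q <: p & q <: p0" using g_dir[OF p(1) assms(2)] g_Q by blast
 ultimately show ?thesis by blast
qed

definition same :: "'m => 'm => bool" (infix "\<approx>" 50) where
 "x \<approx> y <-> (EX p:g. eqf p x y)"

text \<open>The value of a name is its equivalence class under equality forced by \<open>g\<close>.
  A collapse of names by recursion is not at hand, because the ground model may be
  ill-founded.\<close>

definition val where
 "val x = {y : subs w. x \<approx> y}"

definition N where "N = val ` subs w"
definition NS where "NS = val ` {x. x \<E> w}"

definition NE where
 "NE X Y <-> (EX x:subs w. EX y:subs w. X = val x & Y = val y & (EX p:g. memf p x y))"

lemma same_refl: "x \<approx> x" using g_nonempty eqf_refl by (auto simp: same_def)
lemma same_sym: "x \<approx> y ==> y \<approx> x" using eqf_sym by (auto simp: same_def)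
lemma same_trans: "x \<approx> y ==> y \<approx> z ==> x \<approx> z" unfolding same_def using g_dir eqf_mono eqf_trans by meson

lemma val_eq: "x : subs w ==> y : subs w ==> val x = val y <-> x \<approx> y" unfolding val_def using same_refl same_sym same_trans by blast

lemma w_subs: "x \<E> w ==> x : subs w" unfolding subs_def using univ_in[OF univ_w] by blast

lemma NE_val:
 assumes "x : subs w" "y : subs w"
 shows "NE (val x) (val y) <-> (EX p:g. memf p x y)"
proof
 assume "NE (val x) (val y)"
 then obtain x' y' p where *: "x' : subs w" "y' : subs w" "val x = val x'" "val y = val y'" "p : g" "memf p x' y'"
  unfolding NE_def by blast
 then obtain q r where "q : g" "eqf q x' x" "r : g" "eqf r y' y" using val_eq assms same_sym unfolding same_def by metis
 moreover obtain s where "s : g" "s <: p" "s <: q" using g_dir[OF \<open>p : g\<close> \<open>q : g\<close>] by blast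
 moreover obtain s' where "s' : g" "s' <: s" "s' <: r" using g_dir[OF \<open>s : g\<close> \<open>r : g\<close>] by blast
 ultimately have "memf s' x y" using memf_cong2[OF memf_cong1[OF memf_mono[OF *(6)] eqf_mono] eqf_mono] ext'_trans by meson
 thus "EX p:g. memf p x y" using \<open>s' : g\<close> by blast
next
 assume "EX p:g. memf p x y"
 thus "NE (val x) (val y)" unfolding NE_def using assms by blast
qed

lemma memf_pairs:
 assumes "p : g" "memf p x y"
 shows "EX pi r. opair pi r \<E> y & pi \<E> w & r : g & x \<approx> pi"
proof -
 have "EX q:g. q <: p & (EX pi r. opair pi r \<E> y & pi \<E> w & r \<E> Q & q <: r & eqf q x pi)"
 proof (rule g_dense_below[OF _ assms(1)])
  show "dp (%e. EX pi r. opair pi r \<E> y & pi \<E> w & r \<E> Q & e 0 <: r & eqf (e 0) x pi)" by (intro dps)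
  show "EX q'. q' \<E> Q & q' <: q & (EX pi r. opair pi r \<E> y & pi \<E> w & r \<E> Q & q' <: r & eqf q' x pi)"
   if "q \<E> Q" "q <: p" for q using assms(2) that unfolding memf_iff by blast
 qed
 thus ?thesis unfolding same_def using g_up by blast
qed

lemma NE_pairs:
 assumes "x : subs w" "y : subs w"
 shows "NE (val x) (val y) <-> (EX pi r. opair pi r \<E> y & pi \<E> w & r : g & x \<approx> pi)"
proof
 assume "EX pi r. opair pi r \<E> y & pi \<E> w & r : g & x \<approx> pi"
 then obtain pi r where *: "opair pi r \<E> y" "pi \<E> w" "r : g" "x \<approx> pi" by blast
 hence "memf r pi y" using memf_pair g_Q by auto
 hence "NE (val pi) (val y)" using NE_val w_subs * assms by blast
 thus "NE (val x) (val y)" using val_eq * w_subs assms by metis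
qed (use NE_val[OF assms] memf_pairs in blast)

text \<open>For implications and quantifiers, \<open>g\<close> meets the dense set of conditions
  that force the formula or rule it out by a counterexample.\<close>

lemma truth:
 "range t <= subs w ==> sat N NE a (val o t) <-> (EX p:g. frc a p t)"
proof (induction a arbitrary: t)
 case (Member i j)
 hence "t i : subs w" "t j : subs w" by auto
 thus ?case by (simp add: NE_val)
next
 case (Equal i j)
 hence "t i : subs w" "t j : subs w" by auto
 thus ?case by (simp add: val_eq same_def)
next
 case (Implies a b)
 note IH = Implies.IH(1)[OF Implies.prems] Implies.IH(2)[OF Implies.prems]
 show ?case
 proof
  assume "EX p:g. frc (Implies a b) p t"
  then obtain p where p: "p : g" "frc (Implies a b) p t" by blast
  have "EX q:g. frc b q t" if h: "q : g" "frc a q t" for q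
  proof -
   obtain r where r: "r : g" "r <: p" "r <: q" using g_dir[OF p(1) h(1)] by blast
   hence "frc b r t" using p(2) g_Q frc_mono[OF h(2)] by simp
   thus ?thesis using r by blast
  qed
  thus "sat N NE (Implies a b) (val o t)" unfolding sat.simps IH by blast
 next
  assume s: "sat N NE (Implies a b) (val o t)"
  have "EX p:g. frc (Implies a b) p t | (frc a p t & ~(EX q. q \<E> Q & q <: p & frc b q t))"
  proof (rule g_dense)
   have d: "dp (%e. frc c (f e) t)" if "dt f" for f c using dp_frc[OF that, of "%i e. t i"] dt_const' by simp
   show "dp (%e. frc (Implies a b) (e 0) t | (frc a (e 0) t & ~(EX q. q \<E> Q & q <: e 0 & frc b q t)))" by (intro dps d)
   fix p assume p: "p \<E> Q"
   show "EX q. q \<E> Q & q <: p & (frc (Implies a b) q t | (frc a q t & ~(EX q'. q' \<E> Q & q' <: q & frc b q' t)))"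
   proof (cases "frc (Implies a b) p t")
    case True
    thus ?thesis using p ext'_refl by blast
   next
    case False
    then obtain q where q: "q \<E> Q" "q <: p" "frc a q t" "~frc b q t" by auto
    then obtain q1 where q1: "q1 \<E> Q" "q1 <: q" "~(EX q'. q' \<E> Q & q' <: q1 & frc b q' t)"
     using frc_dense[OF q(1), of b t] by blast
    thus ?thesis using frc_mono[OF q(3) q1(2)] ext'_trans[OF q1(2) q(2)] by blast
   qed
  qed
  then obtain p where p: "p : g" "frc (Implies a b) p t | (frc a p t & ~(EX q. q \<E> Q & q <: p & frc b q t))" by blast
  show "EX p:g. frc (Implies a b) p t"
  proof (rule ccontr)
   assume "~ ?thesis"
   hence p': "frc a p t" "~(EX q. q \<E> Q & q <: p & frc b q t)" using p by blast+
   then obtain q where q: "q : g" "frc b q t" using s[unfolded sat.simps IH] p(1) by blast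
   obtain r where "r : g" "r <: p" "r <: q" using g_dir[OF p(1) q(1)] by blast
   thus False using p'(2) g_Q frc_mono[OF q(2)] by blast
  qed
 qed
next
 case (Forall a)
 have cn: "case_nat (val x) (val o t) = val o case_nat x t" for x by (rule HOL.ext) (simp split: nat.split)
 have "range (case_nat x t) <= subs w" if "x : subs w" for x using that Forall.prems by (fastforce split: nat.splits)
 hence IH: "sat N NE a (case_nat (val x) (val o t)) <-> (EX p:g. frc a p (case_nat x t))"
  if "x : subs w" for x unfolding cn using that by (intro Forall.IH) blast
 have NB: "(ALL X:N. R X) <-> (ALL x:subs w. R (val x))" for R by (simp add: N_def)
 have "sat N NE (Forall a) (val o t) <-> (ALL x:subs w. EX p:g. frc a p (case_nat x t))" unfolding sat.simps NB using IH by blast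
 also have "\<dots> <-> (EX p:g. frc (Forall a) p t)"
 proof
  assume s: "ALL x:subs w. EX p:g. frc a p (case_nat x t)"
  have "EX p:g. frc (Forall a) p t | (EX x. x : subs w & ~(EX q. q \<E> Q & q <: p & frc a q (case_nat x t)))"
  proof (rule g_dense)
   have d: "dp (%e. frc (Forall a) (f e) t)" if "dt f" for f by (rule dp_frc[OF that, of "%i e. t i"]) (rule dt_const')
   have d': "dp (%e. frc a (f e) (case_nat (h e) t))" if "dt f" "dt h" for f h
   proof -
    have "dp (%e. frc a (f e) (%i. case_nat (h e) t i))"
    proof (rule dp_frc[OF that(1)])
     show "dt (%e. case_nat (h e) t i)" for i by (cases i) (simp_all add: that dt_const')
    qed
    thus ?thesis by simp
   qed
   show "dp (%e. frc (Forall a) (e 0) t | (EX x. x : subs w & ~(EX q. q \<E> Q & q <: e 0 & frc a q (case_nat x t))))"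
    by (intro dps d d')
   fix p assume p: "p \<E> Q"
   show "EX q. q \<E> Q & q <: p & (frc (Forall a) q t |
     (EX x. x : subs w & ~(EX q'. q' \<E> Q & q' <: q & frc a q' (case_nat x t))))"
   proof (cases "frc (Forall a) p t")
    case True
    thus ?thesis using p ext'_refl by blast
   next
    case False
    then obtain x where x: "x : subs w" "~frc a p (case_nat x t)" by auto
    then obtain q1 where q1: "q1 \<E> Q" "q1 <: p" "~(EX q'. q' \<E> Q & q' <: q1 & frc a q' (case_nat x t))"
     using frc_dense[OF p, of a "case_nat x t"] by blast
    thus ?thesis using x by blast
   qed
  qed
  then obtain p where p: "p : g" "frc (Forall a) p t | (EX x. x : subs w & ~(EX q. q \<E> Q & q <: p & frc a q (case_nat x t)))" by blast
  show "EX p:g. frc (Forall a) p t"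
  proof (rule ccontr)
   assume "~ ?thesis"
   then obtain x where x: "x : subs w" "~(EX q. q \<E> Q & q <: p & frc a q (case_nat x t))" using p by blast
   then obtain q where q: "q : g" "frc a q (case_nat x t)" using s by blast
   obtain r where "r : g" "r <: p" "r <: q" using g_dir[OF p(1) q(1)] by blast
   thus False using x(2) g_Q frc_mono[OF q(2)] by blast
  qed
 qed auto
 finally show ?case .
qed simp

end

subsection \<open>Definability of forcing, uniformly in the universe\<close>

text \<open>The Boolean selects the orientation of the triples in \<open>R\<close>, since the second
  half of a bisimulation step uses the converse relation.\<close>

definition F_half :: "bool => nat => nat => nat => nat => nat => form" where
 "F_half b R p x y Q =
  (\<^bold>\<forall>a. \<^bold>\<forall>r. related x a r \<^bold>\<and> r \<^bold>\<in> Q \<^bold>\<longrightarrow>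
   (\<^bold>\<forall>q. q \<^bold>\<in> Q \<^bold>\<and> subset p q \<^bold>\<and> subset r q \<^bold>\<longrightarrow>
    (\<^bold>\<exists>q'. q' \<^bold>\<in> Q \<^bold>\<and> subset q q' \<^bold>\<and>
     (\<^bold>\<exists>a'. \<^bold>\<exists>r'. related y a' r' \<^bold>\<and> r' \<^bold>\<in> Q \<^bold>\<and> subset r' q' \<^bold>\<and>
      (\<^bold>\<exists>t. (if b then is_pair t a a' else is_pair t a' a) \<^bold>\<and> related R q' t)))))"

definition F_bis :: "nat => nat => form" where
 "F_bis R Q = (\<^bold>\<forall>q. \<^bold>\<forall>a. \<^bold>\<forall>b. q \<^bold>\<in> Q \<^bold>\<and> (\<^bold>\<exists>t. is_pair t a b \<^bold>\<and> related R q t) \<^bold>\<longrightarrow>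
   F_half True R q a b Q \<^bold>\<and> F_half False R q b a Q)"

definition F_eq :: "nat => nat => nat => nat => form" where
 "F_eq p Q x y = (\<^bold>\<exists>R. in_sets (F_bis R Q \<^bold>\<and> F_half True R p x y Q \<^bold>\<and> F_half False R p y x Q))"

definition F_mem :: "nat => nat => nat => nat => form" where
 "F_mem p Q x y = (\<^bold>\<exists>R. in_sets (F_bis R Q \<^bold>\<and>
   (\<^bold>\<forall>q. q \<^bold>\<in> Q \<^bold>\<and> subset p q \<^bold>\<longrightarrow>
    (\<^bold>\<exists>q'. q' \<^bold>\<in> Q \<^bold>\<and> subset q q' \<^bold>\<and> (\<^bold>\<exists>a. \<^bold>\<exists>r. related y a r \<^bold>\<and> r \<^bold>\<in> Q \<^bold>\<and> subset r q' \<^bold>\<and>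
     F_half True R q' x a Q \<^bold>\<and> F_half False R q' a x Q)))))"

text \<open>In \<open>tr a\<close> the variables 0 and 1 are the condition and the poset, and the variable \<open>i + 2\<close> is the
 name substituted for the variable \<open>i\<close> of \<open>a\<close>.\<close>

primrec tr :: "fm => fm" where
 "tr Falsum = Falsum"
| "tr (Member i j) = rename (case_nat 0 (case_nat 1 (case_nat (i + 2) (%_. j + 2)))) (F_mem 3 2 1 0 4)"
| "tr (Equal i j) = rename (case_nat 0 (case_nat 1 (case_nat (i + 2) (%_. j + 2)))) (F_eq 3 2 1 0 4)"
| "tr (Implies a b) = Forall (Implies (Member 0 2) (Implies (in_sets (subset 1 2) 3)
   (Implies (rename (case_nat 0 (%k. k + 2)) (tr a)) (rename (case_nat 0 (%k. k + 2)) (tr b)))))"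
| "tr (Forall a) = Forall (rename (case_nat 1 (case_nat 2 (case_nat 0 (%k. k + 3)))) (tr a))"

context base
begin

definition Half where
 "Half rho p x y Q <-> (ALL a:S. ALL r:S. opair a r \<E> x & r \<E> Q -->
   (ALL q:S. q \<E> Q & Sub p q & Sub r q -->
    (EX q':S. q' \<E> Q & Sub q q' & (EX a':S. EX r':S. opair a' r' \<E> y & r' \<E> Q & Sub r' q' & rho q' a a'))))"

lemma sat_F_half [simp]:
 assumes "R < n" "p < n" "x < n" "y < n" "P < n" "lv e n R : C" "lv e n x : C" "lv e n y : C"
 shows "sat S E (F_half True R p x y P n) e <->
   Half (%q a b. opair q (opair a b) \<E> lv e n R) (lv e n p) (lv e n x) (lv e n y) (lv e n P)"
  "sat S E (F_half False R p x y P n) e <->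
   Half (%q a b. opair q (opair b a) \<E> lv e n R) (lv e n p) (lv e n x) (lv e n y) (lv e n P)"
 using assms by (simp_all add: F_half_def Half_def)

definition Bis where
 "Bis R Q <-> (ALL q:S. ALL a:S. ALL b:S. q \<E> Q & opair q (opair a b) \<E> R -->
   Half (%q a b. opair q (opair a b) \<E> R) q a b Q & Half (%q a b. opair q (opair b a) \<E> R) q b a Q)"

lemma sat_F_bis [simp]:
 assumes "R < n" "P < n" "lv e n R : C"
 shows "sat S E (F_bis R P n) e <-> Bis (lv e n R) (lv e n P)" using assms by (simp add: F_bis_def Bis_def)

lemma sat_F_eq_body:
 assumes "R < n" "p < n" "x < n" "y < n" "P < n" "lv e n R : C" "lv e n x : C" "lv e n y : C"
 shows "sat S E ((F_bis R P \<^bold>\<and> F_half True R p x y P \<^bold>\<and> F_half False R p y x P) n) e <->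
  Bis (lv e n R) (lv e n P) &
  Half (%q a b. opair q (opair a b) \<E> lv e n R) (lv e n p) (lv e n x) (lv e n y) (lv e n P) &
  Half (%q a b. opair q (opair b a) \<E> lv e n R) (lv e n p) (lv e n y) (lv e n x) (lv e n P)" using assms by simp

lemma sat_F_mem_body:
 assumes "R < n" "p < n" "x < n" "y < n" "P < n" "lv e n R : C" "lv e n x : C" "lv e n y : C"
 shows "sat S E ((F_bis R P \<^bold>\<and>
   (\<^bold>\<forall>q. q \<^bold>\<in> P \<^bold>\<and> subset p q \<^bold>\<longrightarrow>
    (\<^bold>\<exists>q'. q' \<^bold>\<in> P \<^bold>\<and> subset q q' \<^bold>\<and> (\<^bold>\<exists>a. \<^bold>\<exists>r. related y a r \<^bold>\<and> r \<^bold>\<in> P \<^bold>\<and> subset r q' \<^bold>\<and>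
     F_half True R q' x a P \<^bold>\<and> F_half False R q' a x P)))) n) e <->
  Bis (lv e n R) (lv e n P) & (ALL q:S. q \<E> lv e n P & Sub (lv e n p) q -->
   (EX q':S. q' \<E> lv e n P & Sub q q' & (EX a:S. EX r:S. opair a r \<E> lv e n y & r \<E> lv e n P & Sub r q' &
    Half (%q a b. opair q (opair a b) \<E> lv e n R) q' (lv e n x) a (lv e n P) &
    Half (%q a b. opair q (opair b a) \<E> lv e n R) q' a (lv e n x) (lv e n P))))" using assms by simp

end

context fposet
begin

interpretation W: base "subs w" E "{x. x \<E> w}"
proof
 show "{x. x \<E> w} <= subs w" unfolding subs_def using univ_in[OF univ_w] by blast
 show "x : {x. x \<E> w}" if "x \<E> y" "y : subs w" for x y using that unfolding subs_def by blast
 show "x = y" if "x : subs w" "y : subs w" "!!z. z : {x. x \<E> w} ==> z \<E> x <-> z \<E> y" for x y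
  by (rule eqI) (use that in "unfold subs_def, blast")
 show "EX p:{x. x \<E> w}. ALL z:{x. x \<E> w}. z \<E> p <-> z = a | z = b"
  if "a : {x. x \<E> w}" "b : {x. x \<E> w}" for a b by (rule bexI[of _ "upair a b"]) (use that univ_upair[OF univ_w, of a b] in simp_all)
 show "{x. x \<E> w} ~= {}" using univ_om[OF univ_w] by blast
qed

lemma W_opair [simp]: "a \<E> w ==> b \<E> w ==> W.opair a b = opair a b"
proof -
 have u: "W.upair a b = upair a b" if "a \<E> w" "b \<E> w" for a b by (rule eqI) (use that W.upair(2) in auto)
 assume ab: "a \<E> w" "b \<E> w"
 thus ?thesis unfolding W.opair_def opair_def using u univ_upair[OF univ_w] by simp
qed

lemma W_Sub [simp]: "p : subs w ==> W.Sub p q <-> q <: p" by (auto simp: W.Sub_def ext'_def subs_def)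

lemma w_sub [simp]: "x \<E> w ==> x : subs w" unfolding subs_def using univ_in[OF univ_w] by blast

lemma sat_in_sets: "sat (subs w) E (in_sets F n) e = sat {x. x \<E> w} E (F n) e"
proof -
 have "{x : subs w. EX y:subs w. x \<E> y} = {x. x \<E> w}"
 proof (intro equalityI subsetI)
  fix x assume "x : {x. x \<E> w}"
  moreover have "w : subs w" by (simp add: subs_def)
  ultimately show "x : {x : subs w. EX y:subs w. x \<E> y}" using w_sub by blast
 qed (auto simp: subs_def)
 thus ?thesis by (simp add: in_sets_def sat_relativize)
qed

lemma W_Half:
 assumes "p : subs w" "!!q a b. q \<E> w ==> a \<E> w ==> b \<E> w ==> rho q a b <-> rho' q a b"
 shows "W.Half rho p x y Q <-> half rho' p x y"
 unfolding W.Half_def half_def using assms by (simp add: Ball_def Bex_def cong: conj_cong imp_cong)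

lemma W_halves:
 assumes "p : subs w"
 shows "W.Half (%q a b. W.opair q (W.opair a b) \<E> R) p x y Q <-> half (trip R) p x y"
  "W.Half (%q a b. W.opair q (W.opair b a) \<E> R) p x y Q <-> half (%q a b. trip R q b a) p x y"
 by (intro W_Half[OF assms]; simp add: univ_opair[OF univ_w])+

lemma W_Bis: "W.Bis R Q <-> bis R" unfolding W.Bis_def bis_def eqP_def by (simp add: Ball_def W_halves univ_opair[OF univ_w] cong: imp_cong)

lemma sat_F_eq:
 assumes "p < n" "x < n" "y < n" "P < n" "lv e n p : subs w"
  "lv e n x : subs w" "lv e n y : subs w" "lv e n P = Q"
 shows "sat (subs w) E (F_eq p P x y n) e <-> eqf (lv e n p) (lv e n x) (lv e n y)"
proof -
 have "sat (subs w) E (in_sets (F_bis n P \<^bold>\<and> F_half True n p x y P \<^bold>\<and> F_half False n p y x P) (Suc n)) (case_nat R e) <->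
   bis R & eqP (trip R) (lv e n p) (lv e n x) (lv e n y)" if R: "R : subs w" for R unfolding sat_in_sets
  by (subst W.sat_F_eq_body) (use assms R in "simp_all add: W_Bis W_halves eqP_def")
 thus ?thesis unfolding F_eq_def eqf_def by (simp add: Bex_def)
qed

lemma sat_F_mem:
 assumes "p < n" "x < n" "y < n" "P < n" "lv e n p : subs w"
  "lv e n x : subs w" "lv e n y : subs w" "lv e n P = Q"
 shows "sat (subs w) E (F_mem p P x y n) e <-> memf (lv e n p) (lv e n x) (lv e n y)"
proof -
 have "sat (subs w) E (in_sets (F_bis n P \<^bold>\<and>
   (\<^bold>\<forall>q. q \<^bold>\<in> P \<^bold>\<and> subset p q \<^bold>\<longrightarrow>
    (\<^bold>\<exists>q'. q' \<^bold>\<in> P \<^bold>\<and> subset q q' \<^bold>\<and> (\<^bold>\<exists>a. \<^bold>\<exists>r. related y a r \<^bold>\<and> r \<^bold>\<in> P \<^bold>\<and> subset r q' \<^bold>\<and>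
     F_half True n q' x a P \<^bold>\<and> F_half False n q' a x P)))) (Suc n)) (case_nat R e) <->
   bis R & memP (trip R) (lv e n p) (lv e n x) (lv e n y)" if R: "R : subs w" for R unfolding sat_in_sets
  by (subst W.sat_F_mem_body) (use assms R in "simp_all add: W_Bis W_halves memP_def eqP_def Ball_def Bex_def
   univ_opair[OF univ_w] cong: conj_cong imp_cong")
 thus ?thesis unfolding F_mem_def memf_def by (simp add: Bex_def)
qed

text \<open>One formula, independent of \<open>w\<close>, expresses forcing over every universe
  \<open>w\<close>. Thus \<open>reflection\<close> can compare forcing over \<open>T\<close> with
  forcing over \<open>H\<close>.\<close>

lemma sat_tr:
 assumes "p : subs w" "range t <= subs w"
 shows "sat (subs w) E (tr a) (case_nat p (case_nat Q t)) <-> frc a p t" using assms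
proof (induction a arbitrary: p t)
 case (Member i j)
 have "t i : subs w" "t j : subs w" using Member.prems by auto
 thus ?case using Member.prems(1) by (simp add: sat_rename) (subst sat_F_mem, simp_all add: lv_def numeral_2_eq_2 numeral_3_eq_3)
next
 case (Equal i j)
 have "t i : subs w" "t j : subs w" using Equal.prems by auto
 thus ?case using Equal.prems(1) by (simp add: sat_rename) (subst sat_F_eq, simp_all add: lv_def numeral_2_eq_2 numeral_3_eq_3)
next
 case (Implies a b)
 have env: "case_nat q (case_nat p (case_nat Q t)) o case_nat 0 (%k. k + 2) = case_nat q (case_nat Q t)" for q
  by (rule HOL.ext) (simp split: nat.split)
 have "sat (subs w) E (in_sets (subset 1 2) 3) (case_nat q (case_nat p (case_nat Q t))) <-> q <: p" for q
  using Implies.prems(1) by (simp add: sat_in_sets lv_def numeral_2_eq_2 numeral_3_eq_3)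
 moreover have "sat (subs w) E (rename (case_nat 0 (%k. k + 2)) (tr c)) (case_nat q (case_nat p (case_nat Q t))) <-> frc c q t"
  if c: "c = a | c = b" and q: "q : subs w" for c q
 proof -
  have "sat (subs w) E (tr c) (case_nat q (case_nat Q t)) <-> frc c q t" using c Implies.IH[OF q Implies.prems(2)] by blast
  thus ?thesis unfolding sat_rename env .
 qed
 ultimately have "sat (subs w) E (tr (Implies a b)) (case_nat p (case_nat Q t)) <->
   (ALL q:subs w. q \<E> Q --> q <: p --> frc a q t --> frc b q t)"
  unfolding tr.simps sat.simps by (simp add: numeral_2_eq_2 cong: ball_cong imp_cong)
 thus ?case using Q_w by auto
next
 case (Forall a)
 have env: "case_nat x (case_nat p (case_nat Q t)) o case_nat 1 (case_nat 2 (case_nat 0 (%k. k + 3))) =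
   case_nat p (case_nat Q (case_nat x t))" for x by (rule HOL.ext) (simp split: nat.split add: numeral_2_eq_2 numeral_3_eq_3)
 have "range (case_nat x t) <= subs w" if "x : subs w" for x using that Forall.prems(2) by (fastforce split: nat.splits)
 hence "sat (subs w) E (tr a) (case_nat p (case_nat Q (case_nat x t))) <-> frc a p (case_nat x t)"
  if "x : subs w" for x using Forall.IH[OF Forall.prems(1)] that by blast
 thus ?case by (simp add: sat_rename env Ball_def del: One_nat_def)
qed simp

text \<open>Rasiowa-Sikorski. \<open>d\<close> enumerates the whole model, and \<open>pick\<close>
  skips a set that has no member below the current condition.\<close>

lemma generic_exists:
 fixes d :: "nat => 'm"
 assumes d: "range d = UNIV" and "p0 \<E> Q"
 shows "EX g. p0 : g & generic E kap w Q g"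
proof -
 define pick where "pick D p = (if EX q. q \<E> D & q \<E> Q & q <: p then SOME q. q \<E> D & q \<E> Q & q <: p else p)" for D p
 have pick: "pick D p <: p" "p \<E> Q ==> pick D p \<E> Q"
  "EX q. q \<E> D & q \<E> Q & q <: p ==> pick D p \<E> D" for D p
  using someI_ex[of "%q. q \<E> D & q \<E> Q & q <: p"] by (auto simp: pick_def)
 define s where "s = rec_nat p0 (%n p. pick (d n) p)"
 have s0: "s 0 = p0" and sS: "s (Suc n) = pick (d n) (s n)" for n by (simp_all add: s_def)
 have sQ: "s n \<E> Q" for n by (induction n) (simp_all add: s0 sS assms(2) pick(2))
 have mono: "n <= m ==> s m <: s n" for n m
 proof (induction m)
  case (Suc m)
  thus ?case using sS pick(1) ext'_trans ext'_refl by (metis le_Suc_eq)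
 qed simp
 define g where "g = {q. q \<E> Q & (EX n. s n <: q)}"
 have "generic E kap w Q g"
 proof
  show "p \<E> Q" if "p : g" for p using that by (simp add: g_def)
  have sg: "s n : g" for n using sQ ext'_refl unfolding g_def by blast
  thus "g ~= {}" by blast
  show "q : g" if "p : g" "q \<E> Q" "p <: q" for p q using that ext'_trans unfolding g_def by blast
  show "EX r:g. r <: p & r <: q" if "p : g" "q : g" for p q
  proof -
   obtain n m where nm: "s n <: p" "s m <: q" using \<open>p : g\<close> \<open>q : g\<close> unfolding g_def by blast
   have "s (max n m) <: p" "s (max n m) <: q" using nm mono[of n "max n m"] mono[of m "max n m"] ext'_trans
    by (meson max.cobounded1 max.cobounded2)+
   thus ?thesis using sg by blast
  qed
  fix D assume D: "!!p. p \<E> Q ==> EX q. q \<E> D & q \<E> Q & q <: p"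
  obtain n where n: "d n = D" using d by (metis UNIV_I rangeE)
  have "s (Suc n) \<E> D" using sS n pick(3)[OF D[OF sQ]] by simp
  thus "EX p:g. p \<E> D" using sg by blast
 qed
 moreover have "p0 : g" unfolding g_def using assms(2) s0 ext'_refl[of "s 0"] by blast
 ultimately show ?thesis by blast
qed

end

subsection \<open>Classes of the extension\<close>

context generic
begin

lemma emp_g: "emp : g"
proof -
 obtain p where p: "p : g" using g_nonempty by blast
 show ?thesis by (rule g_up[OF p emp_Q]) (simp add: ext'_def)
qed

lemma NS_N: "X : NS ==> X : N" using w_subs by (auto simp: NS_def N_def)

lemma val_NS: "x \<E> w ==> val x : NS" by (auto simp: NS_def)
lemma val_N: "x : subs w ==> val x : N" by (auto simp: N_def)

lemma NE_NS: "NE X Y ==> X : NS"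
proof -
 assume "NE X Y"
 then obtain x y where xy: "x : subs w" "y : subs w" "X = val x" "Y = val y" "NE (val x) (val y)" unfolding NE_def by blast
 then obtain pi r where "opair pi r \<E> y" "pi \<E> w" "x \<approx> pi" using NE_pairs by blast
 thus ?thesis using val_eq xy val_NS w_subs by metis
qed

lemma NE_cases:
 assumes "NE X (val y)" "y : subs w"
 obtains pi r where "X = val pi" "opair pi r \<E> y" "pi \<E> w" "r : g"
proof -
 obtain x where x: "x : subs w" "X = val x" using assms(1) unfolding NE_def by blast
 then obtain pi r where "opair pi r \<E> y" "pi \<E> w" "r : g" "x \<approx> pi" using NE_pairs assms by blast
 thus ?thesis using that val_eq x w_subs by metis
qed

lemma NE_I:
 assumes "y : subs w" "opair pi r \<E> y" "r : g" "pi \<E> w"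
 shows "NE (val pi) (val y)" using NE_pairs[OF w_subs[OF assms(4)] assms(1)] assms same_refl by blast

text \<open>Below a condition without extensions forcing a difference \<open>W\<close>, the two
  names match each other's members and are forced equal. Hence \<open>g\<close> contains a condition
  that forces equality or a difference, and the latter contradicts \<open>xy\<close>.\<close>

lemma val_extI:
 assumes x: "x : subs w" and y: "y : subs w" and xy: "!!Z. Z : NS ==> NE Z (val x) <-> NE Z (val y)"
 shows "x \<approx> y"
proof -
 define W where "W p x y <-> (EX pi. pi \<E> w & memf p pi x & ~(EX q. q \<E> Q & q <: p & memf q pi y))" for p x y
 have Wd: "dp (%e. W (f e) x y)" if "dt f" for f x y by (rule dp_rel1[OF _ that, of "%p. W p x y"], unfold W_def, intro dps)
 have half: "half eqf p x y" if "p \<E> Q" "~(EX q. q \<E> Q & q <: p & W q x y)" for p x y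
 proof (rule halfI)
  fix pi r q assume h: "opair pi r \<E> x" "r \<E> Q" "pi \<E> w" "q \<E> Q" "q <: p" "q <: r"
  have "memf q pi x" by (rule memf_pair[OF h(1,3,2,6)])
  then obtain q1 where q1: "q1 \<E> Q" "q1 <: q" "memf q1 pi y"
   using \<open>~(EX q. q \<E> Q & q <: p & W q x y)\<close> h unfolding W_def by blast
  obtain q' pi' r' where "q' \<E> Q" "q' <: q1" "opair pi' r' \<E> y" "pi' \<E> w" "r' \<E> Q" "q' <: r'" "eqf q' pi pi'"
   by (rule memfD[OF q1(3,1) ext'_refl])
  thus "EX q' pi' r'. q' \<E> Q & q' <: q & opair pi' r' \<E> y & pi' \<E> w & r' \<E> Q & q' <: r' & eqf q' pi pi'"
   using ext'_trans[OF _ q1(2)] by blast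
 qed
 have "EX p:g. eqf p x y | W p x y | W p y x"
 proof (rule g_dense)
  show "dp (%e. eqf (e 0) x y | W (e 0) x y | W (e 0) y x)" by (intro dps Wd)
  fix p assume p: "p \<E> Q"
  show "EX q. q \<E> Q & q <: p & (eqf q x y | W q x y | W q y x)"
  proof (rule ccontr)
   assume n: "~ ?thesis"
   hence "half eqf p x y" "half eqf p y x" using half[OF p] by blast+
   hence "eqP eqf p x y" unfolding eqP_def using half_mono[of eqf p y x p "%q a b. eqf q b a"] eqf_sym by auto
   thus False using n p eqfI ext'_refl by blast
  qed
 qed
 moreover have "~W p x y" if p: "p : g" and x: "x : subs w" and y: "y : subs w"
  and xy: "!!Z. Z : NS ==> NE Z (val x) <-> NE Z (val y)" for p x y
 proof
  assume "W p x y"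
  then obtain pi where pi: "pi \<E> w" "memf p pi x" "~(EX q. q \<E> Q & q <: p & memf q pi y)" unfolding W_def by blast
  have "NE (val pi) (val x)" using NE_val[OF w_subs[OF pi(1)] x] pi(2) p by blast
  hence "NE (val pi) (val y)" using xy val_NS[OF pi(1)] by blast
  then obtain q where q: "q : g" "memf q pi y" using NE_val[OF w_subs[OF pi(1)] y] by blast
  obtain r where "r : g" "r <: p" "r <: q" using g_dir[OF p q(1)] by blast
  thus False using pi(3) memf_mono[OF q(2)] g_Q by blast
 qed
 ultimately show ?thesis using x y xy unfolding same_def by blast
qed

lemma name_upair: "a \<E> w ==> b \<E> w ==> upair (opair a emp) (opair b emp) \<E> w"
 using univ_upair[OF univ_w] univ_opair[OF univ_w] Q_w[OF emp_Q] by simp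

sublocale N: base N NE NS
proof
 show "NS <= N" using NS_N by blast
 show "X : NS" if "NE X Y" for X Y using NE_NS that .
 show "X = Y" if XY: "X : N" "Y : N" "!!Z. Z : NS ==> NE Z X <-> NE Z Y" for X Y
 proof -
  obtain x y where "x : subs w" "y : subs w" "X = val x" "Y = val y" using XY by (auto simp: N_def)
  thus ?thesis using val_extI[of x y] XY(3) val_eq by blast
 qed
 show "EX P:NS. ALL Z:NS. NE Z P <-> Z = A | Z = B" if AB: "A : NS" "B : NS" for A B
 proof -
  obtain a b where ab: "a \<E> w" "b \<E> w" "A = val a" "B = val b" using AB by (auto simp: NS_def)
  let ?p = "upair (opair a emp) (opair b emp)"
  have p: "?p \<E> w" by (rule name_upair[OF ab(1,2)])
  have "NE Z (val ?p) <-> Z = A | Z = B" for Z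
  proof
   assume "NE Z (val ?p)"
   then obtain pi r where "Z = val pi" "opair pi r \<E> ?p" using NE_cases[OF _ w_subs[OF p]] by metis
   thus "Z = A | Z = B" using ab by auto
  next
   assume "Z = A | Z = B"
   thus "NE Z (val ?p)" using NE_I[OF w_subs[OF p] _ emp_g] ab by auto
  qed
  thus ?thesis using val_NS[OF p] by blast
 qed
 show "NS ~= {}" using val_NS[OF univ_om[OF univ_w]] by blast
qed

definition opn where
 "opn a b = upair (opair (upair (opair a emp) (opair a emp)) emp) (opair (upair (opair a emp) (opair b emp)) emp)"

lemma dt_opn [dps]: "dt f ==> dt h ==> dt (%e. opn (f e) (h e))" unfolding opn_def by (intro dps)

lemma opn_w: "a \<E> w ==> b \<E> w ==> opn a b \<E> w" unfolding opn_def by (intro name_upair)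

lemma val_upair: "a \<E> w ==> b \<E> w ==> val (upair (opair a emp) (opair b emp)) = N.upair (val a) (val b)"
proof (rule N.upair_eqI)
 assume ab: "a \<E> w" "b \<E> w"
 let ?p = "upair (opair a emp) (opair b emp)"
 have p: "?p \<E> w" by (rule name_upair[OF ab])
 thus "val ?p : N" using val_NS NS_N by blast
 show "val a : NS" "val b : NS" using val_NS ab by auto
 show "NE Z (val ?p) <-> Z = val a | Z = val b" for Z
 proof
  assume "NE Z (val ?p)"
  then obtain pi r where "Z = val pi" "opair pi r \<E> ?p" using NE_cases[OF _ w_subs[OF p]] by metis
  thus "Z = val a | Z = val b" using ab by auto
 next
  assume "Z = val a | Z = val b"
  thus "NE Z (val ?p)" using NE_I[OF w_subs[OF p] _ emp_g] ab by auto
 qed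
qed

lemma val_opn: "a \<E> w ==> b \<E> w ==> val (opn a b) = N.opair (val a) (val b)"
 unfolding opn_def N.opair_def by (simp add: val_upair name_upair)

lemma NS_iff: "NS = {X : N. EX Y:N. NE X Y}"
proof (intro equalityI subsetI)
 fix X assume "X : NS"
 thus "X : {X : N. EX Y:N. NE X Y}" using N.upair[of X X] NS_N by blast
qed (use NE_NS in blast)

text \<open>The name pairs each \<open>pi\<close> in \<open>w\<close> with the conditions that force
  the formula at \<open>pi\<close>. It is a subset of \<open>w\<close> because forcing a fixed
  formula is definable.\<close>

lemma comprehension:
 assumes "range t <= N"
 shows "EX Y:N. ALL X:NS. NE X Y <-> sat NS NE a (case_nat X t)"
proof -
 have "ALL i. EX x. x : subs w & t i = val x" using assms by (auto simp: N_def)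
 then obtain s where s: "!!i. s i : subs w" "!!i. t i = val (s i)" by metis
 define F where "F p pi <-> frc (relativize a) p (case_nat pi s)" for p pi
 have Fd: "dp (%e. F (f e) (h e))" if "dt f" "dt h" for f h
 proof -
  have "dp (%e. frc (relativize a) (f e) (%i. case_nat (h e) s i))"
  proof (rule dp_frc[OF that(1)])
   show "dt (%e. case_nat (h e) s i)" for i by (cases i) (simp_all add: that dt_const')
  qed
  thus ?thesis by (simp add: F_def)
 qed
 define y where "y = Coll (prod w Q) (%u. EX pi p. u = opair pi p & F p pi)"
 have y: "opair pi p \<E> y <-> pi \<E> w & p \<E> Q & F p pi" for pi p
 proof -
  have "dp (%e. EX pi p. e 0 = opair pi p & F p pi)" by (intro dps Fd)
  from mem_Coll[OF this] show ?thesis by (auto simp: y_def)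
 qed
 have "u \<E> w" if "u \<E> y" for u
 proof -
  have "dp (%e. EX pi p. e 0 = opair pi p & F p pi)" by (intro dps Fd)
  from mem_Coll[OF this] that have "u \<E> prod w Q" by (auto simp: y_def)
  thus ?thesis using univ_opair[OF univ_w] Q_w by (auto simp: prod_iff)
 qed
 hence yw: "y : subs w" by (auto simp: subs_def)
 have tr: "sat NS NE a (case_nat (val pi) t) <-> (EX p:g. F p pi)" if "pi \<E> w" for pi
 proof -
  have r: "range (case_nat pi s) <= subs w" using s(1) w_subs[OF that] by (auto split: nat.splits)
  have c: "val o case_nat pi s = case_nat (val pi) t" by (rule HOL.ext) (simp add: s split: nat.split)
  show ?thesis using truth[OF r, of "relativize a"] unfolding c sat_relativize NS_iff[symmetric] F_def .
 qed
 have "NE X (val y) <-> sat NS NE a (case_nat X t)" if X: "X : NS" for X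
 proof
  assume "NE X (val y)"
  then obtain pi r where "X = val pi" "opair pi r \<E> y" "pi \<E> w" "r : g" using NE_cases[OF _ yw] by metis
  thus "sat NS NE a (case_nat X t)" using tr y by blast
 next
  assume sat: "sat NS NE a (case_nat X t)"
  obtain pi where pi: "pi \<E> w" "X = val pi" using X by (auto simp: NS_def)
  then obtain p where "p : g" "F p pi" using tr sat by blast
  thus "NE X (val y)" unfolding pi using y g_Q pi by (intro NE_I[OF yw, of _ p]) auto
 qed
 thus ?thesis using val_N[OF yw] by blast
qed

lemma class_exists:
 assumes "N.dp (%e. R (e 0))"
 shows "EX Y:N. ALL X:NS. NE X Y <-> R X"
proof -
 obtain p c where p: "range c <= N" "!!e. range e <= NS ==> R (e 0) = sat NS NE p (weave e c)" using assms unfolding N.dp_def by blast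
 define r where "r i = (if even i then 0 else Suc (i div 2))" for i :: nat
 have "weave (%_. X) c = case_nat X c o r" for X by (rule sym, rule weave_eqI) (auto simp: r_def)
 hence "R X = sat NS NE (rename r p) (case_nat X c)" if "X : NS" for X using p(2)[of "%_. X"] that by (simp add: sat_rename)
 thus ?thesis using comprehension[OF p(1), of "rename r p"] by auto
qed

text \<open>If no condition below some \<open>p\<close> forces a minimal element, the names that can
  be forced into \<open>x\<close> below \<open>p\<close> have no minimal one either: each has a
  member of the same kind. Induction along membership in the ground model excludes this.\<close>

lemma N_foundation:
 assumes "X : N" "NE Y X"
 shows "EX Y. NE Y X & (ALL Z. NE Z Y --> ~NE Z X)"
proof -
 obtain x where x: "x : subs w" "X = val x" using assms by (auto simp: N_def)
 obtain pi0 where pi0: "pi0 \<E> w" "Y = val pi0" using NE_NS[OF assms(2)] by (auto simp: NS_def)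
 then obtain p0 where p0: "p0 : g" "memf p0 pi0 x" using NE_val[OF w_subs[OF pi0(1)] x(1)] assms(2) x by blast
 have "EX p:g. p <: p0 & (EX pi. pi \<E> w & memf p pi x &
   ~(EX q rho. q \<E> Q & q <: p & rho \<E> w & memf q rho pi & memf q rho x))"
 proof (rule g_dense_below[OF _ p0(1)])
  show "dp (%e. EX pi. pi \<E> w & memf (e 0) pi x &
   ~(EX q rho. q \<E> Q & q <: e 0 & rho \<E> w & memf q rho pi & memf q rho x))" by (intro dps)
  fix p assume p: "p \<E> Q" "p <: p0"
  define Z where "Z pi <-> (EX q. q \<E> Q & q <: p & memf q pi x)" for pi
  have Zd: "dp (%e. Z (f e))" if "dt f" for f by (rule dp_rel1[OF _ that, of Z], unfold Z_def, intro dps)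
  show "EX q. q \<E> Q & q <: p & (EX pi. pi \<E> w & memf q pi x &
   ~(EX q' rho. q' \<E> Q & q' <: q & rho \<E> w & memf q' rho pi & memf q' rho x))"
  proof (rule ccontr)
   assume n: "~ ?thesis"
   have step: "EX pi' r. opair pi' r \<E> pi & pi' \<E> w & Z pi'" if pi: "pi \<E> w" "Z pi" for pi
   proof -
    obtain q where q: "q \<E> Q" "q <: p" "memf q pi x" using pi unfolding Z_def by blast
    then obtain q1 rho where q1: "q1 \<E> Q" "q1 <: q" "rho \<E> w" "memf q1 rho pi" "memf q1 rho x" using n pi by blast
    obtain q' pi' r where 2: "q' \<E> Q" "q' <: q1" "opair pi' r \<E> pi" "pi' \<E> w" "r \<E> Q" "q' <: r" "eqf q' rho pi'"
     by (rule memfD[OF q1(4,1) ext'_refl])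
    have "memf q' pi' x" using memf_cong1[OF memf_mono[OF q1(5) 2(2)] 2(7)] .
    hence "Z pi'" unfolding Z_def using 2 q q1 ext'_trans by blast
    thus ?thesis using 2 by blast
   qed
   \<comment> \<open>A member \<open>pi'\<close> of the name \<open>u\<close> lies three levels
     down, as \<open>pi'\<close> is in \<open>{pi'}\<close>, which is in the pair, which is in
     \<open>u\<close>. The statement is strengthened to reach that depth.\<close>
   have "~Z u & (ALL v. v \<E> u --> ~Z v & (ALL v'. v' \<E> v --> ~Z v'))" if "u \<E> w" for u using univ_trans[OF univ_w] _ that
   proof (rule trans_induct)
    show "dp (%e. ~Z (e 0) & (ALL v. v \<E> e 0 --> ~Z v & (ALL v'. v' \<E> v --> ~Z v')))" by (intro dps Zd)
    fix u assume u: "u \<E> w"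
     and IH: "!!v. v \<E> u ==> ~Z v & (ALL v'. v' \<E> v --> ~Z v' & (ALL v''. v'' \<E> v' --> ~Z v''))"
    have "~Z u"
    proof
     assume "Z u"
     then obtain pi' r where "opair pi' r \<E> u" "Z pi'" using step[OF u] by blast
     moreover have "upair pi' pi' \<E> opair pi' r" by (simp add: opair_def)
     moreover have "pi' \<E> upair pi' pi'" by simp
     ultimately show False using IH by blast
    qed
    thus "~Z u & (ALL v. v \<E> u --> ~Z v & (ALL v'. v' \<E> v --> ~Z v'))" using IH by blast
   qed
   hence "~Z pi0" using pi0 by blast
   moreover have "Z pi0" unfolding Z_def using p ext'_refl memf_mono[OF p0(2) p(2)] by blast
   ultimately show False by blast
  qed
 qed
 then obtain p pi where p: "p : g" "pi \<E> w" "memf p pi x"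
  "~(EX q rho. q \<E> Q & q <: p & rho \<E> w & memf q rho pi & memf q rho x)" by blast
 have "~NE Z X" if Z: "NE Z (val pi)" for Z
 proof
  assume ZX: "NE Z X"
  obtain rho where rho: "rho \<E> w" "Z = val rho" using NE_NS[OF Z] by (auto simp: NS_def)
  obtain q q' where q: "q : g" "memf q rho pi" "q' : g" "memf q' rho x"
   using NE_val[OF w_subs[OF rho(1)] w_subs[OF p(2)]] NE_val[OF w_subs[OF rho(1)] x(1)] Z ZX rho(2) x(2) by blast
  obtain r where r: "r : g" "r <: p" "r <: q" using g_dir[OF p(1) q(1)] by blast
  obtain r' where r': "r' : g" "r' <: r" "r' <: q'" using g_dir[OF r(1) q(3)] by blast
  show False using p(4) g_Q[OF r'(1)] ext'_trans[OF r'(2) r(2)] rho(1)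
    memf_mono[OF q(2) ext'_trans[OF r'(2) r(3)]] memf_mono[OF q(4) r'(3)] by blast
 qed
 moreover have "NE (val pi) X" using NE_val[OF w_subs[OF p(2)] x(1)] p x by blast
 ultimately show ?thesis by blast
qed

end

section \<open>The forcing notion\<close>

context zf
begin

lemma app_sub:
 assumes "isfn q b" "isfn p a" "p <: q | q <: p" "x \<E> a" "x \<E> b"
 shows "app p x = app q x" using assms(3)
proof
 assume "p <: q"
 hence "opair x (app q x) \<E> p" using isfn_opair[OF assms(1), of x "app q x"] assms(5) by (simp add: ext'_def)
 thus ?thesis using isfn_opair[OF assms(2)] by simp
next
 assume "q <: p"
 hence "opair x (app p x) \<E> q" using isfn_opair[OF assms(2), of x "app p x"] assms(4) by (simp add: ext'_def)
 thus ?thesis using isfn_opair[OF assms(1)] by simp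
qed

lemma ext'_dom: "q <: p ==> x \<E> dom p ==> x \<E> dom q" by (auto simp: ext'_def)

lemma isfn_cup:
 assumes "isfn p a" "isfn q b" "ALL x. x \<E> a --> ~x \<E> b"
 shows "isfn (cup p q) (cup a b)" "x \<E> a ==> app (cup p q) x = app p x" "x \<E> b ==> app (cup p q) x = app q x"
proof -
 show i: "isfn (cup p q) (cup a b)"
 proof (rule isfnI)
  show "EX x y. x \<E> cup a b & u = opair x y" if "u \<E> cup p q" for u
   using that isfn_mem[OF assms(1), of u] isfn_mem[OF assms(2), of u] by auto
  show "EX! y. opair x y \<E> cup p q" if "x \<E> cup a b" for x
   using that assms(3) by (auto simp: isfn_opair[OF assms(1)] isfn_opair[OF assms(2)])
 qed
 have "cup p q <: p" "cup p q <: q" by (auto simp: ext'_def)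
 thus "x \<E> a ==> app (cup p q) x = app p x" "x \<E> b ==> app (cup p q) x = app q x"
  using app_sub[OF assms(1) i] app_sub[OF assms(2) i] by auto
qed

lemma Ord_max: "Ord a ==> Ord b ==> EX c. (c = a | c = b) & (ALL x. x \<E> a | x \<E> b --> x \<E> c)"
 using Ord_lin[of a b] Ord_transD by blast

end

context supercompact
begin

section \<open>Universes inside \<open>H\<close>\<close>

definition uni where "uni T <-> univ T & T \<E> H"

lemma dp_uni [dps]: "dt f ==> dp (%e. uni (f e))" by (rule dp_rel1[of uni], unfold uni_def, intro dps)

lemma uni_univ: "uni T ==> univ T" by (simp add: uni_def)

definition Ords where "Ords T = Coll T Ord"

lemma Ords_iff [simp]: "x \<E> Ords T <-> x \<E> T & Ord x" unfolding Ords_def by (rule mem_Coll) (intro dps)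

lemma dt_Ords [dps]: "dt f ==> dt (%e. Ords (f e))" unfolding Ords_def by (intro dps)

lemma Ord_Ords: "univ T ==> Ord (Ords T)" unfolding Ord_def[of "Ords T"] trans_def using univ_in Ord_in Ord_lin unfolding Ords_iff by blast

context
 fixes w assumes w: "univ w"
begin

lemma univ_sng: "x \<E> w ==> sng x \<E> w" using univ_upair[OF w] by (simp add: sng_def)

lemma univ_cup: "x \<E> w ==> y \<E> w ==> cup x y \<E> w" using univ_union[OF w univ_upair[OF w]] by (simp add: cup_def)

lemma univ_suc: "x \<E> w ==> suc x \<E> w" unfolding suc_def by (intro univ_cup univ_sng)

lemma univ_emp: "emp \<E> w" by (rule univ_in[OF w univ_om[OF w] emp_om])

lemma univ_dom: "p \<E> w ==> dom p \<E> w" by (rule univ_sub[OF w univ_union[OF w univ_union[OF w]], of p]) (use opair_union in auto)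

lemma univ_prod: "x \<E> w ==> y \<E> w ==> prod x y \<E> w"
proof -
 assume xy: "x \<E> w" "y \<E> w"
 have d: "dt (%e. prod (sng (e 0)) y)" by (intro dps)
 have "prod (sng a) y \<E> w" if "a \<E> x" for a
 proof -
  have d': "dt (%e. opair a (e 0))" by (intro dps)
  have "prod (sng a) y = Img y (opair a)" by (rule eqI) (auto simp: prod_iff mem_Img[OF d'])
  thus ?thesis using univ_repl[OF w d' xy(2)] univ_opair[OF w] univ_in[OF w] xy that by auto
 qed
 hence "union (Img x (%a. prod (sng a) y)) \<E> w" by (intro univ_union[OF w] univ_repl[OF w d] xy) auto
 moreover have "union (Img x (%a. prod (sng a) y)) = prod x y" by (rule eqI) (auto simp: prod_iff mem_Img[OF d])
 ultimately show ?thesis by simp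
qed

text \<open>By induction, each ordinal up to \<open>z\<close> is the image of a subset of
  \<open>T\<close> under the inverse of \<open>f\<close>, so replacement in \<open>w\<close> yields
  it.\<close>

lemma univ_ord_inj:
 assumes z: "Ord z" and T: "T \<E> w" and f: "!!x. x \<E> z ==> app f x \<E> T"
  and inj: "!!x x'. x \<E> z ==> x' \<E> z ==> app f x = app f x' ==> x = x'"
 shows "z \<E> w"
proof -
 define h where "h = Coll (prod T z) (%u. EX x. u = opair (app f x) x)"
 have h: "opair y x \<E> h <-> x \<E> z & y = app f x" for x y
 proof -
  have "dp (%e. EX x. e 0 = opair (app f x) x)" by (intro dps)
  from mem_Coll[OF this] show ?thesis unfolding h_def using f by auto
 qed
 have hf: "app h (app f x) = x" if "x \<E> z" for x by (rule app_eq) (use h inj that in metis)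
 have dh: "dt (%e. app h (e 0))" by (intro dps)
 have "x \<E> suc z --> x \<E> w" if "Ord x" for x
 proof (rule Ord_induct[of "%x. x \<E> suc z --> x \<E> w", OF _ that], intro dps, intro impI)
  fix x assume IH: "!!y. y \<E> x ==> y \<E> suc z --> y \<E> w" and x: "x \<E> suc z"
  have xz: "y \<E> z" if "y \<E> x" for y using x that Ord_transD[OF z] by auto
  let ?S = "Coll T (%u. EX y. y \<E> x & u = app f y)"
  have S: "u \<E> ?S <-> u \<E> T & (EX y. y \<E> x & u = app f y)" for u by (rule mem_Coll) (intro dps)
  have "?S \<E> w" by (rule univ_sub[OF w T]) (simp add: S)
  hence "Img ?S (app h) \<E> w" by (rule univ_repl[OF w dh]) (use S hf xz IH in auto)
  moreover have "Img ?S (app h) = x"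
  proof (rule eqI2)
   show "u \<E> x" if "u \<E> Img ?S (app h)" for u using that hf xz unfolding mem_Img[OF dh] S by auto
   show "u \<E> Img ?S (app h)" if "u \<E> x" for u
    unfolding mem_Img[OF dh] S using hf[OF xz[OF that]] f[OF xz[OF that]] that by (intro exI[of _ "app f u"]) auto
  qed
  ultimately show "x \<E> w" by simp
 qed
 thus ?thesis using z by simp
qed

end

text \<open>\<open>T\<close> is contained in the level of the cumulative hierarchy indexed by its
  height \<open>Ords T\<close>, and \<open>w\<close> contains each level whose index it
  contains.\<close>

lemma uni_mem:
 assumes T: "univ T" and w: "univ w" and d: "Ords T \<E> w"
 shows "T \<E> w"
proof -
 have G: "dt (%e. union (Img (ran (e 1)) Pow))" by (intro dps)
 obtain V where V: "dt (%e. V (e 0))" and Veq: "!!a. Ord a ==> V a = union (Img (ran (lam a V)) Pow)"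
  using ordrec[of "%a h. union (Img (ran h) Pow)", OF G] by blast
 note V' = dt_fun1[OF V]
 have dP: "dt (%e. Pow (e 0))" by (intro dps)
 have Vi: "z \<E> V a <-> (EX b. b \<E> a & (ALL u. u \<E> z --> u \<E> V b))" if "Ord a" for a z
  unfolding Veq[OF that] union_iff mem_Img[OF dP] ran_iff lam_iff[OF V] opair_eq by (metis Pow_iff)
 have Vw: "a \<E> w --> V a \<E> w" if "Ord a" for a
 proof (rule Ord_induct[of "%a. a \<E> w --> V a \<E> w", OF _ that], intro dps V', intro impI)
  fix a assume a: "Ord a" "a \<E> w" and IH: "!!b. b \<E> a ==> b \<E> w --> V b \<E> w"
  have "ran (lam a V) = Img a V" by (rule eqI) (auto simp: lam_iff[OF V] mem_Img[OF V])
  moreover have "Img a V \<E> w" by (rule univ_repl[OF w V a(2)]) (use IH univ_in[OF w a(2)] in blast)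
  moreover have "Img b Pow \<E> w" if "b \<E> w" for b by (rule univ_repl[OF w dP that]) (use univ_Pow[OF w] univ_in[OF w that] in blast)
  ultimately show "V a \<E> w" unfolding Veq[OF a(1)] using univ_union[OF w] by simp
 qed
 have "EX a. a \<E> T & Ord a & (ALL u. u \<E> x --> u \<E> V a)" if "x \<E> T" for x
 proof (rule trans_induct[OF univ_trans[OF T] _ that])
  show "dp (%e. EX a. a \<E> T & Ord a & (ALL u. u \<E> e 0 --> u \<E> V a))" by (intro dps V')
  fix x assume x: "x \<E> T" and IH: "!!y. y \<E> x ==> EX a. a \<E> T & Ord a & (ALL u. u \<E> y --> u \<E> V a)"
  have "dp (%e. Ord (e 1) & (ALL u. u \<E> e 0 --> u \<E> V (e 1)))" by (intro dps V')
  from AC_fun[of "%y a. Ord a & (ALL u. u \<E> y --> u \<E> V a)", OF this] IH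
  obtain s where s: "!!y. y \<E> x ==> app s y \<E> T & Ord (app s y) & (ALL u. u \<E> y --> u \<E> V (app s y))" by blast
  have ds: "dt (%e. suc (app s (e 0)))" by (intro dps)
  let ?A = "union (Img x (%y. suc (app s y)))"
  have A: "z \<E> ?A <-> (EX y. y \<E> x & (z \<E> app s y | z = app s y))" for z by (auto simp: mem_Img[OF ds])
  have "?A \<E> T" by (intro univ_union[OF T] univ_repl[OF T ds x]) (use s univ_suc[OF T] in blast)
  moreover have OA: "Ord ?A" by (rule Ord_union) (use s Ord_suc in "auto simp: mem_Img[OF ds]")
  moreover have "u \<E> V ?A" if "u \<E> x" for u unfolding Vi[OF OA] using A[of "app s u"] s[OF that] that by blast
  ultimately show "EX a. a \<E> T & Ord a & (ALL u. u \<E> x --> u \<E> V a)" by blast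
 qed
 hence "x \<E> V (Ords T)" if "x \<E> T" for x using that Vi[OF Ord_Ords[OF T]] by (metis Ords_iff)
 thus ?thesis using univ_sub[OF w] Vw[OF Ord_Ords[OF T]] d by blast
qed

lemma uni_cases:
 assumes "univ T" "univ T'"
 shows "T \<E> T' | (ALL x. Ord x --> x \<E> T' --> x \<E> T)"
 using Ord_lin[OF Ord_Ords[OF assms(1)] Ord_Ords[OF assms(2)]] uni_mem[OF assms] by (metis Ords_iff Ord_Ords[OF assms(1)] Ord_transD)

text \<open>The ordinals between two consecutive universes form one class of this equivalence.
  Entries stay within a class, so restricting a condition to a universe never cuts a
  relation.\<close>

definition near where
 "near x y <-> (ALL T. uni T --> (x \<E> T <-> y \<E> T))"

lemma dp_near [dps]: "dt f ==> dt g ==> dp (%e. near (f e) (g e))" by (rule dp_rel2[of near], unfold near_def, intro dps)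

section \<open>Vertices, their relations, and conditions\<close>

abbreviation entry :: "'m => 'm => 'm => 'm" where
 "entry k x n \<equiv> opair k (opair x n)"

definition vert where
 "vert D b c <-> Ord b &
  (ALL u. u \<E> c --> (EX k x n. u = entry k x n & k \<E> om & n \<E> om & x \<E> D & x \<E> b & near x b)) &
  (ALL h. h \<E> b --> (EX K. K \<E> om & (ALL k x n. entry k x n \<E> c --> ~k \<E> K --> ~x \<E> h)))"

definition good where
 "good p f <-> (ALL b. b \<E> dom p --> app f b \<E> om &
   (ALL k x n. entry k x n \<E> app p b --> ~k \<E> app f b --> n \<E> app f x))"

definition bdd where
 "bdd D T <-> (EX h. Ord h & h \<E> T & (ALL x. x \<E> D --> x \<E> T --> x \<E> h))"

text \<open>A condition \<open>p\<close> assigns to each vertex \<open>b\<close> a relation \<open>p(b)\<close> of triples \<open>(k, (x, n))\<close> that tends to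
 \<open>b\<close>; \<open>good p f\<close> says that \<open>f x > n\<close> for all those triples with \<open>k >= f b\<close>. The domain has Easton
 support with respect to the universes.\<close>

definition cond where
 "cond p <-> p \<E> H & isfn p (dom p) & (ALL b. b \<E> dom p --> vert (dom p) b (app p b)) &
   (ALL T. uni T --> bdd (dom p) T) & (EX f. good p f)"

lemma dp_vert [dps]: "dt f ==> dt g ==> dt h ==> dp (%e. vert (f e) (g e) (h e))" by (rule dp_rel3[of vert], unfold vert_def, intro dps)
lemma dp_good [dps]: "dt f ==> dt g ==> dp (%e. good (f e) (g e))" by (rule dp_rel2[of good], unfold good_def, intro dps)
lemma dp_bdd [dps]: "dt f ==> dt g ==> dp (%e. bdd (f e) (g e))" by (rule dp_rel2[of bdd], unfold bdd_def, intro dps)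
lemma dp_cond [dps]: "dt f ==> dp (%e. cond (f e))" by (rule dp_rel1[of cond], unfold cond_def, intro dps)

lemma cond_H: "cond p ==> p \<E> H" and cond_isfn: "cond p ==> isfn p (dom p)"
 and cond_vert: "cond p ==> b \<E> dom p ==> vert (dom p) b (app p b)"
 and cond_bdd: "cond p ==> uni T ==> bdd (dom p) T" and cond_good: "cond p ==> EX f. good p f"
 unfolding cond_def by blast+

lemma cond_Ord: "cond p ==> b \<E> dom p ==> Ord b" using cond_vert unfolding vert_def by blast

lemma cond_entry:
 assumes "cond p" "b \<E> dom p" "entry k x n \<E> app p b"
 shows "k \<E> om" "n \<E> om" "x \<E> dom p" "x \<E> b" "near x b"
 using cond_vert[OF assms(1,2)] assms(3) unfolding vert_def by fastforce+

lemma cond_ext_app: "cond p ==> cond q ==> q <: p ==> b \<E> dom p ==> app q b = app p b"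
 using app_sub[OF cond_isfn cond_isfn] ext'_dom by blast

lemma vert_mono: "vert D b c ==> (!!x. x \<E> D ==> near x b ==> x \<E> D') ==> vert D' b c" unfolding vert_def by blast

lemma vert_emp: "Ord b ==> vert D b emp" unfolding vert_def using emp_om by auto

lemma cond_emp: "cond emp"
proof -
 have [simp]: "dom emp = emp" by (rule eqI) simp
 have "isfn emp emp" by (rule isfnI) auto
 thus ?thesis unfolding cond_def bdd_def good_def using univ_emp[OF univ_H] univ_emp[OF uni_univ] Ord_emp by auto
qed

end

context supercompact
begin

subsection \<open>Restriction and amalgamation of conditions\<close>

definition rs where
 "rs p A = Coll p (%u. EX b y. u = opair b y & A b)"

lemma rs_iff:
 assumes A: "dp (%e. A (e 0))"
 shows "u \<E> rs p A <-> u \<E> p & (EX b y. u = opair b y & A b)"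
proof -
 note A' = dp_rel1[OF A]
 show ?thesis unfolding rs_def by (rule mem_Coll) (intro dps A')
qed

lemma cond_rs:
 assumes p: "cond p" and A: "dp (%e. A (e 0))" and inv: "!!x b. near x b ==> A x <-> A b"
 shows "cond (rs p A)" "x \<E> dom (rs p A) <-> x \<E> dom p & A x"
proof -
 let ?q = "rs p A"
 note q = rs_iff[OF A, of _ p]
 have d: "x \<E> dom ?q <-> x \<E> dom p & A x" for x by (auto simp: q)
 thus "x \<E> dom ?q <-> x \<E> dom p & A x" .
 have f: "isfn ?q (dom ?q)"
 proof (rule isfnI)
  show "EX x y. x \<E> dom ?q & u = opair x y" if "u \<E> ?q" for u using that q by auto
  show "EX! y. opair x y \<E> ?q" if "x \<E> dom ?q" for x
  proof -
   have "opair x y \<E> ?q <-> y = app p x" for y using that unfolding d q isfn_opair[OF cond_isfn[OF p]] by blast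
   thus ?thesis by simp
  qed
 qed
 have "p <: ?q" by (simp add: ext'_def q)
 hence app: "app ?q x = app p x" if "x \<E> dom ?q" for x using app_sub[OF cond_isfn[OF p] f _ that] that unfolding d by blast
 have v: "vert (dom ?q) b (app ?q b)" if b: "b \<E> dom ?q" for b unfolding app[OF b]
 proof (rule vert_mono)
  show "vert (dom p) b (app p b)" using cond_vert[OF p] b d by blast
  show "x \<E> dom ?q" if "x \<E> dom p" "near x b" for x using that b d inv by blast
 qed
 obtain f where "good p f" using cond_good[OF p] by blast
 hence g: "good ?q f" unfolding good_def using d app by metis
 have "bdd (dom ?q) T" if "uni T" for T using cond_bdd[OF p that] d unfolding bdd_def by blast
 moreover have "?q \<E> H" by (rule univ_sub[OF univ_H cond_H[OF p]]) (simp add: q)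
 ultimately show "cond ?q" unfolding cond_def using f v g by blast
qed

text \<open>Entries lead into the domain of their own condition, so on disjoint domains the
  witnesses of goodness do not interfere.\<close>

lemma glue:
 assumes p: "cond p" and q: "cond q" and disj: "!!x. x \<E> dom p ==> ~x \<E> dom q"
 shows "cond (cup p q)" "x \<E> dom (cup p q) <-> x \<E> dom p | x \<E> dom q"
proof -
 let ?r = "cup p q"
 have d: "dom ?r = cup (dom p) (dom q)" by (rule eqI) auto
 thus "x \<E> dom ?r <-> x \<E> dom p | x \<E> dom q" by simp
 have disj': "ALL x. x \<E> dom p --> ~x \<E> dom q" using disj by blast
 note c = isfn_cup[OF cond_isfn[OF p] cond_isfn[OF q] disj']
 have v: "vert (dom ?r) b (app ?r b)" if "b \<E> dom ?r" for b
 proof (cases "b \<E> dom p")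
  case True
  show ?thesis unfolding c(2)[OF True] by (rule vert_mono[OF cond_vert[OF p True]]) auto
 next
  case False
  hence b: "b \<E> dom q" using that d by simp
  show ?thesis unfolding c(3)[OF b] by (rule vert_mono[OF cond_vert[OF q b]]) auto
 qed
 obtain f g where fg: "good p f" "good q g" using cond_good p q by blast
 let ?f = "lam (dom p) (app f)" and ?g = "lam (dom q) (app g)"
 have da: "dt (%e. app f (e 0))" "dt (%e. app g (e 0))" by (intro dps)+
 note h = isfn_cup[OF isfn_lam[OF da(1)] isfn_lam[OF da(2)] disj']
 have hp: "app (cup ?f ?g) x = app f x" if "x \<E> dom p" for x using h(2)[OF that] app_lam[OF da(1) that] by simp
 have hq: "app (cup ?f ?g) x = app g x" if "x \<E> dom q" for x using h(3)[OF that] app_lam[OF da(2) that] by simp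
 have "good ?r (cup ?f ?g)" unfolding good_def
 proof (intro allI impI)
  fix b assume "b \<E> dom ?r"
  then consider "b \<E> dom p" | "b \<E> dom q" using d by auto
  thus "app (cup ?f ?g) b \<E> om & (ALL k x n. entry k x n \<E> app ?r b --> ~k \<E> app (cup ?f ?g) b --> n \<E> app (cup ?f ?g) x)"
  proof cases
   case 1
   thus ?thesis using fg(1) cond_entry(3)[OF p 1] hp c(2)[OF 1] unfolding good_def by auto
  next
   case 2
   thus ?thesis using fg(2) cond_entry(3)[OF q 2] hq c(3)[OF 2] unfolding good_def by auto
  qed
 qed
 moreover have "bdd (dom ?r) T" if T: "uni T" for T
 proof -
  obtain h1 h2 where h: "Ord h1" "h1 \<E> T" "!!x. x \<E> dom p ==> x \<E> T ==> x \<E> h1"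
   "Ord h2" "h2 \<E> T" "!!x. x \<E> dom q ==> x \<E> T ==> x \<E> h2" using cond_bdd[OF p T] cond_bdd[OF q T] unfolding bdd_def by blast
  then obtain c where "c = h1 | c = h2" "!!x. x \<E> h1 | x \<E> h2 ==> x \<E> c" using Ord_max[OF h(1,4)] by blast
  thus ?thesis unfolding bdd_def d cup_iff using h by blast
 qed
 moreover have "?r \<E> H" using univ_cup[OF univ_H] cond_H p q by blast
 moreover have "isfn ?r (dom ?r)" using c(1) d by simp
 ultimately show "cond ?r" unfolding cond_def using v by blast
qed

subsection \<open>Adding isolated vertices\<close>

lemma add_isolated:
 assumes p: "cond p" and z: "z \<E> H" "!!x. x \<E> z ==> Ord x & ~x \<E> dom p" and b: "!!T. uni T ==> bdd z T"
 shows "cond (cup p (lam z (%_. emp)))" "x \<E> dom (cup p (lam z (%_. emp))) <-> x \<E> dom p | x \<E> z"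
proof -
 let ?q = "lam z (%_. emp)"
 have dc: "dt (%e. emp)" by (intro dps)
 have f: "isfn ?q z" by (rule isfn_lam[OF dc])
 have d: "dom ?q = z" by (rule isfn_dom[OF f])
 have "?q \<E> H" by (rule univ_sub[OF univ_H univ_prod[OF univ_H z(1) univ_sng[OF univ_H univ_emp[OF univ_H]]]])
   (auto simp: lam_iff[OF dc])
 moreover have "good ?q (lam z (%_. emp))" unfolding good_def d using dc emp_om by simp
 ultimately have "cond ?q" unfolding cond_def d using f b z(2) dc vert_emp by auto
 note g = glue[OF p this]
 show "cond (cup p ?q)" by (rule g(1)) (use z(2) d in auto)
 have "x \<E> dom (cup p ?q) <-> x \<E> dom p | x \<E> dom ?q" by auto
 thus "x \<E> dom (cup p ?q) <-> x \<E> dom p | x \<E> z" unfolding d .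
qed

text \<open>The missing ordinals up to and including the least strict upper bound of the vertices in
  each class of \<open>near\<close>. Their relations are frozen as empty, so that no later relation
  can accumulate on \<open>dom p\<close> there.\<close>

definition fill where
 "fill p = Coll H (%z. Ord z & ~z \<E> dom p & (EX x. x \<E> dom p & near x z) &
   (ALL h. h \<E> z --> near h z --> (EX x. x \<E> dom p & near x z & (h \<E> x | h = x))))"

definition hat where
 "hat p = cup p (lam (fill p) (%_. emp))"

lemma dt_hat [dps]: "dt f ==> dt (%e. hat (f e))" by (rule dt_fun1[of hat], unfold hat_def fill_def, intro dps)

lemma fill_iff: "z \<E> fill p <-> z \<E> H & Ord z & ~z \<E> dom p & (EX x. x \<E> dom p & near x z) &
   (ALL h. h \<E> z --> near h z --> (EX x. x \<E> dom p & near x z & (h \<E> x | h = x)))"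
 unfolding fill_def by (rule mem_Coll) (intro dps)

lemma fill_bound:
 assumes z: "z \<E> fill p" and e: "Ord e" "!!x. x \<E> dom p ==> near x z ==> x \<E> e"
 shows "z \<E> suc e"
proof (rule ccontr)
 assume n: "~z \<E> suc e"
 have "e \<E> z" using Ord_lin[OF e(1), of z] z n by (auto simp: fill_iff)
 obtain x where x: "x \<E> dom p" "near x z" using z by (auto simp: fill_iff)
 \<comment> \<open>\<open>e\<close> lies strictly between \<open>x\<close> and \<open>z\<close>,
   which belong to one class, so it belongs to the class as well and violates the last clause of
   \<open>fill\<close>.\<close>
 have "near e z" unfolding near_def
 proof (intro allI impI)
  fix T assume T: "uni T"
  show "e \<E> T <-> z \<E> T" using \<open>e \<E> z\<close> univ_in[OF uni_univ[OF T]] x e(2)[OF x] T unfolding near_def by blast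
 qed
 then obtain x' where "x' \<E> dom p" "near x' z" "e \<E> x' | e = x'" using z \<open>e \<E> z\<close> unfolding fill_iff by blast
 thus False using e(2) mem_asym by auto
qed

lemma cond_hat:
 assumes p: "cond p"
 shows "cond (hat p)" "x \<E> dom (hat p) <-> x \<E> dom p | x \<E> fill p" "hat p <: p"
proof -
 have ds: "dt (%e. suc (e 0))" by (intro dps)
 let ?u = "union (Img (dom p) suc)"
 have u: "Ord ?u" by (rule Ord_union) (use cond_Ord[OF p] Ord_suc in "auto simp: mem_Img[OF ds]")
 have dp: "dom p \<E> H" by (rule univ_dom[OF univ_H cond_H[OF p]])
 have "?u \<E> H" by (intro univ_union[OF univ_H] univ_repl[OF univ_H ds dp] univ_suc[OF univ_H] univ_in[OF univ_H dp])
 hence "suc ?u \<E> H" by (rule univ_suc[OF univ_H])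
 moreover have "z \<E> suc ?u" if "z \<E> fill p" for z
  by (rule fill_bound[OF that u]) (unfold union_iff mem_Img[OF ds], use suc_iff in blast)
 ultimately have "fill p \<E> H" using univ_sub[OF univ_H] by blast
 moreover have "bdd (fill p) T" if T: "uni T" for T
 proof -
  obtain h where h: "Ord h" "h \<E> T" "!!x. x \<E> dom p ==> x \<E> T ==> x \<E> h" using cond_bdd[OF p T] unfolding bdd_def by blast
  have "z \<E> suc h" if "z \<E> fill p" "z \<E> T" for z
   by (rule fill_bound[OF that(1) h(1)]) (use h(3) that(2) T in "auto simp: near_def")
  thus ?thesis unfolding bdd_def using Ord_suc[OF h(1)] univ_suc[OF uni_univ[OF T] h(2)] by blast
 qed
 moreover have "Ord z & ~z \<E> dom p" if "z \<E> fill p" for z using that unfolding fill_iff by blast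
 ultimately show "cond (hat p)" "x \<E> dom (hat p) <-> x \<E> dom p | x \<E> fill p" unfolding hat_def using add_isolated[OF p] by blast+
 show "hat p <: p" by (auto simp: hat_def ext'_def)
qed

definition isolated where
 "isolated D q <-> (ALL b. b \<E> dom q --> ~b \<E> D -->
   (EX K. K \<E> om & (ALL k x n. entry k x n \<E> app q b --> ~k \<E> K --> ~x \<E> D)))"

text \<open>A new vertex in \<open>fill p\<close> has the empty relation. Any other new vertex has
  below it a bound \<open>h\<close> for the old vertices of its class, and since its relation tends
  to it, a tail lies beyond \<open>h\<close>.\<close>

lemma hat_isolated:
 assumes p: "cond p" and q: "cond q" and le: "q <: hat p"
 shows "isolated (dom p) q" unfolding isolated_def
proof (intro allI impI)
 fix b assume b: "b \<E> dom q" "~b \<E> dom p"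
 note ent = cond_entry[OF q b(1)]
 show "EX K. K \<E> om & (ALL k x n. entry k x n \<E> app q b --> ~k \<E> K --> ~x \<E> dom p)"
 proof (cases "EX x. x \<E> dom p & near x b")
  case False
  thus ?thesis using ent emp_om by blast
 next
  case near: True
  show ?thesis
  proof (cases "b \<E> fill p")
   case True
   have "opair b emp \<E> hat p" using True by (auto simp: hat_def lam_iff[OF dt_const'])
   hence "opair b emp \<E> q" using le unfolding ext'_def by blast
   hence "app q b = emp" unfolding isfn_opair[OF cond_isfn[OF q]] by simp
   thus ?thesis using emp_om by auto
  next
   case False
   have "b \<E> H" using univ_in[OF univ_H univ_dom[OF univ_H cond_H[OF q]]] b(1) by blast
   then obtain h where h: "h \<E> b" "near h b" "!!x. x \<E> dom p ==> near x b ==> ~(h \<E> x | h = x)"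
    using False near b cond_Ord[OF q b(1)] unfolding fill_iff by blast
   obtain K where K: "K \<E> om" "!!k x n. entry k x n \<E> app q b ==> ~k \<E> K ==> ~x \<E> h"
    using cond_vert[OF q b(1)] h(1) unfolding vert_def by blast
   have "~x \<E> dom p" if "entry k x n \<E> app q b" "~k \<E> K" for k x n
    using K(2)[OF that] h(3) ent(5)[OF that(1)] Ord_lin[of x h] cond_Ord[OF p]
     Ord_in[OF cond_Ord[OF q b(1)] h(1)] by blast
   thus ?thesis using K(1) by blast
  qed
 qed
qed

subsection \<open>Unions of chains\<close>

text \<open>At the first stage where a vertex \<open>b\<close> occurs its relation has a tail that avoids all vertices of
 earlier stages, so the tail only concerns vertices that occur first at the same stage. Hence the
 witnesses for goodness of the stages can be combined.\<close>

lemma chain_union: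
 assumes a: "Ord a" "a \<E> H" and V: "dt (%e. V (e 0))" and cV: "!!c. c \<E> a ==> cond (V c)"
  and dec: "!!c c'. c \<E> a ==> c' \<E> c ==> V c <: V c'"
  and iso: "!!c. c \<E> a ==> isolated (dom (union (Img c V))) (V c)"
  and bd: "!!T. uni T ==> a \<E> T | (ALL c x. c \<E> a --> x \<E> dom (V c) --> ~x \<E> T)"
 shows "cond (union (Img a V))"
proof -
 note V' = dt_fun1[OF V]
 let ?U = "union (Img a V)"
 have U: "u \<E> union (Img c V) <-> (EX c'. c' \<E> c & u \<E> V c')" for u c by (auto simp: mem_Img[OF V])
 have dU: "x \<E> dom (union (Img c V)) <-> (EX c'. c' \<E> c & x \<E> dom (V c'))" for x c unfolding dom_iff U by blast
 have cmp: "EX d. d \<E> a & V d <: V c & V d <: V c'" if "c \<E> a" "c' \<E> a" for c c'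
  using that Ord_lin[OF Ord_in[OF a(1)] Ord_in[OF a(1)], of c c'] dec ext'_refl by blast
 have f: "isfn ?U (dom ?U)"
 proof (rule isfnI)
  show "EX x y. x \<E> dom ?U & u = opair x y" if u: "u \<E> ?U" for u
  proof -
   obtain c where c: "c \<E> a" "u \<E> V c" using u U by blast
   then obtain x where "x \<E> dom (V c)" "u = opair x (app (V c) x)" using isfn_mem[OF cond_isfn[OF cV]] by blast
   thus ?thesis using dU c(1) by blast
  qed
  show "EX! y. opair x y \<E> ?U" if x: "x \<E> dom ?U" for x
  proof -
   have "y = y'" if y: "opair x y \<E> ?U" and y': "opair x y' \<E> ?U" for y y'
   proof -
    obtain c c' where c: "c \<E> a" "opair x y \<E> V c" "c' \<E> a" "opair x y' \<E> V c'" using U y y' by blast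
    then obtain d where "d \<E> a" "opair x y \<E> V d" "opair x y' \<E> V d" using cmp unfolding ext'_def by blast
    thus ?thesis using isfn_opair[OF cond_isfn[OF cV]] by metis
   qed
   thus ?thesis using x unfolding dom_iff by blast
  qed
 qed
 have app: "app ?U x = app (V c) x" if "c \<E> a" "x \<E> dom (V c)" for c x
  by (rule app_sub[OF cond_isfn[OF cV[OF that(1)]] f]) (use that U dU in "auto simp: ext'_def")
 have v: "vert (dom ?U) b (app ?U b)" if b: "b \<E> dom ?U" for b
 proof -
  obtain c where c: "c \<E> a" "b \<E> dom (V c)" using b dU by blast
  show ?thesis unfolding app[OF c] by (rule vert_mono[OF cond_vert[OF cV[OF c(1)] c(2)]]) (use dU c in blast)
 qed
 have "EX F. isfn F a & (ALL c. c \<E> a --> app F c \<E> Pow (prod H om) & good (V c) (app F c))"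
 proof (rule AC_fun[of "%c. good (V c)"])
  show "dp (%e. good (V (e 0)) (e 1))" by (intro dps V')
  fix c assume c: "c \<E> a"
  obtain f where g: "good (V c) f" using cond_good[OF cV[OF c]] by blast
  have da: "dt (%e. app f (e 0))" by (intro dps)
  have "app (lam (dom (V c)) (app f)) x = app f x" if "x \<E> dom (V c)" for x using that by simp
  hence "good (V c) (lam (dom (V c)) (app f))" using g cond_entry(3)[OF cV[OF c]] unfolding good_def by auto
  moreover have "lam (dom (V c)) (app f) \<E> Pow (prod H om)"
   using g univ_in[OF univ_H univ_dom[OF univ_H cond_H[OF cV[OF c]]]] unfolding good_def by (auto simp: lam_iff[OF da] simp del: dom_iff)
  ultimately show "EX f. f \<E> Pow (prod H om) & good (V c) f" by blast
 qed
 then obtain F where F: "!!c. c \<E> a ==> good (V c) (app F c)" by blast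
 define first where "first c x <-> c \<E> a & x \<E> dom (V c) & (ALL c'. c' \<E> c --> ~x \<E> dom (V c'))" for c x
 have first: "dp (%e. first (f e) (g e))" if "dt f" "dt g" for f g by (rule dp_rel2[of first, OF _ that], unfold first_def, intro dps V')
 have fex: "EX c. first c x" if x: "x \<E> dom ?U" for x
 proof -
  obtain c where c: "c \<E> a" "x \<E> dom (V c)" using x unfolding dU by blast
  have "dp (%e. x \<E> dom (V (e 0)))" by (intro dps V')
  from min_el[of "%c. x \<E> dom (V c)", OF this c] show ?thesis unfolding first_def using Ord_transD[OF a(1)] by blast
 qed
 have funct: "c = c'" if "first c x" "first c' x" for c c' x
  using that Ord_lin[OF Ord_in[OF a(1)] Ord_in[OF a(1)], of c c'] unfolding first_def by blast
 have omO: "Ord k" if "k \<E> om" for k using that Ord_om Ord_in by blast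
 \<comment> \<open>The value at \<open>b\<close> is raised until it exceeds the value of the stage's
   own witness and skips all entries leading to earlier stages. Raising values is harmless: at
   \<open>b\<close> fewer entries count, at \<open>x\<close> the required inequality becomes
   weaker.\<close>
 define R where "R b m <-> (ALL c. first c b --> (ALL j. j \<E> app (app F c) b --> j \<E> m) &
   (ALL k x n. entry k x n \<E> app (V c) b --> ~k \<E> m --> (ALL c'. c' \<E> c --> ~x \<E> dom (V c'))))" for b m
 have "EX f. isfn f (dom ?U) & (ALL b. b \<E> dom ?U --> app f b \<E> om & R b (app f b))"
 proof (rule AC_fun[of R])
  show "dp (%e. R (e 0) (e 1))" unfolding R_def by (intro dps V' first)
  fix b assume "b \<E> dom ?U"
  from fex[OF this] obtain c where c: "first c b" by blast
  hence ca: "c \<E> a" "b \<E> dom (V c)" "~b \<E> dom (union (Img c V))" unfolding first_def dU by blast+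
  obtain K where K: "K \<E> om" "!!k x n. entry k x n \<E> app (V c) b ==> ~k \<E> K ==> ~x \<E> dom (union (Img c V))"
   using iso[OF ca(1)] ca(2,3) unfolding isolated_def by blast
  have m0: "app (app F c) b \<E> om" using F[OF ca(1)] ca(2) unfolding good_def by blast
  obtain m where m: "m = K | m = app (app F c) b" "!!j. j \<E> K | j \<E> app (app F c) b ==> j \<E> m"
   using Ord_max[OF omO[OF K(1)] omO[OF m0]] by blast
  moreover from m(1) have "m \<E> om" using K(1) m0 by blast
  moreover have "R b m" unfolding R_def
  proof (intro allI impI)
   fix c1 assume "first c1 b"
   hence "c1 = c" using funct[OF c] by blast
   thus "(ALL j. j \<E> app (app F c1) b --> j \<E> m) &
    (ALL k x n. entry k x n \<E> app (V c1) b --> ~k \<E> m --> (ALL c'. c' \<E> c1 --> ~x \<E> dom (V c')))"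
    using m(2) K(2)[unfolded dU] by blast
  qed
  ultimately show "EX m. m \<E> om & R b m" by blast
 qed
 then obtain f where fR: "!!b. b \<E> dom ?U ==> app f b \<E> om" "!!b. b \<E> dom ?U ==> R b (app f b)" by blast
 have "good ?U f" unfolding good_def
 proof (intro allI impI conjI fR(1))
  fix b k x n assume b: "b \<E> dom ?U" and e: "entry k x n \<E> app ?U b" and k: "~k \<E> app f b"
  obtain c where c: "first c b" using fex[OF b] by blast
  hence ca: "c \<E> a" "b \<E> dom (V c)" unfolding first_def by blast+
  have e': "entry k x n \<E> app (V c) b" using e app[OF ca] by simp
  have x: "x \<E> dom (V c)" by (rule cond_entry(3)[OF cV[OF ca(1)] ca(2) e'])
  have xU: "x \<E> dom ?U" unfolding dU using x ca(1) by blast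
  have "~x \<E> dom (V c')" if "c' \<E> c" for c' using fR(2)[OF b] c e' k that unfolding R_def by blast
  hence "first c x" unfolding first_def using ca(1) x by blast
  moreover have "~k \<E> app (app F c) b" using fR(2)[OF b] c k unfolding R_def by blast
  hence "n \<E> app (app F c) x" using F[OF ca(1)] ca(2) e' unfolding good_def by blast
  ultimately show "n \<E> app f x" using fR(2)[OF xU] unfolding R_def by blast
 qed
 moreover have "bdd (dom ?U) T" if T: "uni T" for T using bd[OF T]
 proof
  assume aT: "a \<E> T"
  define B where "B c h <-> Ord h & (ALL x. x \<E> dom (V c) --> x \<E> T --> x \<E> h)" for c h
  have "dp (%e. B (e 0) (e 1))" unfolding B_def by (intro dps V')
  from AC_fun[of B a T, OF this] cond_bdd[OF cV T]
  obtain s where s: "!!c. c \<E> a ==> app s c \<E> T" "!!c. c \<E> a ==> B c (app s c)" unfolding bdd_def B_def by metis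
  have ds: "dt (%e. app s (e 0))" by (intro dps)
  have "union (Img a (app s)) \<E> T" by (intro univ_union[OF uni_univ[OF T]] univ_repl[OF uni_univ[OF T] ds aT] s)
  moreover have "Ord (union (Img a (app s)))" by (rule Ord_union) (use s(2) in "auto simp: mem_Img[OF ds] B_def")
  moreover have "x \<E> union (Img a (app s))" if x: "x \<E> dom ?U" "x \<E> T" for x
  proof -
   obtain c where "c \<E> a" "x \<E> dom (V c)" using x(1) unfolding dU by blast
   thus ?thesis using s(2) x(2) unfolding B_def union_iff mem_Img[OF ds] by blast
  qed
  ultimately show ?thesis unfolding bdd_def by blast
 next
  assume "ALL c x. c \<E> a --> x \<E> dom (V c) --> ~x \<E> T"
  thus ?thesis unfolding bdd_def dU using Ord_emp univ_emp[OF uni_univ[OF T]] by blast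
 qed
 moreover have "?U \<E> H" by (intro univ_union[OF univ_H] univ_repl[OF univ_H V a(2)] cond_H cV)
 ultimately show ?thesis unfolding cond_def using f v by blast
qed

subsection \<open>Strategic chains\<close>

text \<open>For \<open>T = emp\<close> these are all conditions.\<close>

definition above where
 "above T p <-> cond p & (ALL x. x \<E> dom p --> ~x \<E> T)"

lemma dp_above [dps]: "dt f ==> dt g ==> dp (%e. above (f e) (g e))" by (rule dp_rel2[of above], unfold above_def, intro dps)

lemma above_cond: "above T p ==> cond p" by (simp add: above_def)

lemma above_hat:
 assumes T: "T = emp | uni T" and p: "above T p"
 shows "above T (hat p)" unfolding above_def cond_hat(2)[OF above_cond[OF p]]
proof (intro conjI allI impI cond_hat(1) above_cond[OF p])
 fix x assume "x \<E> dom p | x \<E> fill p"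
 then obtain x' where "x' \<E> dom p" "near x' x" unfolding fill_iff near_def by blast
 thus "~x \<E> T" using T p unfolding near_def above_def by auto
qed

text \<open>A game in which one player applies \<open>hat\<close> to everything played so far and
  \<open>resp\<close> answers below it; \<open>chain_union\<close> handles the limits. By
  \<open>bd\<close> the length belongs to every universe in which the conditions can have vertices,
  which keeps the domains bounded there.\<close>

lemma strategic_chain:
 fixes D :: "'m => 'm => 'm => bool"
 assumes T: "T = emp | uni T" and p0: "above T p0" and z: "Ord z" "z \<E> H"
  and D: "dp (%e. D (e 0) (e 1) (e 2))"
  and resp: "!!a b. a \<E> z ==> above T b ==> b <: p0 ==> EX t. above T t & t <: hat b & D a b t"
  and bd: "!!T'. uni T' ==> z \<E> T' | (ALL x. Ord x --> x \<E> T' --> x \<E> T)"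
 shows "EX V B. dt (%e. V (e 0)) & dt (%e. B (e 0)) & (ALL a u. u \<E> B a <-> u \<E> p0 | (EX c. c \<E> a & u \<E> V c)) &
  (ALL a. a \<E> z --> above T (V a) & V a <: hat (B a) & D a (B a) (V a)) & (ALL a. a \<E> suc z --> above T (B a))"
proof -
 note D' = dp_rel3[OF D]
 \<comment> \<open>One choice function on the subsets of \<open>H\<close> makes the answers part of
   a definable recursion.\<close>
 obtain ch where ch: "!!y. y \<E> Pow H ==> (EX u. u \<E> y) ==> app ch y \<E> y" using choice_fun[of "Pow H"] by blast
 define G where "G a h = app ch (Coll H (%t. above T t & t <: hat (cup p0 (union (ran h))) & D a (cup p0 (union (ran h))) t))"
  for a h
 have G: "dt (%e. G (e 0) (e 1))" unfolding G_def by (intro dps D')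
 obtain V where V: "dt (%e. V (e 0))" and Veq: "!!a. Ord a ==> V a = G a (lam a V)" using ordrec[OF G] by blast
 note V' = dt_fun1[OF V]
 define B where "B a = cup p0 (union (Img a V))" for a
 have dB: "dt (%e. B (e 0))" unfolding B_def by (intro dps V')
 have Bi: "u \<E> B a <-> u \<E> p0 | (EX c. c \<E> a & u \<E> V c)" for u a by (auto simp: B_def mem_Img[OF V])
 have "ran (lam a V) = Img a V" for a by (rule eqI) (auto simp: lam_iff[OF V] mem_Img[OF V])
 hence Va: "V a = app ch (Coll H (%t. above T t & t <: hat (B a) & D a (B a) t))" if "Ord a" for a
  unfolding Veq[OF that] G_def B_def by simp
 have step: "above T (V a) & V a <: hat (B a) & D a (B a) (V a)" if a: "a \<E> z" and Ba: "above T (B a)" for a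
 proof -
  have C: "t \<E> Coll H (%t. above T t & t <: hat (B a) & D a (B a) t) <->
    t \<E> H & above T t & t <: hat (B a) & D a (B a) t" for t by (rule mem_Coll) (intro dps D')
  have "B a <: p0" by (auto simp: ext'_def Bi)
  then obtain t where t: "above T t" "t <: hat (B a)" "D a (B a) t" using resp[OF a Ba] by blast
  hence "EX t. t \<E> Coll H (%t. above T t & t <: hat (B a) & D a (B a) t)" unfolding C using cond_H above_cond by blast
  moreover have "Coll H (%t. above T t & t <: hat (B a) & D a (B a) t) \<E> Pow H" using C by auto
  ultimately have "V a \<E> Coll H (%t. above T t & t <: hat (B a) & D a (B a) t)" using ch Va Ord_in[OF z(1) a] by simp
  thus ?thesis unfolding C by blast
 qed
 have main: "a \<E> suc z --> above T (B a)" if "Ord a" for a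
 proof (rule Ord_induct[of "%a. a \<E> suc z --> above T (B a)", OF _ that], intro dps dt_fun1[OF dB], intro impI)
  fix a assume a: "Ord a" and IH: "!!c. c \<E> a ==> c \<E> suc z --> above T (B c)" and az: "a \<E> suc z"
  have az': "c \<E> z" if "c \<E> a" for c using az that Ord_transD[OF z(1)] by auto
  have BV: "above T (B c) & above T (V c) & V c <: hat (B c)" if "c \<E> a" for c
   using step[OF az'[OF that]] IH[OF that] az'[OF that] by simp
  have VB: "V c <: B c" if "c \<E> a" for c using ext'_trans[OF _ cond_hat(3)] BV[OF that] above_cond by blast
  show "above T (B a)"
  proof (cases "a = emp")
   case True
   hence "B a = p0" by (intro eqI) (simp add: Bi)
   thus ?thesis using p0 by simp
  next
   case False
   hence e: "emp \<E> a" using Ord_lin[OF Ord_emp a] by auto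
   \<comment> \<open>From the first stage on, \<open>p0\<close> is contained in
     \<open>V emp\<close>, so the base is the union of the chain alone, as
     \<open>chain_union\<close> expects.\<close>
   have B0: "B a = union (Img a V)" by (rule eqI) (use VB[OF e] e in "auto simp: Bi mem_Img[OF V] ext'_def")
   have "cond (union (Img a V))"
   proof (rule chain_union[OF a _ V])
    show "a \<E> H" using univ_in[OF univ_H univ_suc[OF univ_H z(2)] az] .
    show "cond (V c)" if "c \<E> a" for c using BV[OF that] above_cond by blast
    show "V c <: V c'" if "c \<E> a" "c' \<E> c" for c c' using VB[OF that(1)] that(2) by (auto simp: ext'_def Bi)
    show "isolated (dom (union (Img c V))) (V c)" if c: "c \<E> a" for c
    proof -
     have i: "isolated (dom (B c)) (V c)" using hat_isolated BV[OF c] above_cond by blast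
     show ?thesis
     proof (cases "c = emp")
      case True
      hence "~x \<E> dom (union (Img c V))" for x by (auto simp: mem_Img[OF V])
      thus ?thesis unfolding isolated_def using emp_om by blast
     next
      case False
      hence "emp \<E> c" using Ord_lin[OF Ord_emp Ord_in[OF a c]] by auto
      hence "B c = union (Img c V)" by (intro eqI) (use VB[OF e] in "auto simp: Bi mem_Img[OF V] ext'_def")
      thus ?thesis using i by simp
     qed
    qed
    show "a \<E> T' | (ALL c x. c \<E> a --> x \<E> dom (V c) --> ~x \<E> T')" if T': "uni T'" for T' using bd[OF T']
    proof
     assume "z \<E> T'"
     thus ?thesis using univ_in[OF uni_univ[OF T'] univ_suc[OF uni_univ[OF T']]] az by blast
    next
     assume "ALL x. Ord x --> x \<E> T' --> x \<E> T"
     thus ?thesis using BV cond_Ord unfolding above_def by blast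
    qed
   qed
   moreover have "~x \<E> T" if x: "x \<E> dom (union (Img a V))" for x
   proof -
    have "EX c. c \<E> a & x \<E> dom (V c)" using x by (auto simp: mem_Img[OF V])
    thus ?thesis using BV unfolding above_def by blast
   qed
   ultimately show ?thesis unfolding B0 above_def by blast
  qed
 qed
 have "Ord a" if "a \<E> suc z" for a using Ord_in[OF Ord_suc[OF z(1)] that] .
 hence "above T (B a)" if "a \<E> suc z" for a using main that by blast
 thus ?thesis using V dB Bi step by (intro exI[of _ V] exI[of _ B]) simp
qed

text \<open>Above \<open>T\<close>, chains may have the length of a well-ordering of
  \<open>T\<close>: a universe with ordinals beyond \<open>T\<close> contains \<open>T\<close> and
  hence this length. So a single condition settles \<open>P\<close> for all elements of
  \<open>T\<close>.\<close>

lemma decide: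
 assumes T: "uni T" and t0: "above T t0" and P: "dp (%e. P (e 0) (e 1))"
  and mono: "!!t t' u. P t u ==> t' <: t ==> above T t' ==> P t' u"
 shows "EX t. above T t & t <: t0 & (ALL u. u \<E> T --> P t u | (ALL t'. above T t' --> t' <: t --> ~P t' u))"
proof -
 note P' = dp_rel2[OF P]
 obtain z f where z: "Ord z" and f: "!!y. y \<E> T <-> (EX x. x \<E> z & y = app f x)"
  "!!x x'. x \<E> z ==> x' \<E> z ==> app f x = app f x' ==> x = x'" using well_ordering[of T] by blast
 have zw: "z \<E> w" if "univ w" "T \<E> w" for w by (rule univ_ord_inj[OF that(1) z that(2)]) (use f in blast)+
 define D where "D a b t <-> P t (app f a) | (ALL t'. above T t' --> t' <: t --> ~P t' (app f a))" for a b t :: 'm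
 have "EX V B. dt (%e. V (e 0)) & dt (%e. B (e 0)) & (ALL a u. u \<E> B a <-> u \<E> t0 | (EX c. c \<E> a & u \<E> V c)) &
  (ALL a. a \<E> z --> above T (V a) & V a <: hat (B a) & D a (B a) (V a)) & (ALL a. a \<E> suc z --> above T (B a))"
 proof (rule strategic_chain[OF _ t0 z])
  show "T = emp | uni T" using T by blast
  show "z \<E> H" by (rule zw[OF univ_H]) (use T uni_def in blast)
  show "dp (%e. D (e 0) (e 1) (e 2))" unfolding D_def by (intro dps P')
  show "z \<E> T' | (ALL x. Ord x --> x \<E> T' --> x \<E> T)" if "uni T'" for T'
   using uni_cases[OF uni_univ[OF T] uni_univ[OF that]] zw[OF uni_univ[OF that]] by blast
  fix a b assume "above T b"
  hence h: "above T (hat b)" using above_hat T by blast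
  show "EX t. above T t & t <: hat b & D a b t"
  proof (cases "EX t. above T t & t <: hat b & P t (app f a)")
   case False
   thus ?thesis unfolding D_def using h ext'_refl by blast
  qed (auto simp: D_def)
 qed
 then obtain V B where B: "!!a u. u \<E> B a <-> u \<E> t0 | (EX c. c \<E> a & u \<E> V c)"
  and V: "!!a. a \<E> z ==> D a (B a) (V a)" and Bz: "above T (B z)" by (metis suc_iff)
 have "B z <: t0" by (simp add: ext'_def B)
 moreover have "P (B z) u | (ALL t'. above T t' --> t' <: B z --> ~P t' u)" if u: "u \<E> T" for u
 proof -
  obtain a where a: "a \<E> z" "u = app f a" using f(1) u by blast
  have le: "B z <: V a" using a(1) by (auto simp: ext'_def B)
  from V[OF a(1)] show ?thesis unfolding D_def a(2)[symmetric] using mono[OF _ le Bz] ext'_trans[OF _ le] by blast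
 qed
 ultimately show ?thesis using Bz by blast
qed

end

section \<open>The generic extension and its restrictions\<close>

context supercompact
begin

definition PP :: 'm where "PP = Coll H cond"

lemma PP_iff [simp]: "p \<E> PP <-> cond p"
proof -
 have "dp (%e. cond (e 0))" by (intro dps)
 from mem_Coll[OF this] show ?thesis unfolding PP_def using cond_H by blast
qed

definition hi where "hi T p = Coll p (%u. ~u \<E> T)"

lemma hi_iff: "u \<E> hi T p <-> u \<E> p & ~u \<E> T" unfolding hi_def by (rule mem_Coll) (intro dps)

lemma dt_hi [dps]: "dt f ==> dt g ==> dt (%e. hi (f e) (g e))" by (rule dt_fun2[of hi], unfold hi_def, intro dps)

lemma ext'_cut: "q <: p ==> cut T q <: cut T p" and ext'_hi: "q <: p ==> hi T q <: hi T p"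
 and ext'_cup: "r' <: r ==> t' <: t ==> cup r' t' <: cup r t" and cup_ext'1: "cup r t <: r"
 and cup_least: "s <: r ==> s <: t ==> s <: cup r t" and ext'_cutI: "p <: cut T p" and ext'_hiI: "p <: hi T p"
 by (auto simp: ext'_def hi_iff)

lemma cut_hi: "cup (cut T p) (hi T p) = p" by (rule eqI) (auto simp: hi_iff)

lemma vert_prod:
 assumes "vert D b c" "z \<E> c" "!!x. x \<E> D ==> x \<E> b ==> x \<E> h"
 shows "z \<E> prod om (prod h om)"
proof -
 obtain k x n where "z = entry k x n" "k \<E> om" "n \<E> om" "x \<E> D" "x \<E> b" using assms(1,2) unfolding vert_def by blast
 thus ?thesis using assms(3) by simp
qed

section \<open>Splitting conditions along a universe\<close>

context
 fixes T assumes T: "uni T"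
begin

private lemma uT: "univ T" using T by (simp add: uni_def)

text \<open>The relation at \<open>b\<close> is a subset of a product of omega and \<open>b\<close>,
  so it belongs to \<open>T\<close> whenever \<open>b\<close> does.\<close>

lemma vertex_in:
 assumes "cond p" "u \<E> p" "u = opair b y"
 shows "u \<E> T <-> b \<E> T"
proof -
 have b: "b \<E> dom p" "y = app p b" using assms isfn_opair[OF cond_isfn[OF assms(1)]] by blast+
 have "y \<E> T" if "b \<E> T"
 proof (rule univ_sub[OF uT])
  show "prod om (prod b om) \<E> T" using that univ_prod[OF uT] univ_om[OF uT] by blast
  show "z \<E> prod om (prod b om)" if "z \<E> y" for z by (rule vert_prod[OF cond_vert[OF assms(1) b(1)]]) (use that b(2) in auto)
 qed
 thus ?thesis using assms(3) univ_opair[OF uT] by blast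
qed

private lemma near_T: "near x b ==> x \<E> T <-> b \<E> T" using T by (simp add: near_def)

text \<open>Invariance under \<open>near\<close> makes both parts conditions. The lower part is even
  an element of \<open>T\<close>, because its domain is bounded by an ordinal of \<open>T\<close>;
  this is the purpose of the Easton support.\<close>

lemma
 assumes p: "cond p"
 shows cond_cut: "cond (cut T p)" and above_hi: "above T (hi T p)" and cut_T: "cut T p \<E> T"
proof -
 have d: "dp (%e. e 0 \<E> T)" "dp (%e. ~e 0 \<E> T)" by (intro dps)+
 have mem: "EX b y. u = opair b y" if "u \<E> p" for u using isfn_mem[OF cond_isfn[OF p] that] by blast
 have "cut T p = rs p (%b. b \<E> T)" by (rule eqI) (unfold cut_iff rs_iff[OF d(1)], use vertex_in[OF p] mem in blast)
 thus c: "cond (cut T p)" using cond_rs(1)[OF p d(1)] near_T by simp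
 have "hi T p = rs p (%b. ~b \<E> T)" by (rule eqI) (unfold hi_iff rs_iff[OF d(2)], use vertex_in[OF p] mem in blast)
 thus "above T (hi T p)" unfolding above_def using cond_rs[OF p d(2)] near_T by simp
 obtain h where h: "Ord h" "h \<E> T" "!!x. x \<E> dom p ==> x \<E> T ==> x \<E> h" using cond_bdd[OF p T] unfolding bdd_def by blast
 show "cut T p \<E> T"
 proof (rule univ_sub[OF uT])
  show "prod h (Pow (prod om (prod h om))) \<E> T" using h(2) by (intro univ_prod[OF uT] univ_Pow[OF uT] univ_om[OF uT])
  fix u assume u: "u \<E> cut T p"
  then obtain b where b: "b \<E> dom (cut T p)" "u = opair b (app (cut T p) b)" using isfn_mem[OF cond_isfn[OF c]] by blast
  have bp: "x \<E> h" if x: "x \<E> dom (cut T p)" for x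
  proof -
   obtain y where "opair x y \<E> cut T p" using x unfolding dom_iff by blast
   thus ?thesis using h(3) univ_opair[OF uT] by (simp, blast)
  qed
  have "z \<E> prod om (prod h om)" if "z \<E> app (cut T p) b" for z by (rule vert_prod[OF cond_vert[OF c b(1)] that]) (rule bp)
  thus "u \<E> prod h (Pow (prod om (prod h om)))" using b(2) bp[OF b(1)] by simp
 qed
qed

lemma cut_id: "r \<E> T ==> cut T r = r" using cut_sub univ_in[OF uT] by blast

text \<open>Converse of the splitting: the forcing is the product of its part in \<open>T\<close>
  and its part above \<open>T\<close>.\<close>

lemma amalgam:
 assumes r: "cond r" "r \<E> T" and t: "above T t"
 shows "cond (cup r t)" "cut T (cup r t) = r" "hi T (cup r t) = t"
proof -
 have rT: "u \<E> T" if "u \<E> r" for u using univ_in[OF uT r(2)] that .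
 have tT: "~u \<E> T" if "u \<E> t" for u
 proof -
  obtain b y where "u = opair b y" "b \<E> dom t" using isfn_mem[OF cond_isfn[OF above_cond[OF t]] \<open>u \<E> t\<close>] by blast
  thus ?thesis using t univ_opair[OF uT] unfolding above_def by blast
 qed
 have "~x \<E> dom t" if "x \<E> dom r" for x
 proof -
  obtain y where "opair x y \<E> r" using \<open>x \<E> dom r\<close> by auto
  hence "x \<E> T" using rT univ_opair[OF uT] by blast
  thus ?thesis using t unfolding above_def by blast
 qed
 thus "cond (cup r t)" by (rule glue(1)[OF r(1) above_cond[OF t]])
 show "cut T (cup r t) = r" "hi T (cup r t) = t" by (rule eqI, use rT tT in "auto simp: hi_iff")+
qed

end

lemma fposet_H: "fposet E kap H PP"
proof
 show "univ H" by (rule univ_H)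
 show "x \<E> PP ==> x \<E> H" for x by (simp add: cond_H)
 show "emp \<E> PP" by (simp add: cond_emp)
qed

lemma fposet_T: "uni T ==> fposet E kap T (cut T PP)"
proof
 assume T: "uni T"
 show "univ T" using T by (simp add: uni_def)
 show "x \<E> cut T PP ==> x \<E> T" for x by simp
 show "emp \<E> cut T PP" using univ_emp[OF uni_univ[OF T]] cond_emp by simp
qed

end

locale gext = generic E kap "supercompact.H E kap" "supercompact.PP E kap" g
 for E :: "'m => 'm => bool" (infix "\<E>" 50) and kap g
begin

lemma g_cond: "p : g ==> cond p" using g_Q by simp

lemma g_cut: "p : g ==> uni T ==> cut T p : g" and g_hi: "p : g ==> uni T ==> hi T p : g"
 using g_up[of p] ext'_cutI ext'_hiI cond_cut[of T p] above_cond[OF above_hi[of T p]] g_cond[of p] by (metis PP_iff)+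

lemma g_cup:
 assumes "r : g" "t : g" "cond (cup r t)"
 shows "cup r t : g" using g_dir[OF assms(1,2)] g_up cup_least assms(3) by (metis PP_iff)

text \<open>A dense set of the lower factor pulls back along \<open>cut T\<close> to a dense set of
  the product.\<close>

lemma generic_T:
 assumes T: "uni T"
 shows "generic E kap T (cut T PP) {r : g. r \<E> T}"
proof -
 interpret T: fposet E kap T "cut T PP" by (rule fposet_T[OF T])
 have c: "cut T p : {r : g. r \<E> T}" if "p : g" for p using g_cut cut_T T g_cond that by blast
 show ?thesis
 proof
  show "p \<E> cut T PP" if "p : {r : g. r \<E> T}" for p using that g_cond by simp
  show "{r : g. r \<E> T} ~= {}" using c g_nonempty by blast
  show "q : {r : g. r \<E> T}" if "p : {r : g. r \<E> T}" "q \<E> cut T PP" "p <: q" for p q using that g_up by auto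
  show "EX r:{r : g. r \<E> T}. r <: p & r <: q" if pq: "p : {r : g. r \<E> T}" "q : {r : g. r \<E> T}" for p q
  proof -
   obtain s where "s : g" "s <: p" "s <: q" using g_dir pq by blast
   thus ?thesis using c ext'_cut[of s p T] ext'_cut[of s q T] cut_id[OF T] pq by (metis (lifting) mem_Collect_eq)
  qed
  fix D assume D: "!!p. p \<E> cut T PP ==> EX q. q \<E> D & q \<E> cut T PP & q <: p"
  have "EX p:g. cut T p \<E> D"
  proof (rule g_dense)
   show "dp (%e. cut T (e 0) \<E> D)" by (intro dps)
   fix p assume "p \<E> PP"
   hence p: "cond p" by simp
   obtain q where q: "q \<E> D" "cond q" "q \<E> T" "q <: cut T p" using D[of "cut T p"] cond_cut[OF T p] cut_T[OF T p] by auto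
   note a = amalgam[OF T q(2,3) above_hi[OF T p]]
   have "cup q (hi T p) <: p" using ext'_cup[OF q(4) ext'_refl, of "hi T p"] by (simp add: cut_hi)
   thus "EX q. q \<E> PP & q <: p & cut T q \<E> D" using a q(1) by (intro exI[of _ "cup q (hi T p)"]) simp
  qed
  thus "EX p:{r : g. r \<E> T}. p \<E> D" using c by blast
 qed
qed

text \<open>\<open>decide\<close> is applied to pairs of a lower condition \<open>r\<close> and an
  index \<open>i\<close>, which are elements of \<open>T\<close>. The upper condition
  \<open>t\<close> obtained in \<open>g\<close> leaves only lower conditions to be
  consulted.\<close>

lemma reduce:
 assumes T: "uni T" and F: "dp (%e. F (e 0) (e 1))" and mono: "!!p q i. F p i ==> q <: p ==> F q i"
 shows "EX t:g. above T t & (ALL i. i \<E> T --> (EX p:g. F p i) --> (EX r:g. r \<E> T & F (cup r t) i))"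
proof -
 note F' = dp_rel2[OF F]
 define P where "P t u <-> (EX r i. u = opair r i & F (cup r t) i)" for t u
 have dP: "dp (%e. P (f e) (h e))" if "dt f" "dt h" for f h by (rule dp_rel2[OF _ that, of P], unfold P_def, intro dps F')
 define D where "D t <-> (ALL u. u \<E> T --> P t u | (ALL t'. above T t' --> t' <: t --> ~P t' u))" for t
 have dD: "dp (%e. D (f e))" if "dt f" for f by (rule dp_rel1[OF _ that, of D], unfold D_def, intro dps dP)
 have Pm: "P t' u" if "P t u" "t' <: t" for t t' u using that mono ext'_cup[OF ext'_refl] unfolding P_def by blast
 have "EX p:g. D (hi T p)"
 proof (rule g_dense)
  show "dp (%e. D (hi T (e 0)))" by (intro dps dD)
  fix p assume "p \<E> PP"
  hence p: "cond p" by simp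
  have "dp (%e. P (e 0) (e 1))" by (intro dps dP)
  from decide[OF T above_hi[OF T p], of P, OF this] obtain t where
   t: "above T t" "t <: hi T p" "D t" unfolding D_def using Pm by metis
  note a = amalgam[OF T cond_cut[OF T p] cut_T[OF T p] t(1)]
  have "cup (cut T p) t <: p" using ext'_cup[OF ext'_refl t(2), of "cut T p"] by (simp add: cut_hi)
  thus "EX q. q \<E> PP & q <: p & D (hi T q)" using a t(3) by (intro exI[of _ "cup (cut T p) t"]) simp
 qed
 then obtain t where t: "t : g" "above T t" "D t" using g_hi T above_hi g_cond by blast
 moreover have "EX r:g. r \<E> T & F (cup r t) i" if i: "i \<E> T" "EX p:g. F p i" for i
 proof -
  obtain p where p: "p : g" "F p i" using i by blast
  obtain s where s: "s : g" "s <: p" "s <: t" using g_dir[OF p(1) t(1)] by blast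
  let ?r = "cut T s"
  have r: "?r : g" "?r \<E> T" using g_cut cut_T T s(1) g_cond by blast+
  have "hi T (cup emp t) = t" by (rule amalgam(3)[OF T cond_emp univ_emp[OF uni_univ[OF T]] t(2)])
  moreover have "cup emp t = t" by (rule eqI) simp
  ultimately have "hi T s <: t" using ext'_hi[OF s(3), of T] by simp
  moreover have "P (hi T s) (opair ?r i)" unfolding P_def using mono[OF p(2) s(2)] by (auto simp: cut_hi)
  moreover have "opair ?r i \<E> T" using univ_opair[OF uni_univ[OF T]] r(2) i(1) by blast
  ultimately have "P t (opair ?r i)" using t(3) above_hi[OF T g_cond[OF s(1)]] unfolding D_def by blast
  thus ?thesis using r unfolding P_def by auto
 qed
 ultimately show ?thesis by blast
qed

text \<open>With \<open>t\<close> from \<open>reduce\<close>, the pairs \<open>(pi, r)\<close> such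
  that \<open>cup r t\<close> forces \<open>pi\<close> into \<open>y\<close> form a name inside
  \<open>T\<close>. This bounds the names of subclasses and is the source of power sets and
  replacement in the extension.\<close>

lemma small_class:
 assumes T: "uni T" and y: "y : subs H" and sub: "!!X. NE X (val y) ==> EX pi. pi \<E> T & X = val pi"
 shows "EX b:subs T. val b = val y"
proof -
 have "dp (%e. memf (e 0) (e 1) y)" by (intro dps)
 from reduce[OF T, of "%p pi. memf p pi y", OF this] memf_mono obtain t where t: "t : g" "above T t"
  and red: "!!pi. pi \<E> T ==> EX p:g. memf p pi y ==> EX r:g. r \<E> T & memf (cup r t) pi y" by blast
 have TH: "x \<E> H" if "x \<E> T" for x using univ_in[OF univ_H] T that by (auto simp: uni_def)
 define b where "b = Coll T (%u. EX pi r. u = opair pi r & cond r & memf (cup r t) pi y)"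
 have bi: "u \<E> b <-> u \<E> T & (EX pi r. u = opair pi r & cond r & memf (cup r t) pi y)" for u
  unfolding b_def by (rule mem_Coll) (intro dps)
 have bT: "b : subs T" by (auto simp: subs_def bi)
 have bH: "b : subs H" using bT TH by (auto simp: subs_def)
 have op: "opair x z \<E> T <-> x \<E> T & z \<E> T" for x z using univ_opair[OF uni_univ[OF T]] .
 have "same b y"
 proof (rule val_extI[OF bH y])
  fix Z
  show "NE Z (val b) <-> NE Z (val y)"
  proof
   assume "NE Z (val b)"
   then obtain pi r where r: "Z = val pi" "opair pi r \<E> b" "pi \<E> H" "r : g" using NE_cases[OF _ bH] by metis
   hence "memf (cup r t) pi y" "r \<E> T" using bi op by auto
   moreover have "cup r t : g" using g_cup[OF r(4) t(1)] amalgam(1)[OF T g_cond[OF r(4)] \<open>r \<E> T\<close> t(2)] by blast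
   ultimately show "NE Z (val y)" using NE_val[OF w_subs[OF r(3)] y] r(1) by blast
  next
   assume Z: "NE Z (val y)"
   then obtain pi where pi: "pi \<E> T" "Z = val pi" using sub by blast
   then obtain r where "r : g" "r \<E> T" "memf (cup r t) pi y" using red NE_val[OF w_subs[OF TH[OF pi(1)]] y] Z by blast
   thus "NE Z (val b)" unfolding pi(2) using bi op pi(1) g_cond TH by (intro NE_I[OF bH, of _ r]) auto
  qed
 qed
 thus ?thesis using bT val_eq[OF bH y] by blast
qed

text \<open>To each pair of an argument and a lower condition the ground function \<open>c\<close>
  assigns one value that is forced, if there is any. Its range on \<open>T\<close> therefore meets
  the values of \<open>f\<close> at every argument that has a value in \<open>B\<close>.\<close>

lemma covering:
 assumes T: "uni T" and f: "f : subs H" and B: "!!s. s \<E> B ==> s \<E> H"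
 shows "EX c. (ALL u. u \<E> T --> app c u \<E> B | (ALL s. ~s \<E> B)) &
  (ALL pi s. pi \<E> T --> s \<E> B --> NE (N.opair (val pi) (val s)) (val f) -->
   (EX u. u \<E> T & app c u \<E> B & NE (N.opair (val pi) (val (app c u))) (val f)))"
proof -
 define F where "F p pi <-> (EX s. s \<E> B & memf p (opn pi s) f)" for p pi
 have dF: "dp (%e. F (e 0) (e 1))" unfolding F_def by (intro dps)
 have "F q i" if "F p i" "q <: p" for p q i using that memf_mono unfolding F_def by blast
 hence "EX t:g. above T t & (ALL i. i \<E> T --> (EX p:g. F p i) --> (EX r:g. r \<E> T & F (cup r t) i))" by (rule reduce[OF T dF])
 then obtain t where t: "t : g" "above T t"
  and red: "!!pi. pi \<E> T ==> EX p:g. F p pi ==> EX r:g. r \<E> T & F (cup r t) pi" by blast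
 have TH: "x \<E> H" if "x \<E> T" for x using univ_in[OF univ_H] T that by (auto simp: uni_def)
 \<comment> \<open>When no value is forced, every \<open>s\<close> qualifies, so
   \<open>AC_fun\<close> only asks for a member of \<open>B\<close>.\<close>
 define R where "R u s <-> (ALL pi r. u = opair pi r --> F (cup r t) pi --> memf (cup r t) (opn pi s) f)" for u s
 show ?thesis
 proof (cases "EX s. s \<E> B")
  case True
  note F' = dp_rel2[OF dF]
  have dR: "dp (%e. R (e 0) (e 1))" unfolding R_def by (intro dps F')
  have "EX s. s \<E> B & R u s" for u using True unfolding R_def F_def by (metis opair_eq)
  with AC_fun[of R T B, OF dR] obtain c where c: "!!u. u \<E> T ==> app c u \<E> B & R u (app c u)" by blast
  have "EX u. u \<E> T & app c u \<E> B & NE (N.opair (val pi) (val (app c u))) (val f)"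
   if h: "pi \<E> T" "s \<E> B" "NE (N.opair (val pi) (val s)) (val f)" for pi s
  proof -
   have o: "N.opair (val pi) (val s) = val (opn pi s)" "opn pi s \<E> H" if "s \<E> B" for s
    using val_opn opn_w TH[OF h(1)] B[OF that] by auto
   obtain p where "p : g" "memf p (opn pi s) f" using h(3) o[OF h(2)] NE_val[OF w_subs f] by metis
   hence "EX p:g. F p pi" unfolding F_def using h(2) by blast
   then obtain r where r: "r : g" "r \<E> T" "F (cup r t) pi" using red h(1) by blast
   let ?u = "opair pi r"
   have u: "?u \<E> T" using univ_opair[OF uni_univ[OF T]] h(1) r(2) by blast
   hence m: "memf (cup r t) (opn pi (app c ?u)) f" and cB: "app c ?u \<E> B" using c r(3) unfolding R_def by auto
   have "cup r t : g" using g_cup[OF r(1) t(1)] amalgam(1)[OF T g_cond[OF r(1)] r(2) t(2)] by blast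
   hence "NE (val (opn pi (app c ?u))) (val f)" using NE_val[OF w_subs[OF o(2)[OF cB]] f] m by blast
   thus ?thesis using u cB o(1)[OF cB] by auto
  qed
  thus ?thesis using c by (intro exI[of _ c]) simp
 next
  case False
  thus ?thesis by simp
 qed
qed

end

context gext
begin

subsection \<open>The generic extension of a small universe\<close>

context
 fixes T assumes T: "uni T"
begin

interpretation T: generic E kap T "cut T PP" "{r : g. r \<E> T}" by (rule generic_T[OF T])

private lemma opT: "opair x y \<E> T <-> x \<E> T & y \<E> T" using univ_opair[OF uni_univ[OF T]] .

private lemma subsT: "x \<E> T ==> x : subs T" by (rule T.w_subs)

private lemma TH: "x \<E> T ==> x \<E> H" using univ_in[OF univ_H] T by (auto simp: uni_def)

private lemma subsTH: "x : subs T ==> x : subs H" using TH by (auto simp: subs_def)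

text \<open>Equality of names inside \<open>T\<close> depends only on the lower part of a condition:
  \<open>rho\<close> is a bisimulation because upper parts can be exchanged by amalgamation.\<close>

lemma eqf_cut:
 assumes "eqf p x y" "cond p" "cond q" "cut T q = cut T p" "x : subs T" "y : subs T"
 shows "eqf q x y"
proof -
 define rho where "rho q a b <-> (ALL z. z \<E> a | z \<E> b --> z \<E> T) & (EX q1. cond q1 & cut T q1 = cut T q & eqf q1 a b)" for q a b
 have sym: "(%q a b. rho q b a) = rho" unfolding rho_def using eqf_sym by (intro HOL.ext) blast
 have half: "half rho q a b" if q: "cond q" and r: "rho q a b" for q a b
 proof (rule halfI)
  obtain q1 where q1: "cond q1" "cut T q1 = cut T q" "eqf q1 a b" using r unfolding rho_def by blast
  have abT: "z \<E> T" if "z \<E> a | z \<E> b" for z using r that unfolding rho_def by blast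
  fix pi r q0 assume h: "opair pi r \<E> a" "r \<E> PP" "pi \<E> H" "q0 \<E> PP" "q0 <: q" "q0 <: r"
  have q0: "cond q0" using h(4) by simp
  have rT: "r \<E> T" "pi \<E> T" using abT h(1) opT by blast+
  let ?s = "cup (cut T q0) (hi T q1)"
  note s = amalgam[OF T cond_cut[OF T q0] cut_T[OF T q0] above_hi[OF T q1(1)]]
  have "?s <: q1" using ext'_cup[OF ext'_cut[OF h(5)] ext'_refl, of T "hi T q1"] q1(2) cut_hi by metis
  moreover have "cut T q0 <: r" using ext'_cut[OF h(6), of T] cut_id[OF T rT(1)] by simp
  hence "?s <: r" using cup_ext'1 ext'_trans by blast
  ultimately obtain q' pi' r' where q': "q' \<E> PP" "q' <: ?s" "opair pi' r' \<E> b" "pi' \<E> H" "r' \<E> PP" "q' <: r'" "eqf q' pi pi'"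
   using halfD[of eqf q1 a b pi r ?s] eqf_unfold[OF q1(3)] h(1-3) s(1) unfolding eqP_def by (metis PP_iff)
  have c': "cond q'" using q'(1) by simp
  have r'T: "r' \<E> T" "pi' \<E> T" using abT q'(3) opT by blast+
  let ?q = "cup (cut T q') (hi T q0)"
  note a = amalgam[OF T cond_cut[OF T c'] cut_T[OF T c'] above_hi[OF T q0]]
  have "cut T q' <: cut T q0" using ext'_cut[OF q'(2), of T] s(2) by simp
  hence "?q <: q0" using ext'_cup[OF _ ext'_refl, of _ _ "hi T q0"] cut_hi by metis
  moreover have "cut T q' <: r'" using ext'_cut[OF q'(6), of T] cut_id[OF T r'T(1)] by simp
  hence "?q <: r'" using cup_ext'1 ext'_trans by blast
  moreover have "rho ?q pi pi'" unfolding rho_def using a(2) q'(7) c' univ_in[OF uni_univ[OF T]] rT(2) r'T(2) by metis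
  ultimately show "EX q' pi' r'. q' \<E> PP & q' <: q0 & opair pi' r' \<E> b & pi' \<E> H & r' \<E> PP & q' <: r' & rho q' pi pi'"
   using a(1) q' by (intro exI[of _ ?q] exI[of _ pi'] exI[of _ r']) simp
 qed
 have eqP: "eqP rho q a b" if "cond q" "rho q a b" for q a b unfolding eqP_def sym using half that sym by metis
 show ?thesis
 proof (rule eqf_coinduct[of rho])
  show "dp (%e. rho (e 0) (e 1) (e 2))" unfolding rho_def by (intro dps)
  show "eqP rho q x y" by (rule eqP) (use assms in "auto simp: rho_def subs_def")
  show "eqP rho q a b" if "q \<E> PP" "rho q a b" for q a b using eqP that by simp
 qed
qed

text \<open>A bisimulation over \<open>T\<close> becomes one over \<open>H\<close> by cutting the
  conditions, and conversely by \<open>eqf_cut\<close>; the matching conditions are found by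
  amalgamating and cutting.\<close>

lemma eqf_T:
 assumes p: "cond p" "p \<E> T" and xy: "x : subs T" "y : subs T"
 shows "T.eqf p x y <-> eqf p x y"
proof
 assume e: "T.eqf p x y"
 define rho where "rho q a b <-> (ALL z. z \<E> a | z \<E> b --> z \<E> T) & T.eqf (cut T q) a b" for q a b
 have sym: "(%q a b. rho q b a) = rho" unfolding rho_def using T.eqf_sym by (intro HOL.ext) blast
 have half: "half rho q a b" if q: "cond q" and r: "rho q a b" for q a b
 proof (rule halfI)
  have abT: "z \<E> T" if "z \<E> a | z \<E> b" for z using r that unfolding rho_def by blast
  fix pi r q0 assume h: "opair pi r \<E> a" "r \<E> PP" "pi \<E> H" "q0 \<E> PP" "q0 <: q" "q0 <: r"
  have q0: "cond q0" using h(4) by simp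
  have rT: "r \<E> T" "pi \<E> T" using abT h(1) opT by blast+
  have "T.half T.eqf (cut T q) a b" using r T.eqf_unfold unfolding rho_def T.eqP_def by blast
  moreover have "cut T q0 \<E> cut T PP" "r \<E> cut T PP" using cond_cut[OF T q0] cut_T[OF T q0] h(2) rT by simp_all
  moreover have "cut T q0 <: r" using ext'_cut[OF h(6), of T] cut_id[OF T rT(1)] by simp
  ultimately obtain q' pi' r' where q': "q' \<E> cut T PP" "q' <: cut T q0" "opair pi' r' \<E> b" "pi' \<E> T"
    "r' \<E> cut T PP" "q' <: r'" "T.eqf q' pi pi'"
   using T.halfD[of T.eqf "cut T q" a b pi r "cut T q0"] h(1) rT(2) ext'_cut[OF h(5)] by metis
  have c': "cond q'" "q' \<E> T" using q'(1) by simp_all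
  let ?q = "cup q' (hi T q0)"
  note a = amalgam[OF T c' above_hi[OF T q0]]
  have "?q <: q0" using ext'_cup[OF q'(2) ext'_refl, of "hi T q0"] cut_hi by metis
  moreover have "?q <: r'" using cup_ext'1 ext'_trans q'(6) by blast
  moreover have "rho ?q pi pi'" unfolding rho_def using a(2) q'(7) univ_in[OF uni_univ[OF T]] rT(2) q'(4) by metis
  ultimately show "EX q' pi' r'. q' \<E> PP & q' <: q0 & opair pi' r' \<E> b & pi' \<E> H & r' \<E> PP & q' <: r' & rho q' pi pi'"
   using a(1) q' TH by (intro exI[of _ ?q] exI[of _ pi'] exI[of _ r']) simp
 qed
 have eqP: "eqP rho q a b" if "cond q" "rho q a b" for q a b unfolding eqP_def sym using half that sym by metis
 show "eqf p x y"
 proof (rule eqf_coinduct[of rho])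
  show "dp (%e. rho (e 0) (e 1) (e 2))" unfolding rho_def by (intro dps T.dp_eqf)
  show "eqP rho p x y" by (rule eqP) (use p xy e cut_id[OF T p(2)] in "auto simp: rho_def subs_def")
  show "eqP rho q a b" if "q \<E> PP" "rho q a b" for q a b using eqP that by simp
 qed
next
 assume e: "eqf p x y"
 define rho where "rho q a b <-> (ALL z. z \<E> a | z \<E> b --> z \<E> T) & eqf q a b" for q a b
 have sym: "(%q a b. rho q b a) = rho" unfolding rho_def using eqf_sym by (intro HOL.ext) blast
 have half: "T.half rho q a b" if r: "rho q a b" for q a b
 proof (rule T.halfI)
  have abT: "z \<E> T" if "z \<E> a | z \<E> b" for z using r that unfolding rho_def by blast
  fix pi r q0 assume h: "opair pi r \<E> a" "r \<E> cut T PP" "pi \<E> T" "q0 \<E> cut T PP" "q0 <: q" "q0 <: r"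
  have "half eqf q a b" using r eqf_unfold unfolding rho_def eqP_def by blast
  moreover have "r \<E> PP" "q0 \<E> PP" using h by simp_all
  ultimately obtain q' pi' r' where q': "q' \<E> PP" "q' <: q0" "opair pi' r' \<E> b" "pi' \<E> H" "r' \<E> PP" "q' <: r'" "eqf q' pi pi'"
   using halfD[of eqf q a b pi r q0] h(1,5,6) TH[OF h(3)] by metis
  have c': "cond q'" using q'(1) by simp
  have r'T: "r' \<E> T" "pi' \<E> T" using abT q'(3) opT by blast+
  have "cut T q' <: q0" "cut T q' <: r'" using ext'_cut[OF q'(2), of T] ext'_cut[OF q'(6), of T] cut_id[OF T] r'T(1) h(4) by simp_all
  moreover have "eqf (cut T q') pi pi'"
   by (rule eqf_cut[OF q'(7) c' cond_cut[OF T c']]) (use cut_id[OF T cut_T[OF T c']] subsT h(3) r'T in auto)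
  hence "rho (cut T q') pi pi'" unfolding rho_def using univ_in[OF uni_univ[OF T]] h(3) r'T(2) by blast
  ultimately show "EX q' pi' r'. q' \<E> cut T PP & q' <: q0 & opair pi' r' \<E> b & pi' \<E> T & r' \<E> cut T PP & q' <: r' & rho q' pi pi'"
   using cond_cut[OF T c'] cut_T[OF T c'] q' r'T by (intro exI[of _ "cut T q'"] exI[of _ pi'] exI[of _ r']) simp
 qed
 have eqP: "T.eqP rho q a b" if "rho q a b" for q a b unfolding T.eqP_def sym using half that sym by metis
 show "T.eqf p x y"
 proof (rule T.eqf_coinduct[of rho])
  show "dp (%e. rho (e 0) (e 1) (e 2))" unfolding rho_def by (intro dps)
  show "T.eqP rho p x y" by (rule eqP) (use xy e in "auto simp: rho_def subs_def")
  show "T.eqP rho q a b" if "rho q a b" for q a b using eqP that .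
 qed
qed

lemma same_T:
 assumes "x : subs T" "y : subs T"
 shows "T.same x y <-> same x y"
proof
 assume "T.same x y"
 then obtain p where p: "p : g" "p \<E> T" "T.eqf p x y" unfolding T.same_def by blast
 hence "eqf p x y" using eqf_T[OF g_cond[OF p(1)] p(2) assms] by blast
 thus "same x y" unfolding same_def using p(1) by blast
next
 assume "same x y"
 then obtain p where p: "p : g" "eqf p x y" unfolding same_def by blast
 note c = cond_cut[OF T g_cond[OF p(1)]] cut_T[OF T g_cond[OF p(1)]]
 have "eqf (cut T p) x y" by (rule eqf_cut[OF p(2) g_cond[OF p(1)] c(1) _ assms]) (use cut_id[OF T c(2)] in simp)
 hence "T.eqf (cut T p) x y" using eqf_T[OF c assms] by blast
 thus "T.same x y" unfolding T.same_def using c(2) g_cut[OF p(1) T] by blast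
qed

text \<open>The extension of \<open>T\<close> by the restricted filter is isomorphic to the part of
  the large extension whose classes have names inside \<open>T\<close>, because both equality and
  membership agree.\<close>

lemma sat_T:
 assumes "range s <= subs T"
 shows "sat T.N T.NE a (T.val o s) <-> sat (val ` subs T) NE a (val o s)"
proof -
 have v: "T.val x = T.val y <-> val x = val y" if "x : subs T" "y : subs T" for x y
  using T.val_eq[OF that] val_eq subsTH that same_T[OF that] by simp
 define F where "F X = val (SOME x. x : subs T & T.val x = X)" for X
 have F: "F (T.val x) = val x" if x: "x : subs T" for x
 proof -
  have s: "(SOME x'. x' : subs T & T.val x' = T.val x) : subs T & T.val (SOME x'. x' : subs T & T.val x' = T.val x) = T.val x"
   by (rule someI[of _ x]) (use x in simp)
  show ?thesis unfolding F_def using v[OF conjunct1[OF s] x] conjunct2[OF s] by blast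
 qed
 have ne: "T.NE (T.val x) (T.val y) <-> NE (val x) (val y)" if x: "x : subs T" and y: "y : subs T" for x y
  unfolding T.NE_pairs[OF x y] NE_pairs[OF subsTH[OF x] subsTH[OF y]]
 proof (intro iffI; elim exE conjE)
  fix pi r assume h: "opair pi r \<E> y" "pi \<E> T" "r : {r : g. r \<E> T}" "T.same x pi"
  have "same x pi" using h(4) same_T[OF x subsT[OF h(2)]] by blast
  thus "EX pi r. opair pi r \<E> y & pi \<E> H & r : g & same x pi" using h TH[OF h(2)] by blast
 next
  fix pi r assume h: "opair pi r \<E> y" "pi \<E> H" "r : g" "same x pi"
  hence pi: "pi \<E> T" "r \<E> T" using y opT unfolding subs_def by blast+
  have "T.same x pi" using h(4) same_T[OF x subsT[OF pi(1)]] by blast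
  thus "EX pi r. opair pi r \<E> y & pi \<E> T & r : {r : g. r \<E> T} & T.same x pi" using h pi by blast
 qed
 have bij: "bij_betw F T.N (val ` subs T)" unfolding bij_betw_def
 proof
  show "inj_on F T.N"
  proof (rule inj_onI)
   fix X Y assume XY: "X : T.N" "Y : T.N" "F X = F Y"
   obtain x y where "x : subs T" "y : subs T" "X = T.val x" "Y = T.val y" using XY(1,2) unfolding T.N_def by blast
   thus "X = Y" using XY(3) F v by simp
  qed
  show "F ` T.N = val ` subs T" unfolding T.N_def image_image using F by simp
 qed
 have "F o (T.val o s) = val o s" using F assms by (intro HOL.ext) (simp add: range_subsetD)
 moreover have "range (T.val o s) <= T.N" using assms by (auto simp: T.N_def)
 moreover have "T.NE X Y <-> NE (F X) (F Y)" if "X : T.N" "Y : T.N" for X Y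
 proof -
  obtain x y where "x : subs T" "y : subs T" "X = T.val x" "Y = T.val y" using \<open>X : T.N\<close> \<open>Y : T.N\<close> unfolding T.N_def by blast
  thus ?thesis using F ne by simp
 qed
 ultimately show ?thesis using sat_iso[OF bij, of T.NE NE "T.val o s" a] by simp
qed

lemma truth_T:
 assumes "range s <= subs T"
 shows "sat (val ` subs T) NE a (val o s) <->
  (EX p:g. p \<E> T & sat (subs T) E (tr a) (case_nat p (case_nat (cut T PP) s)))"
proof -
 have "sat (subs T) E (tr a) (case_nat p (case_nat (cut T PP) s)) <-> T.frc a p s" if "p \<E> T" for p
  by (rule T.sat_tr[OF subsT[OF that] assms])
 thus ?thesis using T.truth[OF assms, of a] sat_T[OF assms] by blast
qed

end

end

section \<open>The axioms of GB + AC in the extension\<close>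

context gext
begin

text \<open>The sets of the extension of \<open>T\<close>, viewed in the large extension. It serves
  as a bound: a class all of whose members satisfy it is a set (\<open>set_of\<close>).\<close>

definition inT where
 "inT T X <-> (EX pi. pi \<E> T & X = val pi)"

lemma uniH: "uni T ==> x \<E> T ==> x \<E> H" using univ_in[OF univ_H] by (auto simp: uni_def)

lemma subs_uniH: "uni T ==> x : subs T ==> x \<E> H" using univ_sub[OF univ_H, of T x] by (auto simp: uni_def subs_def)

lemma inT_NS: "uni T ==> inT T X ==> X : NS" using uniH val_NS by (auto simp: inT_def)

lemma NE_subs:
 assumes "uni T" "y : subs T" "NE X (val y)"
 shows "inT T X"
proof -
 obtain pi r where "X = val pi" "opair pi r \<E> y" using NE_cases[OF assms(3) w_subs[OF subs_uniH[OF assms(1,2)]]] by metis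
 thus ?thesis using assms(2) univ_opair[OF uni_univ[OF assms(1)]] unfolding inT_def subs_def by blast
qed

lemma uni_subs: "uni T ==> x \<E> T ==> x : subs T" using univ_in[OF uni_univ] by (auto simp: subs_def)

lemma inT_mem: "uni T ==> inT T X ==> NE Y X ==> inT T Y" using NE_subs uni_subs unfolding inT_def[of T X] by blast

lemma inT_upair: "uni T ==> inT T A ==> inT T B ==> inT T (N.upair A B)"
proof -
 assume T: "uni T" and "inT T A" "inT T B"
 then obtain a b where ab: "a \<E> T" "b \<E> T" "A = val a" "B = val b" by (auto simp: inT_def)
 have "upair (opair a emp) (opair b emp) \<E> T"
  using univ_upair[OF uni_univ[OF T]] univ_opair[OF uni_univ[OF T]] univ_emp[OF uni_univ[OF T]] ab by simp
 thus ?thesis unfolding inT_def using val_upair[OF uniH[OF T ab(1)] uniH[OF T ab(2)]] ab by metis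
qed

lemma inT_opair:
 assumes T: "uni T" and AB: "A : NS" "B : NS"
 shows "inT T (N.opair A B) <-> inT T A & inT T B"
proof
 assume o: "inT T (N.opair A B)"
 have "NE (N.upair A B) (N.opair A B)" unfolding N.opair_def using N.upair AB by simp
 hence "inT T (N.upair A B)" using inT_mem[OF T o] by blast
 thus "inT T A & inT T B" using inT_mem[OF T] N.upair(2)[OF AB] by blast
qed (simp add: N.opair_def inT_upair T)

lemma uni_ex:
 assumes "x \<E> H"
 shows "EX T. uni T & x \<E> T"
proof -
 have "emp : subs H" by (simp add: subs_def)
 from reflection[of "{}", OF _ this this this assms] show ?thesis unfolding uni_def by blast
qed

lemma ext_uni:
 assumes "x \<E> H" "X : NS" "Y : NS"
 shows "EX T. uni T & x \<E> T & inT T X & inT T Y"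
proof -
 obtain a b where ab: "a \<E> H" "b \<E> H" "X = val a" "Y = val b" using assms by (auto simp: NS_def)
 have "opair x (opair a b) \<E> H" using ab assms(1) univ_opair[OF univ_H] by simp
 then obtain T where T: "uni T" "opair x (opair a b) \<E> T" using uni_ex by blast
 hence "x \<E> T" "a \<E> T" "b \<E> T" using univ_opair[OF uni_univ[OF T(1)]] by auto
 thus ?thesis using T(1) ab unfolding inT_def by blast
qed

lemma inT_mono: "uni T' ==> T \<E> T' ==> inT T X ==> inT T' X" using univ_in[OF uni_univ] by (auto simp: inT_def)

lemma set_of:
 assumes T: "uni T" and Y: "Y : N" and m: "!!X. NE X Y ==> inT T X"
 shows "EX b:subs T. Y = val b" "Y : NS"
proof -
 obtain y where y: "y : subs H" "Y = val y" using Y by (auto simp: N_def)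
 have "EX b:subs T. val b = val y" by (rule small_class[OF T y(1)]) (use m y(2) inT_def in blast)
 thus b: "EX b:subs T. Y = val b" using y(2) by metis
 thus "Y : NS" using val_NS subs_uniH[OF T] by blast
qed

lemma class_set:
 assumes T: "uni T" and R: "N.dp (%e. R (e 0))" and m: "!!X. X : NS ==> R X ==> inT T X"
 shows "EX Y:NS. ALL X:NS. NE X Y <-> R X"
proof -
 obtain Y where Y: "Y : N" "ALL X:NS. NE X Y <-> R X" using class_exists[OF R] by blast
 have "Y : NS" by (rule set_of(2)[OF T Y(1)]) (use Y(2) m NE_NS in blast)
 thus ?thesis using Y(2) by blast
qed

text \<open>Attaching the weakest condition to each element of \<open>S\<close> gives the canonical
  name for the set of their values.\<close>

definition flat where "flat S = Img S (%pi. opair pi emp)"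

lemma flat_iff: "u \<E> flat S <-> (EX pi. pi \<E> S & u = opair pi emp)" unfolding flat_def by (rule mem_Img) (intro dps)

lemma dt_flat [dps]: "dt f ==> dt (%e. flat (f e))" unfolding flat_def by (intro dps)

lemma flat_univ:
 assumes "univ w" "S \<E> w"
 shows "flat S \<E> w"
proof -
 have d: "dt (%e. opair (e 0) emp)" by (intro dps)
 show ?thesis unfolding flat_def
  by (rule univ_repl[OF assms(1) d assms(2)]) (use univ_opair[OF assms(1)] univ_emp[OF assms(1)] univ_in[OF assms] in blast)
qed

lemma NE_flat:
 assumes "S : subs H"
 shows "NE X (val (flat S)) <-> (EX pi. pi \<E> S & X = val pi)"
proof -
 have f: "flat S : subs H" using assms univ_opair[OF univ_H] univ_emp[OF univ_H] by (auto simp: subs_def flat_iff)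
 show ?thesis
 proof
  assume "NE X (val (flat S))"
  then obtain pi r where "X = val pi" "opair pi r \<E> flat S" using NE_cases[OF _ f] by metis
  thus "EX pi. pi \<E> S & X = val pi" by (auto simp: flat_iff)
 next
  assume "EX pi. pi \<E> S & X = val pi"
  then obtain pi where pi: "pi \<E> S" "X = val pi" by blast
  thus "NE X (val (flat S))" using NE_I[OF f, of pi emp] emp_g assms by (auto simp: flat_iff subs_def)
 qed
qed

lemma NE_flat_T: "uni T ==> NE X (val (flat T)) <-> inT T X" using NE_flat[of T] w_subs unfolding inT_def by (auto simp: uni_def)

lemma val_flat_NS: "S \<E> H ==> val (flat S) : NS" using val_NS flat_univ[OF univ_H] by blast

lemma rel_class:
 assumes R: "N.dp (%e. R (e 0) (e 1))"
 shows "EX F:N. (ALL p:NS. NE p F --> (EX X:NS. EX Y:NS. p = N.opair X Y & R X Y)) & (ALL X:NS. ALL Y:NS. NE (N.opair X Y) F <-> R X Y)"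
proof -
 have "N.dp (%e. EX X:NS. EX Y:NS. e 0 = N.opair X Y & R X Y)" by (intro dps N.dp_rel2[OF R])
 from class_exists[OF this] obtain F where F: "F : N" "ALL p:NS. NE p F <-> (EX X:NS. EX Y:NS. p = N.opair X Y & R X Y)" by (elim bexE)
 have "NE (N.opair X Y) F <-> R X Y" if h: "X : NS" "Y : NS" for X Y using bspec[OF F(2) N.opair_S[OF h]] N.opair_inject[OF h] h by blast
 thus ?thesis using F by blast
qed

lemma rel_set:
 assumes R: "N.dp (%e. R (e 0) (e 1))" and T: "uni T"
  and m: "ALL X:NS. ALL Y:NS. R X Y --> inT T X & inT T Y"
 shows "EX F:NS. (ALL p:NS. NE p F --> (EX X:NS. EX Y:NS. p = N.opair X Y & R X Y)) & (ALL X:NS. ALL Y:NS. NE (N.opair X Y) F <-> R X Y)"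
proof -
 obtain F where F: "F : N" "ALL p:NS. NE p F --> (EX X:NS. EX Y:NS. p = N.opair X Y & R X Y)"
  "ALL X:NS. ALL Y:NS. NE (N.opair X Y) F <-> R X Y" using rel_class[of R, OF R] by (elim bexE conjE)
 have p: "inT T p" if p: "NE p F" for p using bspec[OF F(2) NE_NS[OF p]] p m inT_opair[OF T] by blast
 have "F : NS" by (rule set_of(2)[OF T F(1)]) (rule p)
 thus ?thesis by (rule rev_bexI) (rule conjI[OF F(2,3)])
qed

text \<open>By \<open>covering\<close>, a ground function on \<open>T\<close> captures the values,
  and its range is an element of \<open>H\<close>. A universe containing that range bounds the
  image.\<close>

lemma replacement:
 assumes R: "N.dp (%e. R (e 0) (e 1))" and A: "A : NS"
  and un: "!!X Y Z. X : NS ==> Y : NS ==> Z : NS ==> NE X A ==> R X Y ==> R X Z ==> Y = Z"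
 shows "EX B:NS. ALL Y:NS. NE Y B <-> (EX X:NS. NE X A & R X Y)"
proof -
 note R' = N.dp_rel2[OF R]
 obtain F where F: "F : N" "ALL X:NS. ALL Y:NS. NE (N.opair X Y) F <-> R X Y" using rel_class[of R, OF R] by (elim bexE conjE)
 note FR = F(2)[rule_format]
 obtain f where f: "f : subs H" "F = val f" using F(1) by (auto simp: N_def)
 obtain T where T: "uni T" "inT T A" using ext_uni[OF univ_emp[OF univ_H] A A] by blast
 obtain c where c: "!!u. u \<E> T ==> app c u \<E> H"
  "!!pi s. pi \<E> T ==> s \<E> H ==> NE (N.opair (val pi) (val s)) F ==>
   EX u. u \<E> T & app c u \<E> H & NE (N.opair (val pi) (val (app c u))) F"
  using covering[OF T(1) f(1), of H] univ_emp[OF univ_H] unfolding f(2)[symmetric] by blast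
 have d: "dt (%e. app c (e 0))" by (intro dps)
 have "Img T (app c) \<E> H" by (rule univ_repl[OF univ_H d]) (use T(1) c(1) uni_def in blast)+
 then obtain T' where T': "uni T'" "Img T (app c) \<E> T'" using uni_ex by blast
 show ?thesis
 proof (rule class_set[OF T'(1)])
  show "N.dp (%e. EX X:NS. NE X A & R X (e 0))" by (intro dps R' A)
  fix Y assume Y: "Y : NS" "EX X:NS. NE X A & R X Y"
  then obtain X where X: "X : NS" "NE X A" "R X Y" by blast
  obtain pi where pi: "pi \<E> T" "X = val pi" using inT_mem[OF T X(2)] by (auto simp: inT_def)
  obtain s where s: "s \<E> H" "Y = val s" using Y(1) by (auto simp: NS_def)
  have "NE (N.opair (val pi) (val s)) F" using FR X(1,3) Y(1) pi s by simp
  then obtain u where u: "u \<E> T" "app c u \<E> H" "NE (N.opair (val pi) (val (app c u))) F" using c(2) pi(1) s(1) by blast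
  hence "R X (val (app c u))" using FR X(1) pi(2) val_NS by simp
  hence "Y = val (app c u)" using un[OF X(1) Y(1) val_NS[OF u(2)] X(2,3)] by blast
  moreover have "app c u \<E> T'" using univ_in[OF uni_univ[OF T'(1)] T'(2)] u(1) mem_Img[OF d] by blast
  ultimately show "inT T' Y" unfolding inT_def by blast
 qed
qed

subsection \<open>Check names and choice\<close>

text \<open>Check names are produced by one recursion on the set \<open>H\<close>, so that
  \<open>chk\<close> is application of a fixed set and thus a definable term.\<close>

definition chkf :: 'm where
 "chkf = (SOME f. ALL x. x \<E> H --> app f x = flat (ran (lam x (app f))))"

definition chk where "chk x = app chkf x"

lemma dt_chk [dps]: "dt f ==> dt (%e. chk (f e))" unfolding chk_def by (intro dps)

lemma chk_iff: "x \<E> H ==> u \<E> chk x <-> (EX y. y \<E> x & u = opair (chk y) emp)"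
proof -
 assume x: "x \<E> H"
 have "dt (%e. flat (ran (e 1)))" by (intro dps)
 from rec_exists[of H "%x h. flat (ran h)", OF trans_H this]
 have ex: "EX f. ALL x. x \<E> H --> app f x = flat (ran (lam x (app f)))" by blast
 have c: "chk x = flat (ran (lam x (app chkf)))" unfolding chk_def chkf_def using someI_ex[OF ex] x by blast
 have d: "dt (%e. app chkf (e 0))" by (intro dps)
 show ?thesis unfolding c unfolding flat_iff ran_iff lam_iff[OF d] chk_def by auto
qed

lemma chk_univ:
 assumes w: "univ w" "!!x. x \<E> w ==> x \<E> H" and x: "x \<E> w"
 shows "chk x \<E> w"
proof (rule trans_induct[OF univ_trans[OF w(1)] _ x])
 show "dp (%e. chk (e 0) \<E> w)" by (intro dps)
 fix x assume x: "x \<E> w" and IH: "!!y. y \<E> x ==> chk y \<E> w"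
 have d: "dt (%e. chk (e 0))" by (intro dps)
 have "flat (Img x chk) \<E> w" by (rule flat_univ[OF w(1) univ_repl[OF w(1) d x IH]])
 moreover have "flat (Img x chk) = chk x" by (rule eqI) (unfold flat_iff mem_Img[OF d] chk_iff[OF w(2)[OF x]], blast)
 ultimately show "chk x \<E> w" by simp
qed

lemma chk_H: "x \<E> H ==> chk x \<E> H" by (rule chk_univ[OF univ_H])

lemma chk_T: "uni T ==> x \<E> T ==> chk x \<E> T" by (rule chk_univ[OF uni_univ]) (use uniH in blast)+

lemma chk_eqf:
 assumes "x \<E> H"
 shows "ALL y p. y \<E> H --> cond p --> eqf p (chk x) (chk y) --> x = y"
proof (rule trans_induct[OF trans_H _ assms])
 show "dp (%e. ALL y p. y \<E> H --> cond p --> eqf p (chk (e 0)) (chk y) --> e 0 = y)" by (intro dps)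
 fix x assume x: "x \<E> H"
  and IH: "!!z. z \<E> x ==> ALL y p. y \<E> H --> cond p --> eqf p (chk z) (chk y) --> z = y"
 show "ALL y p. y \<E> H --> cond p --> eqf p (chk x) (chk y) --> x = y"
 proof (intro allI impI)
  fix y p assume y: "y \<E> H" and p: "cond p" and e: "eqf p (chk x) (chk y)"
  have h: "half eqf p (chk x) (chk y)" "half (%q a b. eqf q b a) p (chk y) (chk x)" using eqf_unfold[OF e] unfolding eqP_def by blast+
  have pP: "p \<E> PP" and pe: "p <: emp" using p by (auto simp: ext'_def)
  show "x = y"
  proof (rule eqI2)
   fix z assume z: "z \<E> x"
   hence zH: "z \<E> H" using univ_in[OF univ_H x] by blast
   have "opair (chk z) emp \<E> chk x" using chk_iff[OF x] z by blast
   then obtain q pi r where q: "q \<E> PP" "opair pi r \<E> chk y" "eqf q (chk z) pi"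
    using halfD[OF h(1) _ emp_Q chk_H[OF zH] pP ext'_refl pe] by metis
   then obtain z' where z': "z' \<E> y" "pi = chk z'" unfolding chk_iff[OF y] by auto
   have "z' \<E> H" using univ_in[OF univ_H y] z'(1) by blast
   thus "z \<E> y" using IH[OF z] q z' by auto
  next
   fix z assume z: "z \<E> y"
   hence zH: "z \<E> H" using univ_in[OF univ_H y] by blast
   have "opair (chk z) emp \<E> chk y" using chk_iff[OF y] z by blast
   then obtain q pi r where q: "q \<E> PP" "opair pi r \<E> chk x" "eqf q pi (chk z)"
    using halfD[OF h(2) _ emp_Q chk_H[OF zH] pP ext'_refl pe] by metis
   then obtain z' where z': "z' \<E> x" "pi = chk z'" unfolding chk_iff[OF x] by auto
   thus "z \<E> x" using IH[OF z'(1)] q zH by auto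
  qed
 qed
qed

abbreviation ck :: "'m => 'm set" where "ck x \<equiv> val (chk x)"

lemma ck_NS: "x \<E> H ==> ck x : NS" using val_NS chk_H by blast

lemma ck_inj: "x \<E> H ==> y \<E> H ==> ck x = ck y <-> x = y"
 using chk_eqf val_eq[of "chk x" "chk y"] w_subs chk_H g_cond unfolding same_def by blast

lemma NE_ck: "x \<E> H ==> NE Z (ck x) <-> (EX y. y \<E> x & Z = ck y)"
proof -
 assume x: "x \<E> H"
 have d: "dt (%e. chk (e 0))" by (intro dps)
 have c: "flat (Img x chk) = chk x" by (rule eqI) (unfold flat_iff mem_Img[OF d] chk_iff[OF x], blast)
 have "Img x chk : subs H" using chk_H univ_in[OF univ_H x] by (auto simp: subs_def mem_Img[OF d])
 from NE_flat[OF this, of Z] show ?thesis unfolding c mem_Img[OF d] by blast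
qed

lemma NE_ck_ck: "x \<E> H ==> y \<E> H ==> NE (ck x) (ck y) <-> x \<E> y" using NE_ck[of y "ck x"] ck_inj univ_in[OF univ_H] by metis

lemma ck_opair:
 assumes xy: "x \<E> H" "y \<E> H"
 shows "ck (opair x y) = N.opair (ck x) (ck y)"
proof -
 have "ck (upair u v) = N.upair (ck u) (ck v)" if h: "u \<E> H" "v \<E> H" for u v
  by (rule N.upair_eqI[OF ck_NS[OF h(1)] ck_NS[OF h(2)] NS_N[OF ck_NS]])
   (use univ_upair[OF univ_H h] NE_ck[OF univ_upair[OF univ_H h]] in auto)
 thus ?thesis unfolding opair_def N.opair_def using xy univ_upair[OF univ_H] by simp
qed

text \<open>Choice for a class of arguments, as long as the values come from \<open>T\<close>: a
  ground well-ordering of \<open>T\<close> is carried into the extension as a set \<open>W\<close>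
  of pairs of index and value, and a value of least index is taken.\<close>

lemma choice_class:
 assumes T: "uni T" and R: "N.dp (%e. R (e 0) (e 1))"
 obtains F where "F : N"
  and "!!X Z. X : NS ==> Z : NS ==> NE (N.opair X Z) F ==> R X Z & inT T Z"
  and "!!X Z Z'. X : NS ==> Z : NS ==> Z' : NS ==> NE (N.opair X Z) F ==> NE (N.opair X Z') F ==> Z = Z'"
  and "!!X Z. X : NS ==> inT T Z ==> R X Z ==> EX Z:NS. NE (N.opair X Z) F"
proof -
 note R' = N.dp_rel2[OF R]
 obtain z f where z: "Ord z" and f: "!!y. y \<E> T <-> (EX x. x \<E> z & y = app f x)"
  "!!x x'. x \<E> z ==> x' \<E> z ==> app f x = app f x' ==> x = x'" using well_ordering[of T] by blast
 have zH: "z \<E> H" by (rule univ_ord_inj[OF univ_H z]) (use f T uni_def in blast)+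
 have aH: "a \<E> H" "app f a \<E> H" if "a \<E> z" for a using univ_in[OF univ_H zH that] f that uniH[OF T] by blast+
 define W where "W = val (flat (Img z (%a. opn (chk a) (app f a))))"
 have d: "dt (%e. opn (chk (e 0)) (app f (e 0)))" by (intro dps)
 have WI: "Img z (%a. opn (chk a) (app f a)) \<E> H" by (rule univ_repl[OF univ_H d zH]) (use aH opn_w chk_H in blast)
 have WN: "W : NS" unfolding W_def by (rule val_flat_NS[OF WI])
 have W: "NE (N.opair A Z) W <-> (EX a. a \<E> z & A = ck a & Z = val (app f a))" if "A : NS" "Z : NS" for A Z
 proof -
  have "NE (N.opair A Z) W <-> (EX a. a \<E> z & N.opair A Z = val (opn (chk a) (app f a)))"
   unfolding W_def NE_flat[OF w_subs[OF WI]] mem_Img[OF d] by blast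
  moreover have "val (opn (chk a) (app f a)) = N.opair (ck a) (val (app f a))" if "a \<E> z" for a
   using val_opn[OF chk_H] aH[OF that] by blast
  ultimately show ?thesis using N.opair_inject that ck_NS aH val_NS by (metis (no_types, lifting))
 qed
 define Q where "Q X Z <-> R X Z & (EX A:NS. NE (N.opair A Z) W &
  (ALL B:NS. ALL Z':NS. NE (N.opair B Z') W --> R X Z' --> ~NE B A))" for X Z
 have Q: "N.dp (%e. Q (f e) (g e))" if "N.dt f" "N.dt g" for f g by (rule N.dp_rel2[OF _ that, of Q], unfold Q_def, intro dps R' WN)
 have "N.dp (%e. Q (e 0) (e 1))" by (intro dps Q)
 from rel_class[of Q, OF this] obtain F where F: "F : N" "ALL X:NS. ALL Z:NS. NE (N.opair X Z) F <-> Q X Z" by (elim bexE conjE)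
 note FQ = F(2)[rule_format]
 have 1: "R X Z & inT T Z" if h: "X : NS" "Z : NS" "Q X Z" for X Z
 proof -
  obtain A where A: "A : NS" "NE (N.opair A Z) W" using h(3) unfolding Q_def by blast
  then obtain a where "a \<E> z" "Z = val (app f a)" using W[OF A(1) h(2)] by blast
  thus ?thesis using h(3) f(1) unfolding inT_def Q_def by blast
 qed
 have 2: "Z = Z'" if X: "X : NS" and Z: "Z : NS" "Q X Z" and Z': "Z' : NS" "Q X Z'" for X Z Z'
 proof -
  obtain A where A: "A : NS" "NE (N.opair A Z) W" "!!B Z'. B : NS ==> Z' : NS ==> NE (N.opair B Z') W ==> R X Z' ==> ~NE B A"
   using Z(2) unfolding Q_def by blast
  obtain A' where A': "A' : NS" "NE (N.opair A' Z') W" "!!B Z'. B : NS ==> Z' : NS ==> NE (N.opair B Z') W ==> R X Z' ==> ~NE B A'"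
   using Z'(2) unfolding Q_def by blast
  obtain a where a: "a \<E> z" "A = ck a" "Z = val (app f a)" using W[OF A(1) Z(1)] A(2) by blast
  obtain a' where a': "a' \<E> z" "A' = ck a'" "Z' = val (app f a')" using W[OF A'(1) Z'(1)] A'(2) by blast
  have "R X Z" "R X Z'" using Z(2) Z'(2) unfolding Q_def by blast+
  hence n: "~NE A' A" "~NE A A'" using A(3)[OF A'(1) Z'(1) A'(2)] A'(3)[OF A(1) Z(1) A(2)] by blast+
  have "~a' \<E> a" "~a \<E> a'"
   using n NE_ck_ck[OF aH(1)[OF a'(1)] aH(1)[OF a(1)]] NE_ck_ck[OF aH(1)[OF a(1)] aH(1)[OF a'(1)]] unfolding a(2) a'(2) by blast+
  moreover have "Ord a" "Ord a'" using Ord_in[OF z] a(1) a'(1) by blast+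
  ultimately have "a = a'" using Ord_lin[of a a'] by blast
  thus ?thesis using a(3) a'(3) by simp
 qed
 have 3: "EX Z:NS. Q X Z" if X: "X : NS" and Z0: "inT T Z0" "R X Z0" for X Z0
 proof -
  have ZN: "Z0 : NS" by (rule inT_NS[OF T Z0(1)])
  obtain pi where pi: "pi \<E> T" "Z0 = val pi" using Z0(1) unfolding inT_def by blast
  obtain a where a: "a \<E> z" "Z0 = val (app f a)" using f(1)[of pi] pi by blast
  have "N.dp (%e. EX Z:NS. NE (N.opair (e 0) Z) W & R X Z)" by (intro dps R' WN X)
  from class_exists[OF this] obtain I where I: "I : N" and
   Im: "ALL A:NS. NE A I <-> (EX Z:NS. NE (N.opair A Z) W & R X Z)" by (elim bexE)
  have cN: "ck a : NS" by (rule ck_NS[OF aH(1)[OF a(1)]])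
  have "NE (N.opair (ck a) Z0) W" using W[OF cN ZN] a by blast
  hence "NE (ck a) I" using bspec[OF Im cN] Z0(2) ZN by blast
  from N_foundation[OF I this] obtain A where A: "NE A I" "!!B. NE B A ==> ~NE B I" by blast
  have AN: "A : NS" by (rule NE_NS[OF A(1)])
  obtain Z where Z: "Z : NS" "NE (N.opair A Z) W" "R X Z" using bspec[OF Im AN] A(1) by blast
  have "~NE B A" if "B : NS" "Z' : NS" "NE (N.opair B Z') W" "R X Z'" for B Z' using A(2)[of B] bspec[OF Im that(1)] that by blast
  hence "Q X Z" unfolding Q_def using AN Z by blast
  thus ?thesis using Z(1) by blast
 qed
 show ?thesis
 proof (rule that[OF F(1)])
  show "R X Z & inT T Z" if "X : NS" "Z : NS" "NE (N.opair X Z) F" for X Z using 1 FQ that by blast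
  show "Z = Z'" if "X : NS" "Z : NS" "Z' : NS" "NE (N.opair X Z) F" "NE (N.opair X Z') F" for X Z Z' using 2[of X Z Z'] FQ that by blast
  show "EX Z:NS. NE (N.opair X Z) F" if "X : NS" "inT T Z" "R X Z" for X Z using 3 FQ that by blast
 qed
qed

lemma GB_AC_holds:
 assumes "p : GB_AC"
 shows "sat N NE p e"
proof -
 have inS: "sat N NE (in_sets F n) e = sat NS NE (F n) e" for F n e unfolding in_sets_def sat_relativize NS_iff[symmetric] by (rule refl)
 consider "p = sentence ax_extensionality" | "p = sentence ax_foundation" | "p = sentence (in_sets ax_pairing)"
  | "p = sentence (in_sets ax_union)" | "p = sentence (in_sets ax_power)" | "p = sentence (in_sets ax_infinity)"
  | "p = sentence ax_class_replacement" | "p = sentence (in_sets ax_choice)"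
  | k q where "p = foralls k (class_comprehension q)" "free_below (k + 1) q" using assms unfolding GB_AC_def by blast
 thus ?thesis
 proof cases
  case 1
  have "ALL x:N. ALL y:N. (ALL z:N. NE z x <-> NE z y) --> x = y" using N.ext NS_N by blast
  thus ?thesis unfolding 1 sentence_def ax_extensionality_def by simp
 next
  case 2
  have "ALL x:N. (EX z:N. NE z x) --> (EX y:N. NE y x & ~(EX z:N. NE z y & NE z x))" using N_foundation NE_NS NS_N by meson
  thus ?thesis unfolding 2 sentence_def ax_foundation_def Defs.nonempty_def by simp
 next
  case 3
  have "ALL a:NS. ALL b:NS. EX p:NS. ALL z:NS. NE z p <-> z = a | z = b" using N.pairing by blast
  thus ?thesis unfolding 3 sentence_def inS ax_pairing_def is_upair_def by simp
 next
  case 4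
  have "EX u:NS. ALL z:NS. NE z u <-> (EX y:NS. NE y x & NE z y)" if x: "x : NS" for x
  proof -
   obtain T where T: "uni T" "inT T x" using ext_uni[OF univ_emp[OF univ_H] x x] by blast
   show ?thesis by (rule class_set[OF T(1)]) (intro dps x, use inT_mem[OF T(1)] T(2) in blast)
  qed
  thus ?thesis unfolding 4 sentence_def inS ax_union_def by simp
 next
  case 5
  have "EX u:NS. ALL z:NS. NE z u <-> N.Sub z x" if x: "x : NS" for x
  proof -
   obtain T where T: "uni T" "inT T x" using ext_uni[OF univ_emp[OF univ_H] x x] by blast
   \<comment> \<open>Subsets of \<open>x\<close> have names that are subsets of \<open>T\<close>, so
     a universe containing \<open>Pow T\<close> bounds them all.\<close>
   have "Pow T \<E> H" using univ_Pow[OF univ_H] T(1) by (simp add: uni_def)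
   then obtain T' where T': "uni T'" "Pow T \<E> T'" using uni_ex by blast
   show ?thesis
   proof (rule class_set[OF T'(1)])
    show "N.dp (%e. N.Sub (e 0) x)" unfolding N.Sub_def by (intro dps x)
    fix z assume z: "z : NS" "N.Sub z x"
    obtain b where b: "b : subs T" "z = val b"
     using set_of(1)[OF T(1) NS_N[OF z(1)]] z(2) inT_mem[OF T] NE_NS unfolding N.Sub_def by blast
    hence "b \<E> T'" using univ_in[OF uni_univ[OF T'(1)] T'(2)] by (auto simp: subs_def)
    thus "inT T' z" unfolding inT_def using b(2) by blast
   qed
  qed
  thus ?thesis unfolding 5 sentence_def inS ax_power_def by simp
 next
  case 6
  \<comment> \<open>The sets of the extension of any universe form an inductive set.\<close>
  obtain T where T: "uni T" using uni_ex[OF univ_emp[OF univ_H]] by blast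
  let ?x = "val (flat T)"
  have mem: "NE X ?x <-> inT T X" for X by (rule NE_flat_T[OF T])
  have x: "?x : NS" using val_flat_NS T by (simp add: uni_def)
  have e: "inT T (ck emp)" "~NE Z (ck emp)" for Z
   using NE_ck[OF univ_emp[OF univ_H]] chk_T[OF T univ_emp[OF uni_univ[OF T]]] unfolding inT_def by auto
  have s: "EX s:NS. (ALL z:NS. NE z s <-> NE z y | z = y) & inT T s" if y: "inT T y" for y
  proof -
   obtain pi where pi: "pi \<E> T" "y = val pi" using y by (auto simp: inT_def)
   let ?s = "cup pi (sng (opair pi emp))"
   have sT: "?s \<E> T" using pi(1) univ_cup[OF uni_univ[OF T]] univ_sng[OF uni_univ[OF T]] univ_opair[OF uni_univ[OF T]]
     univ_emp[OF uni_univ[OF T]] by simp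
   have sH: "?s : subs H" and piH: "pi : subs H" using w_subs uniH[OF T] sT pi(1) by blast+
   have "NE z (val ?s) <-> NE z y | z = y" for z
   proof
    assume "NE z (val ?s)"
    then obtain rho r where r: "z = val rho" "opair rho r \<E> ?s" "rho \<E> H" "r : g" using NE_cases[OF _ sH] by metis
    thus "NE z y | z = y" using NE_I[OF piH, of rho r] pi(2) by auto
   next
    assume "NE z y | z = y"
    thus "NE z (val ?s)"
    proof
     assume "NE z y"
     then obtain rho r where r: "z = val rho" "opair rho r \<E> pi" "rho \<E> H" "r : g" using NE_cases[OF _ piH] pi(2) by metis
     thus ?thesis using NE_I[OF sH, of rho r] by simp
    next
     assume "z = y"
     thus ?thesis using NE_I[OF sH, of pi emp] emp_g pi uniH[OF T] by simp
    qed
   qed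
   thus ?thesis using sT val_NS[OF uniH[OF T sT]] unfolding inT_def by blast
  qed
  have "EX x:NS. (EX z:NS. NE z x & ~(EX u:NS. NE u z)) &
    (ALL y:NS. NE y x --> (EX s:NS. (ALL z:NS. NE z s <-> NE z y | z = y) & NE s x))"
   by (rule bexI[OF _ x], unfold mem, rule conjI, rule bexI[of _ "ck emp"])
    (use e inT_NS[OF T] s in blast)+
  thus ?thesis unfolding 6 sentence_def inS ax_infinity_def Defs.nonempty_def is_succ_def by simp
 next
  case 7
  have "EX b:NS. ALL y:NS. NE y b <-> (EX x:NS. NE x a & NE (N.opair x y) F)"
   if F: "F : N" and un: "ALL x:NS. ALL y:NS. ALL z:NS. NE (N.opair x y) F & NE (N.opair x z) F --> y = z" and a: "a : NS" for F a
   by (rule replacement[OF _ a]) (intro dps F, use un in blast)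
  thus ?thesis unfolding 7 sentence_def ax_class_replacement_def by (simp add: inS)
 next
  case 8
  have "EX f:NS. N.FunOn f x & (ALL y:NS. ALL z:NS. NE (N.opair y z) f --> NE z y)"
   if x: "x : NS" and ne: "ALL y:NS. NE y x --> (EX z:NS. NE z y)" for x
  proof -
   obtain T where T: "uni T" "inT T x" using ext_uni[OF univ_emp[OF univ_H] x x] by blast
   have d: "N.dp (%e. NE (e 1) (e 0))" by (intro dps)
   obtain F where F: "F : N"
    "!!y z. y : NS ==> z : NS ==> NE (N.opair y z) F ==> NE z y & inT T z"
    "!!y z z'. y : NS ==> z : NS ==> z' : NS ==> NE (N.opair y z) F ==> NE (N.opair y z') F ==> z = z'"
    "!!y z. y : NS ==> inT T z ==> NE z y ==> EX z:NS. NE (N.opair y z) F"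
    by (rule choice_class[of T "%y z. NE z y", OF T(1) d], rule that, assumption+)
   have d: "N.dp (%e. NE (e 0) x & NE (N.opair (e 0) (e 1)) F)" by (intro dps x F(1))
   have "ALL y:NS. ALL z:NS. NE y x & NE (N.opair y z) F --> inT T y & inT T z" using F(2) inT_mem[OF T] by blast
   from rel_set[of "%y z. NE y x & NE (N.opair y z) F", OF d T(1) this]
   obtain f where f: "f : NS" "ALL p:NS. NE p f --> (EX y:NS. EX z:NS. p = N.opair y z & NE y x & NE (N.opair y z) F)"
    "ALL y:NS. ALL z:NS. NE (N.opair y z) f <-> NE y x & NE (N.opair y z) F" by (elim bexE conjE)
   note fo = f(3)[rule_format]
   have "N.FunOn f x" unfolding N.FunOn_def
   proof (intro conjI ballI impI)
    show "EX y:NS. EX z:NS. NE y x & p = N.opair y z" if "p : NS" "NE p f" for p using f(2) that by blast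
    fix y assume y: "y : NS" "NE y x"
    obtain u where u: "NE u y" using ne y by blast
    have "inT T u" by (rule inT_mem[OF T(1) inT_mem[OF T y(2)] u])
    then obtain z where z: "z : NS" "NE (N.opair y z) F" using F(4)[OF y(1) _ u] by blast
    thus "EX z:NS. NE (N.opair y z) f & (ALL z':NS. NE (N.opair y z') f --> z' = z)" using fo F(3) y by blast
   qed
   thus ?thesis using f(1) fo F(2) by blast
  qed
  thus ?thesis unfolding 8 sentence_def inS ax_choice_def by simp
 next
  case (9 k q)
  obtain X0 where X0: "X0 : N" using NS_N N.nonempty by blast
  have "sat N NE (class_comprehension q k) e'" if e': "!!i. i < k ==> e' i : N" for e'
  proof -
   define t where "t j = (if j < k then e' (k - Suc j) else X0)" for j
   have "range t <= N" using e' X0 by (auto simp: t_def)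
   from comprehension[OF this, of q] obtain C where C: "C : N" "!!X. X : NS ==> NE X C <-> sat NS NE q (case_nat X t)" by blast
   have "sat N NE (schematic (relativize q) [Suc k] (Suc (Suc k))) (case_nat X (case_nat C e')) <-> NE X C"
    if X: "X : NS" for X
   proof -
    have c: "lv (case_nat X (case_nat C e')) (Suc (Suc k)) (if i < length [Suc k] then [Suc k] ! i else i - length [Suc k]) =
      case_nat X t i" if "i : fv q" for i
    proof (cases i)
     case (Suc j)
     hence "j < k" using that 9(2) free_below_fv by fastforce
     thus ?thesis using Suc by (simp add: t_def) (simp add: lv_def)
    qed simp
    have "sat NS NE q (%i. lv (case_nat X (case_nat C e')) (Suc (Suc k))
      (if i < length [Suc k] then [Suc k] ! i else i - length [Suc k])) = sat NS NE q (case_nat X t)" by (rule sat_cong) (rule c)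
    thus ?thesis unfolding C(2)[OF X] sat_schematic sat_relativize NS_iff[symmetric] .
   qed
   hence "EX C:N. ALL X:N. (EX Y:N. NE X Y) -->
     (NE X C <-> sat N NE (schematic (relativize q) [Suc k] (Suc (Suc k))) (case_nat X (case_nat C e')))"
    using C(1) N.S_C N.mem_S by blast
   thus ?thesis unfolding class_comprehension_def by (simp add: is_set_def)
  qed
  thus ?thesis unfolding 9(1) sat_foralls by simp
 qed
qed

end

section \<open>The Semi-Weak Vopenka Principle in the extension\<close>

context base
begin

text \<open>A thread choosing a vertex in each graph. With \<open>Edge\<close> this describes the
  product of all graphs of the sequence, whose vertices are proper classes.\<close>

definition Vtx where
 "Vtx y G <-> (ALL a:S. ORD a --> (EX gr:S. EX v:S. EX d:S. EX x:S. opair a gr \<E> G & gr = opair v d & x \<E> v &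
   opair a x \<E> y & (ALL x':S. opair a x' \<E> y --> x' = x)))"

definition Edge where
 "Edge y z G <-> (ALL a:S. ORD a --> (EX gr:S. EX v:S. EX d:S. EX x:S. EX x':S. opair a gr \<E> G & gr = opair v d &
   opair a x \<E> y & opair a x' \<E> z & opair x x' \<E> d))"

end

definition F_Vtx :: "nat => nat => form" where
 "F_Vtx y G = (\<^bold>\<forall>a. ordinal a \<^bold>\<longrightarrow> (\<^bold>\<exists>gr. \<^bold>\<exists>v. \<^bold>\<exists>d. \<^bold>\<exists>x. related G a gr \<^bold>\<and> is_pair gr v d \<^bold>\<and> x \<^bold>\<in> v \<^bold>\<and>
   related y a x \<^bold>\<and> (\<^bold>\<forall>x'. related y a x' \<^bold>\<longrightarrow> x' \<^bold>= x)))"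

definition F_Edge :: "nat => nat => nat => form" where
 "F_Edge y z G = (\<^bold>\<forall>a. ordinal a \<^bold>\<longrightarrow> (\<^bold>\<exists>gr. \<^bold>\<exists>v. \<^bold>\<exists>d. \<^bold>\<exists>x. \<^bold>\<exists>x'. related G a gr \<^bold>\<and> is_pair gr v d \<^bold>\<and>
   related y a x \<^bold>\<and> related z a x' \<^bold>\<and> related d x x'))"

lemma (in base) sat_F_Vtx:
 "y < n ==> G < n ==> lv e n y : C ==> lv e n G : C ==> sat S E (F_Vtx y G n) e <-> Vtx (lv e n y) (lv e n G)"
 by (simp add: F_Vtx_def Vtx_def)

lemma (in base) sat_F_Edge:
 "y < n ==> z < n ==> G < n ==> lv e n y : C ==> lv e n z : C ==> lv e n G : C ==>
  sat S E (F_Edge y z G n) e <-> Edge (lv e n y) (lv e n z) (lv e n G)" by (simp add: F_Edge_def Edge_def)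

definition e3 :: "'a => 'a => 'a => nat => 'a" where
 "e3 y z c = case_nat y (case_nat z (%_. c))"

lemma lv_e3: "lv (e3 y z c) 3 0 = c" "lv (e3 y z c) 3 1 = z" "lv (e3 y z c) 3 2 = y"
 by (simp_all add: lv_def e3_def numeral_2_eq_2 numeral_3_eq_3)

lemma e3_comp: "f o e3 y z c = e3 (f y) (f z) (f c)" by (rule HOL.ext) (simp add: e3_def split: nat.split)

lemma e3_range: "y : A ==> z : A ==> c : A ==> range (e3 y z c) <= A" by (auto simp: e3_def split: nat.split)

context gext
begin

text \<open>Reflection of the structure of names, combined with the forcing theorem for the extensions
 by the generic filter and by its restriction to \<open>T\<close>.\<close>

lemma elementary:
 assumes \<Phi>: "finite \<Phi>" and c: "c : subs H"
 shows "EX T ev. uni T & (ALL b:subs T. app ev b : subs H) & (ALL a:\<Phi>. ALL y:subs T. ALL z:subs T.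
  sat (val ` subs T) NE a (e3 (val y) (val z) (val (cut T c))) <->
  sat N NE a (e3 (val (app ev y)) (val (app ev z)) (val c)))"
proof -
 define rho :: "nat => nat" where "rho = case_nat 0 (case_nat 3 (case_nat 1 (case_nat 2 (%_. 4))))"
 \<comment> \<open>Forcing theorem and reflection carry truth from the extension of \<open>T\<close>
   to the large one; including the negations yields the equivalence.\<close>
 define \<Psi> where "\<Psi> = (%a. rename rho (tr a)) ` (\<Phi> Un (%a. Implies a Falsum) ` \<Phi>)"
 have P: "PP : subs H" unfolding subs_def using Q_w by blast
 have e: "emp : subs H" by (simp add: subs_def)
 have f: "finite \<Psi>" using \<Phi> by (simp add: \<Psi>_def)
 obtain T ev where T: "T \<E> H" "univ T" "ALL b:subs T. app ev b : subs H" "ALL x. x \<E> T --> app ev x = x"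
  and sat: "ALL p:\<Psi>. ALL x:subs T. ALL y:subs T. ALL z:subs T.
    sat (subs T) E p (env6 x y z (cut T PP) (cut T c) (cut T emp)) <->
    sat (subs H) E p (env6 (app ev x) (app ev y) (app ev z) PP c emp)"
  using reflection[OF f P c e univ_emp[OF univ_H]] by - (elim exE conjE, rule that, assumption+)
 have uT: "uni T" using T(1,2) by (simp add: uni_def)
 have env: "env6 p y z Q c d o rho = case_nat p (case_nat Q (e3 y z c))" for p y z Q c d :: 'm
  by (rule HOL.ext) (simp add: env6_def e3_def rho_def numeral_2_eq_2 numeral_3_eq_3 numeral_eq_Suc split: nat.split)
 have imp: "sat (val ` subs T) NE a (e3 (val y) (val z) (val (cut T c))) ==>
   sat N NE a (e3 (val (app ev y)) (val (app ev z)) (val c))"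
  if a: "a : \<Phi> Un (%a. Implies a Falsum) ` \<Phi>" and y: "y : subs T" and z: "z : subs T" for a y z
 proof -
  assume s: "sat (val ` subs T) NE a (e3 (val y) (val z) (val (cut T c)))"
  have cT: "cut T c : subs T" by (auto simp: subs_def)
  obtain p where p: "p : g" "p \<E> T" "sat (subs T) E (tr a) (case_nat p (case_nat (cut T PP) (e3 y z (cut T c))))"
   using truth_T[OF uT e3_range[OF y z cT], of a] s unfolding e3_comp by blast
  have "sat (subs T) E (rename rho (tr a)) (env6 p y z (cut T PP) (cut T c) (cut T emp))" using p(3) unfolding sat_rename env .
  moreover have "rename rho (tr a) : \<Psi>" using a unfolding \<Psi>_def by blast
  ultimately have "sat (subs H) E (rename rho (tr a)) (env6 (app ev p) (app ev y) (app ev z) PP c emp)"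
   using sat uni_subs[OF uT p(2)] y z by blast
  hence "sat (subs H) E (tr a) (case_nat p (case_nat PP (e3 (app ev y) (app ev z) c)))" using T(4) p(2) unfolding sat_rename env by simp
  moreover have r: "range (e3 (app ev y) (app ev z) c) <= subs H" using T(3) y z c by (intro e3_range) blast+
  ultimately have "frc a p (e3 (app ev y) (app ev z) c)" using sat_tr[OF w_subs[OF Q_w[OF g_Q[OF p(1)]]] r] by blast
  thus ?thesis using truth[OF r, of a] p(1) unfolding e3_comp by blast
 qed
 have "sat (val ` subs T) NE a (e3 (val y) (val z) (val (cut T c))) <->
   sat N NE a (e3 (val (app ev y)) (val (app ev z)) (val c))"
  if "a : \<Phi>" "y : subs T" "z : subs T" for a y z
  using imp[of a y z] imp[of "Implies a Falsum" y z] that by (simp only: sat.simps) blast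
 thus ?thesis using uT T(3) by blast
qed

subsection \<open>Ordinals of the extension\<close>

text \<open>The extension has sets and classes and is no instance of \<open>zf\<close>. What is
  needed about its ordinals as indices of graphs is therefore proved from foundation and
  comprehension.\<close>

lemma N_min:
 assumes R: "N.dp (%e. R (e 0))" and X: "X : NS" "R X"
 shows "EX Y:NS. R Y & (ALL Z:NS. NE Z Y --> ~R Z)"
proof -
 obtain C where C: "C : N" "ALL Z:NS. NE Z C <-> R Z" using class_exists[OF R] by (elim bexE)
 hence "NE X C" using X by blast
 from N_foundation[OF C(1) this] obtain Y where "NE Y C" "ALL Z. NE Z Y --> ~NE Z C" by blast
 thus ?thesis using C(2) NE_NS by blast
qed

lemma N_cycle3: "x : NS ==> y : NS ==> z : NS ==> NE x y ==> NE y z ==> ~NE z x"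
proof -
 assume h: "x : NS" "y : NS" "z : NS" "NE x y" "NE y z"
 have "N.dp (%e. e 0 = x | e 0 = y | e 0 = z)" by (intro dps h)
 from N_min[of "%u. u = x | u = y | u = z", OF this h(1)] show ?thesis using h by blast
qed

lemma N_irrefl: "x : NS ==> ~NE x x" using N_cycle3[of x x x] by blast

lemma N_asym: "x : NS ==> y : NS ==> NE x y ==> ~NE y x"
proof -
 assume h: "x : NS" "y : NS" "NE x y"
 have "N.dp (%e. e 0 = x | e 0 = y)" by (intro dps h)
 from N_min[of "%u. u = x | u = y", OF this h(1)] show ?thesis using h by blast
qed

lemma N_dp_ORD: "N.dt f ==> N.dp (%e. N.ORD (f e))" by (rule N.dp_rel1[of N.ORD], unfold N.ORD_def N.Sub_def, intro dps)

lemma ORD_trans: "N.ORD a ==> NE x a ==> NE y x ==> NE y a" using NE_NS unfolding N.ORD_def N.Sub_def by blast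

lemma ORD_cmp: "N.ORD a ==> NE x a ==> NE y a ==> NE x y | x = y | NE y x" using NE_NS unfolding N.ORD_def by blast

lemma ORDI: "(!!x y. NE x a ==> NE y x ==> NE y a) ==> (!!x y. NE x a ==> NE y a ==> NE x y | x = y | NE y x) ==> N.ORD a"
 unfolding N.ORD_def N.Sub_def by blast

lemma ORD_in: "a : NS ==> N.ORD a ==> NE b a ==> N.ORD b"
proof (rule ORDI)
 assume a: "a : NS" "N.ORD a" "NE b a"
 note S = NE_NS
 fix x y assume x: "NE x b"
 hence xa: "NE x a" using ORD_trans a by blast
 { assume y: "NE y x"
  hence "NE y a" using ORD_trans a xa by blast
  hence "NE y b | y = b | NE b y" using ORD_cmp a by blast
  thus "NE y b" using N_asym[OF S[OF x] S[OF y]] N_asym[OF S[OF a(3)] S[OF x]] N_cycle3[OF S[OF a(3)] S[OF y] S[OF x]] x y by blast }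
 { assume "NE y b"
  thus "NE x y | x = y | NE y x" using ORD_cmp a xa ORD_trans by blast }
qed

lemma ORD_initial:
 assumes a: "a : NS" "N.ORD a" and c: "N.dp (%e. c (e 0))" "ALL x. c x --> NE x a" "ALL x y. c x --> NE y x --> c y"
  and x: "NE x a" "~c x"
 shows "EX y. NE y a & (ALL z. NE z y <-> c z)"
proof -
 note c' = N.dp_rel1[OF c(1)]
 have "N.dp (%e. NE (e 0) a & ~c (e 0))" by (intro dps c' a)
 from N_min[of "%x. NE x a & ~c x", OF this NE_NS[OF x(1)]] x
 obtain y where y: "y : NS" "NE y a" "~c y" "!!z. NE z y ==> NE z a ==> c z" using NE_NS by blast
 have "c z" if "NE z y" for z using y(4) that ORD_trans[OF a(2) y(2)] by blast
 moreover have "NE z y" if "c z" for z using ORD_cmp[OF a(2) _ y(2), of z] c(2,3) that y(3) by blast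
 ultimately show ?thesis using y(2) by blast
qed

lemma ORD_lin:
 assumes a: "a : NS" "N.ORD a" and b: "b : NS" "N.ORD b"
 shows "NE a b | a = b | NE b a"
proof -
 have d: "N.dp (%e. NE (e 0) a & NE (e 0) b)" by (intro dps a b)
 have i: "ALL x. NE x a & NE x b --> NE x a" "ALL x. NE x a & NE x b --> NE x b"
  "ALL x y. NE x a & NE x b --> NE y x --> NE y a & NE y b" using ORD_trans a(2) b(2) by blast+
 have A: "(ALL x. NE x a --> NE x b) | (EX y. NE y a & (ALL z. NE z y <-> NE z a & NE z b))"
  using ORD_initial[of a "%x. NE x a & NE x b", OF a d i(1,3)] by blast
 have B: "(ALL x. NE x b --> NE x a) | (EX y. NE y b & (ALL z. NE z y <-> NE z a & NE z b))"
  using ORD_initial[of b "%x. NE x a & NE x b", OF b d i(2,3)] by blast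
 have eq: "u = v" if "u : NS" "v : NS" "!!z. NE z u <-> NE z v" for u v using N.ext[of u v] that NS_N by blast
 show ?thesis
 proof (cases "ALL x. NE x a --> NE x b")
  case ab: True
  from B show ?thesis
  proof
   assume "ALL x. NE x b --> NE x a"
   thus ?thesis using eq[OF a(1) b(1)] ab by blast
  next
   assume "EX y. NE y b & (ALL z. NE z y <-> NE z a & NE z b)"
   then obtain y where y: "NE y b" "!!z. NE z y <-> NE z a & NE z b" by blast
   hence "y = a" using eq[OF NE_NS[OF y(1)] a(1)] ab by blast
   thus ?thesis using y(1) by blast
  qed
 next
  case False
  then obtain y where y: "NE y a" "!!z. NE z y <-> NE z a & NE z b" using A by blast
  show ?thesis
  proof (cases "ALL x. NE x b --> NE x a")
   case True
   hence "y = b" using eq[OF NE_NS[OF y(1)] b(1)] y(2) by blast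
   thus ?thesis using y(1) by blast
  next
   case False
   then obtain y' where y': "NE y' b" "!!z. NE z y' <-> NE z a & NE z b" using B by blast
   hence "y = y'" using eq[OF NE_NS[OF y(1)] NE_NS[OF y'(1)]] y(2) by blast
   hence "NE y y" using y y' by blast
   thus ?thesis using N_irrefl NE_NS by blast
  qed
 qed
qed

lemma ORD_suc:
 assumes a: "a : NS" "N.ORD a"
 shows "EX s:NS. N.ORD s & NE a s"
proof -
 obtain T where T: "uni T" "inT T a" using ext_uni[OF univ_emp[OF univ_H] a(1) a(1)] by blast
 have d: "N.dp (%e. NE (e 0) a | e 0 = a)" by (intro dps a)
 have "EX s:NS. ALL x:NS. NE x s <-> NE x a | x = a" by (rule class_set[OF T(1) d]) (use inT_mem[OF T] T(2) in blast)
 then obtain s where s: "s : NS" "ALL x:NS. NE x s <-> NE x a | x = a" by (elim bexE)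
 have m: "NE x s <-> NE x a | x = a" for x using s(2) NE_NS a(1) by blast
 have "N.ORD s"
 proof (rule ORDI; unfold m)
  show "NE y a | y = a" if "NE x a | x = a" "NE y x" for x y using that ORD_trans[OF a(2), of x y] by auto
  show "NE x y | x = y | NE y x" if "NE x a | x = a" "NE y a | y = a" for x y using that ORD_cmp[OF a(2), of x y] by auto
 qed
 thus ?thesis using s(1) m by blast
qed

end

lemma (in base) sat_e3:
 assumes "y : C" "z : C" "G : C"
 shows "sat S E (graph_sequence 0 3) (e3 y z G) <-> GSeq G"
  "sat S E (F_Vtx 2 0 3) (e3 y z G) <-> Vtx y G"
  "sat S E (F_Edge 2 1 0 3) (e3 y z G) <-> Edge y z G"
proof -
 have "lv (e3 y z G) 3 0 : C" "lv (e3 y z G) 3 1 : C" "lv (e3 y z G) 3 2 : C" unfolding lv_e3 by (rule assms)+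
 note l = this
 show "sat S E (graph_sequence 0 3) (e3 y z G) <-> GSeq G" using sat_graph_sequence[OF _ l(1)] unfolding lv_e3 by simp
 show "sat S E (F_Vtx 2 0 3) (e3 y z G) <-> Vtx y G" using sat_F_Vtx[OF _ _ l(3,1)] unfolding lv_e3 by simp
 show "sat S E (F_Edge 2 1 0 3) (e3 y z G) <-> Edge y z G" using sat_F_Edge[OF _ _ _ l(3,2,1)] unfolding lv_e3 by simp
qed

context gext
begin

context
 fixes T assumes T: "uni T"
begin

text \<open>The extension of \<open>T\<close> together with its classes is again a structure of the
  same kind, so the evaluation of formulas applies to it as it stands.\<close>

lemma base_T: "base (val ` subs T) NE {X. inT T X}"
proof
 show "{X. inT T X} <= val ` subs T" unfolding inT_def using uni_subs[OF T] by blast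
 show "X : {X. inT T X}" if "NE X Y" "Y : val ` subs T" for X Y using that NE_subs[OF T] by blast
 show "X = Y" if XY: "X : val ` subs T" "Y : val ` subs T" and eq: "!!Z. Z : {X. inT T X} ==> NE Z X <-> NE Z Y" for X Y
 proof (rule N.ext)
  show "X : N" "Y : N" using XY val_N w_subs subs_uniH[OF T] by blast+
  show "NE Z X <-> NE Z Y" for Z using eq NE_subs[OF T] XY by blast
 qed
 show "EX P:{X. inT T X}. ALL Z:{X. inT T X}. NE Z P <-> Z = A | Z = B" if "A : {X. inT T X}" "B : {X. inT T X}" for A B
  using that inT_upair[OF T, of A B] N.upair(2) inT_NS[OF T] by blast
 show "{X. inT T X} ~= {}" using univ_om[OF uni_univ[OF T]] unfolding inT_def by blast
qed

interpretation B: base "val ` subs T" NE "{X. inT T X}" by (rule base_T)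

private lemma NS': "inT T X ==> X : NS" by (rule inT_NS[OF T])

lemma B_opair: "inT T A ==> inT T X ==> B.opair A X = N.opair A X"
proof -
 have u: "B.upair A X = N.upair A X" if h: "inT T A" "inT T X" for A X
 proof (rule B.upair_eqI[symmetric])
  show "A : {X. inT T X}" "X : {X. inT T X}" using h by simp_all
  show "N.upair A X : val ` subs T" using inT_upair[OF T h] B.S_C by blast
  show "NE z (N.upair A X) <-> z = A | z = X" for z using N.upair(2)[OF NS'[OF h(1)] NS'[OF h(2)]] .
 qed
 assume h: "inT T A" "inT T X"
 show ?thesis unfolding B.opair_def N.opair_def using u h inT_upair[OF T] by simp
qed

text \<open>Only members of members matter, and these stay in the extension of
  \<open>T\<close>.\<close>

lemma B_ORD: "inT T a ==> B.ORD a <-> N.ORD a"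
proof -
 assume a: "inT T a"
 have m: "inT T x & x : NS" if "NE x a" for x using inT_mem[OF T a that] NS' by blast
 have s: "B.Sub x a <-> N.Sub x a" if "NE x a" for x
  unfolding B.Sub_def N.Sub_def using inT_mem[OF T conjunct1[OF m[OF that]]] NE_NS by (simp, blast)
 show ?thesis unfolding B.ORD_def N.ORD_def
 proof (intro conj_cong)
  show "(ALL x:{X. inT T X}. NE x a --> B.Sub x a) <-> (ALL x:NS. NE x a --> N.Sub x a)"
   unfolding Ball_def mem_Collect_eq using s m by metis
  show "(ALL x:{X. inT T X}. ALL y:{X. inT T X}. NE x a & NE y a --> NE x y | x = y | NE y x) <->
    (ALL x:NS. ALL y:NS. NE x a & NE y a --> NE x y | x = y | NE y x)" unfolding Ball_def mem_Collect_eq using m by metis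
 qed
qed

text \<open>Used for the restriction to \<open>T\<close> of the given sequence, which by reflection
  is a graph sequence of the extension of \<open>T\<close>: its graphs are elements of that
  extension.\<close>

lemma swvp_small:
 assumes G: "G : val ` subs T" and seq: "B.GSeq G" and a: "inT T a" "N.ORD a"
 shows "EX gr v d. inT T gr & inT T v & inT T d & NE (N.opair a gr) G & gr = N.opair v d"
proof -
 obtain gr where gr: "inT T gr" "NE (B.opair a gr) G" using seq a B_ORD[OF a(1)] unfolding B.GSeq_def by blast
 have p: "inT T (B.opair a gr)" using B_opair[OF a(1) gr(1)] inT_opair[OF T NS'[OF a(1)] NS'[OF gr(1)]] a(1) gr(1) by simp
 then obtain a' gr' v d where 1: "inT T a'" "inT T gr'" "inT T v" "inT T d" "B.GStr gr' v d" "B.opair a gr = B.opair a' gr'"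
  using seq gr(2) unfolding B.GSeq_def by blast
 have "gr' = gr" using 1(6) B.opair_inject[of a gr a' gr'] a(1) gr(1) 1(1,2) by simp
 hence "gr = N.opair v d" using 1(5) B_opair[OF 1(3,4)] unfolding B.GStr_def by simp
 thus ?thesis using 1 gr B_opair[OF a(1) gr(1)] by metis
qed

lemma B_VtxI:
 assumes "!!a. inT T a ==> N.ORD a ==> EX gr v d x. inT T gr & inT T v & inT T d & NE (N.opair a gr) G & gr = N.opair v d &
   NE x v & NE (N.opair a x) y & (ALL x'. inT T x' --> NE (N.opair a x') y --> x' = x)"
 shows "B.Vtx y G" unfolding B.Vtx_def
proof (intro ballI impI)
 fix a assume "a : {X. inT T X}" "B.ORD a"
 hence a: "inT T a" "N.ORD a" using B_ORD by simp_all
 obtain gr v d x where h: "inT T gr" "inT T v" "inT T d" "NE (N.opair a gr) G" "gr = N.opair v d"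
   "NE x v" "NE (N.opair a x) y" "ALL x'. inT T x' --> NE (N.opair a x') y --> x' = x" using assms[OF a] by blast
 have x: "inT T x" by (rule inT_mem[OF T h(2,6)])
 show "EX gr:{X. inT T X}. EX v:{X. inT T X}. EX d:{X. inT T X}. EX x:{X. inT T X}.
   NE (B.opair a gr) G & gr = B.opair v d & NE x v & NE (B.opair a x) y & (ALL x':{X. inT T X}. NE (B.opair a x') y --> x' = x)"
 proof (rule bexI[of _ gr], rule bexI[of _ v], rule bexI[of _ d], rule bexI[of _ x], intro conjI ballI impI)
  show "NE (B.opair a gr) G" "NE (B.opair a x) y" using h(4,7) B_opair[OF a(1) h(1)] B_opair[OF a(1) x] by simp_all
  show "gr = B.opair v d" using h(5) B_opair[OF h(2,3)] by simp
  show "x' = x" if "x' : {X. inT T X}" "NE (B.opair a x') y" for x' using h(8) that B_opair[OF a(1), of x'] by simp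
 qed (use h(1-3,6) x in simp_all)
qed

lemma B_EdgeI:
 assumes "!!a. inT T a ==> N.ORD a ==> EX gr v d x x'. inT T gr & inT T v & inT T d & inT T x & inT T x' &
   NE (N.opair a gr) G & gr = N.opair v d & NE (N.opair a x) y & NE (N.opair a x') z & NE (N.opair x x') d"
 shows "B.Edge y z G" unfolding B.Edge_def
proof (intro ballI impI)
 fix a assume "a : {X. inT T X}" "B.ORD a"
 hence a: "inT T a" "N.ORD a" using B_ORD by simp_all
 obtain gr v d x x' where h: "inT T gr" "inT T v" "inT T d" "inT T x" "inT T x'"
   "NE (N.opair a gr) G" "gr = N.opair v d" "NE (N.opair a x) y" "NE (N.opair a x') z" "NE (N.opair x x') d" using assms[OF a] by blast
 show "EX gr:{X. inT T X}. EX v:{X. inT T X}. EX d:{X. inT T X}. EX x:{X. inT T X}. EX x':{X. inT T X}.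
   NE (B.opair a gr) G & gr = B.opair v d & NE (B.opair a x) y & NE (B.opair a x') z & NE (B.opair x x') d"
 proof (rule bexI[of _ gr], rule bexI[of _ v], rule bexI[of _ d], rule bexI[of _ x], rule bexI[of _ x'], intro conjI)
  show "NE (B.opair a gr) G" "NE (B.opair a x) y" "NE (B.opair a x') z"
   using h(6,8,9) B_opair[OF a(1) h(1)] B_opair[OF a(1) h(4)] B_opair[OF a(1) h(5)] by simp_all
  show "gr = B.opair v d" "NE (B.opair x x') d" using h(7,10) B_opair[OF h(2,3)] B_opair[OF h(4,5)] by simp_all
 qed (use h(1-5) in simp_all)
qed

lemma sat_in_sets_T: "sat (val ` subs T) NE (in_sets F n) e = sat {X. inT T X} NE (F n) e"
proof -
 have "{X : val ` subs T. EX Y:val ` subs T. NE X Y} = {X. inT T X}"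
 proof (rule set_eqI)
  fix X
  have "inT T X ==> X : val ` subs T & B.upair X X : val ` subs T & NE X (B.upair X X)"
   using B.S_C[of X] B.S_C[OF B.upair(1), of X X] B.upair(2)[of X X X] by simp
  moreover have "NE X Y ==> Y : val ` subs T ==> inT T X" for Y using B.mem_S[of X Y] by simp
  ultimately show "X : {X : val ` subs T. EX Y:val ` subs T. NE X Y} <-> X : {X. inT T X}" unfolding mem_Collect_eq by blast
 qed
 thus ?thesis unfolding in_sets_def sat_relativize by simp
qed

end

lemma sat_in_sets_N: "sat N NE (in_sets F n) e = sat NS NE (F n) e" unfolding in_sets_def sat_relativize NS_iff[symmetric] by (rule refl)

end

lemma (in base) Hom_opair:
 assumes h: "Hom h (opair v d) (opair v' d')" and S: "v : S" "d : S" "v' : S" "d' : S"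
 shows "FunTo h v v'" "ALL x:S. ALL y:S. ALL x':S. ALL y':S. opair x y \<E> d & opair x x' \<E> h & opair y y' \<E> h --> opair x' y' \<E> d'"
proof -
 obtain v1 d1 v2 d2 where 1: "v1 : S" "d1 : S" "v2 : S" "d2 : S" "GStr (opair v d) v1 d1" "GStr (opair v' d') v2 d2" "FunTo h v1 v2"
  "ALL x:S. ALL y:S. ALL x':S. ALL y':S. opair x y \<E> d1 & opair x x' \<E> h & opair y y' \<E> h --> opair x' y' \<E> d2"
  using h unfolding Hom_def by blast
 have "v1 = v & d1 = d" "v2 = v' & d2 = d'"
  using 1(5,6) opair_inject[OF S(1,2) 1(1,2)] opair_inject[OF S(3,4) 1(3,4)] unfolding GStr_def by simp_all
 thus "FunTo h v v'" "ALL x:S. ALL y:S. ALL x':S. ALL y':S. opair x y \<E> d & opair x x' \<E> h & opair y y' \<E> h --> opair x' y' \<E> d'"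
  using 1(7,8) by simp_all
qed

context base
begin

lemma FunTo_ex: "FunTo h v v' ==> x : S ==> x \<E> v ==>
  EX y:S. opair x y \<E> h & y \<E> v' & (ALL y':S. opair x y' \<E> h --> y' = y)" unfolding FunTo_def FunOn_def by blast

lemma FunTo_to: "FunTo h v v' ==> x : S ==> y : S ==> opair x y \<E> h ==> y \<E> v'" unfolding FunTo_def by blast

lemma FunTo_pair: "FunTo h v v' ==> p : S ==> p \<E> h ==> EX x:S. EX y:S. x \<E> v & p = opair x y" unfolding FunTo_def FunOn_def by blast

lemma GSeq_ex: "GSeq G ==> a : S ==> ORD a ==> EX gr:S. opair a gr \<E> G" unfolding GSeq_def by blast

lemma GSeq_unique:
 "GSeq G ==> a : S ==> ORD a ==> gr : S ==> gr' : S ==> opair a gr \<E> G ==> opair a gr' \<E> G ==> gr' = gr"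
 unfolding GSeq_def by (metis (no_types, lifting))

lemma GSeq_str:
 assumes G: "GSeq G" and S: "a : S" "gr : S" "opair a gr \<E> G"
 shows "EX v:S. EX d:S. GStr gr v d"
proof -
 have "EX a':S. EX g:S. ORD a' & (EX v:S. EX d:S. GStr g v d) & opair a gr = opair a' g"
  using G S(3) opair_S[OF S(1,2)] unfolding GSeq_def by blast
 then obtain a' g where 1: "a' : S" "g : S" "EX v:S. EX d:S. GStr g v d" "opair a gr = opair a' g" by blast
 hence "g = gr" using opair_inject[OF S(1,2) 1(1,2)] by simp
 thus ?thesis using 1(3) by simp
qed

end

context gext
begin

lemma ords_T:
 assumes T: "uni T"
 obtains D where "D : NS" "N.ORD D" "!!a. NE a D <-> inT T a & N.ORD a"
proof -
 have tt: "val (flat T) : NS" using val_flat_NS T by (simp add: uni_def)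
 have d: "N.dp (%e. NE (e 0) (val (flat T)) & N.ORD (e 0))" by (intro dps tt N_dp_ORD)
 have "EX D:NS. ALL a:NS. NE a D <-> NE a (val (flat T)) & N.ORD a" by (rule class_set[OF T d]) (use NE_flat_T[OF T] in blast)
 then obtain D where D: "D : NS" "ALL a:NS. NE a D <-> inT T a & N.ORD a" unfolding NE_flat_T[OF T] by (elim bexE)
 have Dm: "NE a D <-> inT T a & N.ORD a" for a using bspec[OF D(2), of a] NE_NS[of a D] inT_NS[OF T, of a] by blast
 have "N.ORD D"
 proof (rule ORDI; unfold Dm)
  show "inT T y & N.ORD y" if "inT T x & N.ORD x" "NE y x" for x y
   using that inT_mem[OF T, of x y] ORD_in[of x y] inT_NS[OF T, of x] by blast
  show "NE x y | x = y | NE y x" if "inT T x & N.ORD x" "inT T y & N.ORD y" for x y using that ORD_lin[of x y] inT_NS[OF T] by blast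
 qed
 thus ?thesis using that D(1) Dm by blast
qed

text \<open>\<open>ev\<close> lives in the ground model, so its action on names yields a class
  \<open>E0\<close> of the extension: it relates \<open>val b\<close> to the members of the value of
  \<open>ev b\<close>. The forward homomorphism is defined from this class.\<close>

lemma ext_name:
 assumes T: "uni T" and ev: "ALL b:subs T. app ev b : subs H"
 obtains E0 where "E0 : N"
  "!!X Z. X : NS ==> Z : NS ==> NE (N.opair X Z) E0 <-> (EX b:subs T. X = val b & NE Z (val (app ev b)))"
proof -
 define E0 where "E0 = Coll H (%u. EX b rho p. u = opair (opn b rho) p & b \<E> Pow T & opair rho p \<E> app ev b)"
 have E0i: "u \<E> E0 <-> u \<E> H & (EX b rho p. u = opair (opn b rho) p & b \<E> Pow T & opair rho p \<E> app ev b)" for u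
  unfolding E0_def by (rule mem_Coll) (intro dps)
 have E0s: "E0 : subs H" by (simp add: subs_def E0i)
 have PT: "b \<E> Pow T <-> b : subs T" for b by (simp add: subs_def)
 have E0: "NE (N.opair X Z) (val E0) <-> (EX b:subs T. X = val b & NE Z (val (app ev b)))" if X: "X : NS" and Z: "Z : NS" for X Z
 proof
  assume "NE (N.opair X Z) (val E0)"
  then obtain pi r where r: "N.opair X Z = val pi" "opair pi r \<E> E0" "r : g" using NE_cases[OF _ E0s] by metis
  then obtain b rho where b: "pi = opn b rho" "b : subs T" "opair rho r \<E> app ev b" unfolding E0i opair_eq PT by blast
  have s: "app ev b : subs H" using ev b(2) by blast
  have rho: "rho \<E> H" using s b(3) univ_opair[OF univ_H] unfolding subs_def by blast
  have bH: "b \<E> H" by (rule subs_uniH[OF T b(2)])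
  have "N.opair X Z = N.opair (val b) (val rho)" using r(1) b(1) val_opn[OF bH rho] by simp
  hence "X = val b" "Z = val rho" using N.opair_inject[OF X Z val_NS[OF bH] val_NS[OF rho]] by blast+
  thus "EX b:subs T. X = val b & NE Z (val (app ev b))" using NE_I[OF s b(3) r(3) rho] b(2) by blast
 next
  assume "EX b:subs T. X = val b & NE Z (val (app ev b))"
  then obtain b where b: "b : subs T" "X = val b" "NE Z (val (app ev b))" by blast
  have s: "app ev b : subs H" using ev b(1) by blast
  obtain rho r where r: "Z = val rho" "opair rho r \<E> app ev b" "rho \<E> H" "r : g" using NE_cases[OF b(3) s] by metis
  have bH: "b \<E> H" by (rule subs_uniH[OF T b(1)])
  have "opair (opn b rho) r \<E> E0" unfolding E0i univ_opair[OF univ_H] using opn_w[OF bH r(3)] Q_w[OF g_Q[OF r(4)]] b(1) PT r(2) by blast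
  from NE_I[OF E0s this r(4) opn_w[OF bH r(3)]] show "NE (N.opair X Z) (val E0)" unfolding b(2) r(1) val_opn[OF bH r(3)] .
 qed
 show ?thesis by (rule that[OF val_N[OF E0s] E0])
qed

text \<open>Let \<open>D\<close> be the set of ordinals of the extension of \<open>T\<close>. Backward homomorphisms \<open>h_a\<close> send a vertex
 \<open>x\<close> of \<open>G_D\<close> to the thread \<open>(h_a x)\<close> for \<open>a\<close> in \<open>D\<close>. The elementary map \<open>ev\<close> extends it to a thread indexed
 by all ordinals, whose value at some \<open>D'\<close> above \<open>D\<close> defines a homomorphism from \<open>G_D\<close> to \<open>G_D'\<close>.\<close>

theorem swvp:
 assumes G: "G : N" and seq: "N.GSeq G" and bkw: "N.Backward G"
 shows "~N.NoForward G"
proof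
 assume nofw: "N.NoForward G"
 obtain c where c: "c : subs H" "G = val c" using G by (auto simp: N_def)
 \<comment> \<open>Equality is listed so that the value of \<open>ev b\<close> depends only on the
   value of \<open>b\<close>, not on the name.\<close>
 let ?\<Phi> = "{in_sets (graph_sequence 0) 3, in_sets (F_Vtx 2 0) 3, in_sets (F_Edge 2 1 0) 3, Equal 0 1}"
 have fin: "finite ?\<Phi>" by simp
 obtain T ev where T: "uni T" and ev: "ALL b:subs T. app ev b : subs H"
  and el: "ALL a:?\<Phi>. ALL y:subs T. ALL z:subs T. sat (val ` subs T) NE a (e3 (val y) (val z) (val (cut T c))) <->
   sat N NE a (e3 (val (app ev y)) (val (app ev z)) (val c))" using elementary[OF fin c(1)] by - (elim exE conjE, rule that, assumption+)
 interpret B: base "val ` subs T" NE "{X. inT T X}" by (rule base_T[OF T])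
 let ?GT = "val (cut T c)"
 have cT: "cut T c : subs T" by (auto simp: subs_def)
 have GT: "?GT : val ` subs T" using cT by blast
 have valT: "val b : val ` subs T" "val (app ev b) : N" if "b : subs T" for b using that ev val_N by auto
 have e0: "emp : subs T" by (simp add: subs_def)
 note satT = sat_in_sets_T[OF T]
 have elV: "N.Vtx (val (app ev b)) G" if b: "b : subs T" and v: "B.Vtx (val b) ?GT" for b
  using el[rule_format, of "in_sets (F_Vtx 2 0) 3" b b] b v
  unfolding satT sat_in_sets_N c(2)[symmetric] B.sat_e3(2)[OF valT(1)[OF b] valT(1)[OF b] GT] N.sat_e3(2)[OF valT(2)[OF b] valT(2)[OF b] G]
  by blast
 have elE: "N.Edge (val (app ev b)) (val (app ev b')) G" if b: "b : subs T" "b' : subs T" and v: "B.Edge (val b) (val b') ?GT" for b b'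
  using el[rule_format, of "in_sets (F_Edge 2 1 0) 3" b b'] b v
  unfolding satT sat_in_sets_N c(2)[symmetric] B.sat_e3(3)[OF valT(1)[OF b(1)] valT(1)[OF b(2)] GT]
   N.sat_e3(3)[OF valT(2)[OF b(1)] valT(2)[OF b(2)] G] by blast
 have elEq: "val (app ev b) = val (app ev b')" if b: "b : subs T" "b' : subs T" and v: "val b = val b'" for b b'
 proof -
  have "sat (val ` subs T) NE (Equal 0 1) (e3 (val b) (val b') ?GT)" using v by (simp add: e3_def)
  hence "sat N NE (Equal 0 1) (e3 (val (app ev b)) (val (app ev b')) (val c))" using el b by blast
  thus ?thesis by (simp add: e3_def)
 qed
 have seqT: "B.GSeq ?GT" using el[rule_format, of "in_sets (graph_sequence 0) 3" emp emp] e0 seq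
  unfolding satT sat_in_sets_N c(2)[symmetric] B.sat_e3(1)[OF valT(1)[OF e0] valT(1)[OF e0] GT]
   N.sat_e3(1)[OF valT(2)[OF e0] valT(2)[OF e0] G] by blast
 have GTG: "NE X G" if "NE X ?GT" for X
 proof -
  have cTH: "cut T c : subs H" using c(1) by (auto simp: subs_def)
  obtain pi r where "X = val pi" "opair pi r \<E> cut T c" "pi \<E> H" "r : g" using NE_cases[OF \<open>NE X ?GT\<close> cTH] by metis
  thus ?thesis unfolding c(2) using NE_I[OF c(1), of pi r] by simp
 qed
 have NST: "X : NS" if "inT T X" for X using inT_NS[OF T that] .
 obtain D where D: "D : NS" and DO: "N.ORD D" and Dm: "!!a. NE a D <-> inT T a & N.ORD a" by (rule ords_T[OF T], rule that, assumption+)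
 obtain D' where D': "D' : NS" "N.ORD D'" "NE D D'" using ORD_suc[OF D DO] by blast
 note val1 = N.GSeq_unique[OF seq]
 obtain gD where gD: "gD : NS" "NE (N.opair D gD) G" using N.GSeq_ex[OF seq D DO] by blast
 note strD = N.GSeq_str[OF seq]
 obtain V Ed where V: "V : NS" "Ed : NS" "N.GStr gD V Ed" using strD[OF D gD] by blast
 have gDV: "gD = N.opair V Ed" using V(3) unfolding N.GStr_def by blast
 define R where "R b h <-> (EX gr:NS. NE (N.opair b gr) G & N.Hom h gD gr)" for b h
 have dHom: "N.dp (%e. N.Hom (f e) (f' e) (f'' e))" if "N.dt f" "N.dt f'" "N.dt f''" for f f' f''
  by (rule N.dp_rel3[of N.Hom, OF _ that], unfold N.Hom_def N.GStr_def N.FunTo_def N.FunOn_def, intro dps)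
 have dR: "N.dp (%e. R (e 0) (e 1))" unfolding R_def by (intro dps dHom G gD(1))
 \<comment> \<open>Homomorphisms from \<open>gD\<close> to graphs of the extension of
   \<open>T\<close> are subsets of the extension of \<open>T1\<close>, hence elements of that of
   \<open>T2\<close>. This is the bound on values that \<open>choice_class\<close> requires.\<close>
 obtain T1 where T1: "uni T1" "T \<E> T1" "inT T1 V" using ext_uni[of T V V] V(1) T uni_def by blast
 have "Pow T1 \<E> H" using univ_Pow[OF univ_H] T1(1) by (simp add: uni_def)
 then obtain T2 where T2: "uni T2" "Pow T1 \<E> T2" using uni_ex by blast
 have gra: "EX gr v d. inT T gr & inT T v & inT T d & NE (N.opair a gr) ?GT & gr = N.opair v d" if "NE a D" for a
  using swvp_small[OF T GT seqT] that Dm by blast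
 have homs: "EX h. inT T2 h & R b h" if b: "NE b D" for b
 proof -
  obtain gr v d where gr: "inT T gr" "inT T v" "inT T d" "NE (N.opair b gr) ?GT" "gr = N.opair v d" using gra[OF b] by blast
  have bO: "b : NS" "N.ORD b" using b Dm NE_NS by blast+
  obtain h where h: "h : NS" "N.Hom h gD gr"
   using bkw[unfolded N.Backward_def, rule_format, of b D gr gD] bO D DO b NST[OF gr(1)] gD GTG[OF gr(4)] by blast
  have FT: "N.FunTo h V v" by (rule N.Hom_opair(1)[OF h(2)[unfolded gDV gr(5)] V(1,2) NST[OF gr(2)] NST[OF gr(3)]])
  have "inT T1 p" if p: "NE p h" for p
  proof -
   obtain x y where xy: "x : NS" "y : NS" "NE x V" "p = N.opair x y" using N.FunTo_pair[OF FT NE_NS[OF p] p] by blast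
   have "NE y v" using N.FunTo_to[OF FT xy(1,2)] p xy(4) by blast
   hence "inT T1 y" using inT_mono[OF T1(1,2)] inT_mem[OF T gr(2)] by blast
   moreover have "inT T1 x" by (rule inT_mem[OF T1(1,3) xy(3)])
   ultimately show ?thesis using inT_opair[OF T1(1) xy(1,2)] xy(4) by blast
  qed
  then obtain hn where "hn : subs T1" "h = val hn" using set_of(1)[OF T1(1) NS_N[OF h(1)]] by blast
  hence "inT T2 h" unfolding inT_def using univ_in[OF uni_univ[OF T2(1)] T2(2)] by (auto simp: subs_def)
  moreover have "R b h" unfolding R_def using h(2) GTG[OF gr(4)] NST[OF gr(1)] by blast
  ultimately show ?thesis by blast
 qed

 obtain F where F: "F : N"
  and F2: "!!b h. b : NS ==> h : NS ==> NE (N.opair b h) F ==> R b h & inT T2 h"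
  and F3: "!!b h h'. b : NS ==> h : NS ==> h' : NS ==> NE (N.opair b h) F ==> NE (N.opair b h') F ==> h = h'"
  and F4: "!!b h. b : NS ==> inT T2 h ==> R b h ==> EX h:NS. NE (N.opair b h) F"
  by (rule choice_class[of T2 R, OF T2(1) dR], rule that, assumption+)
 have hb: "EX gr v d h. inT T gr & inT T v & inT T d & NE (N.opair b gr) ?GT & gr = N.opair v d & h : NS & NE (N.opair b h) F &
   N.FunTo h V v & (ALL x:NS. ALL y:NS. ALL x':NS. ALL y':NS. NE (N.opair x y) Ed & NE (N.opair x x') h & NE (N.opair y y') h -->
    NE (N.opair x' y') d)" if b: "NE b D" for b
 proof -
  obtain gr v d where gr: "inT T gr" "inT T v" "inT T d" "NE (N.opair b gr) ?GT" "gr = N.opair v d" using gra[OF b] by blast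
  have bO: "b : NS" "N.ORD b" using b Dm NE_NS by blast+
  obtain h0 where "inT T2 h0" "R b h0" using homs[OF b] by blast
  then obtain h where h: "h : NS" "NE (N.opair b h) F" using F4[OF bO(1)] by blast
  then obtain gr' where gr': "gr' : NS" "NE (N.opair b gr') G" "N.Hom h gD gr'" using F2[OF bO(1)] unfolding R_def by blast
  have "gr' = gr" by (rule val1[OF bO NST[OF gr(1)] gr'(1) GTG[OF gr(4)] gr'(2)])
  hence "N.Hom h gD gr" using gr'(3) by simp
  from N.Hom_opair[OF this[unfolded gDV gr(5)] V(1,2) NST[OF gr(2)] NST[OF gr(3)]] show ?thesis using gr h by blast
 qed
 \<comment> \<open>\<open>P x\<close> is the thread of the vertex \<open>x\<close>, given by the
   homomorphisms that \<open>F\<close> selects.\<close>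
 define P where "P x p <-> (EX b:NS. EX v:NS. EX h:NS. p = N.opair b v & NE b D & NE (N.opair b h) F & NE (N.opair x v) h)" for x p
 have dP: "N.dp (%e. P (f e) (f' e))" if "N.dt f" "N.dt f'" for f f' by (rule N.dp_rel2[of P, OF _ that], unfold P_def, intro dps D F)
 \<comment> \<open>Threads consist of sets of the extension of \<open>T\<close>, so they have names
   inside \<open>T\<close> and \<open>ev\<close> can be applied.\<close>
 have "EX b:subs T. ALL p:NS. NE p (val b) <-> P x p" if x: "NE x V" for x
 proof -
  have xN: "x : NS" by (rule NE_NS[OF x])
  have "N.dp (%e. P x (e 0))" by (intro dP dps xN)
  from class_exists[OF this] obtain Y where Y: "Y : N" "ALL p:NS. NE p Y <-> P x p" by (elim bexE)
  have "inT T p" if p: "NE p Y" for p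
  proof -
   obtain b v h where h: "b : NS" "v : NS" "h : NS" "p = N.opair b v" "NE b D" "NE (N.opair b h) F" "NE (N.opair x v) h"
    using bspec[OF Y(2) NE_NS[OF p]] p unfolding P_def by blast
   obtain v' h' where 1: "inT T v'" "h' : NS" "NE (N.opair b h') F" "N.FunTo h' V v'" using hb[OF h(5)] by blast
   have "h' = h" by (rule F3[OF h(1) 1(2) h(3) 1(3) h(6)])
   hence "NE v v'" using N.FunTo_to[OF 1(4) xN h(2)] h(7) by blast
   thus ?thesis using inT_mem[OF T 1(1)] Dm h(5) inT_opair[OF T h(1,2)] h(4) by blast
  qed
  then obtain b where b: "b : subs T" "Y = val b" using set_of(1)[OF T Y(1)] by blast
  show ?thesis by (rule bexI[OF _ b(1)]) (use Y(2) b(2) in simp)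
 qed
 hence "ALL x. EX b. NE x V --> b : subs T & (ALL p:NS. NE p (val b) <-> P x p)" by blast
 then obtain bn where "ALL x. NE x V --> bn x : subs T & (ALL p:NS. NE p (val (bn x)) <-> P x p)" by (rule choice[THEN exE])
 hence bn: "!!x. NE x V ==> bn x : subs T" and bnP: "!!x p. NE x V ==> p : NS ==> NE p (val (bn x)) <-> P x p" by blast+
 have bno: "NE (N.opair b v) (val (bn x)) <-> NE b D & (EX h:NS. NE (N.opair b h) F & NE (N.opair x v) h)"
  if x: "NE x V" "b : NS" "v : NS" for x b v
 proof -
  have "P x (N.opair b v) <-> NE b D & (EX h:NS. NE (N.opair b h) F & NE (N.opair x v) h)"
   unfolding P_def using N.opair_inject x(2,3) by blast
  thus ?thesis using bnP[OF x(1) N.opair_S[OF x(2,3)]] by blast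
 qed
 have Vt: "N.Vtx (val (app ev (bn x))) G" if x: "NE x V" for x
 proof (rule elV[OF bn[OF x] B_VtxI[OF T]])
  fix a assume a: "inT T a" "N.ORD a"
  have aD: "NE a D" using Dm a by blast
  have aN: "a : NS" and xN: "x : NS" using NST[OF a(1)] NE_NS[OF x] by blast+
  obtain gr v d h where h: "inT T gr" "inT T v" "inT T d" "NE (N.opair a gr) ?GT" "gr = N.opair v d" "h : NS" "NE (N.opair a h) F"
   "N.FunTo h V v" using hb[OF aD] by blast
  obtain y where y: "y : NS" "NE (N.opair x y) h" and yv: "NE y v" and yu: "ALL y':NS. NE (N.opair x y') h --> y' = y"
   using N.FunTo_ex[OF h(8) xN x] by blast
  have 1: "NE (N.opair a y) (val (bn x))" using bno[OF x aN y(1)] aD h(6,7) y(2) by blast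
  have 2: "y' = y" if q: "inT T y'" "NE (N.opair a y') (val (bn x))" for y'
  proof -
   have q': "y' : NS" by (rule NST[OF q(1)])
   obtain h' where h': "h' : NS" "NE (N.opair a h') F" "NE (N.opair x y') h'" using bno[OF x aN q'] q(2) by blast
   have "h' = h" by (rule F3[OF aN h'(1) h(6) h'(2) h(7)])
   thus ?thesis using bspec[OF yu q'] h'(3) by blast
  qed
  show "EX gr v d y. inT T gr & inT T v & inT T d & NE (N.opair a gr) ?GT & gr = N.opair v d &
   NE y v & NE (N.opair a y) (val (bn x)) & (ALL y'. inT T y' --> NE (N.opair a y') (val (bn x)) --> y' = y)"
   using h(1-5) yv 1 2 by blast
 qed
 have Eg: "N.Edge (val (app ev (bn x))) (val (app ev (bn y))) G" if x: "NE x V" and y: "NE y V" and xy: "NE (N.opair x y) Ed" for x y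
 proof (rule elE[OF bn[OF x] bn[OF y] B_EdgeI[OF T]])
  fix a assume a: "inT T a" "N.ORD a"
  have aD: "NE a D" using Dm a by blast
  have aN: "a : NS" and xN: "x : NS" "y : NS" using NST[OF a(1)] NE_NS[OF x] NE_NS[OF y] by blast+
  obtain gr v d h where h: "inT T gr" "inT T v" "inT T d" "NE (N.opair a gr) ?GT" "gr = N.opair v d" "h : NS" "NE (N.opair a h) F"
   "N.FunTo h V v" and hE: "ALL x:NS. ALL y:NS. ALL x':NS. ALL y':NS. NE (N.opair x y) Ed & NE (N.opair x x') h & NE (N.opair y y') h -->
    NE (N.opair x' y') d" using hb[OF aD] by blast
  obtain x' where x': "x' : NS" "NE (N.opair x x') h" "NE x' v" using N.FunTo_ex[OF h(8) xN(1) x] by blast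
  obtain y' where y': "y' : NS" "NE (N.opair y y') h" "NE y' v" using N.FunTo_ex[OF h(8) xN(2) y] by blast
  have i: "inT T x'" "inT T y'" using inT_mem[OF T h(2)] x'(3) y'(3) by blast+
  have 1: "NE (N.opair a x') (val (bn x))" "NE (N.opair a y') (val (bn y))"
   using bno[OF x aN x'(1)] bno[OF y aN y'(1)] aD h(6,7) x'(2) y'(2) by blast+
  have "NE (N.opair x' y') d" using hE xN x' y' xy by blast
  thus "EX gr v d x' y'. inT T gr & inT T v & inT T d & inT T x' & inT T y' &
   NE (N.opair a gr) ?GT & gr = N.opair v d & NE (N.opair a x') (val (bn x)) & NE (N.opair a y') (val (bn y)) & NE (N.opair x' y') d"
   using h(1-5) i 1 by blast
 qed
 obtain E0 where E0N: "E0 : N" and E0: "!!X Z. X : NS ==> Z : NS ==>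
   NE (N.opair X Z) E0 <-> (EX b:subs T. X = val b & NE Z (val (app ev b)))" by (rule ext_name[OF T ev], rule that, assumption+)
 obtain gE where gE: "gE : NS" "NE (N.opair D' gE) G" using N.GSeq_ex[OF seq D'(1,2)] by blast
 obtain V' Ed' where V': "V' : NS" "Ed' : NS" "N.GStr gE V' Ed'" using strD[OF D'(1) gE] by blast
 have gEV: "gE = N.opair V' Ed'" using V'(3) unfolding N.GStr_def by blast
 \<comment> \<open>Quantifying over a set \<open>X\<close> equal to the thread keeps
   \<open>Q\<close> definable; the names \<open>bn x\<close> are chosen outside the extension and
   must not occur.\<close>
 define Q where "Q x y <-> NE x V & NE y V' &
  (EX X:NS. (ALL p:NS. NE p X <-> P x p) & NE (N.opair X (N.opair D' y)) E0)" for x y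
 have dQ: "N.dp (%e. Q (f e) (f' e))" if "N.dt f" "N.dt f'" for f f'
  by (rule N.dp_rel2[of Q, OF _ that], unfold Q_def, intro dps dP V(1) V'(1) D'(1) E0N)
 have Q: "Q x y <-> NE x V & NE y V' & NE (N.opair D' y) (val (app ev (bn x)))" if xy: "x : NS" "y : NS" for x y
 proof (cases "NE x V")
  case x: True
  have o: "N.opair D' y : NS" using D'(1) xy(2) by simp
  have bN: "val (bn x) : NS" by (rule val_NS[OF subs_uniH[OF T bn[OF x]]])
  have X: "(ALL p:NS. NE p X <-> P x p) <-> X = val (bn x)" if "X : NS" for X
   using N.ext[of X "val (bn x)"] bnP[OF x] NS_N that bN by blast
  have "NE (N.opair (val (bn x)) (N.opair D' y)) E0 <-> NE (N.opair D' y) (val (app ev (bn x)))"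
   unfolding E0[OF bN o] using elEq[OF bn[OF x]] bn[OF x] by metis
  thus ?thesis unfolding Q_def using X bN x by blast
 qed (simp add: Q_def)
 obtain T3 where T3: "uni T3" "inT T3 V" "inT T3 V'" using ext_uni[OF univ_emp[OF univ_H] V(1) V'(1)] by blast
 have dK: "N.dp (%e. Q (e 0) (e 1))" by (intro dps dQ)
 have "ALL x:NS. ALL y:NS. Q x y --> inT T3 x & inT T3 y" using inT_mem[OF T3(1,2)] inT_mem[OF T3(1,3)] unfolding Q_def by blast
 from rel_set[of Q, OF dK T3(1) this]
 obtain K where K: "K : NS" "ALL p:NS. NE p K --> (EX x:NS. EX y:NS. p = N.opair x y & Q x y)"
  "ALL x:NS. ALL y:NS. NE (N.opair x y) K <-> Q x y" by (elim bexE conjE)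
 note KQ = K(3)[rule_format]
 have at: "EX y:NS. NE y V' & NE (N.opair D' y) (val (app ev (bn x))) & (ALL y':NS. NE (N.opair D' y') (val (app ev (bn x))) --> y' = y)"
  if x: "NE x V" for x
 proof -
  obtain gr v d y where h: "gr : NS" "v : NS" "d : NS" "y : NS" "NE (N.opair D' gr) G" "gr = N.opair v d" "NE y v"
   "NE (N.opair D' y) (val (app ev (bn x)))" "ALL y':NS. NE (N.opair D' y') (val (app ev (bn x))) --> y' = y"
   using Vt[OF x, unfolded N.Vtx_def, rule_format, OF D'(1,2)] by blast
  have "gr = gE" by (rule val1[OF D'(1,2) gE(1) h(1) gE(2) h(5)])
  hence "v = V'" using h(6) gEV N.opair_inject[OF h(2,3) V'(1,2)] by simp
  thus ?thesis using h by blast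
 qed
 have "N.Hom K gD gE" unfolding N.Hom_def
 proof (rule bexI[OF _ V(1)], rule bexI[OF _ V(2)], rule bexI[OF _ V'(1)], rule bexI[OF _ V'(2)], intro conjI V(3) V'(3) ballI impI)
  show "N.FunTo K V V'" unfolding N.FunTo_def N.FunOn_def
  proof (intro conjI ballI impI)
   show "EX x:NS. EX y:NS. NE x V & p = N.opair x y" if p: "p : NS" "NE p K" for p
    using bspec[OF K(2) p(1)] p(2) unfolding Q_def by blast
   show "NE y V'" if "x : NS" "y : NS" "NE (N.opair x y) K" for x y using KQ that unfolding Q_def by blast
   fix x assume x: "x : NS" "NE x V"
   obtain y where y: "y : NS" "NE y V'" "NE (N.opair D' y) (val (app ev (bn x)))" "ALL y':NS. NE (N.opair D' y') (val (app ev (bn x))) --> y' = y"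
    using at[OF x(2)] by blast
   have "NE (N.opair x y) K" using KQ[OF x(1) y(1)] Q[OF x(1) y(1)] x(2) y by blast
   moreover have "y' = y" if "y' : NS" "NE (N.opair x y') K" for y' using KQ[OF x(1) that(1)] Q[OF x(1) that(1)] that y(4) by blast
   ultimately show "EX y:NS. NE (N.opair x y) K & (ALL y':NS. NE (N.opair x y') K --> y' = y)" using y(1) by blast
  qed
  fix x y x' y' assume n: "x : NS" "y : NS" "x' : NS" "y' : NS"
   and e: "NE (N.opair x y) Ed & NE (N.opair x x') K & NE (N.opair y y') K"
  have q: "NE x V" "NE (N.opair D' x') (val (app ev (bn x)))" "NE y V" "NE (N.opair D' y') (val (app ev (bn y)))"
   using e KQ[OF n(1,3)] KQ[OF n(2,4)] Q[OF n(1,3)] Q[OF n(2,4)] by blast+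
  obtain gr v d x1 y1 where h: "gr : NS" "v : NS" "d : NS" "x1 : NS" "y1 : NS" "NE (N.opair D' gr) G" "gr = N.opair v d"
   "NE (N.opair D' x1) (val (app ev (bn x)))" "NE (N.opair D' y1) (val (app ev (bn y)))" "NE (N.opair x1 y1) d"
   using Eg[OF q(1,3) conjunct1[OF e], unfolded N.Edge_def, rule_format, OF D'(1,2)] by blast
  have "gr = gE" by (rule val1[OF D'(1,2) gE(1) h(1) gE(2) h(6)])
  hence "d = Ed'" using h(7) gEV N.opair_inject[OF h(2,3) V'(1,2)] by simp
  moreover have "x1 = x'" using at[OF q(1)] h(4,8) q(2) n(3) by blast
  moreover have "y1 = y'" using at[OF q(3)] h(5,9) q(4) n(4) by blast
  ultimately show "NE (N.opair x' y') Ed'" using h(10) by simp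
 qed
 thus False using nofw[unfolded N.NoForward_def, rule_format, of D D' gD gE] D DO D' gD gE K(1) by blast
qed

end

section \<open>No strongly compact cardinals in the extension\<close>

context supercompact
begin

text \<open>A witness of \<open>q\<close> is raised at each vertex above the value that
  \<open>c\<close> prescribes there; by \<open>un\<close> there is at most one such value, so the
  result stays in omega. At \<open>b\<close> the witness may be 0, as all entries of
  \<open>c\<close> are respected.\<close>

lemma add_vertex:
 assumes q: "cond q" and b: "b \<E> H" "~b \<E> dom q" and c: "vert (dom q) b c"
  and un: "ALL k x n k' n'. entry k x n \<E> c --> entry k' x n' \<E> c --> n = n'"
 shows "cond (cup q (sng (opair b c)))" "app (cup q (sng (opair b c))) b = c"
proof -
 let ?s = "sng (opair b c)" and ?r = "cup q (sng (opair b c))"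
 have ds: "dom ?s = sng b" by (rule eqI) auto
 have fs: "isfn ?s (sng b)" by (rule isfnI) auto
 have sb: "app ?s b = c" by (rule app_eq) auto
 have dr: "dom ?r = cup (dom q) (sng b)" by (rule eqI) auto
 have dis: "ALL x. x \<E> dom q --> ~x \<E> sng b" using b(2) by auto
 note r = isfn_cup[OF cond_isfn[OF q] fs dis]
 show rb: "app ?r b = c" using r(3)[of b] sb by simp
 have bO: "Ord b" using c unfolding vert_def by blast
 have cb: "entry k x n \<E> c ==> k \<E> om & n \<E> om & x \<E> dom q" for k x n using c unfolding vert_def by fastforce
 have v: "vert (dom ?r) y (app ?r y)" if "y \<E> dom ?r" for y
 proof (cases "y = b")
  case True
  show ?thesis unfolding True rb by (rule vert_mono[OF c]) (simp add: dr del: dom_iff)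
 next
  case False
  hence y: "y \<E> dom q" using that unfolding dr by simp
  show ?thesis unfolding r(2)[OF y] by (rule vert_mono[OF cond_vert[OF q y]]) (simp add: dr del: dom_iff)
 qed
 obtain f where f: "good q f" using cond_good[OF q] by blast
 have omO: "Ord k" if "k \<E> om" for k using that Ord_om Ord_in by blast
 define R where "R y m <-> (y ~= b --> (ALL j. j \<E> app f y --> j \<E> m) & (ALL k n. entry k y n \<E> c --> n \<E> m)) & (y = b --> m = emp)" for y m
 have dR: "dp (%e. R (e 0) (e 1))" unfolding R_def by (intro dps)
 have "EX m. m \<E> om & R y m" if y: "y \<E> dom ?r" for y
 proof (cases "y = b")
  case True
  thus ?thesis unfolding R_def using emp_om by blast
 next
  case False
  hence "y \<E> dom q" using y unfolding dr by simp
  hence fy: "app f y \<E> om" using f unfolding good_def by blast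
  show ?thesis
  proof (cases "EX k n. entry k y n \<E> c")
   case True
   then obtain k n where e: "entry k y n \<E> c" by blast
   hence n: "suc n \<E> om" using cb suc_om by blast
   obtain m where m: "m = app f y | m = suc n" "!!j. j \<E> app f y | j \<E> suc n ==> j \<E> m"
    using Ord_max[OF omO[OF fy] omO[OF n]] by blast
   have "n' \<E> m" if "entry k' y n' \<E> c" for k' n' using m(2)[of n'] un[rule_format, OF e that] by simp
   thus ?thesis unfolding R_def using m fy n False by blast
  next
   case none: False
   thus ?thesis unfolding R_def using fy False by blast
  qed
 qed
 with AC_fun[of R "dom ?r" om, OF dR] obtain F where F: "!!y. y \<E> dom ?r ==> app F y \<E> om" "!!y. y \<E> dom ?r ==> R y (app F y)"
  by blast
 have qr: "y \<E> dom ?r" if "y \<E> dom q" for y using that unfolding dr by simp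
 have "good ?r F" unfolding good_def
 proof (intro allI impI conjI F(1))
  fix y k x n assume y: "y \<E> dom ?r" and e: "entry k x n \<E> app ?r y" and k: "~k \<E> app F y"
  show "n \<E> app F x"
  proof (cases "y = b")
   case True
   hence ec: "entry k x n \<E> c" using e rb by simp
   hence x: "x \<E> dom q" using cb by blast
   hence "x ~= b" using b(2) by auto
   thus ?thesis using F(2)[OF qr[OF x]] ec unfolding R_def by blast
  next
   case False
   hence yq: "y \<E> dom q" using y unfolding dr by simp
   have e': "entry k x n \<E> app q y" using e r(2)[OF yq] by simp
   have x: "x \<E> dom q" by (rule cond_entry(3)[OF q yq e'])
   hence xb: "x ~= b" using b(2) by auto
   have "~k \<E> app f y" using F(2)[OF y] False k unfolding R_def by blast
   hence "n \<E> app f x" using f yq e' unfolding good_def by blast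
   thus ?thesis using F(2)[OF qr[OF x]] xb unfolding R_def by blast
  qed
 qed
 moreover have "bdd (dom ?r) T" if T: "uni T" for T
 proof -
  obtain h where h: "Ord h" "h \<E> T" "!!x. x \<E> dom q ==> x \<E> T ==> x \<E> h" using cond_bdd[OF q T] unfolding bdd_def by blast
  show ?thesis
  proof (cases "b \<E> T")
   case True
   obtain m where m: "m = h | m = suc b" "!!j. j \<E> h | j \<E> suc b ==> j \<E> m" using Ord_max[OF h(1) Ord_suc[OF bO]] by blast
   have "Ord m & m \<E> T" using m(1) h(1,2) Ord_suc[OF bO] univ_suc[OF uni_univ[OF T] True] by auto
   moreover have "x \<E> m" if "x \<E> dom ?r" "x \<E> T" for x using that m(2)[of x] h(3)[of x] unfolding dr by auto
   ultimately show ?thesis unfolding bdd_def by blast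
  next
   case False
   have "x \<E> h" if "x \<E> dom ?r" "x \<E> T" for x using that h(3)[of x] False unfolding dr by auto
   thus ?thesis unfolding bdd_def using h(1,2) by blast
  qed
 qed
 moreover have "?r \<E> H"
 proof (intro univ_cup[OF univ_H] cond_H[OF q] univ_sng[OF univ_H])
  have "c \<E> H"
  proof (rule univ_sub[OF univ_H])
   show "prod om (prod b om) \<E> H" using univ_prod[OF univ_H] univ_om[OF univ_H] b(1) by blast
   show "z \<E> prod om (prod b om)" if "z \<E> c" for z by (rule vert_prod[OF c that])
  qed
  thus "opair b c \<E> H" using univ_opair[OF univ_H] b(1) by blast
 qed
 ultimately show "cond ?r" unfolding cond_def using r(1) v dr by auto
qed

definition adjacent where
 "adjacent T T' <-> uni T & uni T' & T \<E> T' &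
   (ALL S. uni S --> (ALL x. Ord x --> x \<E> T' --> x \<E> S) | (ALL x. Ord x --> x \<E> S --> x \<E> T))"

text \<open>The height \<open>Ords S\<close> is minimized among the universes \<open>S\<close> that
  contain \<open>T\<close>; \<open>reflection\<close> without formulas provides at least
  one.\<close>

lemma adjacent_ex:
 assumes T: "uni T"
 shows "EX T'. adjacent T T'"
proof -
 define P where "P d <-> (EX S. uni S & d = Ords S & T \<E> S)" for d
 have dP: "dp (%e. P (e 0))" unfolding P_def by (intro dps)
 have "emp : subs H" by (simp add: subs_def)
 from reflection[of "{}", OF _ this this this, of T] obtain S0 where S0: "uni S0" "T \<E> S0" using T unfolding uni_def by blast
 hence "P (Ords S0)" unfolding P_def by blast
 from Ord_least[OF dP Ord_Ords[OF uni_univ[OF S0(1)]] this]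
 obtain d where d: "Ord d" "P d" "!!c. c \<E> d ==> ~P c" by blast
 then obtain T' where T': "uni T'" "d = Ords T'" "T \<E> T'" unfolding P_def by blast
 have "(ALL x. Ord x --> x \<E> T' --> x \<E> S) | (ALL x. Ord x --> x \<E> S --> x \<E> T)" if S: "uni S" for S
  using uni_cases[OF uni_univ[OF T] uni_univ[OF S]]
 proof
  assume "T \<E> S"
  hence "~Ords S \<E> d" using d(3) S unfolding P_def by blast
  hence "x \<E> Ords S" if "x \<E> d" for x
   using Ord_lin[OF Ord_Ords[OF uni_univ[OF S]] d(1)] that Ord_transD[OF Ord_Ords[OF uni_univ[OF S]], of d x] by auto
  thus ?thesis unfolding T'(2) by simp
 qed blast
 thus ?thesis unfolding adjacent_def using T T' by blast
qed

context
 fixes T T' assumes adj: "adjacent T T'"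
begin

definition gap where "gap = Coll T' (%x. Ord x & ~x \<E> T)"

lemma gap_iff [simp]: "x \<E> gap <-> x \<E> T' & Ord x & ~x \<E> T" unfolding gap_def by (rule mem_Coll) (intro dps)

lemma adj_uni: "uni T" "uni T'" "T \<E> T'" using adj by (simp_all add: adjacent_def)

lemma gap_near: "x \<E> gap ==> y \<E> gap ==> near x y" using adj unfolding adjacent_def near_def gap_iff by blast

lemma near_gap: "x \<E> gap ==> near y x ==> Ord y ==> y \<E> gap" using adj_uni unfolding near_def gap_iff by blast

text \<open>A universe contains all ordinals of \<open>T'\<close> or none of the gap.\<close>

lemma gap_bdd:
 assumes h: "Ord h" "h \<E> T'" and z: "!!x. x \<E> z ==> x \<E> gap & x \<E> h" and S: "uni S"
 shows "bdd z S"
proof -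
 have "(ALL x. Ord x --> x \<E> T' --> x \<E> S) | (ALL x. Ord x --> x \<E> S --> x \<E> T)" using adj S unfolding adjacent_def by blast
 thus ?thesis
 proof
  assume "ALL x. Ord x --> x \<E> T' --> x \<E> S"
  thus ?thesis unfolding bdd_def using h z by blast
 next
  assume "ALL x. Ord x --> x \<E> S --> x \<E> T"
  thus ?thesis unfolding bdd_def using Ord_emp univ_emp[OF uni_univ[OF S]] z gap_iff by blast
 qed
qed

lemma gap_H: "x \<E> T' ==> x \<E> H" using adj_uni(2) univ_in[OF univ_H] unfolding uni_def by blast

text \<open>Bounded domains leave room: the larger of a bound for \<open>dom q\<close> in
  \<open>T'\<close> and the height of \<open>T\<close> is a vertex of the gap beyond
  \<open>dom q\<close>.\<close>

lemma new_vertex: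
 assumes q: "cond q"
 shows "EX x. x \<E> gap & (ALL y. y \<E> dom q --> y \<E> T' --> y \<E> x) & (EX t. cond t & t <: q & x \<E> dom t)"
proof -
 obtain h where h: "Ord h" "h \<E> T'" "!!x. x \<E> dom q ==> x \<E> T' ==> x \<E> h"
  using cond_bdd[OF q adj_uni(2)] unfolding bdd_def by blast
 have uT: "univ T" "univ T'" using adj_uni by (simp_all add: uni_def)
 have dT: "Ords T \<E> T'" by (rule univ_sub[OF uT(2) adj_uni(3)]) simp
 obtain m where m: "m = h | m = Ords T" "!!j. j \<E> h | j \<E> Ords T ==> j \<E> m" using Ord_max[OF h(1) Ord_Ords[OF uT(1)]] by blast
 have mO: "Ord m" "m \<E> T'" using m(1) h(1,2) Ord_Ords[OF uT(1)] dT by auto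
 have "~m \<E> T" using m(2)[of m] mO(1) mem_irrefl[of m] by auto
 hence mg: "m \<E> gap" using mO by simp
 have mq: "~m \<E> dom q" using h(3)[of m] m(2)[of m] mO(2) mem_irrefl[of m] by blast
 have a: "cond (cup q (lam (sng m) (%_. emp)))" "m \<E> dom (cup q (lam (sng m) (%_. emp)))"
 proof -
  have 1: "sng m \<E> H" by (rule univ_sng[OF univ_H gap_H[OF mO(2)]])
  have 2: "Ord x & ~x \<E> dom q" if "x \<E> sng m" for x using that mO(1) mq by (simp del: dom_iff)
  have 3: "bdd (sng m) S" if "uni S" for S by (rule gap_bdd[OF Ord_suc[OF mO(1)] univ_suc[OF uT(2) mO(2)] _ that]) (use mg in auto)
  show "cond (cup q (lam (sng m) (%_. emp)))" by (rule add_isolated(1)[OF q 1 2 3])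
  show "m \<E> dom (cup q (lam (sng m) (%_. emp)))" using add_isolated(2)[OF q 1 2 3, of m] by (simp del: dom_iff)
 qed
 show ?thesis using mg h(3) m(2) a cup_ext'1 by blast
qed

end

end

context gext
begin

context
 fixes T T' assumes adj: "adjacent T T'"
begin

private abbreviation "J \<equiv> gap T T'"

private lemma gapi: "x \<E> J <-> x \<E> T' & Ord x & ~x \<E> T" by (rule gap_iff[OF adj])

text \<open>A function \<open>J \<rightarrow> \<omega>\<close> of the extension that bounds all values prescribed by the generic vertices does
 not exist: decide its values \<open>n\<^sub>k\<close> at an increasing sequence of new vertices \<open>x\<^sub>k\<close>, and add the
 vertex \<open>b = sup x\<^sub>k\<close> with the triples \<open>(k, (x\<^sub>k, n\<^sub>k))\<close>.\<close>

lemma diagonal_dense: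
 assumes f: "f : subs H" and p: "cond p"
  and total: "!!x q. x \<E> J ==> cond q ==> q <: p ==> EX q' n. cond q' & q' <: q & n \<E> om & memf q' (opn (chk x) (chk n)) f"
 shows "EX q b. cond q & q <: p & b \<E> J & b \<E> dom q &
  (ALL k. k \<E> om --> (EX x n. x \<E> J & n \<E> om & entry k x n \<E> app q b & memf q (opn (chk x) (chk n)) f))"
proof -
 define Z where "Z b t x n <-> x \<E> J & (ALL y. y \<E> dom b --> y \<E> T' --> y \<E> x) & x \<E> dom t & n \<E> om & memf t (opn (chk x) (chk n)) f"
  for b t x n
 define D where "D a b t <-> (EX x n. Z b t x n)" for a b t :: 'm
 have dD: "dp (%e. D (e 0) (e 1) (e 2))" unfolding D_def Z_def by (intro dps)
 have T'u: "univ T'" using adj_uni[OF adj] by (simp add: uni_def)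
 have "EX V B. dt (%e. V (e 0)) & dt (%e. B (e 0)) & (ALL a u. u \<E> B a <-> u \<E> p | (EX c. c \<E> a & u \<E> V c)) &
  (ALL a. a \<E> om --> above emp (V a) & V a <: hat (B a) & D a (B a) (V a)) & (ALL a. a \<E> suc om --> above emp (B a))"
 proof (rule strategic_chain[OF _ _ Ord_om univ_om[OF univ_H] dD])
  show "above emp p" using p by (simp add: above_def)
  show "om \<E> S | (ALL x. Ord x --> x \<E> S --> x \<E> emp)" if "uni S" for S using univ_om[OF uni_univ[OF that]] by blast
  fix a b assume b: "above emp b" "b <: p"
  note hb = cond_hat[OF above_cond[OF b(1)]]
  obtain x t where x: "x \<E> J" "!!y. y \<E> dom (hat b) ==> y \<E> T' ==> y \<E> x" "cond t" "t <: hat b" "x \<E> dom t"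
   using new_vertex[OF adj hb(1)] by blast
  have "t <: p" using x(4) hb(3) b(2) ext'_trans by blast
  then obtain q n where q: "cond q" "q <: t" "n \<E> om" "memf q (opn (chk x) (chk n)) f" using total[OF x(1,3)] by blast
  have "D a b q" unfolding D_def Z_def using x q ext'_dom[OF q(2) x(5)] ext'_dom[OF hb(3)] by blast
  thus "EX t. above emp t & t <: hat b & D a b t" using q(1) ext'_trans[OF q(2) x(4)] by (auto simp: above_def)
 qed simp
 then obtain V B where dV: "dt (%e. V (e 0))" and dB: "dt (%e. B (e 0))"
  and B0: "ALL a u. u \<E> B a <-> u \<E> p | (EX c. c \<E> a & u \<E> V c)"
  and V0: "ALL a. a \<E> om --> above emp (V a) & V a <: hat (B a) & D a (B a) (V a)"
  and A0: "ALL a. a \<E> suc om --> above emp (B a)"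
  by - (elim exE conjE, rule that, assumption+)
 have B: "u \<E> B a <-> u \<E> p | (EX c. c \<E> a & u \<E> V c)" for a u using B0 by blast
 have V: "EX x n. Z (B a) (V a) x n" if "a \<E> om" for a using V0 that unfolding D_def by blast
 have Bo: "cond (B om)" using A0 above_cond by (metis suc_iff)
 note V' = dt_fun1[OF dV] and B' = dt_fun1[OF dB]
 have "EX s. isfn s om & (ALL a. a \<E> om --> app s a \<E> J & (EX n. Z (B a) (V a) (app s a) n))"
  by (rule AC_fun[of "%a x. EX n. Z (B a) (V a) x n"]) (unfold Z_def, intro dps V' B', use V Z_def in blast)
 then obtain s where s: "!!a. a \<E> om ==> EX n. Z (B a) (V a) (app s a) n" by blast
 have "EX m. isfn m om & (ALL a. a \<E> om --> app m a \<E> om & Z (B a) (V a) (app s a) (app m a))"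
  by (rule AC_fun[of "%a n. Z (B a) (V a) (app s a) n"]) (unfold Z_def, intro dps V' B', use s Z_def in blast)
 then obtain m where "!!a. a \<E> om ==> Z (B a) (V a) (app s a) (app m a)" by blast
 hence sJ: "!!a. a \<E> om ==> app s a \<E> J" and sB: "!!a y. a \<E> om ==> y \<E> dom (B a) ==> y \<E> T' ==> y \<E> app s a"
  and sV: "!!a. a \<E> om ==> app s a \<E> dom (V a)" and mo: "!!a. a \<E> om ==> app m a \<E> om"
  and mem: "!!a. a \<E> om ==> memf (V a) (opn (chk (app s a)) (chk (app m a))) f" unfolding Z_def by blast+
 have BV: "B a' <: V a" if "a \<E> a'" for a a' using that B by (auto simp: ext'_def)
 have inc: "app s a \<E> app s a'" if a: "a \<E> a'" "a' \<E> om" for a a'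
 proof -
  have ao: "a \<E> om" using Ord_transD[OF Ord_om a(2,1)] .
  show ?thesis using sB[OF a(2) ext'_dom[OF BV[OF a(1)] sV[OF ao]]] sJ[OF ao] unfolding gapi by blast
 qed
 have omO: "Ord a" if "a \<E> om" for a using Ord_in[OF Ord_om that] .
 have inj: "a = a'" if "a \<E> om" "a' \<E> om" "app s a = app s a'" for a a'
  using Ord_lin[OF omO omO, of a a'] inc that mem_irrefl by metis
 have ds: "dt (%e. app s (e 0))" and dc: "dt (%e. opair (app s (e 0)) (app m (e 0)))" by (intro dps)+
 define b where "b = union (Img om (app s))"
 have bi: "y \<E> b <-> (EX a. a \<E> om & y \<E> app s a)" for y unfolding b_def union_iff mem_Img[OF ds] by blast
 have bT': "b \<E> T'" unfolding b_def by (intro univ_union[OF T'u] univ_repl[OF T'u ds] univ_om[OF T'u]) (use sJ gapi in blast)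
 have bO: "Ord b" unfolding b_def by (rule Ord_union) (unfold mem_Img[OF ds], use sJ gapi in blast)
 have sb: "app s a \<E> b" if "a \<E> om" for a unfolding bi using inc[of a "suc a"] suc_om[OF that] by auto
 have "~b \<E> T" using univ_in[OF uni_univ[OF adj_uni(1)[OF adj]] _ sb[OF emp_om]] sJ[OF emp_om] unfolding gapi by blast
 hence bJ: "b \<E> J" unfolding gapi using bT' bO by blast
 \<comment> \<open>A vertex of stage \<open>a\<close> in \<open>T'\<close> lies below the next
   chosen vertex \<open>app s a\<close>, hence below the supremum \<open>b\<close>.\<close>
 have bB: "~b \<E> dom (B om)"
 proof
  assume "b \<E> dom (B om)"
  then obtain y where "opair b y \<E> B om" by auto
  then obtain a where a: "a \<E> om" "b \<E> dom (B a)" unfolding B dom_iff using emp_om suc_om by (metis suc_iff)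
  hence "b \<E> b" unfolding bi using sB bT' by blast
  thus False by simp
 qed
 define c where "c = lam om (%a. opair (app s a) (app m a))"
 have ci: "entry k x n \<E> c <-> k \<E> om & x = app s k & n = app m k" for k x n unfolding c_def lam_iff[OF dc] by auto
 have sBo: "app s a \<E> dom (B om)" if "a \<E> om" for a by (rule ext'_dom[OF BV[OF that] sV[OF that]])
 have vert: "vert (dom (B om)) b c" unfolding vert_def
 proof (intro conjI allI impI bO)
  fix u assume "u \<E> c"
  then obtain a where a: "a \<E> om" "u = entry a (app s a) (app m a)" unfolding c_def lam_iff[OF dc] by blast
  thus "EX k x n. u = entry k x n & k \<E> om & n \<E> om & x \<E> dom (B om) & x \<E> b & near x b"
   using sBo[OF a(1)] sb[OF a(1)] mo[OF a(1)] gap_near[OF adj sJ[OF a(1)] bJ] by blast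
 next
  fix h assume "h \<E> b"
  then obtain K where K: "K \<E> om" "h \<E> app s K" unfolding bi by blast
  have "~x \<E> h" if e: "entry k x n \<E> c" "~k \<E> K" for k x n
  proof -
   have k: "k \<E> om" "x = app s k" using e(1) ci by blast+
   have "k = K | K \<E> k" using Ord_lin[OF omO[OF k(1)] omO[OF K(1)]] e(2) by blast
   hence "h \<E> app s k" using K(2) inc[OF _ k(1), of K] Ord_transD[of "app s k" "app s K" h] sJ[OF k(1)] gapi by blast
   thus ?thesis using k(2) mem_asym by blast
  qed
  thus "EX K. K \<E> om & (ALL k x n. entry k x n \<E> c --> ~k \<E> K --> ~x \<E> h)" using K(1) by blast
 qed
 have un: "ALL k x n k' n'. entry k x n \<E> c --> entry k' x n' \<E> c --> n = n'" unfolding ci using inj by blast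
 let ?q = "cup (B om) (sng (opair b c))"
 note q = add_vertex[OF Bo gap_H[OF adj bT'] bB vert un]
 have qB: "?q <: B om" by (rule cup_ext'1)
 have "EX x n. x \<E> J & n \<E> om & entry k x n \<E> app ?q b & memf ?q (opn (chk x) (chk n)) f" if k: "k \<E> om" for k
 proof (intro exI conjI)
  show "app s k \<E> J" "app m k \<E> om" by (rule sJ[OF k], rule mo[OF k])
  show "entry k (app s k) (app m k) \<E> app ?q b" unfolding q(2) ci using k by blast
  show "memf ?q (opn (chk (app s k)) (chk (app m k))) f" by (rule memf_mono[OF mem[OF k] ext'_trans[OF qB BV[OF k]]])
 qed
 moreover have "opair b c \<E> ?q" by simp
 hence "b \<E> dom ?q" unfolding dom_iff by blast
 moreover have "B om <: p" unfolding ext'_def using B by blast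
 hence "?q <: p" by (rule ext'_trans[OF qB])
 ultimately show ?thesis using q(1) bJ by blast
qed

text \<open>Let \<open>b\<close> be a diagonal vertex for \<open>F\<close>, and \<open>m\<close> the
  value of \<open>F\<close> at \<open>b\<close>. The entry of \<open>b\<close> with
  \<open>k = m\<close> demands that \<open>F\<close> exceed \<open>n\<close> at a vertex
  \<open>x\<close> where the condition forces the value to be exactly \<open>n\<close>.\<close>

lemma no_bounding_function:
 assumes F: "F : N"
  and tot: "!!x. x \<E> J ==> EX n. n \<E> om & NE (N.opair (ck x) (ck n)) F"
  and un: "!!x n n'. x \<E> J ==> n \<E> om ==> n' \<E> om ==> NE (N.opair (ck x) (ck n)) F ==> NE (N.opair (ck x) (ck n')) F ==> n = n'"
  and bound: "!!p b k x n m. p : g ==> b \<E> J ==> b \<E> dom p ==> entry k x n \<E> app p b ==> m \<E> om ==>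
   NE (N.opair (ck b) (ck m)) F ==> ~k \<E> m ==> EX n'. n' \<E> om & NE (N.opair (ck x) (ck n')) F & n \<E> n'"
 shows False
proof -
 obtain f where f: "f : subs H" "F = val f" using F by (auto simp: N_def)
 have omH: "n \<E> H" if "n \<E> om" for n using univ_in[OF univ_H univ_om[OF univ_H] that] .
 have JH: "x \<E> H" if "x \<E> J" for x using gap_H[OF adj] that gapi by blast
 have NEf: "NE (N.opair (ck x) (ck n)) F <-> (EX p:g. memf p (opn (chk x) (chk n)) f)" if "x \<E> H" "n \<E> om" for x n
  using val_opn[OF chk_H chk_H, of x n] NE_val[OF w_subs[OF opn_w[OF chk_H chk_H]] f(1), of x n] that omH f(2) by simp
 \<comment> \<open>Totality of \<open>F\<close> is known only in the extension. Either some
   condition excludes every value at a vertex, which \<open>tot\<close> refutes, or values can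
   always be forced below \<open>p\<close> and \<open>diagonal_dense\<close> applies.\<close>
 define A where "A q <-> (EX x. x \<E> J & (ALL q' n. cond q' --> q' <: q --> n \<E> om --> ~memf q' (opn (chk x) (chk n)) f))" for q
 define D where "D q <-> (EX b. b \<E> J & b \<E> dom q &
  (ALL k. k \<E> om --> (EX x n. x \<E> J & n \<E> om & entry k x n \<E> app q b & memf q (opn (chk x) (chk n)) f)))" for q
 have "EX q:g. A q | D q"
 proof (rule g_dense)
  show "dp (%e. A (e 0) | D (e 0))" unfolding A_def D_def by (intro dps)
  fix p assume "p \<E> PP"
  hence p: "cond p" by simp
  show "EX q. q \<E> PP & q <: p & (A q | D q)"
  proof (cases "EX q. cond q & q <: p & A q")
   case True
   thus ?thesis unfolding PP_iff by blast
  next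
   case False
   have "EX q' n. cond q' & q' <: q & n \<E> om & memf q' (opn (chk x) (chk n)) f" if "x \<E> J" "cond q" "q <: p" for x q
    using False that unfolding A_def by blast
   from diagonal_dense[OF f(1) p this] show ?thesis unfolding PP_iff D_def by blast
  qed
 qed
 then obtain q where q: "q : g" "A q | D q" by blast
 from q(2) show False
 proof
  assume "A q"
  then obtain x where x: "x \<E> J" "!!q' n. cond q' ==> q' <: q ==> n \<E> om ==> ~memf q' (opn (chk x) (chk n)) f" unfolding A_def by blast
  obtain n where n: "n \<E> om" "NE (N.opair (ck x) (ck n)) F" using tot[OF x(1)] by blast
  then obtain p where p: "p : g" "memf p (opn (chk x) (chk n)) f" using NEf[OF JH[OF x(1)] n(1)] by blast
  obtain r where r: "r : g" "r <: q" "r <: p" using g_dir[OF q(1) p(1)] by blast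
  show False using x(2)[OF g_cond[OF r(1)] r(2) n(1)] memf_mono[OF p(2) r(3)] by blast
 next
  assume "D q"
  then obtain b where b: "b \<E> J" "b \<E> dom q"
   "!!k. k \<E> om ==> EX x n. x \<E> J & n \<E> om & entry k x n \<E> app q b & memf q (opn (chk x) (chk n)) f" unfolding D_def by blast
  obtain m where m: "m \<E> om" "NE (N.opair (ck b) (ck m)) F" using tot[OF b(1)] by blast
  obtain x n where x: "x \<E> J" "n \<E> om" "entry m x n \<E> app q b" "memf q (opn (chk x) (chk n)) f" using b(3)[OF m(1)] by blast
  obtain n' where n': "n' \<E> om" "NE (N.opair (ck x) (ck n')) F" "n \<E> n'" using bound[OF q(1) b(1,2) x(3) m] by auto
  have "NE (N.opair (ck x) (ck n)) F" using NEf[OF JH[OF x(1)] x(2)] q(1) x(4) by blast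
  hence "n = n'" using un[OF x(1,2) n'(1) _ n'(2)] by blast
  thus False using n'(3) by simp
 qed
qed

end

end

context gext
begin

subsection \<open>Ultrafilters of the extension\<close>

lemma N_subset_set:
 assumes R: "N.dp (%e. R (e 0))" and P: "P : NS"
 shows "EX B:NS. ALL A:NS. NE A B <-> NE A P & R A"
proof -
 note R' = N.dp_rel1[OF R]
 obtain T where T: "uni T" "inT T P" using ext_uni[OF univ_emp[OF univ_H] P P] by blast
 have d: "N.dp (%e. NE (e 0) P & R (e 0))" by (intro dps P R')
 show ?thesis by (rule class_set[OF T(1) d]) (use inT_mem[OF T] in blast)
qed

text \<open>The identity on \<open>n\<close> is a bijection onto an element of \<open>a\<close>. In
  this way the elements of omega become members of \<open>P\<close>.\<close>

lemma card_less_own: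
 assumes n: "n : NS" and a: "a : NS" and na: "NE n a"
 shows "N.CardLess n a"
proof -
 obtain T where T: "uni T" "inT T n" using ext_uni[OF univ_emp[OF univ_H] n n] by blast
 have d: "N.dp (%e. NE (e 0) n & e 0 = e 1)" by (intro dps n)
 have "ALL x:NS. ALL y:NS. NE x n & x = y --> inT T x & inT T y" using inT_mem[OF T] by blast
 from rel_set[of "%x y. NE x n & x = y", OF d T(1) this]
 obtain h where h: "h : NS" "ALL p:NS. NE p h --> (EX x:NS. EX y:NS. p = N.opair x y & NE x n & x = y)"
  "ALL x:NS. ALL y:NS. NE (N.opair x y) h <-> NE x n & x = y" by (elim bexE conjE)
 note ho = h(3)[rule_format]
 have "N.Bij h n n" unfolding N.Bij_def N.FunTo_def N.FunOn_def
 proof (intro conjI ballI impI)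
  show "EX x:NS. EX y:NS. NE x n & p = N.opair x y" if p: "p : NS" "NE p h" for p using bspec[OF h(2) p(1)] p(2) by blast
  show "EX y:NS. NE (N.opair x y) h & (ALL y':NS. NE (N.opair x y') h --> y' = y)" if "x : NS" "NE x n" for x
   using ho that by (intro bexI[of _ x]) simp_all
  show "EX x:NS. NE (N.opair x y) h & (ALL x':NS. NE (N.opair x' y) h --> x' = x)" if "y : NS" "NE y n" for y
   using ho that by (intro bexI[of _ y]) simp_all
  show "NE y n" if "x : NS" "y : NS" "NE (N.opair x y) h" for x y using ho[OF that(1,2)] that(3) by blast
 qed
 thus ?thesis unfolding N.CardLess_def using n na h(1) by blast
qed

context
 fixes a X P U
 assumes NS: "a : NS" "X : NS" "P : NS" "U : NS" and IsP: "N.IsP P a X" and UF: "N.UF U P"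
  and Fine: "N.Fine U P X" and Comp: "N.Complete a U P"
begin

text \<open>The ultrafilter of the extension as a quantifier over definable properties, parallel to
  \<open>most\<close> in the ground model.\<close>

definition inU where
 "inU R <-> (EX B:NS. NE B U & (ALL A:NS. NE A B <-> NE A P & R A))"

lemma inU_ex: "inU R ==> EX A:NS. NE A P & R A" using UF unfolding inU_def N.UF_def by meson

lemma inU_mono:
 assumes R: "inU R" and R': "N.dp (%e. R' (e 0))" and le: "!!A. A : NS ==> NE A P ==> R A ==> R' A"
 shows "inU R'"
proof -
 obtain B where B: "B : NS" "NE B U" "ALL A:NS. NE A B <-> NE A P & R A" using R unfolding inU_def by (elim bexE conjE)
 obtain C where C: "C : NS" "ALL A:NS. NE A C <-> NE A P & R' A" using N_subset_set[OF R' NS(3)] by (elim bexE)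
 have "N.Sub B C" "N.Sub C P" unfolding N.Sub_def using B(3) C(2) le by simp_all
 moreover have "ALL B:NS. ALL C:NS. NE B U & N.Sub B C & N.Sub C P --> NE C U" using UF unfolding N.UF_def by (elim conjE)
 ultimately have "NE C U" using B(1,2) C(1) by blast
 thus ?thesis unfolding inU_def using C by (intro bexI[of _ C]) simp_all
qed

lemma inU_conj:
 assumes R: "inU R" and R': "inU R'" and d: "N.dp (%e. R (e 0) & R' (e 0))"
 shows "inU (%A. R A & R' A)"
proof -
 obtain B where B: "B : NS" "NE B U" "ALL A:NS. NE A B <-> NE A P & R A" using R unfolding inU_def by (elim bexE conjE)
 obtain B' where B': "B' : NS" "NE B' U" "ALL A:NS. NE A B' <-> NE A P & R' A" using R' unfolding inU_def by (elim bexE conjE)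
 obtain C where C: "C : NS" "ALL A:NS. NE A C <-> NE A P & R A & R' A" using N_subset_set[of "%A. R A & R' A", OF d NS(3)] by (elim bexE)
 have i: "ALL z:NS. NE z C <-> NE z B & NE z B'" using B(3) B'(3) C(2) by simp blast
 have "ALL B:NS. ALL B':NS. ALL C:NS. NE B U & NE B' U & (ALL z:NS. NE z C <-> NE z B & NE z B') --> NE C U"
  using UF unfolding N.UF_def by (elim conjE)
 hence "NE C U" using B(1,2) B'(1,2) C(1) i by blast
 thus ?thesis unfolding inU_def using C by (intro bexI[of _ C]) simp_all
qed

lemma inU_not:
 assumes d: "N.dp (%e. R (e 0))" and n: "~inU R"
 shows "inU (%A. ~R A)"
proof -
 note d' = N.dp_rel1[OF d]
 have dn: "N.dp (%e. ~R (e 0))" by (intro dps d')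
 obtain B where B: "B : NS" "ALL A:NS. NE A B <-> NE A P & R A" using N_subset_set[OF d NS(3)] by (elim bexE)
 obtain C where C: "C : NS" "ALL A:NS. NE A C <-> NE A P & ~R A" using N_subset_set[of "%A. ~R A", OF dn NS(3)] by (elim bexE)
 have s: "N.Sub B P" unfolding N.Sub_def using B(2) by simp
 have i: "ALL z:NS. NE z C <-> NE z P & ~NE z B" using B(2) C(2) by simp blast
 have "ALL B:NS. ALL C:NS. N.Sub B P & (ALL z:NS. NE z C <-> NE z P & ~NE z B) --> NE B U | NE C U"
  using UF unfolding N.UF_def by (elim conjE)
 hence "NE B U | NE C U" using B(1) C(1) s i by blast
 moreover have "~NE B U" using n B unfolding inU_def by blast
 ultimately show ?thesis unfolding inU_def using C by (intro bexI[of _ C]) simp_all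
qed

lemma inU_fine:
 assumes x: "x : NS" "NE x X"
 shows "inU (%A. NE x A)"
proof -
 have d: "N.dp (%e. NE x (e 0))" by (intro dps x)
 obtain B where B: "B : NS" "ALL A:NS. NE A B <-> NE A P & NE x A" using N_subset_set[OF d NS(3)] by (elim bexE)
 have "NE B U" using Fine[unfolded N.Fine_def, rule_format, of x B] x B by blast
 thus ?thesis unfolding inU_def using B by (intro bexI[of _ B]) simp_all
qed

lemma P_iff: "A : NS ==> NE A P <-> N.Sub A X & N.CardLess A a" using IsP unfolding N.IsP_def by blast

text \<open>To apply completeness to a family indexed by \<open>w\<close> it has to be injective. Each \<open>n : w\<close> is itself an
 element of \<open>P\<close>, so adding \<open>w\<close> to the \<open>n\<close>-th set and removing \<open>n\<close> makes the family injective.\<close>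

lemma inU_complete:
 assumes w: "w : NS" "NE w a" and wO: "N.ORD a" and wX: "!!n. NE n w ==> NE n X & N.Sub n X"
  and d: "N.dp (%e. Q (e 0) (e 1))" and Q: "!!n. NE n w ==> inU (Q n)"
 shows "EX A:NS. NE A P & (ALL n. NE n w --> Q n A)"
proof -
 note Q' = N.dp_rel2[OF d]
 have wP: "NE n P" if "NE n w" for n
  using P_iff[OF NE_NS[OF that]] wX[OF that] card_less_own[OF NE_NS[OF that] NS(1) ORD_trans[OF wO w(2) that]] by blast
 define Z where "Z n A <-> (Q n A | NE A w) & A ~= n" for n A
 have dZ: "N.dp (%e. Z (f e) (f' e))" if "N.dt f" "N.dt f'" for f f' by (rule N.dp_rel2[of Z, OF _ that], unfold Z_def, intro dps Q' w(1))
 have ZU: "inU (Z n)" if n: "NE n w" for n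
 proof -
  have nN: "n : NS" by (rule NE_NS[OF n])
  have d1: "N.dp (%e. NE n (e 0) & Q n (e 0))" by (intro dps Q' nN)
  have d2: "N.dp (%e. Z n (e 0))" by (intro dZ dps nN)
  show ?thesis by (rule inU_mono[OF inU_conj[OF inU_fine[OF nN conjunct1[OF wX[OF n]]] Q[OF n] d1] d2])
    (use N_irrefl in "auto simp: Z_def")
 qed
 define S where "S n B <-> (ALL A:NS. NE A B <-> NE A P & Z n A)" for n B
 have dS: "N.dp (%e. S (f e) (f' e))" if "N.dt f" "N.dt f'" for f f' by (rule N.dp_rel2[of S, OF _ that], unfold S_def, intro dps dZ NS(3))
 have SU: "EX B:NS. S n B & NE B U" if "NE n w" for n using ZU[OF that] unfolding inU_def S_def by blast
 have S1: "B = B'" if "B : NS" "B' : NS" "S n B" "S n B'" for n B B' using N.ext[of B B'] that NS_N unfolding S_def by blast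
 have Sn: "n = n'" if h: "NE n w" "NE n' w" "S n B" "S n' B" for n n' B
 proof (rule ccontr)
  assume "n ~= n'"
  hence "Z n' n" using h(1) unfolding Z_def by blast
  hence "NE n B" using h(4) wP[OF h(1)] NE_NS[OF h(1)] unfolding S_def by blast
  thus False using h(3) NE_NS[OF h(1)] unfolding S_def Z_def by blast
 qed
 have "EX F:NS. ALL B:NS. NE B F <-> (EX n:NS. NE n w & S n B)" by (rule replacement[of S, OF _ w(1)], intro dS dps, rule S1)
 then obtain F where F: "F : NS" "ALL B:NS. NE B F <-> (EX n:NS. NE n w & S n B)" by (elim bexE)
 obtain T where T: "uni T" "inT T F" "inT T w" using ext_uni[OF univ_emp[OF univ_H] F(1) w(1)] by blast
 have dh: "N.dp (%e. NE (e 0) F & NE (e 1) w & S (e 1) (e 0))" by (intro dps dS F(1) w(1))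
 have "ALL B:NS. ALL n:NS. NE B F & NE n w & S n B --> inT T B & inT T n" using inT_mem[OF T(1,2)] inT_mem[OF T(1,3)] by blast
 from rel_set[of "%B n. NE B F & NE n w & S n B", OF dh T(1) this]
 obtain h where h: "h : NS" "ALL p:NS. NE p h --> (EX B:NS. EX n:NS. p = N.opair B n & NE B F & NE n w & S n B)"
  "ALL B:NS. ALL n:NS. NE (N.opair B n) h <-> NE B F & NE n w & S n B" by (elim bexE conjE)
 note ho = h(3)[rule_format]
 have "N.Bij h F w" unfolding N.Bij_def N.FunTo_def N.FunOn_def
 proof (intro conjI ballI impI)
  show "EX B:NS. EX n:NS. NE B F & p = N.opair B n" if p: "p : NS" "NE p h" for p using bspec[OF h(2) p(1)] p(2) by blast
  show "NE n w" if "B : NS" "n : NS" "NE (N.opair B n) h" for B n using ho[OF that(1,2)] that(3) by blast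
  show "EX n:NS. NE (N.opair B n) h & (ALL n':NS. NE (N.opair B n') h --> n' = n)" if B: "B : NS" "NE B F" for B
  proof -
   obtain n where n: "n : NS" "NE n w" "S n B" using bspec[OF F(2) B(1)] B(2) by blast
   have "n' = n" if "n' : NS" "NE (N.opair B n') h" for n' using ho[OF B(1) that(1)] that(2) Sn[OF _ n(2) _ n(3)] by blast
   thus ?thesis using ho[OF B(1) n(1)] n B(2) by blast
  qed
  show "EX B:NS. NE (N.opair B n) h & (ALL B':NS. NE (N.opair B' n) h --> B' = B)" if n: "n : NS" "NE n w" for n
  proof -
   obtain B where B: "B : NS" "S n B" using SU[OF n(2)] by blast
   hence "NE B F" using bspec[OF F(2) B(1)] n by blast
   moreover have "B' = B" if "B' : NS" "NE (N.opair B' n) h" for B' using ho[OF that(1) n(1)] that(2) S1[OF that(1) B(1) _ B(2)] by blast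
   ultimately show ?thesis using ho[OF B(1) n(1)] n(2) B by blast
  qed
 qed
 hence CL: "N.CardLess F a" unfolding N.CardLess_def using w h(1) by blast
 have FU: "N.Sub F U" unfolding N.Sub_def
 proof (intro ballI impI)
  fix B assume B: "B : NS" "NE B F"
  obtain n where n: "n : NS" "NE n w" "S n B" using bspec[OF F(2) B(1)] B(2) by blast
  obtain B' where "B' : NS" "S n B'" "NE B' U" using SU[OF n(2)] by blast
  thus "NE B U" using S1[OF B(1) _ n(3)] by blast
 qed
 have dI: "N.dp (%e. ALL B:NS. NE B F --> NE (e 0) B)" by (intro dps F(1))
 obtain I where I: "I : NS" "ALL z:NS. NE z I <-> NE z P & (ALL B:NS. NE B F --> NE z B)"
  using N_subset_set[of "%z. ALL B:NS. NE B F --> NE z B", OF dI NS(3)] by (elim bexE)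
 have "NE I U" using Comp[unfolded N.Complete_def, rule_format, of F I] F(1) I FU CL by blast
 hence "inU (%z. ALL B:NS. NE B F --> NE z B)" unfolding inU_def using I by (intro bexI[of _ I]) simp_all
 from inU_ex[OF this] obtain A where A: "A : NS" "NE A P" "ALL B:NS. NE B F --> NE A B" by blast
 have Zn: "Z n A" if n: "NE n w" for n
 proof -
  obtain B where B: "B : NS" "S n B" using SU[OF n] by blast
  hence "NE B F" using bspec[OF F(2) B(1)] n NE_NS[OF n] by blast
  hence "NE A B" using A(3) B(1) by blast
  thus ?thesis using B(2) A(1) unfolding S_def by blast
 qed
 \<comment> \<open>An \<open>A\<close> in \<open>w\<close> would satisfy \<open>Z A A\<close>, which
   demands that \<open>A\<close> differ from itself; so the enlargement of the sets by
   \<open>w\<close> does no harm.\<close>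
 hence "~NE A w" unfolding Z_def by blast
 hence "Q n A" if "NE n w" for n using Zn[OF that] unfolding Z_def by blast
 thus ?thesis using A(1,2) by blast
qed

end

end

section \<open>Colourings of small sets of vertices\<close>

context gext
begin

lemma omH: "n \<E> om ==> n \<E> H" using univ_in[OF univ_H univ_om[OF univ_H]] .

lemma omO: "n \<E> om ==> Ord n" using Ord_in[OF Ord_om] .

lemma ORD_ck: "x \<E> H ==> Ord x ==> N.ORD (ck x)"
proof (rule ORDI)
 assume x: "x \<E> H" "Ord x"
 have xH: "y \<E> H" if "y \<E> x" for y using univ_in[OF univ_H x(1) that] .
 fix u v assume u: "NE u (ck x)"
 then obtain y where y: "y \<E> x" "u = ck y" using NE_ck[OF x(1)] by blast
 { assume "NE v u"
  then obtain z where "z \<E> y" "v = ck z" using NE_ck[OF xH[OF y(1)]] y(2) by blast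
  thus "NE v (ck x)" using NE_ck[OF x(1)] Ord_transD[OF x(2) y(1)] by blast }
 { assume "NE v (ck x)"
  then obtain z where z: "z \<E> x" "v = ck z" using NE_ck[OF x(1)] by blast
  thus "NE u v | u = v | NE v u" using Ord_lin[OF Ord_in[OF x(2) y(1)] Ord_in[OF x(2) z(1)]] NE_ck_ck[OF xH[OF y(1)] xH[OF z(1)]]
    NE_ck_ck[OF xH[OF z(1)] xH[OF y(1)]] y(2) by blast }
qed

text \<open>No check name of a natural number is a limit ordinal, so \<open>w\<close> is none of
  them and by linearity lies above all of them.\<close>

lemma omega_ck:
 assumes w: "w : NS" "N.OMEGA w" and n: "n \<E> om"
 shows "NE (ck n) w"
proof -
 have lw: "N.LORD w" using w(2) unfolding N.OMEGA_def by blast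
 hence wO: "N.ORD w" unfolding N.LORD_def by blast
 have no: "w ~= ck j" if j: "j \<E> om" for j
 proof
  assume e: "w = ck j"
  have ne: "EX z:NS. NE z w" and li: "ALL x:NS. NE x w --> (EX y:NS. NE y w & NE x y)" using lw unfolding N.LORD_def by blast+
  from om_cases[OF j] show False
  proof
   assume "j = emp"
   thus False using ne NE_ck[OF omH[OF j]] e by auto
  next
   assume "EX m. m \<E> om & j = suc m"
   then obtain m where m: "m \<E> om" "j = suc m" by blast
   have "NE (ck m) w" unfolding e using NE_ck_ck[OF omH[OF m(1)] omH[OF j]] m(2) by simp
   then obtain y where y: "NE y w" "NE (ck m) y" using li ck_NS[OF omH[OF m(1)]] by blast
   then obtain i where i: "i \<E> j" "y = ck i" using e NE_ck[OF omH[OF j]] by blast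
   have iH: "i \<E> H" using univ_in[OF univ_H omH[OF j] i(1)] .
   have "m \<E> i" using y(2) i(2) NE_ck_ck[OF omH[OF m(1)] iH] by blast
   moreover have "i \<E> m | i = m" using i(1) m(2) by auto
   ultimately show False using mem_asym[of m i] mem_irrefl by blast
  qed
 qed
 from ORD_lin[OF ck_NS[OF omH[OF n]] ORD_ck[OF omH[OF n] omO[OF n]] w(1) wO] show ?thesis
 proof (elim disjE)
  assume "NE w (ck n)"
  then obtain j where "j \<E> n" "w = ck j" using NE_ck[OF omH[OF n]] by blast
  thus ?thesis using no Ord_transD[OF Ord_om n] by blast
 next
  assume "ck n = w"
  thus ?thesis using no[OF n] by simp
 qed
qed

context
 fixes T T' a
 assumes adj: "adjacent T T'" and a: "a : NS" "inT T a"
begin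

private abbreviation "J' \<equiv> gap T T'"

private lemma gap_mem: "x \<E> J' <-> x \<E> T' & Ord x & ~x \<E> T" by (rule gap_iff[OF adj])

private lemma uT': "univ T'" by (rule uni_univ[OF adj_uni(2)[OF adj]])

private lemma JH: "x \<E> J' ==> x \<E> H" using gap_H[OF adj] gap_mem by blast

private lemma J_H: "J' \<E> H" by (rule univ_sub[OF univ_H, of T']) (use adj_uni(2)[OF adj] gap_mem in "auto simp: uni_def")

text \<open>A name for the class of all entries occurring in the generic filter. With it the
  bounding property of a function can be stated inside the extension, as \<open>choice_class\<close>
  requires.\<close>

definition entries where
 "entries = Coll H (%u. EX b y p. u = opair (chk (opair b y)) p & b \<E> H & y \<E> H & b \<E> dom p & y \<E> app p b)"

lemma entries_iff: "u \<E> entries <-> u \<E> H & (EX b y p. u = opair (chk (opair b y)) p & b \<E> H & y \<E> H & b \<E> dom p & y \<E> app p b)"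
 unfolding entries_def by (rule mem_Coll) (intro dps)

lemma entries_N: "val entries : N" by (rule val_N) (use entries_iff in "auto simp: subs_def")

lemma NE_entries:
 assumes h: "b \<E> H" "k \<E> H" "x \<E> H" "n \<E> H"
 shows "NE (N.opair (ck b) (N.opair (ck k) (N.opair (ck x) (ck n)))) (val entries) <->
  (EX p:g. b \<E> dom p & entry k x n \<E> app p b)"
proof -
 have op: "opair x y \<E> H" if "x \<E> H" "y \<E> H" for x y using univ_opair[OF univ_H] that by blast
 note eH = op[OF h(2) op[OF h(3,4)]]
 note bH = op[OF h(1) eH]
 have s: "entries : subs H" using entries_iff by (auto simp: subs_def)
 have "NE (ck (opair b (entry k x n))) (val entries) <-> (EX p:g. b \<E> dom p & entry k x n \<E> app p b)"
 proof
  assume "NE (ck (opair b (entry k x n))) (val entries)"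
  then obtain pi r where pi: "ck (opair b (entry k x n)) = val pi" "opair pi r \<E> entries" "r : g" using NE_cases[OF _ s] by metis
  then obtain b' y where e: "pi = chk (opair b' y)" "b' \<E> H" "y \<E> H" "b' \<E> dom r" "y \<E> app r b'"
   unfolding entries_iff opair_eq by blast
  have "opair b (entry k x n) = opair b' y" using pi(1) ck_inj[OF bH op[OF e(2,3)]] unfolding e(1) by blast
  thus "EX p:g. b \<E> dom p & entry k x n \<E> app p b" using e(4,5) pi(3) unfolding opair_eq by blast
 next
  assume "EX p:g. b \<E> dom p & entry k x n \<E> app p b"
  then obtain p where p: "p : g" "b \<E> dom p" "entry k x n \<E> app p b" by (elim bexE conjE)
  have "opair (chk (opair b (entry k x n))) p \<E> entries"
   unfolding entries_iff using op[OF chk_H[OF bH] cond_H[OF g_cond[OF p(1)]]] p h(1) eH by blast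
  thus "NE (ck (opair b (entry k x n))) (val entries)" by (rule NE_I[OF s _ p(1) chk_H[OF bH]])
 qed
 thus ?thesis unfolding ck_opair[OF h(1) eH] ck_opair[OF h(2) op[OF h(3,4)]] ck_opair[OF h(3,4)] .
qed

text \<open>\<open>A\<close> is in bijection with an element of \<open>a\<close>, whose members have
  names in \<open>T\<close>. By \<open>covering\<close>, a ground function on \<open>T\<close>
  captures all gap vertices in \<open>A\<close>, and since \<open>T\<close> is an element of
  \<open>T'\<close> their supremum stays in \<open>T'\<close>.\<close>

lemma small_bounded:
 assumes A: "A : NS" "N.CardLess A a"
 shows "EX h. Ord h & h \<E> T' & (ALL x. x \<E> J' --> NE (ck x) A --> x \<E> h)"
proof (cases "EX x. x \<E> J'")
 case False
 thus ?thesis using Ord_emp univ_emp[OF uT'] by blast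
next
 case True
 then obtain x0 where x0: "x0 \<E> J'" by blast
 obtain i0 h where i0: "i0 : NS" "NE i0 a" and h: "h : NS" "N.Bij h A i0" using A(2) unfolding N.CardLess_def by blast
 have hN: "h : N" using h(1) NS_N by blast
 have dF: "N.dp (%e. NE (N.opair (e 1) (e 0)) h)" by (intro dps h(1))
 obtain F where F: "F : N" "ALL i:NS. ALL u:NS. NE (N.opair i u) F <-> NE (N.opair u i) h"
  using rel_class[of "%i u. NE (N.opair u i) h", OF dF] by (elim bexE conjE)
 note Fo = F(2)[rule_format]
 obtain f where f: "f : subs H" "F = val f" using F(1) by (auto simp: N_def)
 have dc: "dt (%e. chk (e 0))" by (intro dps)
 let ?B = "Img J' chk"
 have BH: "s \<E> H" if "s \<E> ?B" for s using that chk_H[OF JH] unfolding mem_Img[OF dc] by blast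
 have chi: "x = y" if "x \<E> J'" "y \<E> J'" "chk x = chk y" for x y
 proof -
  have "ck x = ck y" using that(3) by simp
  thus ?thesis using ck_inj[OF JH[OF that(1)] JH[OF that(2)]] by blast
 qed
 have "EX c. (ALL u. u \<E> T --> app c u \<E> ?B | (ALL s. ~s \<E> ?B)) & (ALL pi s. pi \<E> T --> s \<E> ?B --> NE (N.opair (val pi) (val s)) (val f) -->
   (EX u. u \<E> T & app c u \<E> ?B & NE (N.opair (val pi) (val (app c u))) (val f)))"
  by (rule covering[OF adj_uni(1)[OF adj] f(1)]) (rule BH)
 then obtain c where c: "ALL u. u \<E> T --> app c u \<E> ?B | (ALL s. ~s \<E> ?B)"
  and cov: "ALL pi s. pi \<E> T --> s \<E> ?B --> NE (N.opair (val pi) (val s)) (val f) -->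
   (EX u. u \<E> T & app c u \<E> ?B & NE (N.opair (val pi) (val (app c u))) (val f))" by (elim exE conjE)
 \<comment> \<open>\<open>G\<close> decodes the check name \<open>app c u\<close> into the vertex it
   stands for.\<close>
 define G where "G u = union (Coll J' (%x. chk x = app c u))" for u
 have dG: "dt (%e. G (e 0))" unfolding G_def by (intro dps)
 have G: "G u = x" if x: "x \<E> J'" "app c u = chk x" for u x
 proof -
  have d: "dp (%e. chk (e 0) = app c u)" by (intro dps)
  have "y \<E> Coll J' (%x. chk x = app c u) <-> y = x" for y using mem_Coll[OF d, of y J'] chi[OF _ x(1), of y] x by auto
  thus ?thesis unfolding G_def by (intro eqI) simp
 qed
 have GJ: "G u \<E> J'" if u: "u \<E> T" for u
 proof -
  have "chk x0 \<E> ?B" unfolding mem_Img[OF dc] using x0 by blast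
  hence "app c u \<E> ?B" using c u by blast
  then obtain x where "x \<E> J'" "app c u = chk x" unfolding mem_Img[OF dc] by blast
  thus ?thesis using G by metis
 qed
 let ?W = "union (Img T G)"
 have WT: "?W \<E> T'" by (intro univ_union[OF uT'] univ_repl[OF uT' dG adj_uni(3)[OF adj]]) (use GJ gap_mem in blast)
 have WO: "Ord ?W" by (rule Ord_union) (unfold mem_Img[OF dG], use GJ gap_mem in blast)
 have "x \<E> suc ?W" if x: "x \<E> J'" "NE (ck x) A" for x
 proof -
  have xN: "ck x : NS" by (rule ck_NS[OF JH[OF x(1)]])
  have FT: "N.FunTo h A i0" and inj: "ALL y:NS. NE y i0 --> (EX x:NS. NE (N.opair x y) h & (ALL x':NS. NE (N.opair x' y) h --> x' = x))"
   using h(2) unfolding N.Bij_def by blast+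
  obtain i where i: "i : NS" "NE (N.opair (ck x) i) h" using N.FunTo_ex[OF FT xN x(2)] by blast
  have ii: "NE i i0" by (rule N.FunTo_to[OF FT xN i])
  have "EX x':NS. NE (N.opair x' i) h & (ALL z:NS. NE (N.opair z i) h --> z = x')" using bspec[OF inj i(1)] ii by (rule mp)
  then obtain x' where x': "ALL z:NS. NE (N.opair z i) h --> z = x'" by (elim bexE conjE)
  have un: "z = ck x" if h: "z : NS" "NE (N.opair z i) h" for z using bspec[OF x' h(1)] bspec[OF x' xN] h(2) i(2) by simp
  have "inT T i0" by (rule inT_mem[OF adj_uni(1)[OF adj] a(2) i0(2)])
  from inT_mem[OF adj_uni(1)[OF adj] this ii] obtain pi where pi: "pi \<E> T" "i = val pi" unfolding inT_def by blast
  have "NE (N.opair (val pi) (val (chk x))) (val f)" unfolding pi(2)[symmetric] f(2)[symmetric] Fo[OF i(1) xN] by (rule i(2))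
  moreover have "chk x \<E> ?B" unfolding mem_Img[OF dc] using x(1) by blast
  ultimately obtain u where u: "u \<E> T" "app c u \<E> ?B" "NE (N.opair (val pi) (val (app c u))) (val f)" using cov pi(1) by blast
  obtain z where z: "z \<E> J'" "app c u = chk z" using u(2) unfolding mem_Img[OF dc] by blast
  have zN: "ck z : NS" by (rule ck_NS[OF JH[OF z(1)]])
  have "NE (N.opair (ck z) i) h" using u(3) unfolding pi(2)[symmetric] f(2)[symmetric] z(2) Fo[OF i(1) zN] .
  hence "ck z = ck x" using un zN by blast
  hence zx: "z = x" using ck_inj[OF JH[OF z(1)] JH[OF x(1)]] by blast
  have "G u = x" using G[OF z] zx by simp
  hence "x \<E> Img T G" unfolding mem_Img[OF dG] using u(1) by blast
  hence "y \<E> ?W" if "y \<E> x" for y using that by auto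
  moreover have "Ord x" using x(1) gap_mem by blast
  ultimately have "~ ?W \<E> x" using mem_irrefl by blast
  thus ?thesis using Ord_lin[OF \<open>Ord x\<close> WO] by auto
 qed
 thus ?thesis using Ord_suc[OF WO] univ_suc[OF uT' WT] by blast
qed

text \<open>A bounded part of the gap may be added to any condition as isolated vertices.\<close>

lemma dense_support:
 assumes h: "Ord h" "h \<E> T'"
 shows "EX p:g. ALL x. x \<E> J' --> x \<E> h --> x \<E> dom p"
proof (rule g_dense)
 show "dp (%e. ALL x. x \<E> J' --> x \<E> h --> x \<E> dom (e 0))" by (intro dps)
 fix p assume "p \<E> PP"
 hence p: "cond p" by simp
 have d: "dp (%e. e 0 \<E> J' & ~e 0 \<E> dom p)" by (intro dps)
 let ?z = "Coll h (%x. x \<E> J' & ~x \<E> dom p)"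
 have z: "x \<E> ?z <-> x \<E> h & x \<E> J' & ~x \<E> dom p" for x by (rule mem_Coll[OF d])
 have zH: "?z \<E> H" by (rule univ_sub[OF univ_H uniH[OF adj_uni(2)[OF adj] h(2)]]) (use z in blast)
 have z1: "Ord x & ~x \<E> dom p" if "x \<E> ?z" for x using that z gap_mem by blast
 have z2: "bdd ?z S" if "uni S" for S by (rule gap_bdd[OF adj h _ that]) (use z in blast)
 note q = add_isolated[OF p zH z1 z2]
 show "EX q. q \<E> PP & q <: p & (ALL x. x \<E> J' --> x \<E> h --> x \<E> dom q)" unfolding PP_iff
 proof (rule exI[of _ "cup p (lam ?z (%_. emp))"], intro conjI q(1) cup_ext'1 allI impI)
  show "x \<E> dom (cup p (lam ?z (%_. emp)))" if "x \<E> J'" "x \<E> h" for x using q(2)[of x] z that by blast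
 qed
qed

text \<open>Some condition in \<open>g\<close> has all gap vertices up to a bound for
  \<open>A\<close> in its domain, and its own goodness supplies the function. Compatibility within
  \<open>g\<close> extends the bounding property to the entries of all conditions in
  \<open>g\<close>.\<close>

lemma colouring:
 assumes A: "A : NS" "N.CardLess A a"
 shows "EX f. inT T' f & (ALL x. x \<E> J' --> NE (ck x) A -->
   (EX n. n \<E> om & (ALL Z:NS. NE (N.opair (ck x) Z) f <-> Z = ck n))) &
  (ALL p:g. ALL b k x n m n'. b \<E> J' --> b \<E> dom p --> entry k x n \<E> app p b --> m \<E> om --> n' \<E> om -->
   NE (N.opair (ck b) (ck m)) f --> NE (N.opair (ck x) (ck n')) f --> ~k \<E> m --> n \<E> n')"
proof -
 obtain h where h: "Ord h" "h \<E> T'" and hA: "!!x. x \<E> J' ==> NE (ck x) A ==> x \<E> h" using small_bounded[OF A] by blast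
 obtain p where p: "p : g" and hp: "!!x. x \<E> J' ==> x \<E> h ==> x \<E> dom p" using dense_support[OF h] by blast
 obtain f0 where f0: "good p f0" using cond_good[OF g_cond[OF p]] by blast
 have f0o: "app f0 x \<E> om" if "x \<E> dom p" for x using f0 that unfolding good_def by blast
 have d: "dp (%e. e 0 \<E> J')" by (intro dps)
 let ?D = "Coll h (%x. x \<E> J')"
 have D: "x \<E> ?D <-> x \<E> h & x \<E> J'" for x by (rule mem_Coll[OF d])
 have DT: "?D \<E> T'" by (rule univ_sub[OF uT' h(2)]) (use D in blast)
 have dS: "dt (%e. opn (chk (e 0)) (chk (app f0 (e 0))))" by (intro dps)
 let ?S = "Img ?D (%x. opn (chk x) (chk (app f0 x)))"
 have Do: "app f0 x \<E> om" if "x \<E> ?D" for x using f0o hp that D by blast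
 have omT': "n \<E> T'" if "n \<E> om" for n using univ_in[OF uT' univ_om[OF uT'] that] .
 have opT: "opn x y \<E> T'" if "x \<E> T'" "y \<E> T'" for x y
  unfolding opn_def using that univ_upair[OF uT'] univ_opair[OF uT'] univ_emp[OF uT'] by simp
 have ST: "?S \<E> T'"
 proof (rule univ_repl[OF uT' dS DT])
  fix y assume y: "y \<E> ?D"
  have "y \<E> T'" using y D gap_mem by blast
  thus "opn (chk y) (chk (app f0 y)) \<E> T'" by (rule opT[OF chk_T[OF adj_uni(2)[OF adj]] chk_T[OF adj_uni(2)[OF adj] omT'[OF Do[OF y]]]])
 qed
 note SH = uniH[OF adj_uni(2)[OF adj] ST]
 define f where "f = val (flat ?S)"
 have fT: "inT T' f" unfolding inT_def f_def by (rule exI, rule conjI[OF flat_univ[OF uT' ST]], rule refl)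
 have fi: "NE (N.opair (ck x) Z) f <-> x \<E> ?D & Z = ck (app f0 x)" if x: "x \<E> H" and Z: "Z : NS" for x Z
 proof -
  have v: "val (opn (chk y) (chk (app f0 y))) = N.opair (ck y) (ck (app f0 y))" if "y \<E> ?D" for y
   by (rule val_opn[OF chk_H[OF JH] chk_H[OF omH[OF Do[OF that]]]]) (use that D in blast)
  have "NE (N.opair (ck x) Z) f <-> (EX pi. pi \<E> ?S & N.opair (ck x) Z = val pi)" unfolding f_def by (rule NE_flat[OF w_subs[OF SH]])
  also have "\<dots> <-> (EX y. y \<E> ?D & N.opair (ck x) Z = N.opair (ck y) (ck (app f0 y)))"
  proof -
   have "(EX pi. pi \<E> ?S & N.opair (ck x) Z = val pi) <-> (EX y. y \<E> ?D & N.opair (ck x) Z = val (opn (chk y) (chk (app f0 y))))"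
    unfolding mem_Img[OF dS] by blast
   moreover have "(y \<E> ?D & N.opair (ck x) Z = val (opn (chk y) (chk (app f0 y)))) <-> (y \<E> ?D & N.opair (ck x) Z = N.opair (ck y) (ck (app f0 y)))" for y
    using v[of y] by (cases "y \<E> ?D") simp_all
   ultimately show ?thesis by simp
  qed
  also have "\<dots> <-> (EX y. y \<E> ?D & ck x = ck y & Z = ck (app f0 y))"
  proof -
   have "N.opair (ck x) Z = N.opair (ck y) (ck (app f0 y)) <-> ck x = ck y & Z = ck (app f0 y)" if "y \<E> ?D" for y
    by (rule N.opair_inject[OF ck_NS[OF x] Z ck_NS[OF JH] ck_NS[OF omH[OF Do[OF that]]]]) (use that D in blast)
   thus ?thesis by blast
  qed
  also have "\<dots> <-> x \<E> ?D & Z = ck (app f0 x)"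
  proof -
   have "ck x = ck y <-> x = y" if "y \<E> ?D" for y by (rule ck_inj[OF x JH]) (use that D in blast)
   thus ?thesis by blast
  qed
  finally show ?thesis .
 qed
 have 1: "EX n. n \<E> om & (ALL Z:NS. NE (N.opair (ck x) Z) f <-> Z = ck n)" if x: "x \<E> J'" "NE (ck x) A" for x
 proof -
  have "x \<E> ?D" using D hA x by blast
  thus ?thesis using fi[OF JH[OF x(1)]] Do by (intro exI[of _ "app f0 x"]) simp
 qed
 have 2: "n \<E> n'" if q: "q : g" and b: "b \<E> J'" "b \<E> dom q" and e: "entry k x n \<E> app q b" and m: "m \<E> om" "n' \<E> om"
  and fm: "NE (N.opair (ck b) (ck m)) f" "NE (N.opair (ck x) (ck n')) f" and k: "~k \<E> m" for q b k x n m n'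
 proof -
  have xH: "x \<E> H" using cond_entry(3)[OF g_cond[OF q] b(2) e] univ_in[OF univ_H univ_dom[OF univ_H cond_H[OF g_cond[OF q]]]] by blast
  have bD: "b \<E> ?D" "ck m = ck (app f0 b)" using fi[OF JH[OF b(1)] ck_NS[OF omH[OF m(1)]]] fm(1) by blast+
  have xD: "x \<E> ?D" "ck n' = ck (app f0 x)" using fi[OF xH ck_NS[OF omH[OF m(2)]]] fm(2) by blast+
  have m': "m = app f0 b" using ck_inj[OF omH[OF m(1)] omH[OF Do[OF bD(1)]]] bD(2) by blast
  have n': "n' = app f0 x" using ck_inj[OF omH[OF m(2)] omH[OF Do[OF xD(1)]]] xD(2) by blast
  have bp: "b \<E> dom p" using hp bD(1) D by blast
  obtain r where r: "r : g" "r <: p" "r <: q" using g_dir[OF p q] by blast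
  have "app p b = app q b"
   using cond_ext_app[OF g_cond[OF p] g_cond[OF r(1)] r(2) bp] cond_ext_app[OF g_cond[OF q] g_cond[OF r(1)] r(3) b(2)] by simp
  thus ?thesis using f0 bp e k unfolding m' n' good_def by auto
 qed
 show ?thesis using fT 1 2 by (intro exI[of _ f] conjI ballI allI impI) (assumption | blast)+
qed

definition colours where
 "colours A F <->
  (ALL x. x \<E> J' --> NE (ck x) A -->
   (EX n. n \<E> om & (ALL Z:NS. NE (N.opair A (N.opair (ck x) Z)) F <-> Z = ck n))) &
  (ALL p:g. ALL b k x n m n'. b \<E> J' --> b \<E> dom p --> entry k x n \<E> app p b --> m \<E> om --> n' \<E> om -->
   NE (N.opair A (N.opair (ck b) (ck m))) F --> NE (N.opair A (N.opair (ck x) (ck n'))) F --> ~k \<E> m --> n \<E> n')"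

text \<open>One class codes a colouring for every small \<open>A\<close>, so that the ultrafilter
  can average them. For the choice to be definable, the requirements are restated inside the
  extension (\<open>fn\<close>, \<open>bd\<close>) with check names of omega and of the gap.\<close>

lemma colouring_class: "EX F:N. ALL A:NS. N.CardLess A a --> colours A F"
proof -
 have omS: "ck om : NS" by (rule ck_NS[OF univ_om[OF univ_H]])
 have IS: "ck J' : NS" by (rule ck_NS[OF J_H])
 define fn where "fn A f <-> (ALL u:NS. NE u (ck J') --> NE u A -->
  (EX n:NS. NE n (ck om) & (ALL Z:NS. NE (N.opair u Z) f <-> Z = n)))" for A f
 define bd where "bd f <-> (ALL b:NS. ALL k:NS. ALL x:NS. ALL n:NS. ALL m:NS. ALL n':NS. NE b (ck J') --> NE k (ck om) --> NE n (ck om) --> NE x (ck J') -->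
  NE (N.opair b (N.opair k (N.opair x n))) (val entries) --> NE m (ck om) --> NE n' (ck om) -->
   NE (N.opair b m) f --> NE (N.opair x n') f --> ~NE k m --> NE n n')" for f
 have dfn: "N.dp (%e. fn (t e) (t' e))" if "N.dt t" "N.dt t'" for t t'
  by (rule N.dp_rel2[OF _ that, of fn], unfold fn_def, intro dps omS IS)
 have dbd: "N.dp (%e. bd (t e))" if "N.dt t" for t by (rule N.dp_rel1[OF _ that, of bd], unfold bd_def, intro dps omS IS entries_N)
 have dR: "N.dp (%e. fn (e 0) (e 1) & bd (e 1))" by (intro dps dfn dbd)
 obtain C where C: "C : N"
  "!!X Z. X : NS ==> Z : NS ==> NE (N.opair X Z) C ==> (fn X Z & bd Z) & inT T' Z"
  "!!X Z Z'. X : NS ==> Z : NS ==> Z' : NS ==> NE (N.opair X Z) C ==> NE (N.opair X Z') C ==> Z = Z'"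
  "!!X Z. X : NS ==> inT T' Z ==> fn X Z & bd Z ==> EX Z:NS. NE (N.opair X Z) C"
  by (rule choice_class[of T' "%X Z. fn X Z & bd Z", OF adj_uni(2)[OF adj] dR], rule that, assumption+)
 have dF: "N.dp (%e. EX f:NS. NE (N.opair (e 0) f) C & NE (e 1) f)" by (intro dps C(1))
 obtain F where F: "F : N" "ALL A:NS. ALL p:NS. NE (N.opair A p) F <-> (EX f:NS. NE (N.opair A f) C & NE p f)"
  using rel_class[of "%A p. EX f:NS. NE (N.opair A f) C & NE p f", OF dF] by (elim bexE conjE)
 note Fo = F(2)[rule_format]
 have nN: "ck n : NS" "NE (ck n) (ck om)" if "n \<E> om" for n
  using ck_NS[OF omH[OF that]] NE_ck_ck[OF omH[OF that] univ_om[OF univ_H]] that by blast+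
 have xN: "ck x : NS" "NE (ck x) (ck J')" if "x \<E> J'" for x using ck_NS[OF JH[OF that]] NE_ck_ck[OF JH[OF that] J_H] that by blast+
 show ?thesis
 proof (rule bexI[OF _ F(1)], intro ballI impI)
  fix A assume A: "A : NS" "N.CardLess A a"
  obtain f0 where f0: "inT T' f0"
   and fc: "ALL x. x \<E> J' --> NE (ck x) A --> (EX n. n \<E> om & (ALL Z:NS. NE (N.opair (ck x) Z) f0 <-> Z = ck n))"
   and fb: "ALL p:g. ALL b k x n m n'. b \<E> J' --> b \<E> dom p --> entry k x n \<E> app p b --> m \<E> om --> n' \<E> om -->
    NE (N.opair (ck b) (ck m)) f0 --> NE (N.opair (ck x) (ck n')) f0 --> ~k \<E> m --> n \<E> n'"
   using colouring[OF A] by (elim exE conjE)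
  have 1: "fn A f0" unfolding fn_def
  proof (intro ballI impI)
   fix u assume u: "u : NS" "NE u (ck J')" "NE u A"
   obtain x where x: "x \<E> J'" "u = ck x" using NE_ck[OF J_H] u(2) by blast
   obtain n where n: "n \<E> om" "ALL Z:NS. NE (N.opair (ck x) Z) f0 <-> Z = ck n" using fc[rule_format, OF x(1)] u(3) x(2) by blast
   show "EX n:NS. NE n (ck om) & (ALL Z:NS. NE (N.opair u Z) f0 <-> Z = n)"
    unfolding x(2) by (rule bexI[OF _ nN(1)[OF n(1)]], rule conjI[OF nN(2)[OF n(1)] n(2)])
  qed
  have 2: "bd f0" unfolding bd_def
  proof (intro ballI impI)
   fix b k x n m n' assume h: "NE b (ck J')" "NE k (ck om)" "NE n (ck om)" "NE x (ck J')"
    "NE (N.opair b (N.opair k (N.opair x n))) (val entries)" "NE m (ck om)" "NE n' (ck om)"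
    "NE (N.opair b m) f0" "NE (N.opair x n') f0" "~NE k m"
   have o: "EX j. j \<E> om & z = ck j" if "NE z (ck om)" for z using NE_ck[OF univ_om[OF univ_H]] that by blast
   have oJ: "EX y. y \<E> J' & z = ck y" if "NE z (ck J')" for z using NE_ck[OF J_H] that by blast
   obtain b' where bx: "b' \<E> J'" "b = ck b'" using oJ[OF h(1)] by blast
   obtain x' where x': "x' \<E> J'" "x = ck x'" using oJ[OF h(4)] by blast
   obtain k' where k: "k' \<E> om" "k = ck k'" using o[OF h(2)] by blast
   obtain j where j: "j \<E> om" "n = ck j" using o[OF h(3)] by blast
   obtain i where i: "i \<E> om" "m = ck i" using o[OF h(6)] by blast
   obtain j' where j': "j' \<E> om" "n' = ck j'" using o[OF h(7)] by blast
   obtain p where p: "p : g" "b' \<E> dom p" "entry k' x' j \<E> app p b'"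
    using iffD1[OF NE_entries[OF JH[OF bx(1)] omH[OF k(1)] JH[OF x'(1)] omH[OF j(1)]] h(5)[unfolded bx(2) x'(2) k(2) j(2)]] by (elim bexE conjE)
   have "~k' \<E> i" using h(10)[unfolded k(2) i(2) NE_ck_ck[OF omH[OF k(1)] omH[OF i(1)]]] .
   from fb[rule_format, OF p(1) bx(1) p(2,3) i(1) j'(1) h(8)[unfolded bx(2) i(2)] h(9)[unfolded x'(2) j'(2)] this]
   show "NE n n'" unfolding j(2) j'(2) NE_ck_ck[OF omH[OF j(1)] omH[OF j'(1)]] .
  qed
  obtain f where f: "f : NS" "NE (N.opair A f) C" using C(4)[OF A(1) f0] 1 2 by blast
  have R: "fn A f" "bd f" using C(2)[OF A(1) f] by blast+
  have FA: "NE (N.opair A p) F <-> NE p f" if "p : NS" for p unfolding Fo[OF A(1) that] using C(3)[OF A(1) f(1) _ f(2)] f by blast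
  show "colours A F" unfolding colours_def
  proof (intro conjI allI ballI impI)
   fix x assume x: "x \<E> J'" "NE (ck x) A"
   obtain u where u: "NE u (ck om)" "ALL Z:NS. NE (N.opair (ck x) Z) f <-> Z = u"
    using R(1)[unfolded fn_def, rule_format, OF xN[OF x(1)] x(2)] by (elim bexE conjE)
   obtain n where n: "n \<E> om" "u = ck n" using NE_ck[OF univ_om[OF univ_H]] u(1) by blast
   have "NE (N.opair A (N.opair (ck x) Z)) F <-> Z = ck n" if Z: "Z : NS" for Z
    using FA[OF N.opair_S[OF xN(1)[OF x(1)] Z]] bspec[OF u(2) Z] n(2) by simp
   thus "EX n. n \<E> om & (ALL Z:NS. NE (N.opair A (N.opair (ck x) Z)) F <-> Z = ck n)" using n(1) by blast
  next
   fix p b k x n m n' assume p: "p : g" "b \<E> J'" "b \<E> dom p" "entry k x n \<E> app p b" and m: "m \<E> om" "n' \<E> om"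
    and h: "NE (N.opair A (N.opair (ck b) (ck m))) F" "NE (N.opair A (N.opair (ck x) (ck n'))) F" "~k \<E> m"
   note e = cond_entry[OF g_cond[OF p(1)] p(3,4)]
   have x: "x \<E> J'" by (rule near_gap[OF adj p(2) e(5) cond_Ord[OF g_cond[OF p(1)] e(3)]])
   have "NE (N.opair (ck b) (N.opair (ck k) (N.opair (ck x) (ck n)))) (val entries)"
    using NE_entries[OF JH[OF p(2)] omH[OF e(1)] JH[OF x] omH[OF e(2)]] p(1,3,4) by blast
   moreover have "NE (N.opair (ck b) (ck m)) f" "NE (N.opair (ck x) (ck n')) f"
    using FA[OF N.opair_S[OF xN(1)[OF p(2)] nN(1)[OF m(1)]]] FA[OF N.opair_S[OF xN(1)[OF x] nN(1)[OF m(2)]]] h(1,2) by blast+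
   moreover have "~NE (ck k) (ck m)" using h(3) NE_ck_ck[OF omH[OF e(1)] omH[OF m(1)]] by blast
   ultimately have "NE (ck n) (ck n')"
    by (rule R(2)[unfolded bd_def, rule_format, OF xN(1)[OF p(2)] nN(1)[OF e(1)] xN(1)[OF x] nN(1)[OF e(2)] nN(1)[OF m(1)] nN(1)[OF m(2)]
     xN(2)[OF p(2)] nN(2)[OF e(1)] nN(2)[OF e(2)] xN(2)[OF x] _ nN(2)[OF m(1)] nN(2)[OF m(2)]])
   thus "n \<E> n'" using NE_ck_ck[OF omH[OF e(2)] omH[OF m(2)]] by blast
  qed
 qed
qed

end

text \<open>A vertex receives the colour that it has for almost all \<open>A\<close>; one exists by
  completeness at the omega of the extension, an element of \<open>a\<close>. Two such colours are
  realized by a common \<open>A\<close>, so the averaged function is bounding like every colouring,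
  against \<open>no_bounding_function\<close>.\<close>

theorem no_strongly_compact:
 assumes a: "a : NS" and U: "N.UNC a"
 shows "EX X:NS. ~N.CompactFor a X"
proof (rule ccontr)
 assume "~(EX X:NS. ~N.CompactFor a X)"
 hence cf: "N.CompactFor a X" if "X : NS" for X using that by blast
 obtain T where T: "uni T" "inT T a" using ext_uni[OF univ_emp[OF univ_H] a a] by blast
 obtain T' where adj: "adjacent T T'" using adjacent_ex[OF T(1)] by blast
 note uT' = adj_uni(2)[OF adj]
 let ?J = "gap T T'"
 have Jm: "x \<E> T'" "x \<E> H" if "x \<E> ?J" for x using gap_iff[OF adj] gap_H[OF adj] that by blast+
 \<comment> \<open>Large enough to contain the vertices of the gap, and to contain each element of
   omega both as an element and as a subset, as \<open>inU_complete\<close> demands.\<close>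
 let ?X = "val (flat T')"
 have X: "?X : NS" by (rule val_flat_NS) (use uT' in "simp add: uni_def")
 obtain P U where PU: "P : NS" "U : NS" "N.IsP P a ?X" "N.UF U P" "N.Fine U P ?X" "N.Complete a U P"
  using cf[OF X] unfolding N.CompactFor_def by (elim bexE conjE)
 note c = a X PU
 note inU_complete = inU_complete[OF c] and inU_mono = inU_mono[OF c] and inU_conj = inU_conj[OF c]
  and inU_fine = inU_fine[OF c] and inU_not = inU_not[OF c] and inU_ex = inU_ex[OF c]
 have aO: "N.ORD a" and "EX w:NS. N.OMEGA w & NE w a" using U unfolding N.UNC_def N.CARD_def by - (elim conjE, assumption, elim conjE, assumption)
 then obtain w where w: "w : NS" "N.OMEGA w" "NE w a" by (elim bexE conjE)
 have XI: "NE Z ?X <-> inT T' Z" for Z by (rule NE_flat_T[OF uT'])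
 have wX: "NE n ?X & N.Sub n ?X" if "NE n w" for n
 proof -
  have "inT T' a" by (rule inT_mono[OF uT' adj_uni(3)[OF adj] T(2)])
  hence "inT T' n" using inT_mem[OF uT'] w(3) that by blast
  thus ?thesis unfolding XI N.Sub_def using inT_mem[OF uT'] by blast
 qed
 have "EX F:N. ALL A:NS. N.CardLess A a --> colours T T' A F" by (rule colouring_class[OF adj a T(2)])
 then obtain F where F: "F : N" and col: "ALL A:NS. N.CardLess A a --> colours T T' A F" by (elim bexE)
 have PA: "N.CardLess A a" if "A : NS" "NE A P" for A using P_iff[OF c that(1)] that(2) by blast
 note col' = col[rule_format, OF _ PA, unfolded colours_def[OF adj a T(2)]]
 note Fn = col'[THEN conjunct1, rule_format] and Fb = col'[THEN conjunct2, rule_format]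
 define Q where "Q u n = inU P U (%A. NE u A & NE (N.opair A (N.opair u n)) F)" for u n
 have dQ: "N.dp (%e. Q (t e) (t' e))" if "N.dt t" "N.dt t'" for t t'
  by (rule N.dp_rel2[OF _ that, of Q], unfold Q_def inU_def[OF c], intro dps F PU(1,2))
 have dG: "N.dp (%e. Q (e 0) (e 1))" by (intro dps dQ)
 obtain G where G: "G : N" "ALL u:NS. ALL n:NS. NE (N.opair u n) G <-> Q u n" using rel_class[of Q, OF dG] by (elim bexE conjE)
 note Go = G(2)[rule_format]
 have nN: "ck n : NS" if "n \<E> om" for n by (rule ck_NS[OF omH[OF that]])
 have xN: "ck x : NS" if "x \<E> ?J" for x by (rule ck_NS[OF Jm(2)[OF that]])
 have fine: "inU P U (%A. NE (ck x) A)" if x: "x \<E> ?J" for x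
  by (rule inU_fine[OF xN[OF x]]) (unfold XI inT_def, use chk_T[OF uT' Jm(1)[OF x]] in blast)
 have dcol: "N.dp (%e. NE (N.opair (e 0) (N.opair u n)) F)" if "u : NS" "n : NS" for u n by (intro dps F that)
 have Qtot: "EX n. n \<E> om & Q (ck x) (ck n)" if x: "x \<E> ?J" for x
 proof (rule ccontr)
  assume no: "~(EX n. n \<E> om & Q (ck x) (ck n))"
  have omS: "ck om : NS" by (rule ck_NS[OF univ_om[OF univ_H]])
  have d: "N.dp (%e. NE (ck x) (e 1) & ~(NE (e 0) (ck om) & NE (N.opair (e 1) (N.opair (ck x) (e 0))) F))" by (intro dps omS xN[OF x] F)
  \<comment> \<open>The family is indexed by all of \<open>w\<close>; the guard makes it trivial at
    indices outside the ground omega.\<close>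
  have "inU P U (%A. NE (ck x) A & ~(NE n (ck om) & NE (N.opair A (N.opair (ck x) n)) F))" if n: "NE n w" for n
  proof (cases "NE n (ck om)")
   case True
   then obtain j where j: "j \<E> om" "n = ck j" using NE_ck[OF univ_om[OF univ_H]] by blast
   have d1: "N.dp (%e. NE (ck x) (e 0) & NE (N.opair (e 0) (N.opair (ck x) (ck j))) F)" by (intro dps F xN[OF x] nN[OF j(1)])
   have d2: "N.dp (%e. NE (ck x) (e 0) & ~(NE (ck x) (e 0) & NE (N.opair (e 0) (N.opair (ck x) (ck j))) F))"
    by (intro dps F xN[OF x] nN[OF j(1)])
   have d3: "N.dp (%e. NE (ck x) (e 0) & ~(NE n (ck om) & NE (N.opair (e 0) (N.opair (ck x) n)) F))"
    by (intro dps F xN[OF x] omS NE_NS[OF n])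
   have "~inU P U (%A. NE (ck x) A & NE (N.opair A (N.opair (ck x) (ck j))) F)" using no j(1) unfolding Q_def by blast
   from inU_mono[OF inU_conj[OF fine[OF x] inU_not[OF d1 this] d2] d3] show ?thesis unfolding j(2) by blast
  next
   case False
   have d3: "N.dp (%e. NE (ck x) (e 0) & ~(NE n (ck om) & NE (N.opair (e 0) (N.opair (ck x) n)) F))"
    by (intro dps F xN[OF x] omS NE_NS[OF n])
   from inU_mono[OF fine[OF x] d3] False show ?thesis by blast
  qed
  from inU_complete[of w "%n A. NE (ck x) A & ~(NE n (ck om) & NE (N.opair A (N.opair (ck x) n)) F)", OF w(1,3) aO wX d this]
  obtain A where A: "A : NS" "NE A P"
   and An: "!!n. NE n w ==> NE (ck x) A & ~(NE n (ck om) & NE (N.opair A (N.opair (ck x) n)) F)" by blast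
  have "NE (ck x) A" using An[OF omega_ck[OF w(1,2) emp_om]] by blast
  from Fn[OF A(1) A x this] obtain n where n: "n \<E> om" "ALL Z:NS. NE (N.opair A (N.opair (ck x) Z)) F <-> Z = ck n" by blast
  have "NE (N.opair A (N.opair (ck x) (ck n))) F" using bspec[OF n(2) nN[OF n(1)]] by simp
  moreover have "NE (ck n) (ck om)" using NE_ck_ck[OF omH[OF n(1)] univ_om[OF univ_H]] n(1) by blast
  ultimately show False using An[OF omega_ck[OF w(1,2) n(1)]] by blast
 qed
 have QQ: "EX A:NS. NE A P & (NE u A & NE (N.opair A (N.opair u n)) F) & (NE v A & NE (N.opair A (N.opair v m)) F)"
  if h: "Q u n" "Q v m" and N: "u : NS" "n : NS" "v : NS" "m : NS" for u n v m
 proof -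
  have d: "N.dp (%e. (NE u (e 0) & NE (N.opair (e 0) (N.opair u n)) F) & (NE v (e 0) & NE (N.opair (e 0) (N.opair v m)) F))"
   by (intro dps F N)
  from inU_ex[OF inU_conj[OF h[unfolded Q_def] d]] show ?thesis .
 qed
 show False
 proof (rule no_bounding_function[OF adj G(1)])
  show "EX n. n \<E> om & NE (N.opair (ck x) (ck n)) G" if x: "x \<E> ?J" for x using Qtot[OF x] Go[OF xN[OF x] nN] by blast
 next
  fix x n n' assume x: "x \<E> ?J" and n: "n \<E> om" "n' \<E> om" and h: "NE (N.opair (ck x) (ck n)) G" "NE (N.opair (ck x) (ck n')) G"
  have "Q (ck x) (ck n)" "Q (ck x) (ck n')" using h Go[OF xN[OF x] nN] n by blast+
  from QQ[OF this xN[OF x] nN[OF n(1)] xN[OF x] nN[OF n(2)]]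
  obtain A where A: "A : NS" "NE A P" "NE (ck x) A" "NE (N.opair A (N.opair (ck x) (ck n))) F" "NE (N.opair A (N.opair (ck x) (ck n'))) F" by blast
  obtain j where "ALL Z:NS. NE (N.opair A (N.opair (ck x) Z)) F <-> Z = ck j" using Fn[OF A(1) A(1,2) x A(3)] by blast
  hence "ck n = ck n'" using nN[OF n(1)] nN[OF n(2)] A(4,5) by blast
  thus "n = n'" using ck_inj[OF omH[OF n(1)] omH[OF n(2)]] by blast
 next
  fix p b k x n m assume p: "p : g" and b: "b \<E> ?J" "b \<E> dom p" "entry k x n \<E> app p b" and m: "m \<E> om" "NE (N.opair (ck b) (ck m)) G" "~k \<E> m"
  note e = cond_entry[OF g_cond[OF p] b(2,3)]
  have x: "x \<E> ?J" by (rule near_gap[OF adj b(1) e(5) cond_Ord[OF g_cond[OF p] e(3)]])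
  obtain n' where n': "n' \<E> om" "Q (ck x) (ck n')" using Qtot[OF x] by blast
  have "Q (ck b) (ck m)" using m(2) Go[OF xN[OF b(1)] nN[OF m(1)]] by blast
  from QQ[OF this n'(2) xN[OF b(1)] nN[OF m(1)] xN[OF x] nN[OF n'(1)]]
  obtain A where A: "A : NS" "NE A P" "NE (N.opair A (N.opair (ck b) (ck m))) F" "NE (ck x) A" "NE (N.opair A (N.opair (ck x) (ck n'))) F" by blast
  have "n \<E> n'" by (rule Fb[OF A(1) A(1,2) p b m(1) n'(1) A(3,5) m(3)])
  thus "EX n'. n' \<E> om & NE (N.opair (ck x) (ck n')) G & n \<E> n'" using n' Go[OF xN[OF x] nN[OF n'(1)]] by blast
 qed
qed

end

context gext
begin

lemma SWVP_holds: "sat N NE SWVP e" unfolding SWVP_def sentence_def sat_form sat_quantifiers sat_in_sets_N using swvp by auto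

text \<open>Unique backward homomorphisms are in particular backward homomorphisms, so a
  counterexample to WVP is one to SWVP.\<close>

lemma WVP_holds: "sat N NE WVP e" unfolding WVP_def sentence_def sat_form sat_quantifiers sat_in_sets_N
 using swvp N.sat_unique_backward_homs by (auto dest!: N.sat_unique_backward_homs[rotated 2])

lemma no_strongly_compact_holds: "~sat N NE exists_strongly_compact e"
 unfolding exists_strongly_compact_def sentence_def sat_in_sets_N sat_quantifiers using no_strongly_compact by auto

end

theorem mainTheorem6:
  assumes "consistent (ZFC \<union> {exists_supercompact})"
  shows "\<not> (GB_AC \<union> {SWVP} \<turnstile> exists_strongly_compact)
    \<and> \<not> (GB_AC \<union> {WVP} \<turnstile> exists_strongly_compact)"
proof -
 obtain E :: "nat => nat => bool" and e where M: "ALL p:ZFC Un {exists_supercompact}. sat UNIV E p e"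
  using countable_model[OF assms Un_upper1] by blast
 interpret zf E by (rule zf_of_model[of E e]) (use M in blast)
 have "sat UNIV E exists_supercompact e" using M by blast
 then obtain kap where kap: "UNC kap" "ALL X. SupercompactFor kap X" unfolding exists_supercompact_def sentence_def by auto
 interpret supercompact E kap by unfold_locales (use kap in blast)+
 interpret P: fposet E kap H PP by (rule fposet_H)
 \<comment> \<open>The model has the natural numbers as its elements, so the identity enumerates all
   its dense sets.\<close>
 obtain g where "generic E kap H PP g" using P.generic_exists[of id emp] P.emp_Q by auto
 then interpret gext E kap g unfolding gext_def .
 obtain X where X: "X : N" using N.nonempty NS_N by blast
 have "~(GB_AC Un {A} \<turnstile> exists_strongly_compact)" if "sat N NE A (%_. X)" for A
 proof
  assume "GB_AC Un {A} \<turnstile> exists_strongly_compact"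
  hence "sat N NE exists_strongly_compact (%_. X)" by (rule soundness) (use X GB_AC_holds that in auto)
  thus False using no_strongly_compact_holds by blast
 qed
 thus ?thesis using SWVP_holds WVP_holds by blast
qed

end
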